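(* Let $d>1$ be an integer. Let $a(\cdot,\cdot)$ be a symmetric bilinear form on $H^1_0(I^d)$ that is $H_0^1$-elliptic, i.e. there are constants $0<\mu_0\le\mu_1<\infty$ with $\mu_0\|u\|_{H_0^1}^2\le a(u,u)\le \mu_1\|u\|_{H_0^1}^2$ for all $u\in H_0^1(I^d)$. For a finite nonempty monotone index set $\Lambda\subset\mathbb{N}^d$ let $\kappa_{S_\Lambda,HB}$ be the spectral condition number of the hierarchical basis stiffness matrix $A_\Lambda$ of $a$ on the generalized sparse grid space $S_\Lambda$, and let $n_\Lambda,\tilde n_\Lambda,\tilde n'_\Lambda$ be the quantities attached to $\Lambda$ (all as defined in the context). Then: (i) For every finite nonempty monotone $\Lambda\subset\mathbb{N}^d$, $$c\, n_{\Lambda}\,\tilde{n}'_{\Lambda}\le \kappa_{S_\Lambda,HB}\le C\, n_{\Lambda}\,\tilde{n}_{\Lambda},$$ with constants $c,C>0$ depending only on $d$ and the ellipticity constants $\mu_0,\mu_1$ (in particular, not on $\Lambda$). (ii) For the standard sparse grid spaces $S_k:=S_\Lambda$ with $\Lambda=\{\beta\in\mathbb{N}^d:\ |\beta|_1\le k+d-1\}$, $$\kappa_{S_k,HB}\approx k^{d-1}2^{k(d-1)/d},\qquad k\to\infty.$$ (iii) For the isotropic full grid spaces $V_k:=S_\Lambda$ with $\Lambda=\{\beta\in\mathbb{N}^d:\ |\beta|_\infty\le k\}$, $$\kappa_{V_k,HB}\approx k^{d-1}2^{k(d-1)},\qquad k\to\infty.$$ (iv) More generally, for every real $a_0$ with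 $-\infty<a_0<1$ and the energy-optimized sparse grid spaces $S_k^{a_0}:=S_{\Lambda_{k,a_0}}$ with $$\Lambda_{k,a_0}:=\{\beta\in\mathbb{N}^d:\ |\beta|_1-a_0|\beta|_\infty\le(1-a_0)k+d-1\},$$ we have $$\kappa_{S_k^{a_0},HB}\approx k^{d-1}2^{k(d-1)(1-a_0)/(d-a_0)},\qquad k\to\infty.$$ Here $X_k\approx Y_k$, $k\to\infty$, means that $cX_k\le Y_k\le CX_k$ for all sufficiently large integers $k$, with constants $c,C>0$ independent of $k$, which depend only on $d,\mu_0,\mu_1$ in (ii) and (iii), and only on $d,\mu_0,\mu_1$ and possibly $a_0$ in (iv).
   Context: Notation: $\mathbb{N}=\{1,2,3,\dots\}$, $I=[0,1]$, $I^d$ is the $d$-dimensional unit cube. For $\beta\in\mathbb{N}^d$, $|\beta|_1=\sum_{i=1}^d\beta_i$ and $|\beta|_\infty=\max_i\beta_i$; $\beta'\le\beta$ means $\beta'_i\le\beta_i$ for all $i$. The $H^1_0$ norm is $\|u\|_{H_0^1}^2=\int_{I^d}|\nabla u|^2\,dx$. A set $\Lambda\subset\mathbb{N}^d$ is monotone if $\beta\in\Lambda$, $\beta'\in\mathbb{N}^d$ and $\beta'\le\beta$ imply $\beta'\in\Lambda$. Faber-Schauder system: let $\phi(t)=(1-|t|)_+$ for $t\in\mathbb{R}$. For $k\in\mathbb{N}$ and $i=0,1,\dots,2^{k-1}-1$ put $\phi_{2^{k-1}+i}(t)=\phi(2^kt-(2i+1))$, $t\in[0,1]$, and let $J_k=\{2^{k-1},\dots,2^k-1\}$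 be the index set of the $k$-th dyadic block. For $\alpha\in\mathbb{N}^d$ put $\phi_\alpha(x)=\prod_{i=1}^d\phi_{\alpha_i}(x_i)$, and for $\beta\in\mathbb{N}^d$ put $J_\beta=J_{\beta_1}\times\dots\times J_{\beta_d}$ and $S_\beta=\mathrm{span}\{\phi_\alpha:\alpha\in J_\beta\}$. Generalized sparse grid space: $S_\Lambda=\mathrm{span}\{S_\beta:\beta\in\Lambda\}$; this sum is direct, so the functions $\phi_\alpha$ with $\alpha\in J_\beta$, $\beta\in\Lambda$, form a basis of $S_\Lambda$ (the hierarchical basis, HB). HB stiffness matrix: for $\alpha\in J_\beta$ let $\hat\phi_\alpha=2^{-|\beta|_\infty}\phi_\alpha/\|\phi_\alpha\|_{L_2(I^d)}$ be the diagonally scaled hierarchical basis functions. $A_\Lambda$ is the symmetric positive definite matrix with entries $a(\hat\phi_\alpha,\hat\phi_{\alpha'})$, where $\alpha,\alpha'$ range over $\bigcup_{\beta\in\Lambda}J_\beta$, and $\kappa_{S_\Lambda,HB}=\lambda_{\max}(A_\Lambda)/\lambda_{\min}(A_\Lambda)$. Quantities attached to $\Lambda$: let $k_\Lambda=\max_{\beta\in\Lambda}|\beta|_\infty$, and for $k=1,\dots,k_\Lambda$ let $\Lambda_k=\{\beta\in\Lambda:|\beta|_\infty=k\}$; let $\Lambda_{k,0}$ be the set of maximal elements of $\Lambda_k$, i.e. those $\beta\in\Lambda_k$ such that $\beta'\in\Lambda_k$ and $\beta'\ge\beta$ imply $\beta'=\beta$. Then $$n_\Lambda=\max_{1\le k\le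 k_\Lambda}|\Lambda_k|,\qquad \tilde n_\Lambda=\sum_{k=1}^{k_\Lambda}\sum_{\beta\in\Lambda_{k,0}}2^{|\beta|_1-|\beta|_\infty},\qquad \tilde n'_\Lambda=\max_{\beta\in\Lambda}2^{|\beta|_1-|\beta|_\infty},$$ where $|\Lambda_k|$ is the cardinality of $\Lambda_k$. *)

theory Defs
  imports "HOL-Analysis.Analysis" "HOL-Library.Discrete_Functions"
begin

section \<open>The Sobolev space of the unit cube with zero boundary values\<close>

text \<open>The dimension is the cardinality of the index type \<open>'n\<close>.  Functions on the closed unit
  cube are total functions on \<open>real ^ 'n\<close>; their values off the cube play no role.\<close>

abbreviation cube_measure :: "(real ^ 'n) measure" where
  "cube_measure \<equiv> lebesgue_on (cbox 0 1)"

definition L2 :: "(real ^ 'n \<Rightarrow> 'b :: euclidean_space) set" where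
  "L2 = {u \<in> borel_measurable cube_measure. integrable cube_measure (\<lambda>x. (norm (u x))\<^sup>2)}"

definition L2_norm :: "(real ^ 'n \<Rightarrow> 'b :: euclidean_space) \<Rightarrow> real" where
  "L2_norm u = sqrt (LINT x|cube_measure. (norm (u x))\<^sup>2)"

definition partial_deriv :: "'n \<Rightarrow> (real ^ 'n \<Rightarrow> real) \<Rightarrow> real ^ 'n \<Rightarrow> real" where
  "partial_deriv i f x = frechet_derivative f (at x) (axis i 1)"

definition classical_grad :: "(real ^ 'n \<Rightarrow> real) \<Rightarrow> real ^ 'n \<Rightarrow> real ^ 'n" where
  "classical_grad f x = (\<chi> i. partial_deriv i f x)"

primrec C_k :: "nat \<Rightarrow> (real ^ 'n \<Rightarrow> real) \<Rightarrow> bool" where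
  "C_k 0 f \<longleftrightarrow> continuous_on UNIV f"
| "C_k (Suc k) f \<longleftrightarrow> (\<forall>x. f differentiable (at x)) \<and> (\<forall>i. C_k k (partial_deriv i f))"

definition test_functions :: "(real ^ 'n \<Rightarrow> real) set" where
  "test_functions = {f. (\<forall>k. C_k k f) \<and> closure {x. f x \<noteq> 0} \<subseteq> box 0 1}"

definition has_weak_grad :: "(real ^ 'n \<Rightarrow> real) \<Rightarrow> (real ^ 'n \<Rightarrow> real ^ 'n) \<Rightarrow> bool" where
  "has_weak_grad u g \<longleftrightarrow> u \<in> L2 \<and> g \<in> L2 \<and>
     (\<forall>f\<in>test_functions. \<forall>i.
        (LINT x|cube_measure. u x * partial_deriv i f x) = - (LINT x|cube_measure. g x $ i * f x))"

text \<open>Weak gradients are unique only almost everywhere on the cube; every use of \<open>weak_grad\<close>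
  below is insensitive to the choice.\<close>

definition weak_grad :: "(real ^ 'n \<Rightarrow> real) \<Rightarrow> real ^ 'n \<Rightarrow> real ^ 'n" where
  "weak_grad u = (SOME g. has_weak_grad u g)"

text \<open>Closure of the test functions in the full \<open>H\<^sup>1\<close> norm.\<close>

definition H10 :: "(real ^ 'n \<Rightarrow> real) set" where
  "H10 = {u. (\<exists>g. has_weak_grad u g) \<and>
     (\<exists>f. (\<forall>m. f m \<in> test_functions) \<and>
        (\<lambda>m. L2_norm (\<lambda>x. f m x - u x)) \<longlonglongrightarrow> 0 \<and>
        (\<lambda>m. L2_norm (\<lambda>x. classical_grad (f m) x - weak_grad u x)) \<longlonglongrightarrow> 0)}"

definition H10_norm :: "(real ^ 'n \<Rightarrow> real) \<Rightarrow> real" where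
  "H10_norm u = L2_norm (weak_grad u)"

text \<open>Elements of \<open>H10\<close> are functions rather than classes modulo null sets.  A form satisfying the
  conditions below respects these classes: by the ellipticity bound \<open>a u u = 0\<close> if \<open>u\<close> vanishes
  almost everywhere on the cube, hence \<open>a u v = 0\<close> for all \<open>v\<close> by Cauchy-Schwarz.\<close>

definition elliptic_form ::
  "real \<Rightarrow> real \<Rightarrow> ((real ^ 'n \<Rightarrow> real) \<Rightarrow> (real ^ 'n \<Rightarrow> real) \<Rightarrow> real) \<Rightarrow> bool" where
  "elliptic_form \<mu>0 \<mu>1 a \<longleftrightarrow>
     (\<forall>u\<in>H10. \<forall>v\<in>H10. a u v = a v u) \<and>
     (\<forall>u\<in>H10. \<forall>v\<in>H10. \<forall>w\<in>H10. \<forall>r s.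
        a (\<lambda>x. r * u x + s * v x) w = r * a u w + s * a v w) \<and>
     (\<forall>u\<in>H10. \<mu>0 * (H10_norm u)\<^sup>2 \<le> a u u \<and> a u u \<le> \<mu>1 * (H10_norm u)\<^sup>2)"


section \<open>Faber-Schauder functions\<close>

definition hat :: "real \<Rightarrow> real" where
  "hat t = max 0 (1 - \<bar>t\<bar>)"

definition dyadic_block :: "nat \<Rightarrow> nat set" where
  "dyadic_block k = {2 ^ (k - 1)..<2 ^ k}"

definition block_of :: "nat \<Rightarrow> nat" where
  "block_of n = Suc (floor_log n)"

definition faber :: "nat \<Rightarrow> real \<Rightarrow> real" where
  "faber n t = hat (2 ^ block_of n * t - (2 * real (n - 2 ^ (block_of n - 1)) + 1))"

lemma block_of_eq:
  assumes "k \<ge> 1" "n \<in> dyadic_block k"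
  shows "block_of n = k"
proof -
  have "2 ^ (k - 1) \<le> n" "n < 2 ^ k" using assms(2) by (auto simp: dyadic_block_def)
  moreover from this have "n > 0" by (metis gr0I le_zero_eq power_not_zero zero_neq_numeral)
  ultimately have "floor_log n = k - 1"
    using assms(1) by (intro floor_log_eqI) (auto simp flip: power_Suc)
  then show ?thesis using assms(1) by (simp add: block_of_def)
qed

lemma faber_eq:
  assumes "k \<ge> 1" "i < 2 ^ (k - 1)"
  shows "faber (2 ^ (k - 1) + i) t = hat (2 ^ k * t - (2 * real i + 1))"
proof -
  have "(2::nat) ^ k = 2 * 2 ^ (k - 1)" using assms(1) by (simp flip: power_Suc)
  then have "block_of (2 ^ (k - 1) + i) = k"
    using assms by (intro block_of_eq) (auto simp: dyadic_block_def)
  then show ?thesis by (simp add: faber_def)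
qed

definition faber_prod :: "nat ^ 'n \<Rightarrow> real ^ 'n \<Rightarrow> real" where
  "faber_prod \<alpha> x = (\<Prod>i\<in>UNIV. faber (\<alpha> $ i) (x $ i))"


section \<open>Multi-indices\<close>

text \<open>The order on \<open>nat ^ 'n\<close> is the componentwise one.\<close>

definition pos_idx :: "(nat ^ 'n) set" where
  "pos_idx = {\<beta>. \<forall>i. 1 \<le> \<beta> $ i}"

definition norm1 :: "nat ^ 'n \<Rightarrow> nat" where
  "norm1 \<beta> = (\<Sum>i\<in>UNIV. \<beta> $ i)"

definition norm_inf :: "nat ^ 'n \<Rightarrow> nat" where
  "norm_inf \<beta> = Max (range (\<lambda>i. \<beta> $ i))"

definition monotone_idx :: "(nat ^ 'n) set \<Rightarrow> bool" where
  "monotone_idx \<Lambda> \<longleftrightarrow> \<Lambda> \<subseteq> pos_idx \<and> (\<forall>\<beta>\<in>\<Lambda>. \<forall>\<beta>'\<in>pos_idx. \<beta>' \<le> \<beta> \<longrightarrow> \<beta>' \<in> \<Lambda>)"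

definition block :: "nat ^ 'n \<Rightarrow> (nat ^ 'n) set" where
  "block \<beta> = {\<alpha>. \<forall>i. \<alpha> $ i \<in> dyadic_block (\<beta> $ i)}"

definition multi_block_of :: "nat ^ 'n \<Rightarrow> nat ^ 'n" where
  "multi_block_of \<alpha> = (\<chi> i. block_of (\<alpha> $ i))"

lemma multi_block_of_eq: "\<beta> \<in> pos_idx \<Longrightarrow> \<alpha> \<in> block \<beta> \<Longrightarrow> multi_block_of \<alpha> = \<beta>"
  by (auto simp: pos_idx_def block_def multi_block_of_def vec_eq_iff intro!: block_of_eq)


section \<open>The scaled hierarchical basis and its stiffness matrix\<close>

definition HB_idx :: "(nat ^ 'n) set \<Rightarrow> (nat ^ 'n) set" where
  "HB_idx \<Lambda> = (\<Union>\<beta>\<in>\<Lambda>. block \<beta>)"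

definition HB_fun :: "nat ^ 'n \<Rightarrow> real ^ 'n \<Rightarrow> real" where
  "HB_fun \<alpha> x = faber_prod \<alpha> x / (2 ^ norm_inf (multi_block_of \<alpha>) * L2_norm (faber_prod \<alpha>))"

definition HB_stiffness ::
  "((real ^ 'n \<Rightarrow> real) \<Rightarrow> (real ^ 'n \<Rightarrow> real) \<Rightarrow> real) \<Rightarrow> nat ^ 'n \<Rightarrow> nat ^ 'n \<Rightarrow> real" where
  "HB_stiffness a \<alpha> \<alpha>' = a (HB_fun \<alpha>) (HB_fun \<alpha>')"

text \<open>Real eigenvalues of a matrix whose rows and columns are indexed by a finite set \<open>T\<close>.\<close>

definition eigenvalues_on :: "'i set \<Rightarrow> ('i \<Rightarrow> 'i \<Rightarrow> real) \<Rightarrow> real set" where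
  "eigenvalues_on T A =
     {l. \<exists>v. (\<exists>i\<in>T. v i \<noteq> 0) \<and> (\<forall>i\<in>T. (\<Sum>j\<in>T. A i j * v j) = l * v i)}"

definition kappa_HB ::
  "((real ^ 'n \<Rightarrow> real) \<Rightarrow> (real ^ 'n \<Rightarrow> real) \<Rightarrow> real) \<Rightarrow> (nat ^ 'n) set \<Rightarrow> real" where
  "kappa_HB a \<Lambda> =
     Max (eigenvalues_on (HB_idx \<Lambda>) (HB_stiffness a)) /
     Min (eigenvalues_on (HB_idx \<Lambda>) (HB_stiffness a))"


section \<open>Quantities attached to an index set\<close>

definition k_max :: "(nat ^ 'n) set \<Rightarrow> nat" where
  "k_max \<Lambda> = Max (norm_inf ` \<Lambda>)"

definition layer :: "(nat ^ 'n) set \<Rightarrow> nat \<Rightarrow> (nat ^ 'n) set" where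
  "layer \<Lambda> k = {\<beta>\<in>\<Lambda>. norm_inf \<beta> = k}"

definition layer_maximal :: "(nat ^ 'n) set \<Rightarrow> nat \<Rightarrow> (nat ^ 'n) set" where
  "layer_maximal \<Lambda> k = {\<beta>\<in>layer \<Lambda> k. \<forall>\<beta>'\<in>layer \<Lambda> k. \<beta> \<le> \<beta>' \<longrightarrow> \<beta>' = \<beta>}"

definition n_idx :: "(nat ^ 'n) set \<Rightarrow> nat" where
  "n_idx \<Lambda> = Max ((\<lambda>k. card (layer \<Lambda> k)) ` {1..k_max \<Lambda>})"

text \<open>The truncated subtractions below are harmless, since \<open>norm_inf \<beta> \<le> norm1 \<beta>\<close>.\<close>

definition nt_idx :: "(nat ^ 'n) set \<Rightarrow> nat" where
  "nt_idx \<Lambda> = (\<Sum>k = 1..k_max \<Lambda>. \<Sum>\<beta>\<in>layer_maximal \<Lambda> k. 2 ^ (norm1 \<beta> - norm_inf \<beta>))"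

definition nt'_idx :: "(nat ^ 'n) set \<Rightarrow> nat" where
  "nt'_idx \<Lambda> = Max ((\<lambda>\<beta>. 2 ^ (norm1 \<beta> - norm_inf \<beta>)) ` \<Lambda>)"


section \<open>Sparse grid index sets and two-sided asymptotic bounds\<close>

definition sparse_idx :: "nat \<Rightarrow> (nat ^ 'n) set" where
  "sparse_idx k = {\<beta>\<in>pos_idx. norm1 \<beta> \<le> k + CARD('n) - 1}"

definition full_idx :: "nat \<Rightarrow> (nat ^ 'n) set" where
  "full_idx k = {\<beta>\<in>pos_idx. norm_inf \<beta> \<le> k}"

definition energy_idx :: "real \<Rightarrow> nat \<Rightarrow> (nat ^ 'n) set" where
  "energy_idx a0 k = {\<beta>\<in>pos_idx.
     real (norm1 \<beta>) - a0 * real (norm_inf \<beta>) \<le> (1 - a0) * real k + real CARD('n) - 1}"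

definition asymp_with :: "real \<Rightarrow> real \<Rightarrow> (nat \<Rightarrow> real) \<Rightarrow> (nat \<Rightarrow> real) \<Rightarrow> bool" where
  "asymp_with c C X Y \<longleftrightarrow> (\<forall>\<^sub>F k in sequentially. c * X k \<le> Y k \<and> Y k \<le> C * X k)"

end

theory Submission
  imports Defs
begin

text \<open>
  Write \<open>u = \<Sum>\<^sub>\<beta> u\<^sub>\<beta>\<close> with \<open>u\<^sub>\<beta> \<in> S\<^sub>\<beta>\<close>.  Blockwise the Faber-Schauder functions are
  orthogonal, so the condition number compares \<open>\<parallel>u\<parallel>\<^sup>2\<close> in the \<open>H\<^sup>1\<^sub>0\<close> norm with
  \<open>\<Sum>\<^sub>\<beta> 4\<^bsup>|\<beta>|\<^sub>\<infinity>\<^esup> \<parallel>u\<^sub>\<beta>\<parallel>\<^sup>2\<close> in \<open>L\<^sub>2\<close>.  In direction \<open>i\<close> the derivatives of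
  the univariate functions are Haar functions, hence orthogonal, so only blocks with the same \<open>\<beta>\<^sub>i\<close>
  interact in \<open>\<parallel>\<partial>\<^sub>i u\<parallel>\<close>; Cauchy-Schwarz gives the bound \<open>n\<^sub>\<Lambda>\<close> for the largest eigenvalue, and it is
  attained because sums of nonnegative hat functions of different blocks are far from orthogonal.

  For the smallest eigenvalue, orthonormalise the univariate system level by level in \<open>L\<^sub>2\<close>
  (a Cholesky factorisation of its Gram matrix).  The resulting tensor product decomposition
  \<open>u = \<Sum>\<^sub>\<gamma> w\<^sub>\<gamma>\<close> is \<open>H\<^sup>1\<close>-stable, \<open>\<Sum>\<^sub>\<gamma> 4\<^bsup>|\<gamma>|\<^sub>\<infinity>\<^esup> \<parallel>w\<^sub>\<gamma>\<parallel>\<^sup>2 \<le> C \<parallel>u\<parallel>\<^sup>2\<close>, and the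
  hierarchical component of \<open>w\<^sub>\<gamma>\<close> in a block \<open>\<beta> \<le> \<gamma>\<close> is bounded by comparing nodal values with the
  \<open>L\<^sub>2\<close> norm, at the price of a factor \<open>2\<^bsup>|\<gamma>|\<^sub>1 - |\<beta>|\<^sub>1\<^esup>\<close>.  A tensor product of nodal hat
  functions shows that this loss does occur.
\<close>

section \<open>Smooth functions of one variable\<close>

primrec smooth_upto :: "nat \<Rightarrow> (real \<Rightarrow> real) \<Rightarrow> bool" where
  "smooth_upto 0 f \<longleftrightarrow> continuous_on UNIV f"
| "smooth_upto (Suc k) f \<longleftrightarrow>
     (\<exists>f'. (\<forall>x. (f has_real_derivative f' x) (at x)) \<and> smooth_upto k f')"

definition smooth :: "(real \<Rightarrow> real) \<Rightarrow> bool" where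
  "smooth f \<longleftrightarrow> (\<forall>k. smooth_upto k f)"

lemma smooth_upto_continuous: "smooth_upto k f \<Longrightarrow> continuous_on UNIV f"
  by (cases k) (auto intro!: continuous_at_imp_continuous_on intro: DERIV_isCont)

lemma smooth_upto_SucD: "smooth_upto (Suc k) f \<Longrightarrow> smooth_upto k f"
proof (induction k arbitrary: f)
  case 0
  then show ?case by (metis smooth_upto.simps(1) smooth_upto_continuous)
next
  case (Suc k)
  then show ?case by (metis smooth_upto.simps(2))
qed

lemma smooth_upto_add:
  "smooth_upto k f \<Longrightarrow> smooth_upto k g \<Longrightarrow> smooth_upto k (\<lambda>x. f x + g x)"
proof (induction k arbitrary: f g)
  case 0
  then show ?case by (auto intro: continuous_intros)
next
  case (Suc k)
  then obtain f' g' where "\<And>x. (f has_real_derivative f' x) (at x)" "smooth_upto k f'"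
    "\<And>x. (g has_real_derivative g' x) (at x)" "smooth_upto k g'" by auto
  then show ?case using Suc.IH by (auto intro!: exI[of _ "\<lambda>x. f' x + g' x"] DERIV_add)
qed

lemma smooth_upto_mult:
  "smooth_upto k f \<Longrightarrow> smooth_upto k g \<Longrightarrow> smooth_upto k (\<lambda>x. f x * g x)"
proof (induction k arbitrary: f g)
  case 0
  then show ?case by (auto intro: continuous_intros)
next
  case (Suc k)
  then obtain f' g' where *: "\<And>x. (f has_real_derivative f' x) (at x)" "smooth_upto k f'"
    "\<And>x. (g has_real_derivative g' x) (at x)" "smooth_upto k g'" by auto
  moreover have "smooth_upto k f" "smooth_upto k g"
    using Suc.prems by (blast intro: smooth_upto_SucD)+
  ultimately show ?case
    using Suc.IH by (auto intro!: exI[of _ "\<lambda>x. f' x * g x + g' x * f x"] DERIV_mult smooth_upto_add)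
qed

lemma smooth_upto_const: "smooth_upto k (\<lambda>_. c)"
proof (induction k arbitrary: c)
  case (Suc k)
  then show ?case by (auto intro!: exI[of _ "\<lambda>_. 0"])
qed simp

lemma smooth_upto_affine: "smooth_upto k f \<Longrightarrow> smooth_upto k (\<lambda>x. f (a * x + b))"
proof (induction k arbitrary: f)
  case 0
  then show ?case
    by (auto intro!: continuous_intros continuous_on_compose2[of UNIV f])
next
  case (Suc k)
  then obtain f' where f': "\<And>x. (f has_real_derivative f' x) (at x)" "smooth_upto k f'" by auto
  have "((\<lambda>x. f (a * x + b)) has_real_derivative f' (a * x + b) * a) (at x)" for x
    by (rule DERIV_chain2[OF f'(1)]) (auto intro!: derivative_eq_intros)
  moreover have "smooth_upto k (\<lambda>x. f' (a * x + b) * a)"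
    using Suc.IH[OF f'(2)] by (intro smooth_upto_mult smooth_upto_const)
  ultimately show ?case by (auto intro!: exI[of _ "\<lambda>x. f' (a * x + b) * a"])
qed

lemma smooth_add: "smooth f \<Longrightarrow> smooth g \<Longrightarrow> smooth (\<lambda>x. f x + g x)"
  and smooth_mult: "smooth f \<Longrightarrow> smooth g \<Longrightarrow> smooth (\<lambda>x. f x * g x)"
  and smooth_const: "smooth (\<lambda>_. c)"
  and smooth_affine: "smooth f \<Longrightarrow> smooth (\<lambda>x. f (a * x + b))"
  by (auto simp: smooth_def intro: smooth_upto_add smooth_upto_mult smooth_upto_const smooth_upto_affine)

lemma smooth_continuous: "smooth f \<Longrightarrow> continuous_on UNIV f"
  by (metis smooth_def smooth_upto_continuous)

lemma smooth_antiderivative: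
  assumes "\<And>x. (F has_real_derivative f x) (at x)" "smooth f"
  shows "smooth F"
  unfolding smooth_def
proof
  fix k
  have "smooth_upto (Suc k) F" using assms by (auto simp: smooth_def)
  then show "smooth_upto k F" by (rule smooth_upto_SucD)
qed

lemma smooth_deriv:
  assumes "smooth f"
  shows "(f has_real_derivative deriv f x) (at x)" and "smooth (deriv f)"
proof -
  have *: "smooth_upto k (deriv f) \<and> (\<forall>x. (f has_real_derivative deriv f x) (at x))" for k
  proof -
    obtain f' where f': "\<And>x. (f has_real_derivative f' x) (at x)" "smooth_upto k f'"
      using assms unfolding smooth_def by (metis smooth_upto.simps(2))
    then have "f' = deriv f" by (auto intro!: ext DERIV_imp_deriv[symmetric])
    then show ?thesis using f' by auto
  qed
  show "(f has_real_derivative deriv f x) (at x)" using * by blast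
  show "smooth (deriv f)" using * by (simp add: smooth_def)
qed

definition flat_exp :: "real poly \<Rightarrow> real \<Rightarrow> real" where
  "flat_exp p t = (if t > 0 then poly p (1 / t) * exp (- (1 / t)) else 0)"

lemma poly_exp_decay:
  fixes p :: "real poly"
  shows "((\<lambda>x. poly p x * exp (- x)) \<longlongrightarrow> 0) at_top"
proof (induction p)
  case (pCons a p)
  have 1: "((\<lambda>x::real. exp (- x)) \<longlongrightarrow> 0) at_top"
    using filterlim_compose[OF exp_at_bot filterlim_uminus_at_bot_at_top] by simp
  have "((\<lambda>x::real. x ^ n / exp x) \<longlongrightarrow> 0) at_top" for n by (rule tendsto_power_div_exp_0)
  then have pw: "((\<lambda>x::real. x ^ n * exp (- x)) \<longlongrightarrow> 0) at_top" for n
    by (simp add: exp_minus divide_inverse)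
  have "((\<lambda>x. \<Sum>i\<le>degree (pCons a p). coeff (pCons a p) i * (x ^ i * exp (- x))) \<longlongrightarrow>
      (\<Sum>i\<le>degree (pCons a p). coeff (pCons a p) i * 0)) at_top"
    by (intro tendsto_intros pw)
  then show ?case
    by (simp only: poly_altdef sum_distrib_right mult.assoc mult_zero_right sum.neutral_const)
qed simp

lemma flat_exp_decay: "((\<lambda>h. poly p (1 / h) * exp (- (1 / h))) \<longlongrightarrow> 0) (at_right (0::real))"
proof -
  have "filterlim (\<lambda>h::real. 1 / h) at_top (at_right 0)"
    using filterlim_inverse_at_top_right by (simp add: inverse_eq_divide)
  then show ?thesis by (rule filterlim_compose[OF poly_exp_decay])
qed

lemma flat_exp_has_derivative:
  "(flat_exp p has_real_derivative flat_exp ([:0, 0, 1:] * (p - pderiv p)) t) (at t)"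
proof -
  consider "t > 0" | "t < 0" | "t = 0" by linarith
  then show ?thesis
  proof cases
    case 1
    have "((\<lambda>t. poly p (1 / t) * exp (- (1 / t))) has_real_derivative
        flat_exp ([:0, 0, 1:] * (p - pderiv p)) t) (at t)"
      using 1 by (auto intro!: derivative_eq_intros DERIV_chain2[OF poly_DERIV]
          simp: flat_exp_def field_simps power2_eq_square)
    moreover have "\<forall>\<^sub>F x in nhds t. flat_exp p x = poly p (1 / x) * exp (- (1 / x))"
      using eventually_nhds_in_open[of "{0<..}" t] 1
      by (auto elim!: eventually_mono simp: flat_exp_def)
    ultimately show ?thesis by (subst DERIV_cong_ev) auto
  next
    case 2
    have "((\<lambda>t. 0) has_real_derivative 0) (at t)" by simp
    moreover have "\<forall>\<^sub>F x in nhds t. flat_exp p x = 0"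
      using eventually_nhds_in_open[of "{..<0}" t] 2
      by (auto elim!: eventually_mono simp: flat_exp_def)
    ultimately show ?thesis using 2 by (subst DERIV_cong_ev) (auto simp: flat_exp_def)
  next
    case 3
    have "((\<lambda>h. flat_exp p h / h) \<longlongrightarrow> 0) (at_right 0)"
    proof (rule Lim_transform_eventually[OF flat_exp_decay[of "[:0, 1:] * p"]])
      show "\<forall>\<^sub>F x in at_right 0. poly ([:0, 1:] * p) (1 / x) * exp (- (1 / x)) = flat_exp p x / x"
        by (auto simp: eventually_at_filter flat_exp_def)
    qed
    moreover have "((\<lambda>h. flat_exp p h / h) \<longlongrightarrow> 0) (at_left 0)"
      by (rule Lim_transform_eventually[OF tendsto_const])
         (auto simp: eventually_at_filter flat_exp_def)
    ultimately have "((\<lambda>h. flat_exp p h / h) \<longlongrightarrow> 0) (at 0)"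
      by (simp add: filterlim_split_at)
    then show ?thesis using 3 by (simp add: DERIV_def flat_exp_def)
  qed
qed

lemma smooth_flat_exp: "smooth (flat_exp p)"
proof -
  have "smooth_upto k (flat_exp p)" for k p
  proof (induction k arbitrary: p)
    case 0
    then show ?case
      by (auto intro!: continuous_at_imp_continuous_on DERIV_isCont flat_exp_has_derivative)
  next
    case (Suc k)
    then show ?case
      using flat_exp_has_derivative by (auto intro!: exI[of _ "flat_exp ([:0, 0, 1:] * (p - pderiv p))"])
  qed
  then show ?thesis by (simp add: smooth_def)
qed

definition margin :: "nat \<Rightarrow> real" where "margin m = 1 / (real m + 2)"

definition bump :: "nat \<Rightarrow> real \<Rightarrow> real" where
  "bump m t = flat_exp 1 (real m * (t - margin m)) * flat_exp 1 (real m * (1 - margin m - t))"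

lemma margin_bounds: "0 < margin m" "margin m \<le> 1 / 2"
  by (auto simp: margin_def field_simps)

lemma flat_exp_1_bounds: "0 \<le> flat_exp 1 t" "flat_exp 1 t \<le> 1"
  by (auto simp: flat_exp_def)

lemma smooth_bump: "smooth (bump m)"
proof -
  have "bump m = (\<lambda>t. flat_exp 1 (real m * t + - (real m * margin m)) *
     flat_exp 1 (- real m * t + real m * (1 - margin m)))"
    by (auto simp: bump_def fun_eq_iff algebra_simps)
  then show ?thesis by (simp only:) (intro smooth_mult smooth_affine smooth_flat_exp)
qed

lemma bump_bounds: "0 \<le> bump m t" "bump m t \<le> 1"
  using flat_exp_1_bounds by (auto simp: bump_def intro!: mult_le_one)

lemma bump_eq_0: "t \<le> margin m \<or> 1 - margin m \<le> t \<Longrightarrow> bump m t = 0"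
  by (auto simp: bump_def flat_exp_def zero_less_mult_iff)

lemma bump_tendsto: "(\<lambda>m. bump m t) \<longlonglongrightarrow> (if 0 < t \<and> t < 1 then 1 else 0)"
proof (cases "0 < t \<and> t < 1")
  case False
  then have "bump m t = 0" for m using margin_bounds[of m] by (intro bump_eq_0) linarith
  with False show ?thesis by (simp only: if_False tendsto_const)
next
  case True
  have margin0: "margin \<longlonglongrightarrow> 0"
  proof -
    have "margin = (\<lambda>m. 1 / real (m + 2))" by (auto simp: margin_def fun_eq_iff)
    then show ?thesis using LIMSEQ_ignore_initial_segment[OF lim_inverse_n', of 2] by metis
  qed
  have *: "(\<lambda>m. flat_exp 1 (real m * (s - margin m))) \<longlonglongrightarrow> 1" if "s > 0" for s
  proof -
    have "filterlim (\<lambda>m. (s - margin m) * real m) at_top sequentially"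
      by (rule filterlim_tendsto_pos_mult_at_top[of _ s])
         (use that margin0 in \<open>auto intro!: tendsto_eq_intros filterlim_real_sequentially\<close>)
    then have lim: "filterlim (\<lambda>m. real m * (s - margin m)) at_top sequentially"
      by (simp add: mult.commute)
    have "((\<lambda>x::real. exp (- (1 / x))) \<longlongrightarrow> exp (- 0)) at_top"
      by (intro tendsto_intros tendsto_divide_0[OF tendsto_const] filterlim_at_top_imp_at_infinity
          filterlim_ident)
    from filterlim_compose[OF this lim]
    have "(\<lambda>m. exp (- (1 / (real m * (s - margin m))))) \<longlonglongrightarrow> 1" by simp
    moreover have "\<forall>\<^sub>F m in sequentially. exp (- (1 / (real m * (s - margin m)))) =
        flat_exp 1 (real m * (s - margin m))"
      using lim[unfolded filterlim_at_top_dense, rule_format, of 0]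
      by (auto elim!: eventually_mono simp: flat_exp_def)
    ultimately show ?thesis by (rule Lim_transform_eventually)
  qed
  have "(\<lambda>m. bump m t) \<longlonglongrightarrow> 1 * 1"
    unfolding bump_def using *[of t] *[of "1 - t"] True
    by (intro tendsto_mult) (auto simp: algebra_simps)
  then show ?thesis using True by simp
qed

section \<open>Smooth approximation of the hat function\<close>

text \<open>The pointwise limit of the smooth approximations below, hence 0 at the kinks of \<open>hat\<close>.\<close>

definition dhat :: "real \<Rightarrow> real" where
  "dhat t = (if -1 < t \<and> t < 0 then 1 else if 0 < t \<and> t < 1 then -1 else 0)"

definition dhat_approx :: "nat \<Rightarrow> real \<Rightarrow> real" where
  "dhat_approx m t = bump m (- t) - bump m t"

lemma smooth_dhat_approx: "smooth (dhat_approx m)"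
proof -
  have "dhat_approx m = (\<lambda>t. bump m (-1 * t + 0) + (-1) * bump m t)"
    by (auto simp: dhat_approx_def)
  then show ?thesis
    by (simp only:) (intro smooth_add smooth_mult smooth_const smooth_affine smooth_bump)
qed

lemma dhat_approx_tendsto: "(\<lambda>m. dhat_approx m t) \<longlonglongrightarrow> dhat t"
  unfolding dhat_approx_def
  by (rule tendsto_eq_rhs[OF tendsto_diff[OF bump_tendsto[of "-t"] bump_tendsto[of t]]])
     (auto simp: dhat_def)

lemma dhat_approx_bound: "\<bar>dhat_approx m t\<bar> \<le> 1"
  using bump_bounds[of m t] bump_bounds[of m "-t"] by (simp add: dhat_approx_def)

lemma hat_approx_exists:
  "\<exists>H. (\<forall>t. (H has_real_derivative dhat_approx m t) (at t)) \<and> H (-1) = 0"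
proof -
  have "continuous_on UNIV (dhat_approx m)" by (intro smooth_continuous smooth_dhat_approx)
  then have "\<exists>F. \<forall>x::real. -\<infinity> < ereal x \<longrightarrow> ereal x < \<infinity> \<longrightarrow> (F has_vector_derivative dhat_approx m x) (at x)"
    by (intro einterval_antiderivative) (auto simp: continuous_on_eq_continuous_at)
  then obtain F where F: "\<And>x. (F has_real_derivative dhat_approx m x) (at x)"
    by (auto simp: has_real_derivative_iff_has_vector_derivative)
  then show ?thesis
    by (intro exI[of _ "\<lambda>x. F x - F (-1)"]) (auto intro!: derivative_eq_intros)
qed

definition hat_approx :: "nat \<Rightarrow> real \<Rightarrow> real" where
  "hat_approx m = (SOME H. (\<forall>t. (H has_real_derivative dhat_approx m t) (at t)) \<and> H (-1) = 0)"

lemma hat_approx_deriv: "(hat_approx m has_real_derivative dhat_approx m t) (at t)"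
  and hat_approx_neg1: "hat_approx m (-1) = 0"
  using someI_ex[OF hat_approx_exists[of m]] by (auto simp: hat_approx_def)

lemma smooth_hat_approx: "smooth (hat_approx m)"
  using hat_approx_deriv smooth_dhat_approx by (rule smooth_antiderivative)

text \<open>Since \<open>dhat_approx\<close> is odd, its primitive vanishing at \<open>-1\<close> also vanishes at \<open>1\<close>.\<close>

lemma hat_approx_even: "hat_approx m (- t) = hat_approx m t"
proof -
  let ?D = "\<lambda>t. hat_approx m t - hat_approx m (- t)"
  have "(?D has_real_derivative 0) (at x)" for x
  proof -
    have "((\<lambda>t. hat_approx m (- t)) has_real_derivative dhat_approx m (- x) * (-1)) (at x)"
      by (rule DERIV_chain2[OF hat_approx_deriv]) (auto intro!: derivative_eq_intros)
    then show ?thesis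
      by (auto intro!: derivative_eq_intros hat_approx_deriv simp: dhat_approx_def)
  qed
  then have "?D t = ?D 0" by (rule DERIV_isconst_all[OF allI])
  then show ?thesis by simp
qed

lemma hat_approx_left:
  assumes "t \<le> -1 + margin m"
  shows "hat_approx m t = 0"
proof -
  have z: "dhat_approx m s = 0" if "s \<le> -1 + margin m" for s
  proof -
    have "- s \<ge> 1 - margin m" "s \<le> margin m" using that margin_bounds[of m] by linarith+
    then show ?thesis using bump_eq_0[of s m] bump_eq_0[of "- s" m] by (simp add: dhat_approx_def)
  qed
  have "\<exists>y. \<forall>x\<in>{..-1 + margin m}. hat_approx m x = y"
  proof (rule has_field_derivative_zero_constant)
    fix x assume "x \<in> {..-1 + margin m}"
    then have "dhat_approx m x = 0" by (intro z) simp
    then show "(hat_approx m has_real_derivative 0) (at x within {..-1 + margin m})"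
      using hat_approx_deriv[of m x] by (metis has_field_derivative_at_within)
  qed simp
  then obtain y where "\<forall>x\<in>{..-1 + margin m}. hat_approx m x = y" by blast
  moreover have "-1 \<in> {..-1 + margin m}" using margin_bounds[of m] by auto
  ultimately show ?thesis using assms hat_approx_neg1[of m] by (metis atMost_iff)
qed

lemma hat_approx_eq_0: "\<bar>t\<bar> \<ge> 1 - margin m \<Longrightarrow> hat_approx m t = 0"
  using hat_approx_left[of t m] hat_approx_left[of "-t" m] hat_approx_even[of m t]
  by (auto simp: abs_if split: if_splits)

lemma hat_approx_integral:
  assumes "-1 \<le> t"
  shows "(dhat_approx m has_integral hat_approx m t) {-1..t}"
  using fundamental_theorem_of_calculus[OF assms, of "hat_approx m" "dhat_approx m"]
    hat_approx_neg1[of m] hat_approx_deriv[of m]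
  by (auto simp: has_real_derivative_iff_has_vector_derivative has_vector_derivative_at_within)

lemma hat_approx_bound: "\<bar>hat_approx m t\<bar> \<le> 1"
proof -
  have neg: "\<bar>hat_approx m s\<bar> \<le> 1" if "s \<le> 0" for s
  proof (cases "s \<ge> -1")
    case True
    have "norm (hat_approx m s) \<le> 1 * measure lborel (cbox (-1) s)"
      by (rule has_integral_bound[of _ "dhat_approx m"])
         (use True hat_approx_integral dhat_approx_bound in auto)
    then show ?thesis using True that by simp
  next
    case False
    then show ?thesis using margin_bounds[of m] by (simp add: hat_approx_eq_0)
  qed
  show ?thesis using neg[of t] neg[of "-t"] hat_approx_even[of m t] by (cases "t \<le> 0") auto
qed

lemma hat_approx_tendsto: "(\<lambda>m. hat_approx m t) \<longlonglongrightarrow> hat t"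
proof -
  have neg: "(\<lambda>m. hat_approx m s) \<longlonglongrightarrow> hat s" if "s \<le> 0" for s
  proof (cases "s \<ge> -1")
    case True
    have "(\<lambda>m. integral {-1..s} (dhat_approx m)) \<longlonglongrightarrow> integral {-1..s} dhat"
      by (rule dominated_convergence(2)[of _ _ "\<lambda>_. 1"])
         (use True hat_approx_integral dhat_approx_bound dhat_approx_tendsto in auto)
    moreover have "integral {-1..s} (dhat_approx m) = hat_approx m s" for m
      using hat_approx_integral[OF True] by (rule integral_unique)
    moreover have "integral {-1..s} dhat = integral {-1..s} (\<lambda>_. 1)"
      by (rule integral_spike[of "{-1, 0}"]) (use that in \<open>auto simp: dhat_def\<close>)
    ultimately show ?thesis using True that by (simp add: hat_def add.commute)
  next
    case False
    then have "hat_approx m s = 0" for m using margin_bounds[of m] by (intro hat_approx_eq_0) linarith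
    then show ?thesis using False by (simp add: hat_def)
  qed
  have "hat (- t) = hat t" by (simp add: hat_def)
  then show ?thesis using neg[of t] neg[of "-t"] hat_approx_even[of _ t] by (cases "t \<le> 0") auto
qed

section \<open>Test functions\<close>

definition tens :: "('n \<Rightarrow> real \<Rightarrow> real) \<Rightarrow> real ^ 'n \<Rightarrow> real" where
  "tens f x = (\<Prod>i\<in>UNIV. f i (x $ i))"

lemma tens_has_derivative:
  assumes "\<And>i. smooth (f i)"
  shows "(tens f has_derivative
    (\<lambda>h. \<Sum>i\<in>UNIV. (h $ i * deriv (f i) (x $ i)) * (\<Prod>j\<in>UNIV - {i}. f j (x $ j)))) (at x)"
  unfolding tens_def
proof (rule has_derivative_prod)
  fix i
  have 1: "(f i has_derivative (\<lambda>h. h * deriv (f i) (x $ i))) (at (x $ i))"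
    using smooth_deriv(1)[OF assms[of i], of "x $ i"] by (simp add: has_field_derivative_def mult_commute_abs)
  have 2: "((\<lambda>x. x $ i) has_derivative (\<lambda>h. h $ i)) (at x)"
    by (rule bounded_linear_imp_has_derivative[OF bounded_linear_vec_nth])
  show "((\<lambda>x. f i (x $ i)) has_derivative (\<lambda>h. h $ i * deriv (f i) (x $ i))) (at x)"
    using has_derivative_compose[OF 2 1] by simp
qed

lemma partial_deriv_eq: "(f has_derivative D) (at x) \<Longrightarrow> partial_deriv i f x = D (axis i 1)"
  by (simp add: partial_deriv_def frechet_derivative_at[symmetric])

lemma partial_deriv_tens:
  assumes "\<And>i. smooth (f i)"
  shows "partial_deriv i (tens f) = tens (f(i := deriv (f i)))"
proof
  fix x :: "real ^ 'a"
  have "partial_deriv i (tens f) x =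
      (\<Sum>k\<in>UNIV. (axis i 1 $ k * deriv (f k) (x $ k)) * (\<Prod>j\<in>UNIV - {k}. f j (x $ j)))"
    by (rule partial_deriv_eq[OF tens_has_derivative[OF assms]])
  also have "\<dots> = deriv (f i) (x $ i) * (\<Prod>j\<in>UNIV - {i}. f j (x $ j))"
    by (subst sum.remove[of _ i]) (auto simp: axis_def intro!: sum.neutral)
  also have "\<dots> = tens (f(i := deriv (f i))) x"
    by (simp add: tens_def prod.remove[of UNIV i])
  finally show "partial_deriv i (tens f) x = tens (f(i := deriv (f i))) x" .
qed

lemma C_k_tens: "(\<And>i. smooth (f i)) \<Longrightarrow> C_k k (tens f)"
proof (induction k arbitrary: f)
  case 0
  then show ?case
    unfolding C_k.simps
    by (intro continuous_at_imp_continuous_on ballI has_derivative_continuous[OF tens_has_derivative])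
next
  case (Suc k)
  have "tens f differentiable (at x)" for x
    using tens_has_derivative[of f x] Suc.prems unfolding differentiable_def by blast
  moreover have "C_k k (partial_deriv i (tens f))" for i
    using Suc.prems by (simp add: partial_deriv_tens Suc.IH smooth_deriv(2))
  ultimately show ?case by simp
qed

lemma tens_test_function:
  assumes "\<And>i. smooth (f i)" and "\<And>i. 0 < a i \<and> b i < 1"
    and "\<And>i t. t < a i \<or> t > b i \<Longrightarrow> f i t = 0"
  shows "tens f \<in> test_functions"
proof -
  have "{x. tens f x \<noteq> 0} \<subseteq> cbox (\<chi> i. a i) (\<chi> i. b i)"
    using assms(3) by (auto simp: tens_def mem_box_cart) (metis not_less)+
  then have "closure {x. tens f x \<noteq> 0} \<subseteq> cbox (\<chi> i. a i) (\<chi> i. b i)"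
    by (rule closure_minimal[OF _ closed_cbox])
  also have "\<dots> \<subseteq> box 0 1"
  proof
    fix x assume "x \<in> cbox (\<chi> i. a i) (\<chi> i. b i)"
    then have "a i \<le> x $ i \<and> x $ i \<le> b i" for i by (simp add: mem_box_cart)
    then have "0 < x $ i \<and> x $ i < 1" for i
      using assms(2)[of i] by (meson less_le_trans le_less_trans)
    then show "x \<in> box 0 1" by (simp add: mem_box_cart)
  qed
  finally show ?thesis using assms(1) C_k_tens by (auto simp: test_functions_def)
qed

lemma partial_deriv_lincomb:
  assumes "f differentiable (at x)" "g differentiable (at x)"
  shows "partial_deriv i (\<lambda>x. a * f x + b * g x) x = a * partial_deriv i f x + b * partial_deriv i g x"
proof -
  obtain f' g' where *: "(f has_derivative f') (at x)" "(g has_derivative g') (at x)"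
    using assms by (auto simp: differentiable_def)
  have "((\<lambda>x. a * f x + b * g x) has_derivative (\<lambda>h. a * f' h + b * g' h)) (at x)"
    using * by (intro has_derivative_add has_derivative_mult_right)
  then show ?thesis using * by (simp add: partial_deriv_eq)
qed

lemma C_k_lincomb: "C_k k f \<Longrightarrow> C_k k g \<Longrightarrow> C_k k (\<lambda>x. a * f x + b * g x)"
proof (induction k arbitrary: f g)
  case 0
  then show ?case by (auto intro!: continuous_intros)
next
  case (Suc k)
  then have "partial_deriv i (\<lambda>x. a * f x + b * g x) =
      (\<lambda>x. a * partial_deriv i f x + b * partial_deriv i g x)" for i
    by (auto simp: partial_deriv_lincomb)
  then show ?case using Suc by auto
qed

lemma test_functionsD:
  assumes "f \<in> test_functions"
  shows "f differentiable (at x)" "continuous_on UNIV f" "continuous_on UNIV (partial_deriv i f)"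
    and "x \<notin> box 0 1 \<Longrightarrow> f x = 0" "x \<notin> box 0 1 \<Longrightarrow> partial_deriv i f x = 0"
proof -
  have C: "C_k k f" for k using assms by (simp add: test_functions_def)
  have supp: "closure {x. f x \<noteq> 0} \<subseteq> box 0 1" using assms by (simp add: test_functions_def)
  show "f differentiable (at x)" "continuous_on UNIV f" "continuous_on UNIV (partial_deriv i f)"
    using C[of 0] C[of "Suc 0"] by simp_all
  have sub: "{x. f x \<noteq> 0} \<subseteq> closure {x. f x \<noteq> 0}" by (rule closure_subset)
  show "x \<notin> box 0 1 \<Longrightarrow> f x = 0" using supp sub by auto
  assume "x \<notin> box 0 1"
  then have x: "x \<in> - closure {x. f x \<noteq> 0}" using supp by auto
  have "(f has_derivative (\<lambda>h. 0)) (at x)"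
  proof (rule has_derivative_transform_within_open[of "\<lambda>_. 0"])
    show "open (- closure {x. f x \<noteq> 0})" by auto
    show "\<And>y. y \<in> - closure {x. f x \<noteq> 0} \<Longrightarrow> 0 = f y" using sub by auto
  qed (use x in auto)
  then show "partial_deriv i f x = 0" by (rule partial_deriv_eq)
qed

lemma test_functions_lincomb:
  assumes "f \<in> test_functions" "g \<in> test_functions"
  shows "(\<lambda>x. a * f x + b * g x) \<in> test_functions"
proof -
  have "{x. a * f x + b * g x \<noteq> 0} \<subseteq> {x. f x \<noteq> 0} \<union> {x. g x \<noteq> 0}" by auto
  from closure_mono[OF this]
  have "closure {x. a * f x + b * g x \<noteq> 0} \<subseteq> closure {x. f x \<noteq> 0} \<union> closure {x. g x \<noteq> 0}"
    by (simp only: closure_Un)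
  also have "\<dots> \<subseteq> box 0 1"
    using assms by (intro Un_least) (simp_all add: test_functions_def)
  finally have "closure {x. a * f x + b * g x \<noteq> 0} \<subseteq> box 0 1" .
  moreover have "C_k k (\<lambda>x. a * f x + b * g x)" for k
    using assms by (intro C_k_lincomb) (simp_all add: test_functions_def)
  ultimately show ?thesis by (simp add: test_functions_def)
qed

lemma test_functions_sum:
  assumes "finite A" "\<And>\<alpha>. \<alpha> \<in> A \<Longrightarrow> f \<alpha> \<in> test_functions"
  shows "(\<lambda>x. \<Sum>\<alpha>\<in>A. c \<alpha> * f \<alpha> x) \<in> test_functions \<and>
    (\<forall>i x. partial_deriv i (\<lambda>x. \<Sum>\<alpha>\<in>A. c \<alpha> * f \<alpha> x) x = (\<Sum>\<alpha>\<in>A. c \<alpha> * partial_deriv i (f \<alpha>) x))"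
  using assms
proof (induction A)
  case empty
  have "C_k k (\<lambda>x::real^'b. 0)" for k
  proof (induction k)
    case (Suc k)
    have "partial_deriv i (\<lambda>x::real^'b. 0) = (\<lambda>x. 0)" for i by (auto intro!: ext partial_deriv_eq)
    with Suc show ?case by simp
  qed simp
  then have "(\<lambda>x::real^'b. 0) \<in> test_functions" by (simp add: test_functions_def)
  moreover have "partial_deriv i (\<lambda>x::real^'b. 0) x = 0" for i x by (auto intro: partial_deriv_eq)
  ultimately show ?case by simp
next
  case (insert \<alpha> A)
  let ?g = "\<lambda>x. \<Sum>\<alpha>\<in>A. c \<alpha> * f \<alpha> x"
  have *: "f \<alpha> \<in> test_functions" "?g \<in> test_functions" using insert by auto
  have "(\<lambda>x. c \<alpha> * f \<alpha> x + 1 * ?g x) \<in> test_functions" using * by (rule test_functions_lincomb)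
  moreover have "partial_deriv i (\<lambda>x. c \<alpha> * f \<alpha> x + 1 * ?g x) x =
      c \<alpha> * partial_deriv i (f \<alpha>) x + 1 * partial_deriv i ?g x" for i x
    using * by (intro partial_deriv_lincomb test_functionsD(1))
  ultimately show ?case using insert by simp
qed

section \<open>Weak gradients\<close>

lemma cube_integral:
  fixes f :: "real ^ 'n \<Rightarrow> real"
  assumes "f \<in> borel_measurable borel" "\<And>x. x \<notin> cbox 0 1 \<Longrightarrow> f x = 0"
  shows "(LINT x|cube_measure. f x) = (LINT x|lborel. f x)"
proof -
  have "(\<lambda>x. indicator (cbox 0 1) x *\<^sub>R f x) = f"
    using assms(2) by (auto simp: indicator_def fun_eq_iff)
  then show ?thesis using assms(1)
    by (simp add: integral_restrict_space integral_completion del: real_scaleR_def)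
qed

text \<open>The integrals of the translates of \<open>F\<close> along a coordinate axis do not depend on the
  translation, so their derivative vanishes.\<close>

lemma integral_line_derivative_eq_0:
  fixes F D :: "real ^ 'n \<Rightarrow> real"
  assumes cont: "continuous_on UNIV F" "continuous_on UNIV D"
    and zero: "\<And>x. x \<notin> cbox 0 1 \<Longrightarrow> F x = 0" "\<And>x. x \<notin> cbox 0 1 \<Longrightarrow> D x = 0"
    and deriv: "\<And>x t. ((\<lambda>t. F (x + t *\<^sub>R axis i 1)) has_real_derivative D (x + t *\<^sub>R axis i 1)) (at t)"
  shows "(LINT x|lborel. D x) = 0"
proof -
  define e :: "real ^ 'n" where "e = axis i 1"
  have [measurable]: "F \<in> borel_measurable borel" "D \<in> borel_measurable borel"
    using cont by (auto intro: borel_measurable_continuous_onI)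
  have "bounded (D ` cbox 0 1)"
    using cont(2) by (intro compact_imp_bounded compact_continuous_image)
      (auto intro: continuous_on_subset)
  then obtain B where B: "B > 0" "\<And>x. x \<in> cbox 0 1 \<Longrightarrow> \<bar>D x\<bar> \<le> B"
    by (auto simp: bounded_pos)
  have DB: "\<bar>D x\<bar> \<le> B" for x using B zero(2)[of x] by (cases "x \<in> cbox 0 1") auto
  have "integrable lborel (\<lambda>x. indicator (cbox 0 1) x *\<^sub>R F x)"
    using cont(1) by (intro borel_integrable_compact) (auto intro: continuous_on_subset)
  moreover have "(\<lambda>x. indicator (cbox 0 1) x *\<^sub>R F x) = F"
    using zero(1) by (auto simp: indicator_def fun_eq_iff)
  ultimately have intF: "integrable lborel F" by simp
  have shift: "integrable lborel (\<lambda>x. F (c + x))" "(LINT x|lborel. F (c + x)) = (LINT x|lborel. F x)" for c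
  proof -
    have "integrable (distr lborel borel ((+) c)) F" using intF by (simp only: lborel_distr_plus)
    then show "integrable lborel (\<lambda>x. F (c + x))" by (subst (asm) integrable_distr_eq) auto
    have "(LINT x|lborel. F x) = (LINT x|distr lborel borel ((+) c). F x)"
      by (simp only: lborel_distr_plus)
    also have "\<dots> = (LINT x|lborel. F (c + x))" by (subst integral_distr) auto
    finally show "(LINT x|lborel. F (c + x)) = (LINT x|lborel. F x)" ..
  qed
  define t where "t m = inverse (real (Suc m))" for m
  have t: "0 < t m" "t m \<le> 1" for m by (auto simp: t_def field_simps)
  have t0: "t \<longlonglongrightarrow> 0" unfolding t_def by (rule LIMSEQ_inverse_real_of_nat)
  define q where "q m x = (F (t m *\<^sub>R e + x) - F x) / t m" for m x
  have "(\<lambda>m. LINT x|lborel. q m x) \<longlonglongrightarrow> (LINT x|lborel. D x)"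
  proof (rule integral_dominated_convergence[where w="\<lambda>x. B * indicator (cbox (-1) 1) x"])
    show "AE x in lborel. (\<lambda>m. q m x) \<longlonglongrightarrow> D x"
    proof (rule AE_I2)
      fix x :: "real ^ 'n"
      have "((\<lambda>h. (F (x + h *\<^sub>R e) - F x) / h) \<longlongrightarrow> D x) (at 0)"
        using deriv[of x 0] by (simp add: DERIV_def e_def)
      then have "(\<lambda>m. (F (x + t m *\<^sub>R e) - F x) / t m) \<longlonglongrightarrow> D x"
        by (rule filterlim_compose)
           (use t t0 in \<open>auto simp: filterlim_at intro!: always_eventually less_imp_neq[symmetric]\<close>)
      then show "(\<lambda>m. q m x) \<longlonglongrightarrow> D x" by (simp add: q_def add.commute)
    qed
    show "AE x in lborel. norm (q m x) \<le> B * indicator (cbox (-1) 1) x" for m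
    proof (rule AE_I2)
      fix x :: "real ^ 'n"
      have "\<exists>z>0. z < t m \<and> F (x + t m *\<^sub>R e) - F (x + 0 *\<^sub>R e) = (t m - 0) * D (x + z *\<^sub>R e)"
        by (rule MVT2) (use t deriv in \<open>auto simp: e_def\<close>)
      then obtain z where z: "F (x + t m *\<^sub>R e) - F x = t m * D (x + z *\<^sub>R e)" by auto
      have "q m x = D (x + z *\<^sub>R e)" using z t(1)[of m] by (simp add: q_def add.commute)
      then have 1: "\<bar>q m x\<bar> \<le> B" using DB by simp
      have 2: "q m x = 0" if "x \<notin> cbox (-1) 1"
      proof -
        have "\<not> (\<forall>j. -1 \<le> x $ j \<and> x $ j \<le> 1)" using that by (simp add: mem_box_cart)
        then obtain j where j: "x $ j < -1 \<or> x $ j > 1" by (meson not_le)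
        have ej: "0 \<le> e $ j" "e $ j \<le> 1" by (auto simp: e_def axis_def)
        have "0 \<le> t m * e $ j" "t m * e $ j \<le> 1"
          using t[of m] ej by (auto intro: mult_le_one)
        then have "\<not> (0 \<le> x $ j \<and> x $ j \<le> 1)" "\<not> (0 \<le> t m * e $ j + x $ j \<and> t m * e $ j + x $ j \<le> 1)"
          using j by linarith+
        then have "x \<notin> cbox 0 1" "t m *\<^sub>R e + x \<notin> cbox 0 1"
          by (auto simp: mem_box_cart)
        then show ?thesis by (simp add: q_def zero)
      qed
      show "norm (q m x) \<le> B * indicator (cbox (-1) 1) x"
        using 1 2 by (auto simp: indicator_def)
    qed
    show "integrable lborel (\<lambda>x::real^'n. B * indicator (cbox (-1) 1) x)"
      by (intro integrable_mult_right) (simp only: integrable_indicator_iff, simp add: emeasure_lborel_cbox_eq)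
  qed (auto simp: q_def)
  moreover have "(LINT x|lborel. q m x) = 0" for m
    using shift[of "t m *\<^sub>R e"] intF by (simp add: q_def)
  ultimately show ?thesis by (simp add: LIMSEQ_const_iff)
qed

lemma test_functions_by_parts:
  fixes f g :: "real ^ 'n \<Rightarrow> real"
  assumes "f \<in> test_functions" "g \<in> test_functions"
  shows "(LINT x|cube_measure. f x * partial_deriv i g x) = - (LINT x|cube_measure. partial_deriv i f x * g x)"
proof -
  have line: "((\<lambda>t. h (x + t *\<^sub>R axis i 1)) has_real_derivative partial_deriv i h (x + t *\<^sub>R axis i 1)) (at t)"
    if h: "h \<in> test_functions" for h :: "real ^ 'n \<Rightarrow> real" and x t
  proof -
    obtain h' where h': "(h has_derivative h') (at (x + t *\<^sub>R axis i 1))"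
      using test_functionsD(1)[OF h] by (auto simp: differentiable_def)
    have "((\<lambda>t. x + t *\<^sub>R axis i 1) has_derivative (\<lambda>s. s *\<^sub>R axis i 1)) (at t)"
      by (auto intro!: derivative_eq_intros)
    from has_derivative_compose[OF this h']
    have "((\<lambda>t. h (x + t *\<^sub>R axis i 1)) has_derivative (\<lambda>s. h' (s *\<^sub>R axis i 1))) (at t)" .
    moreover have "h' (s *\<^sub>R axis i 1) = partial_deriv i h (x + t *\<^sub>R axis i 1) * s" for s
      using h' by (simp add: partial_deriv_eq linear_cmul[OF has_derivative_linear])
    ultimately show ?thesis by (simp add: has_field_derivative_def)
  qed
  note cont = test_functionsD(2)[OF assms(1)] test_functionsD(3)[OF assms(1), of i]
    test_functionsD(2)[OF assms(2)] test_functionsD(3)[OF assms(2), of i]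
  have [measurable]: "f \<in> borel_measurable borel" "g \<in> borel_measurable borel"
    "partial_deriv i f \<in> borel_measurable borel" "partial_deriv i g \<in> borel_measurable borel"
    using cont by (auto intro: borel_measurable_continuous_onI)
  have z: "f x = 0" "g x = 0" if "x \<notin> cbox 0 1" for x
    using assms that box_subset_cbox[of "0::real^'n" 1] by (auto intro: test_functionsD(4))
  have int: "integrable lborel (\<lambda>x. h x)"
    if "continuous_on UNIV h" "\<And>x. x \<notin> cbox 0 1 \<Longrightarrow> h x = 0" for h :: "real ^ 'n \<Rightarrow> real"
  proof -
    have "integrable lborel (\<lambda>x. indicator (cbox 0 1) x *\<^sub>R h x)"
      using that(1) by (intro borel_integrable_compact) (auto intro: continuous_on_subset)
    moreover have "(\<lambda>x. indicator (cbox 0 1) x *\<^sub>R h x) = h"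
      using that(2) by (auto simp: indicator_def fun_eq_iff)
    ultimately show ?thesis by simp
  qed
  have "(LINT x|lborel. f x * partial_deriv i g x + partial_deriv i f x * g x) = 0"
  proof (rule integral_line_derivative_eq_0[of "\<lambda>x. f x * g x" _ i])
    fix x t
    show "((\<lambda>t. f (x + t *\<^sub>R axis i 1) * g (x + t *\<^sub>R axis i 1)) has_real_derivative
        f (x + t *\<^sub>R axis i 1) * partial_deriv i g (x + t *\<^sub>R axis i 1) +
        partial_deriv i f (x + t *\<^sub>R axis i 1) * g (x + t *\<^sub>R axis i 1)) (at t)"
      by (rule DERIV_cong[OF DERIV_mult[OF line[OF assms(1)] line[OF assms(2)]]]) simp
  qed (use cont z in \<open>auto intro!: continuous_intros\<close>)
  moreover have "integrable lborel (\<lambda>x. f x * partial_deriv i g x)"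
    "integrable lborel (\<lambda>x. partial_deriv i f x * g x)"
    using cont z by (auto intro!: int continuous_intros)
  ultimately have "(LINT x|lborel. f x * partial_deriv i g x) = - (LINT x|lborel. partial_deriv i f x * g x)"
    by (simp add: add_eq_0_iff)
  then show ?thesis using z by (simp add: cube_integral)
qed

lemma finite_measure_cube: "finite_measure (cube_measure :: (real ^ 'n) measure)"
  by (rule finite_measure_lebesgue_on) simp

lemma L2_component_integrable:
  fixes g :: "real ^ 'n \<Rightarrow> real ^ 'n"
  assumes "g \<in> L2"
  shows "integrable (cube_measure :: (real ^ 'n) measure) (\<lambda>x. g x $ i)"
proof (rule Bochner_Integration.integrable_bound)
  interpret finite_measure "cube_measure :: (real ^ 'n) measure" by (rule finite_measure_cube)
  show "integrable cube_measure (\<lambda>x. 1 + (norm (g x))\<^sup>2)"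
    using assms by (auto simp: L2_def)
  have g: "g \<in> borel_measurable cube_measure" using assms by (auto simp: L2_def)
  show "(\<lambda>x. g x $ i) \<in> borel_measurable cube_measure"
    by (rule measurable_compose[OF g]) (intro borel_measurable_continuous_onI continuous_intros)
  have "\<bar>g x $ i\<bar> \<le> 1 + (norm (g x))\<^sup>2" for x
  proof -
    have "\<bar>g x $ i\<bar> \<le> norm (g x)" by (rule component_le_norm_cart)
    also have "\<dots> \<le> 1 + (norm (g x))\<^sup>2"
      using zero_le_power2[of "norm (g x) - 1"] norm_ge_zero[of "g x"] power2_diff[of "norm (g x)" 1]
      by (simp del: norm_ge_zero zero_le_power2)
    finally show ?thesis .
  qed
  then show "AE x in cube_measure. norm (g x $ i) \<le> norm (1 + (norm (g x))\<^sup>2)" by auto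
qed

lemma bump_approx_box:
  fixes a b :: "real ^ 'n"
  assumes "\<And>j. 0 \<le> a $ j \<and> a $ j < b $ j \<and> b $ j \<le> 1"
  obtains f where "\<And>m. f m \<in> test_functions" "\<And>m x. \<bar>f m x\<bar> \<le> 1"
    "\<And>x. (\<lambda>m. f m x) \<longlonglongrightarrow> indicator (box a b) x"
proof
  define s where "s m j t = bump m (1 / (b $ j - a $ j) * t + - a $ j / (b $ j - a $ j))" for m j t
  have s_eq: "s m j t = bump m ((t - a $ j) / (b $ j - a $ j))" for m j t
    by (simp add: s_def diff_divide_distrib)
  have d: "b $ j - a $ j > 0" for j using assms[of j] by simp
  show "tens (s m) \<in> test_functions" for m
  proof (rule tens_test_function)
    fix j
    show "smooth (s m j)" unfolding s_def by (intro smooth_affine smooth_bump)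
    let ?l = "a $ j + margin m * (b $ j - a $ j)" and ?u = "b $ j - margin m * (b $ j - a $ j)"
    have "margin m * (b $ j - a $ j) > 0" using d margin_bounds by simp
    then show "0 < ?l \<and> ?u < 1" using assms[of j] by linarith
    fix t assume "t < ?l \<or> t > ?u"
    then have "(t - a $ j) / (b $ j - a $ j) \<le> margin m \<or> 1 - margin m \<le> (t - a $ j) / (b $ j - a $ j)"
      using d[of j] by (simp add: field_simps) (auto simp: algebra_simps)
    then show "s m j t = 0" by (simp add: s_eq bump_eq_0)
  qed
  show "\<bar>tens (s m) x\<bar> \<le> 1" for m x
    using bump_bounds by (auto simp: tens_def abs_prod s_eq intro!: prod_le_1)
  show "(\<lambda>m. tens (s m) x) \<longlonglongrightarrow> indicator (box a b) x" for x
  proof -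
    have "(\<lambda>m. tens (s m) x) \<longlonglongrightarrow>
        (\<Prod>j\<in>UNIV. if 0 < (x $ j - a $ j) / (b $ j - a $ j) \<and> (x $ j - a $ j) / (b $ j - a $ j) < 1 then 1 else 0)"
      unfolding tens_def s_eq by (intro tendsto_prod bump_tendsto)
    also have "(\<Prod>j\<in>UNIV. if 0 < (x $ j - a $ j) / (b $ j - a $ j) \<and> (x $ j - a $ j) / (b $ j - a $ j) < 1 then 1 else 0)
        = (\<Prod>j\<in>UNIV. if a $ j < x $ j \<and> x $ j < b $ j then 1 else (0::real))"
      using d by (intro prod.cong) (auto simp: field_simps)
    also have "\<dots> = indicator (box a b) x"
      by (auto simp: indicator_def mem_box_cart)
    finally show ?thesis .
  qed
qed

text \<open>Smooth bumps approximate indicators of boxes, and boxes generate the Borel sets.\<close>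

lemma test_functions_determine:
  fixes h :: "real ^ 'n \<Rightarrow> real"
  assumes int: "integrable cube_measure h"
    and zero: "\<And>f. f \<in> test_functions \<Longrightarrow> (LINT x|cube_measure. h x * f x) = 0"
  shows "AE x in cube_measure. h x = 0"
proof -
  define h0 where "h0 x = indicator (cbox 0 1) x *\<^sub>R h x" for x
  have int0: "integrable lebesgue h0"
    using int by (simp add: integrable_restrict_space h0_def[abs_def])
  then have m0: "h0 \<in> borel_measurable (completion lborel)" by (rule borel_measurable_integrable)
  then obtain h1 where h1[measurable]: "h1 \<in> borel_measurable lborel" and AE1: "AE x in lborel. h0 x = h1 x"
    using completion_ex_borel_measurable_real by blast
  have AE2: "AE x in lebesgue. h0 x = h1 x" using AE1 by (rule AE_completion)
  have m1: "h1 \<in> borel_measurable (completion lborel)" using h1 by (rule measurable_completion)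
  have int1: "integrable lborel h1"
    using int0 integrable_cong_AE[OF m0 m1 AE2] integrable_completion[OF h1] by blast
  define I where "I A = (LINT x|lborel. indicator A x *\<^sub>R h1 x)" for A
  have box0: "I (box a b) = 0" if ab: "\<And>j. 0 \<le> a $ j \<and> a $ j < b $ j \<and> b $ j \<le> 1" for a b
  proof -
    from bump_approx_box[of a b] ab obtain f where f: "\<And>m. f m \<in> test_functions" "\<And>m x. \<bar>f m x\<bar> \<le> 1"
      "\<And>x. (\<lambda>m. f m x) \<longlonglongrightarrow> indicator (box a b) x" by blast
    have [measurable]: "f m \<in> borel_measurable borel" for m
      using test_functionsD(2)[OF f(1)] by (rule borel_measurable_continuous_onI)
    have fz: "f m x = 0" if "x \<notin> cbox 0 1" for m x
      using f that box_subset_cbox[of "0::real^'n" 1] by (auto intro: test_functionsD(4))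
    have "(\<lambda>m. LINT x|lborel. f m x * h1 x) \<longlonglongrightarrow> I (box a b)"
      unfolding I_def
    proof (rule integral_dominated_convergence[where w="\<lambda>x. \<bar>h1 x\<bar>"])
      show "AE x in lborel. (\<lambda>m. f m x * h1 x) \<longlonglongrightarrow> indicat_real (box a b) x *\<^sub>R h1 x"
        using f(3) by (auto intro!: tendsto_mult)
      show "AE x in lborel. norm (f m x * h1 x) \<le> \<bar>h1 x\<bar>" for m
        using f(2) by (auto simp: abs_mult intro!: mult_left_le_one_le)
      show "integrable lborel (\<lambda>x. \<bar>h1 x\<bar>)" using int1 by simp
    qed auto
    moreover have "(LINT x|lborel. f m x * h1 x) = 0" for m
    proof -
      have fm: "f m \<in> borel_measurable lebesgue" by (rule measurable_completion) simp
      note [measurable] = m0 m1 fm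
      have "(LINT x|lborel. f m x * h1 x) = (LINT x|lebesgue. f m x * h1 x)"
        by (rule integral_completion[symmetric]) auto
      also have "\<dots> = (LINT x|lebesgue. f m x * h0 x)"
        by (rule integral_cong_AE) (use AE2 in \<open>auto elim!: eventually_mono\<close>)
      also have "\<dots> = (LINT x|cube_measure. h x * f m x)"
        by (simp add: integral_restrict_space h0_def mult_ac)
      finally show ?thesis using zero f(1) by simp
    qed
    ultimately show ?thesis by (simp add: LIMSEQ_const_iff)
  qed
  have AEin: "AE x in lborel. x \<in> box 0 1 \<or> h1 x = 0"
  proof -
    have "AE x in lborel. x \<notin> cbox 0 1 - box 0 (1::real^'n)"
    proof (rule AE_not_in)
      show "cbox 0 1 - box 0 (1::real^'n) \<in> null_sets lborel"
        by (auto simp: null_sets_def emeasure_lborel_cbox_eq emeasure_lborel_box_eq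
            intro!: emeasure_Diff[THEN trans] box_subset_cbox)
    qed
    then show ?thesis using AE1 by eventually_elim (auto simp: h0_def indicator_def split: if_splits)
  qed
  have clip: "I (box a b) = 0" for a b
  proof -
    define a' :: "real ^ 'n" where "a' = (\<chi> j. max (a $ j) 0)"
    define b' :: "real ^ 'n" where "b' = (\<chi> j. min (b $ j) 1)"
    have eq: "box a b \<inter> box 0 1 = box a' b'"
      by (auto simp: a'_def b'_def mem_box_cart set_eq_iff)
    have "I (box a b) = I (box a' b')"
      unfolding I_def eq[symmetric]
      by (rule integral_cong_AE) (use AEin in \<open>auto elim!: eventually_mono simp: indicator_def\<close>)
    also have "\<dots> = 0"
    proof (cases "\<forall>j. a' $ j < b' $ j")
      case True
      then show ?thesis by (intro box0) (auto simp: a'_def b'_def)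
    next
      case False
      then obtain j where "\<not> a' $ j < b' $ j" by blast
      then have "x \<notin> box a' b'" for x unfolding mem_box_cart by (meson less_trans)
      then have "box a' b' = {}" by blast
      then show ?thesis by (simp add: I_def)
    qed
    finally show ?thesis .
  qed
  have UNIV0: "I UNIV = 0"
  proof -
    have "I UNIV = I (box 0 1)"
      unfolding I_def by (rule integral_cong_AE) (use AEin in \<open>auto elim!: eventually_mono simp: indicator_def\<close>)
    then show ?thesis using clip by simp
  qed
  have "I A = 0" if "A \<in> sets borel" for A
  proof -
    have "Int_stable (range (\<lambda>(a, b). box a b :: (real ^ 'n) set))"
      by (auto simp: Int_stable_def box_Int_box)
    moreover have "range (\<lambda>(a, b). box a b :: (real ^ 'n) set) \<subseteq> Pow UNIV" by auto
    moreover have "A \<in> sigma_sets UNIV (range (\<lambda>(a, b). box a b :: (real ^ 'n) set))"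
      using that by (simp add: borel_eq_box)
    ultimately show ?thesis
    proof (induction rule: sigma_sets_induct_disjoint)
      case (basic A)
      then show ?case using clip by auto
    next
      case empty
      then show ?case by (simp add: I_def)
    next
      case (compl A)
      then have [measurable]: "A \<in> sets borel" by (simp add: borel_eq_box)
      have iA: "integrable lborel (\<lambda>x. indicator A x *\<^sub>R h1 x)"
        using int1 by (intro integrable_mult_indicator) auto
      have "I (UNIV - A) = (LINT x|lborel. h1 x - indicator A x *\<^sub>R h1 x)"
        unfolding I_def by (rule Bochner_Integration.integral_cong) (auto simp: indicator_def)
      also have "\<dots> = I UNIV - I A" using int1 iA by (simp add: I_def)
      finally show ?case using UNIV0 compl by simp
    next
      case (union A)
      then have [measurable]: "A i \<in> sets borel" for i by (auto simp: borel_eq_box)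
      have "set_lebesgue_integral lborel (\<Union>i. A i) h1 = (\<Sum>i. set_lebesgue_integral lborel (A i) h1)"
      proof (rule lebesgue_integral_countable_add)
        show "set_integrable lborel (\<Union>i. A i) h1"
          unfolding set_integrable_def using int1 by (intro integrable_mult_indicator) auto
        show "i \<noteq> j \<Longrightarrow> A i \<inter> A j = {}" for i j
          using union(1) by (auto simp: disjoint_family_on_def)
      qed auto
      then show ?case using union(3) by (simp add: I_def set_lebesgue_integral_def)
    qed
  qed
  then have "AE x in lborel. h1 x = 0"
    using int1 by (intro density_unique_real) (auto simp: I_def set_lebesgue_integral_def)
  then have "AE x in lborel. h0 x = 0" using AE1 by eventually_elim simp
  then have "AE x in lebesgue. h0 x = 0" by (rule AE_completion)
  then show ?thesis
    by (subst AE_restrict_space_iff) (auto elim!: eventually_mono simp: h0_def indicator_def)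
qed

lemma has_weak_grad_unique:
  fixes u :: "real ^ 'n \<Rightarrow> real"
  assumes "has_weak_grad u g" "has_weak_grad u g'"
  shows "AE x in cube_measure. g x = g' x"
proof -
  have L2: "g \<in> L2" "g' \<in> L2" using assms by (auto simp: has_weak_grad_def)
  have "AE x in cube_measure. g x $ i - g' x $ i = 0" for i
  proof (rule test_functions_determine)
    note int = L2_component_integrable[OF L2(1), of i] L2_component_integrable[OF L2(2), of i]
    then show "integrable cube_measure (\<lambda>x. g x $ i - g' x $ i)" by simp
    fix f :: "real ^ 'n \<Rightarrow> real" assume f: "f \<in> test_functions"
    have "bounded (f ` cbox 0 1)"
      using test_functionsD(2)[OF f] by (intro compact_imp_bounded compact_continuous_image)
        (auto intro: continuous_on_subset)
    then obtain B where B: "B > 0" "\<And>x. x \<in> cbox 0 1 \<Longrightarrow> \<bar>f x\<bar> \<le> B" by (auto simp: bounded_pos)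
    have "f \<in> borel_measurable borel"
      using test_functionsD(2)[OF f] by (rule borel_measurable_continuous_onI)
    then have fm: "f \<in> borel_measurable cube_measure"
      by (intro measurable_restrict_space1 measurable_completion) simp
    have *: "integrable cube_measure (\<lambda>x. h x * f x)"
      if h: "integrable cube_measure h" for h :: "real ^ 'n \<Rightarrow> real"
    proof (rule Bochner_Integration.integrable_bound)
      show "integrable cube_measure (\<lambda>x. B * h x)" using h by simp
      show "(\<lambda>x. h x * f x) \<in> borel_measurable cube_measure"
        using h fm by (intro borel_measurable_times) auto
      show "AE x in cube_measure. norm (h x * f x) \<le> norm (B * h x)"
      proof (rule AE_I2)
        fix x :: "real ^ 'n" assume "x \<in> space cube_measure"
        then have "\<bar>f x\<bar> \<le> \<bar>B\<bar>" using B by force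
        then show "norm (h x * f x) \<le> norm (B * h x)"
          by (simp add: abs_mult mult_right_mono mult.commute[of "\<bar>h x\<bar>"])
      qed
    qed
    have "(LINT x|cube_measure. g x $ i * f x) = (LINT x|cube_measure. g' x $ i * f x)"
    proof -
      have "(LINT x|cube_measure. u x * partial_deriv i f x) = - (LINT x|cube_measure. p x $ i * f x)"
        if "has_weak_grad u p" for p
        using that f by (simp add: has_weak_grad_def)
      from this[OF assms(1)] this[OF assms(2)] show ?thesis by simp
    qed
    then show "(LINT x|cube_measure. (g x $ i - g' x $ i) * f x) = 0"
      using *[OF int(1)] *[OF int(2)] by (simp add: left_diff_distrib)
  qed
  then have "AE x in cube_measure. \<forall>i\<in>UNIV. g x $ i - g' x $ i = 0"
    by (intro AE_finite_allI) auto
  then show ?thesis by eventually_elim (simp add: vec_eq_iff)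
qed

lemma L2_bounded:
  fixes u :: "real ^ 'n \<Rightarrow> 'b::euclidean_space"
  assumes "u \<in> borel_measurable cube_measure" "\<And>x. x \<in> cbox 0 1 \<Longrightarrow> norm (u x) \<le> B"
  shows "u \<in> L2"
proof -
  interpret finite_measure "cube_measure :: (real ^ 'n) measure" by (rule finite_measure_cube)
  have "AE x in cube_measure. norm ((norm (u x))\<^sup>2) \<le> B\<^sup>2"
    using assms(2) by (intro AE_I2) (auto intro!: power_mono)
  then show ?thesis using assms(1)
    by (auto simp: L2_def intro!: integrable_const_bound[of _ "B\<^sup>2"])
qed

lemma L2_norm_tendsto_0:
  fixes u :: "real ^ 'n \<Rightarrow> 'b::euclidean_space"
  assumes meas: "\<And>m. f m \<in> borel_measurable cube_measure" "u \<in> borel_measurable cube_measure"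
    and bound: "\<And>m x. x \<in> cbox 0 1 \<Longrightarrow> norm (f m x) \<le> B"
    and lim: "\<And>x. x \<in> cbox 0 1 \<Longrightarrow> (\<lambda>m. f m x) \<longlonglongrightarrow> u x"
  shows "(\<lambda>m. L2_norm (\<lambda>x. f m x - u x)) \<longlonglongrightarrow> 0"
proof -
  interpret finite_measure "cube_measure :: (real ^ 'n) measure" by (rule finite_measure_cube)
  have u: "norm (u x) \<le> B" if "x \<in> cbox 0 1" for x
    using bound[OF that] lim[OF that] by (intro LIMSEQ_le_const2[OF tendsto_norm]) auto
  have "(\<lambda>m. LINT x|cube_measure. (norm (f m x - u x))\<^sup>2) \<longlonglongrightarrow> (LINT x|(cube_measure :: (real ^ 'n) measure). 0)"
  proof (rule integral_dominated_convergence[where w="\<lambda>_. (2 * B)\<^sup>2"])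
    show "AE x in cube_measure. (\<lambda>m. (norm (f m x - u x))\<^sup>2) \<longlonglongrightarrow> 0"
    proof (rule AE_I2)
      fix x :: "real ^ 'n" assume "x \<in> space cube_measure"
      then have "(\<lambda>m. (norm (f m x - u x))\<^sup>2) \<longlonglongrightarrow> (norm (u x - u x))\<^sup>2"
        by (intro tendsto_intros lim) simp
      then show "(\<lambda>m. (norm (f m x - u x))\<^sup>2) \<longlonglongrightarrow> 0" by simp
    qed
    show "AE x in cube_measure. norm ((norm (f m x - u x))\<^sup>2) \<le> (2 * B)\<^sup>2" for m
    proof (rule AE_I2)
      fix x :: "real ^ 'n" assume "x \<in> space cube_measure"
      then have "norm (f m x) + norm (u x) \<le> 2 * B" using bound[of x m] u[of x] by simp
      then have "norm (f m x - u x) \<le> 2 * B" using norm_triangle_ineq4[of "f m x" "u x"] by linarith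
      from power_mono[OF this norm_ge_zero, of 2]
      show "norm ((norm (f m x - u x))\<^sup>2) \<le> (2 * B)\<^sup>2" by simp
    qed
  qed (use meas in auto)
  then have "(\<lambda>m. sqrt (LINT x|cube_measure. (norm (f m x - u x))\<^sup>2)) \<longlonglongrightarrow> sqrt 0"
    by (intro tendsto_real_sqrt) simp
  then show ?thesis by (simp add: L2_norm_def)
qed

lemma L2_norm_cong_AE:
  assumes "u \<in> borel_measurable cube_measure" "v \<in> borel_measurable cube_measure"
    and "AE x in cube_measure. u x = v x"
  shows "L2_norm u = L2_norm v"
proof -
  have "(LINT x|cube_measure. (norm (u x))\<^sup>2) = (LINT x|cube_measure. (norm (v x))\<^sup>2)"
    using assms by (intro integral_cong_AE) (auto elim!: eventually_mono)
  then show ?thesis by (simp add: L2_norm_def)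
qed

lemma weak_grad_limit:
  fixes u :: "real ^ 'n \<Rightarrow> real" and g :: "real ^ 'n \<Rightarrow> real ^ 'n"
  assumes test: "\<And>m. f m \<in> test_functions"
    and lim: "\<And>x. x \<in> cbox 0 1 \<Longrightarrow> (\<lambda>m. f m x) \<longlonglongrightarrow> u x"
      "\<And>x i. x \<in> cbox 0 1 \<Longrightarrow> (\<lambda>m. partial_deriv i (f m) x) \<longlonglongrightarrow> g x $ i"
    and bound: "\<And>m x. x \<in> cbox 0 1 \<Longrightarrow> \<bar>f m x\<bar> \<le> B"
      "\<And>m i x. x \<in> cbox 0 1 \<Longrightarrow> \<bar>partial_deriv i (f m) x\<bar> \<le> B"
  shows "u \<in> H10" and "H10_norm u = L2_norm g"
proof -
  interpret finite_measure "cube_measure :: (real ^ 'n) measure" by (rule finite_measure_cube)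
  have cube_meas: "h \<in> borel_measurable cube_measure"
    if "continuous_on UNIV h" for h :: "real ^ 'n \<Rightarrow> real"
    using borel_measurable_continuous_onI[OF that]
    by (intro measurable_restrict_space1 measurable_completion) simp
  have fm: "f m \<in> borel_measurable cube_measure" "partial_deriv i (f m) \<in> borel_measurable cube_measure" for m i
    using test_functionsD(2,3)[OF test] by (auto intro: cube_meas)
  have um: "u \<in> borel_measurable cube_measure"
    by (rule borel_measurable_LIMSEQ_real[of _ f]) (use lim fm in auto)
  have gim: "(\<lambda>x. g x $ i) \<in> borel_measurable cube_measure" for i
    by (rule borel_measurable_LIMSEQ_real[of _ "\<lambda>m. partial_deriv i (f m)"]) (use lim fm in auto)
  have vec_meas: "h \<in> borel_measurable cube_measure"
    if "\<And>i. (\<lambda>x. h x $ i) \<in> borel_measurable cube_measure" for h :: "real ^ 'n \<Rightarrow> real ^ 'n"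
  proof (rule borel_measurable_euclidean_space[THEN iffD2], intro ballI)
    fix b :: "real ^ 'n" assume "b \<in> Basis"
    then obtain i where "b = axis i 1" by (auto simp: Basis_vec_def)
    then show "(\<lambda>x. h x \<bullet> b) \<in> borel_measurable cube_measure"
      using that[of i] by (simp add: inner_axis)
  qed
  have gm: "g \<in> borel_measurable cube_measure" using gim by (rule vec_meas)
  have cgm: "classical_grad (f m) \<in> borel_measurable cube_measure" for m
    using fm by (intro vec_meas) (simp add: classical_grad_def)
  have norm_vec: "norm v \<le> real CARD('n) * B" if "\<And>i. \<bar>v $ i\<bar> \<le> B" for v :: "real ^ 'n"
    using norm_le_l1_cart[of v] sum_bounded_above[of UNIV "\<lambda>i. \<bar>v $ i\<bar>" B] that by simp
  have ub: "\<bar>u x\<bar> \<le> B" if "x \<in> cbox 0 1" for x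
    using bound(1)[OF that] lim(1)[OF that] by (intro LIMSEQ_le_const2[OF tendsto_rabs]) auto
  have gb: "\<bar>g x $ i\<bar> \<le> B" if "x \<in> cbox 0 1" for x i
    by (rule LIMSEQ_le_const2[OF tendsto_rabs[OF lim(2)[OF that]]]) (use bound(2)[OF that] in auto)
  have wg: "has_weak_grad u g"
    unfolding has_weak_grad_def
  proof (intro conjI ballI allI)
    show "u \<in> L2" by (rule L2_bounded[of u B]) (use um ub in auto)
    show "g \<in> L2" by (rule L2_bounded[of g "real CARD('n) * B"]) (use gm gb norm_vec in auto)
    fix h :: "real ^ 'n \<Rightarrow> real" and i assume h: "h \<in> test_functions"
    have conv: "(\<lambda>m. LINT x|cube_measure. p m x * q x) \<longlonglongrightarrow> (LINT x|cube_measure. w x * q x)"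
      if p: "\<And>m. p m \<in> borel_measurable cube_measure" "\<And>m x. x \<in> cbox 0 1 \<Longrightarrow> \<bar>p m x\<bar> \<le> B"
        "\<And>x. x \<in> cbox 0 1 \<Longrightarrow> (\<lambda>m. p m x) \<longlonglongrightarrow> w x"
        and q: "continuous_on UNIV q" and w: "w \<in> borel_measurable cube_measure"
      for p :: "nat \<Rightarrow> real ^ 'n \<Rightarrow> real" and q w
    proof -
      have "bounded (q ` cbox 0 1)"
        using q by (intro compact_imp_bounded compact_continuous_image) (auto intro: continuous_on_subset)
      then obtain Q where Q: "Q > 0" "\<And>x. x \<in> cbox 0 1 \<Longrightarrow> \<bar>q x\<bar> \<le> Q" by (auto simp: bounded_pos)
      note [measurable] = p(1) w cube_meas[OF q]
      show ?thesis
      proof (rule integral_dominated_convergence[where w="\<lambda>_. B * Q"])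
        show "AE x in cube_measure. (\<lambda>m. p m x * q x) \<longlonglongrightarrow> w x * q x"
          using p(3) by (intro AE_I2) (auto intro: tendsto_mult)
        show "AE x in cube_measure. norm (p m x * q x) \<le> B * Q" for m
        proof (rule AE_I2)
          fix x :: "real ^ 'n" assume "x \<in> space cube_measure"
          then have "\<bar>p m x\<bar> \<le> B" "\<bar>q x\<bar> \<le> Q" using p(2) Q by auto
          then show "norm (p m x * q x) \<le> B * Q"
            using abs_ge_zero[of "p m x"] by (simp add: abs_mult mult_mono)
        qed
      qed auto
    qed
    have 1: "(\<lambda>m. LINT x|cube_measure. f m x * partial_deriv i h x) \<longlonglongrightarrow> (LINT x|cube_measure. u x * partial_deriv i h x)"
      using fm bound lim um by (intro conv test_functionsD(3)[OF h]) auto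
    have 2: "(\<lambda>m. LINT x|cube_measure. partial_deriv i (f m) x * h x) \<longlonglongrightarrow> (LINT x|cube_measure. g x $ i * h x)"
      using fm bound lim gim by (intro conv test_functionsD(2)[OF h]) auto
    have "(\<lambda>m. LINT x|cube_measure. f m x * partial_deriv i h x) \<longlonglongrightarrow> - (LINT x|cube_measure. g x $ i * h x)"
      using tendsto_minus[OF 2] by (simp add: test_functions_by_parts[OF test h])
    with 1 show "(LINT x|cube_measure. u x * partial_deriv i h x) = - (LINT x|cube_measure. g x $ i * h x)"
      by (rule LIMSEQ_unique)
  qed
  then have wg': "has_weak_grad u (weak_grad u)"
    unfolding weak_grad_def by (rule someI[of "has_weak_grad u"])
  have eq: "AE x in cube_measure. weak_grad u x = g x" by (rule has_weak_grad_unique[OF wg' wg])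
  have wgm: "weak_grad u \<in> borel_measurable cube_measure"
    using wg' by (auto simp: has_weak_grad_def L2_def)
  show "H10_norm u = L2_norm g"
    unfolding H10_norm_def by (rule L2_norm_cong_AE[OF wgm gm eq])
  have "(\<lambda>m. L2_norm (\<lambda>x. f m x - u x)) \<longlonglongrightarrow> 0"
    by (rule L2_norm_tendsto_0[of _ _ B]) (use fm um bound lim in auto)
  moreover have "(\<lambda>m. L2_norm (\<lambda>x. classical_grad (f m) x - g x)) \<longlonglongrightarrow> 0"
  proof (rule L2_norm_tendsto_0[of _ _ "real CARD('n) * B"])
    show "norm (classical_grad (f m) x) \<le> real CARD('n) * B" if "x \<in> cbox 0 1" for m x
      using bound(2)[OF that] by (intro norm_vec) (simp add: classical_grad_def)
    show "(\<lambda>m. classical_grad (f m) x) \<longlonglongrightarrow> g x" if "x \<in> cbox 0 1" for x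
      using lim(2)[OF that] by (intro vec_tendstoI) (simp add: classical_grad_def)
  qed (use cgm gm in auto)
  moreover have "L2_norm (\<lambda>x. classical_grad (f m) x - g x) = L2_norm (\<lambda>x. classical_grad (f m) x - weak_grad u x)" for m
    using eq cgm gm wgm by (intro L2_norm_cong_AE) (auto elim!: eventually_mono)
  ultimately show "u \<in> H10"
    using wg test by (auto simp: H10_def intro!: exI[of _ g] exI[of _ f])
qed

lemma lborel_integral_tens:
  fixes f :: "'n::finite \<Rightarrow> real \<Rightarrow> real"
  assumes "\<And>i. integrable lborel (f i)"
  shows "(LINT x|lborel. tens f x) = (\<Prod>i\<in>UNIV. LINT t|lborel. f i t)"
    and "integrable lborel (tens f)"
proof -
  interpret product_sigma_finite "\<lambda>_ :: real ^ 'n. lborel :: real measure" ..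
  define ix where "ix b = (THE i. b = (axis i 1 :: real ^ 'n))" for b
  have ix: "ix (axis i 1) = i" for i
    unfolding ix_def by (rule the_equality) (auto simp: axis_eq_axis)
  have inj: "inj (\<lambda>i. axis i (1::real) :: real ^ 'n)" by (auto simp: inj_on_def axis_eq_axis)
  have Basis: "(Basis :: (real ^ 'n) set) = range (\<lambda>i. axis i 1)" by (auto simp: Basis_vec_def)
  have [measurable]: "f i \<in> borel_measurable borel" for i
    using borel_measurable_integrable[OF assms[of i]] by simp
  have tm: "tens f \<in> borel_measurable borel" unfolding tens_def by measurable
  have eq: "tens f (\<Sum>b\<in>Basis. y b *\<^sub>R b) = (\<Prod>b\<in>Basis. f (ix b) (y b))" for y
  proof -
    have "(\<Sum>b\<in>Basis. y b *\<^sub>R b) $ i = y (axis i 1)" for i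
    proof -
      have "(\<Sum>b\<in>Basis. y b *\<^sub>R b) $ i = (\<Sum>b\<in>Basis. y b *\<^sub>R b) \<bullet> axis i 1" by (simp add: inner_axis)
      also have "\<dots> = y (axis i 1)" by (rule inner_sum_left_Basis) (simp add: Basis)
      finally show ?thesis .
    qed
    then have "tens f (\<Sum>b\<in>Basis. y b *\<^sub>R b) = (\<Prod>i\<in>UNIV. f i (y (axis i 1)))" by (simp add: tens_def)
    also have "\<dots> = (\<Prod>b\<in>Basis. f (ix b) (y b))"
      unfolding Basis by (subst prod.reindex[OF inj]) (simp add: ix)
    finally show ?thesis .
  qed
  have meas: "(\<lambda>y. \<Sum>b\<in>Basis. y b *\<^sub>R b) \<in> (\<Pi>\<^sub>M b\<in>Basis. lborel) \<rightarrow>\<^sub>M (borel :: (real ^ 'n) measure)"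
    by measurable
  have lb: "(lborel :: (real ^ 'n) measure) = distr (\<Pi>\<^sub>M b\<in>Basis. lborel) borel (\<lambda>y. \<Sum>b\<in>Basis. y b *\<^sub>R b)"
    by (rule lborel_eq)
  have "(LINT x|lborel. tens f x) = (LINT y|(\<Pi>\<^sub>M b\<in>Basis. lborel). tens f (\<Sum>b\<in>Basis. y b *\<^sub>R b))"
    by (subst lb, rule integral_distr[OF meas tm])
  also have "\<dots> = (\<Prod>b\<in>Basis. LINT t|lborel. f (ix b) t)"
    unfolding eq by (rule product_integral_prod) (auto intro: assms)
  also have "\<dots> = (\<Prod>i\<in>UNIV. LINT t|lborel. f i t)"
    unfolding Basis by (subst prod.reindex[OF inj]) (simp add: ix)
  finally show "(LINT x|lborel. tens f x) = (\<Prod>i\<in>UNIV. LINT t|lborel. f i t)" .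
  have "integrable (\<Pi>\<^sub>M b\<in>Basis. lborel) (\<lambda>y. tens f (\<Sum>b\<in>Basis. y b *\<^sub>R b))"
    unfolding eq by (rule product_integrable_prod) (auto intro: assms)
  then show "integrable lborel (tens f)"
    by (subst lb) (rule integrable_distr_eq[OF meas tm, THEN iffD2])
qed

section \<open>Faber-Schauder products in the Sobolev space\<close>

definition dfaber :: "nat \<Rightarrow> real \<Rightarrow> real" where
  "dfaber n t = 2 ^ block_of n * dhat (2 ^ block_of n * t - (2 * real (n - 2 ^ (block_of n - 1)) + 1))"

lemma mem_dyadic_block:
  assumes "n \<ge> 1"
  shows "n \<in> dyadic_block (block_of n)"
  using assms floor_log_exp2_le[of n] floor_log_exp2_gt[of n] by (simp add: block_of_def dyadic_block_def)

lemma block_of_ge_1: "block_of n \<ge> 1"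
  by (simp add: block_of_def)

lemma offset_less:
  assumes "n \<ge> 1"
  shows "2 * real (n - 2 ^ (block_of n - 1)) + 2 \<le> 2 ^ block_of n"
proof -
  obtain k where k: "block_of n = Suc k" by (simp add: block_of_def)
  have "n < 2 * 2 ^ k" using mem_dyadic_block[OF assms] k by (simp add: dyadic_block_def)
  then have "n - 2 ^ k + 1 \<le> 2 ^ k" by simp
  then have "real (n - 2 ^ k + 1) \<le> real (2 ^ k)" by (rule of_nat_mono)
  then show ?thesis by (simp add: k)
qed

lemma faber_support:
  assumes "n \<ge> 1" "t \<notin> {0..1}"
  shows "faber n t = 0" "dfaber n t = 0"
proof -
  let ?s = "2 ^ block_of n * t - (2 * real (n - 2 ^ (block_of n - 1)) + 1)"
  have "?s \<le> -1 \<or> ?s \<ge> 1"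
  proof (cases "t < 0")
    case True
    then have "2 ^ block_of n * t \<le> 0" by (simp add: mult_nonneg_nonpos)
    then show ?thesis by simp
  next
    case False
    then have "t \<ge> 1" using assms(2) by simp
    then have "2 ^ block_of n * t \<ge> 2 ^ block_of n * 1" by (intro mult_left_mono) auto
    then show ?thesis using offset_less[OF assms(1)] by linarith
  qed
  then show "faber n t = 0" "dfaber n t = 0"
    by (auto simp: faber_def dfaber_def hat_def dhat_def)
qed

lemma faber_bounds: "0 \<le> faber n t" "faber n t \<le> 1"
  by (auto simp: faber_def hat_def)

lemma dfaber_bound: "\<bar>dfaber n t\<bar> \<le> 2 ^ block_of n"
  by (auto simp: dfaber_def dhat_def abs_mult)

lemma faber_measurable [measurable]: "faber n \<in> borel_measurable borel"
  unfolding faber_def[abs_def] hat_def by measurable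

lemma dfaber_measurable [measurable]: "dfaber n \<in> borel_measurable borel"
  unfolding dfaber_def[abs_def] dhat_def by measurable

definition faber_approx :: "nat \<Rightarrow> nat \<Rightarrow> real \<Rightarrow> real" where
  "faber_approx m n t = hat_approx m (2 ^ block_of n * t + - (2 * real (n - 2 ^ (block_of n - 1)) + 1))"

lemma smooth_faber_approx: "smooth (faber_approx m n)"
  unfolding faber_approx_def[abs_def] by (intro smooth_affine smooth_hat_approx)

lemma deriv_faber_approx:
  "deriv (faber_approx m n) t =
    2 ^ block_of n * dhat_approx m (2 ^ block_of n * t + - (2 * real (n - 2 ^ (block_of n - 1)) + 1))"
proof (rule DERIV_imp_deriv)
  have "(faber_approx m n has_real_derivative
      dhat_approx m (2 ^ block_of n * t + - (2 * real (n - 2 ^ (block_of n - 1)) + 1)) * 2 ^ block_of n) (at t)"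
    unfolding faber_approx_def[abs_def]
    by (rule DERIV_chain2[OF hat_approx_deriv]) (auto intro!: derivative_eq_intros)
  then show "(faber_approx m n has_real_derivative
      2 ^ block_of n * dhat_approx m (2 ^ block_of n * t + - (2 * real (n - 2 ^ (block_of n - 1)) + 1))) (at t)"
    by (simp add: mult.commute)
qed

text \<open>The factors of \<open>\<partial>\<^sub>i \<phi>\<^sub>\<alpha>\<close> and of its smooth approximation.\<close>

definition pfaber :: "'n \<Rightarrow> 'n \<Rightarrow> nat \<Rightarrow> real \<Rightarrow> real" where
  "pfaber i j = (if j = i then dfaber else faber)"

definition pfaber_approx :: "nat \<Rightarrow> 'n \<Rightarrow> 'n \<Rightarrow> nat \<Rightarrow> real \<Rightarrow> real" where
  "pfaber_approx m i j n = (if j = i then deriv (faber_approx m n) else faber_approx m n)"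

lemma faber_approx_tendsto: "(\<lambda>m. faber_approx m n t) \<longlonglongrightarrow> faber n t"
  unfolding faber_approx_def faber_def using hat_approx_tendsto by (simp add: algebra_simps)

lemma faber_approx_bound: "\<bar>faber_approx m n t\<bar> \<le> 1"
  by (simp only: faber_approx_def hat_approx_bound)

lemma pfaber_approx_tendsto: "(\<lambda>m. pfaber_approx m i j n t) \<longlonglongrightarrow> pfaber i j n t"
proof (cases "j = i")
  case True
  have "(\<lambda>m. 2 ^ block_of n * dhat_approx m (2 ^ block_of n * t + - (2 * real (n - 2 ^ (block_of n - 1)) + 1)))
    \<longlonglongrightarrow> 2 ^ block_of n * dhat (2 ^ block_of n * t + - (2 * real (n - 2 ^ (block_of n - 1)) + 1))"
    by (intro tendsto_intros dhat_approx_tendsto)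
  then show ?thesis unfolding True
    by (simp only: refl pfaber_approx_def pfaber_def if_True deriv_faber_approx dfaber_def diff_conv_add_uminus)
qed (simp add: pfaber_approx_def pfaber_def faber_approx_tendsto)

lemma pfaber_approx_bound: "\<bar>pfaber_approx m i j n t\<bar> \<le> (if j = i then 2 ^ block_of n else 1)"
  using dhat_approx_bound
  by (auto simp: pfaber_approx_def deriv_faber_approx faber_approx_bound abs_mult simp del: minus_add_distrib)

lemma faber_approx_test:
  assumes "\<alpha> \<in> pos_idx"
  shows "tens (\<lambda>j. faber_approx m (\<alpha> $ j)) \<in> test_functions"
proof (rule tens_test_function)
  fix j
  let ?n = "\<alpha> $ j"
  let ?c = "2 * real (?n - 2 ^ (block_of ?n - 1))" and ?K = "2 ^ block_of ?n :: real"
  have n: "?n \<ge> 1" using assms by (simp add: pos_idx_def)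
  show "smooth (faber_approx m ?n)" by (rule smooth_faber_approx)
  have "?c + 2 - margin m < ?K" using offset_less[OF n] margin_bounds[of m] by linarith
  then show "0 < (?c + margin m) / ?K \<and> (?c + 2 - margin m) / ?K < 1"
    using margin_bounds[of m] by (auto intro!: divide_pos_pos add_nonneg_pos)
  fix t assume "t < (?c + margin m) / ?K \<or> t > (?c + 2 - margin m) / ?K"
  then have "?K * t < ?c + margin m \<or> ?K * t > ?c + 2 - margin m"
    by (simp add: pos_less_divide_eq pos_divide_less_eq mult.commute)
  then have "1 - margin m \<le> \<bar>?K * t + - (?c + 1)\<bar>" by (auto simp: abs_if)
  then show "faber_approx m ?n t = 0" by (simp only: faber_approx_def hat_approx_eq_0)
qed

definition gram :: "nat \<Rightarrow> nat \<Rightarrow> real" where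
  "gram m n = (LINT t|lborel. faber m t * faber n t)"

definition dgram :: "nat \<Rightarrow> nat \<Rightarrow> real" where
  "dgram m n = (LINT t|lborel. dfaber m t * dfaber n t)"

definition kern :: "'n \<Rightarrow> 'n \<Rightarrow> nat \<Rightarrow> nat \<Rightarrow> real" where
  "kern i j = (if j = i then dgram else gram)"

definition energy :: "(nat ^ 'n) set \<Rightarrow> (nat ^ 'n \<Rightarrow> real) \<Rightarrow> 'n::finite \<Rightarrow> real" where
  "energy A c i = (\<Sum>\<alpha>\<in>A. \<Sum>\<alpha>'\<in>A. c \<alpha> * c \<alpha>' * (\<Prod>j\<in>UNIV. kern i j (\<alpha> $ j) (\<alpha>' $ j)))"

lemma integrable_bounded_unit:
  fixes f :: "real \<Rightarrow> real"
  assumes "f \<in> borel_measurable borel" "\<And>t. \<bar>f t\<bar> \<le> B" "\<And>t. t \<notin> {0..1} \<Longrightarrow> f t = 0"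
  shows "integrable lborel f"
proof (rule Bochner_Integration.integrable_bound)
  show "integrable lborel (\<lambda>t. B * indicator {0..1::real} t)" by simp
  show "AE t in lborel. norm (f t) \<le> norm (B * indicator {0..1::real} t)"
  proof (rule AE_I2)
    fix t
    show "norm (f t) \<le> norm (B * indicator {0..1::real} t)"
      using assms(2)[of t] assms(3)[of t] by (cases "t \<in> {0..1}") auto
  qed
qed (use assms(1) in simp)

lemma integrable_faber:
  assumes "m \<ge> 1"
  shows "integrable lborel (faber m)" "integrable lborel (\<lambda>t. faber m t * faber n t)"
    "integrable lborel (dfaber m)" "integrable lborel (\<lambda>t. dfaber m t * dfaber n t)"
proof -
  show "integrable lborel (faber m)"
    by (rule integrable_bounded_unit[of _ 1]) (use assms faber_support faber_bounds in auto)
  show "integrable lborel (dfaber m)"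
    by (rule integrable_bounded_unit[of _ "2 ^ block_of m"]) (use assms faber_support dfaber_bound in auto)
  show "integrable lborel (\<lambda>t. faber m t * faber n t)"
    by (rule integrable_bounded_unit[of _ 1])
      (use assms faber_support faber_bounds in \<open>auto simp: abs_mult intro!: mult_le_one\<close>)
  show "integrable lborel (\<lambda>t. dfaber m t * dfaber n t)"
    by (rule integrable_bounded_unit[of _ "2 ^ block_of m * 2 ^ block_of n"])
      (use assms faber_support dfaber_bound in \<open>auto simp: abs_mult intro!: mult_mono\<close>)
qed

lemma pfaber_integral:
  assumes "m \<ge> 1"
  shows "(LINT t|lborel. pfaber i j m t * pfaber i j n t) = kern i j m n"
    and "integrable lborel (\<lambda>t. pfaber i j m t * pfaber i j n t)"
  using integrable_faber[OF assms] by (auto simp: pfaber_def kern_def gram_def dgram_def)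

lemma tens_pfaber_support:
  assumes "\<alpha> \<in> pos_idx" "x \<notin> cbox 0 1"
  shows "tens (\<lambda>j. pfaber i j (\<alpha> $ j)) x = 0" "faber_prod \<alpha> x = 0"
proof -
  obtain j where j: "x $ j \<notin> {0..1}" using assms(2) by (auto simp: mem_box_cart)
  have "\<alpha> $ j \<ge> 1" using assms(1) by (simp add: pos_idx_def)
  from faber_support[OF this j] show "tens (\<lambda>j. pfaber i j (\<alpha> $ j)) x = 0" "faber_prod \<alpha> x = 0"
    by (auto simp: tens_def faber_prod_def pfaber_def)
qed

lemma faber_combination_H10:
  fixes A :: "(nat ^ 'n) set" and c :: "nat ^ 'n \<Rightarrow> real"
  assumes A: "finite A" "A \<subseteq> pos_idx"
  defines "u \<equiv> \<lambda>x. \<Sum>\<alpha>\<in>A. c \<alpha> * faber_prod \<alpha> x"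
  shows "u \<in> H10" and "(H10_norm u)\<^sup>2 = (\<Sum>i\<in>UNIV. energy A c i)"
proof -
  define g where "g x = (\<chi> i. \<Sum>\<alpha>\<in>A. c \<alpha> * tens (\<lambda>j. pfaber i j (\<alpha> $ j)) x)" for x
  define f where "f m x = (\<Sum>\<alpha>\<in>A. c \<alpha> * tens (\<lambda>j. faber_approx m (\<alpha> $ j)) x)" for m x
  define B where "B = (\<Sum>\<alpha>\<in>A. \<bar>c \<alpha>\<bar> * (\<Sum>i\<in>UNIV. 2 ^ block_of (\<alpha> $ i)))"
  have test: "tens (\<lambda>j. faber_approx m (\<alpha> $ j)) \<in> test_functions" if "\<alpha> \<in> A" for m \<alpha>
    using that A(2) by (intro faber_approx_test) auto
  have f: "f m \<in> test_functions" "partial_deriv i (f m) x =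
      (\<Sum>\<alpha>\<in>A. c \<alpha> * partial_deriv i (tens (\<lambda>j. faber_approx m (\<alpha> $ j))) x)" for m i x
    using test_functions_sum[OF A(1), of "\<lambda>\<alpha>. tens (\<lambda>j. faber_approx m (\<alpha> $ j))" c] test
    by (auto simp: f_def[abs_def])
  have pd: "partial_deriv i (tens (\<lambda>j. faber_approx m (\<alpha> $ j))) x = tens (\<lambda>j. pfaber_approx m i j (\<alpha> $ j)) x" for m i \<alpha> x
    by (subst partial_deriv_tens[OF smooth_faber_approx])
       (auto simp: tens_def pfaber_approx_def intro!: prod.cong)
  have one: "1 \<le> (2 ^ block_of (\<alpha> $ i) :: real)" for \<alpha> :: "nat ^ 'n" and i by simp
  have le: "2 ^ block_of (\<alpha> $ i) \<le> (\<Sum>i\<in>UNIV. 2 ^ block_of (\<alpha> $ i) :: real)" for \<alpha> :: "nat ^ 'n" and i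
    by (rule member_le_sum) auto
  have lim: "(\<lambda>m. f m x) \<longlonglongrightarrow> u x" "(\<lambda>m. partial_deriv i (f m) x) \<longlonglongrightarrow> g x $ i" for x i
    unfolding f_def u_def f(2) pd g_def tens_def faber_prod_def vec_lambda_beta
    by (intro tendsto_intros faber_approx_tendsto pfaber_approx_tendsto)+
  have "\<bar>f m x\<bar> \<le> B" for m x
  proof -
    have "\<bar>f m x\<bar> \<le> (\<Sum>\<alpha>\<in>A. \<bar>c \<alpha>\<bar> * 1)"
      unfolding f_def by (rule order_trans[OF sum_abs])
        (auto simp: abs_mult tens_def abs_prod faber_approx_bound intro!: sum_mono mult_left_le prod_le_1)
    also have "\<dots> \<le> B" unfolding B_def
      using order_trans[OF one le] by (intro sum_mono mult_left_mono) auto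
    finally show ?thesis .
  qed
  moreover have "\<bar>partial_deriv i (f m) x\<bar> \<le> B" for m i x
  proof -
    have "\<bar>tens (\<lambda>j. pfaber_approx m i j (\<alpha> $ j)) x\<bar> \<le> (\<Sum>i\<in>UNIV. 2 ^ block_of (\<alpha> $ i))" for \<alpha>
    proof -
      have "\<bar>tens (\<lambda>j. pfaber_approx m i j (\<alpha> $ j)) x\<bar> \<le> (\<Prod>j\<in>UNIV. if j = i then 2 ^ block_of (\<alpha> $ j) else 1)"
        unfolding tens_def abs_prod by (intro prod_mono) (simp add: pfaber_approx_bound)
      also have "\<dots> = 2 ^ block_of (\<alpha> $ i)" by (simp add: prod.delta)
      finally show ?thesis using le order_trans by blast
    qed
    then show ?thesis
      unfolding f(2) pd B_def
      by (intro order_trans[OF sum_abs] sum_mono) (auto simp: abs_mult intro!: mult_left_mono)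
  qed
  ultimately have *: "u \<in> H10" "H10_norm u = L2_norm g"
    using weak_grad_limit[of f u g B] f(1) lim by auto
  show "u \<in> H10" by fact
  let ?t = "\<lambda>i \<alpha> \<alpha>'. tens (\<lambda>j t. pfaber i j (\<alpha> $ j) t * pfaber i j (\<alpha>' $ j) t)"
  have sq: "(norm (g x))\<^sup>2 = (\<Sum>i\<in>UNIV. \<Sum>\<alpha>\<in>A. \<Sum>\<alpha>'\<in>A. c \<alpha> * c \<alpha>' * ?t i \<alpha> \<alpha>' x)" for x
  proof -
    have "(norm (g x))\<^sup>2 = (\<Sum>i\<in>UNIV. g x $ i * g x $ i)"
      by (simp add: power2_norm_eq_inner inner_vec_def)
    also have "\<dots> = (\<Sum>i\<in>UNIV. \<Sum>\<alpha>\<in>A. \<Sum>\<alpha>'\<in>A. c \<alpha> * c \<alpha>' * ?t i \<alpha> \<alpha>' x)"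
      by (simp add: g_def sum_product tens_def prod.distrib mult_ac)
    finally show ?thesis .
  qed
  have int: "integrable lborel (?t i \<alpha> \<alpha>')" "(LINT x|lborel. ?t i \<alpha> \<alpha>' x) = (\<Prod>j\<in>UNIV. kern i j (\<alpha> $ j) (\<alpha>' $ j))"
    if "\<alpha> \<in> A" for i \<alpha> \<alpha>'
  proof -
    have 1: "\<alpha> $ j \<ge> 1" for j using that A(2) by (auto simp: pos_idx_def)
    show "integrable lborel (?t i \<alpha> \<alpha>')"
      by (rule lborel_integral_tens(2)) (rule pfaber_integral(2)[OF 1])
    show "(LINT x|lborel. ?t i \<alpha> \<alpha>' x) = (\<Prod>j\<in>UNIV. kern i j (\<alpha> $ j) (\<alpha>' $ j))"
      by (subst lborel_integral_tens(1)) (simp_all add: pfaber_integral[OF 1])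
  qed
  have "(L2_norm g)\<^sup>2 = (LINT x|cube_measure. (norm (g x))\<^sup>2)" by (simp add: L2_norm_def)
  also have "\<dots> = (LINT x|lborel. (norm (g x))\<^sup>2)"
  proof (rule cube_integral)
    have "integrable lborel (\<lambda>x. (norm (g x))\<^sup>2)"
      unfolding sq using int(1) by (intro Bochner_Integration.integrable_sum integrable_mult_right) auto
    then show "(\<lambda>x. (norm (g x))\<^sup>2) \<in> borel_measurable borel" by auto
    fix x :: "real ^ 'n" assume "x \<notin> cbox 0 1"
    then have "g x = 0" using A(2) by (auto simp: g_def vec_eq_iff tens_pfaber_support subsetD intro!: sum.neutral)
    then show "(norm (g x))\<^sup>2 = 0" by simp
  qed
  also have "\<dots> = (\<Sum>i\<in>UNIV. energy A c i)"
    unfolding sq energy_def using int by (simp add: Bochner_Integration.integral_sum)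
  finally show "(H10_norm u)\<^sup>2 = (\<Sum>i\<in>UNIV. energy A c i)" using *(2) by simp
qed

lemma L2_norm_faber_prod:
  assumes "\<alpha> \<in> pos_idx"
  shows "(L2_norm (faber_prod \<alpha>))\<^sup>2 = (\<Prod>j\<in>UNIV. gram (\<alpha> $ j) (\<alpha> $ j))"
proof -
  have 1: "\<alpha> $ j \<ge> 1" for j using assms by (auto simp: pos_idx_def)
  have eq: "(norm (faber_prod \<alpha> x))\<^sup>2 = tens (\<lambda>j t. faber (\<alpha> $ j) t * faber (\<alpha> $ j) t) x" for x
    by (simp add: faber_prod_def tens_def power2_eq_square prod.distrib)
  have int: "integrable lborel (tens (\<lambda>j t. faber (\<alpha> $ j) t * faber (\<alpha> $ j) t))"
    by (rule lborel_integral_tens(2)) (rule integrable_faber(2)[OF 1])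
  have "(L2_norm (faber_prod \<alpha>))\<^sup>2 = (LINT x|cube_measure. (norm (faber_prod \<alpha> x))\<^sup>2)"
    by (simp add: L2_norm_def)
  also have "\<dots> = (LINT x|lborel. (norm (faber_prod \<alpha> x))\<^sup>2)"
    by (rule cube_integral) (use int eq assms in \<open>auto simp: tens_pfaber_support(2)\<close>)
  also have "\<dots> = (\<Prod>j\<in>UNIV. gram (\<alpha> $ j) (\<alpha> $ j))"
    unfolding eq by (subst lborel_integral_tens(1)) (simp_all add: integrable_faber(2)[OF 1] gram_def)
  finally show ?thesis .
qed

section \<open>The univariate Faber-Schauder system\<close>

lemma integral_two_pieces:
  fixes f f1 f2 F1 F2 :: "real \<Rightarrow> real"
  assumes "f \<in> borel_measurable borel"
    and "\<And>s. -1 < s \<Longrightarrow> s < 0 \<Longrightarrow> f s = f1 s" "\<And>s. 0 < s \<Longrightarrow> s < 1 \<Longrightarrow> f s = f2 s"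
    and "\<And>s. s < -1 \<or> s > 1 \<Longrightarrow> f s = 0"
    and F1: "\<And>s. (F1 has_real_derivative f1 s) (at s)" "continuous_on UNIV f1"
    and F2: "\<And>s. (F2 has_real_derivative f2 s) (at s)" "continuous_on UNIV f2"
  shows "(LINT s|lborel. f s) = F1 0 - F1 (-1) + (F2 1 - F2 0)"
proof -
  have piece: "has_bochner_integral lborel (\<lambda>s. indicator {a..b} s *\<^sub>R g s) (G b - G a)"
    if "a \<le> b" "\<And>s. (G has_real_derivative g s) (at s)" "continuous_on UNIV g" for a b :: real and g G
    using that by (intro has_bochner_integral_FTC_Icc)
      (auto simp: has_real_derivative_iff_has_vector_derivative[symmetric] intro: has_field_derivative_at_within
        continuous_on_subset)
  have "has_bochner_integral lborel
      (\<lambda>s. indicator {-1..0} s *\<^sub>R f1 s + indicator {0..1} s *\<^sub>R f2 s) (F1 0 - F1 (-1) + (F2 1 - F2 0))"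
    by (intro has_bochner_integral_add piece F1 F2) auto
  then have int: "(LINT s|lborel. indicator {-1..0} s *\<^sub>R f1 s + indicator {0..1} s *\<^sub>R f2 s) =
      F1 0 - F1 (-1) + (F2 1 - F2 0)"
    by (rule has_bochner_integral_integral_eq)
  have [measurable]: "f1 \<in> borel_measurable borel" "f2 \<in> borel_measurable borel"
    using F1(2) F2(2) by (auto intro: borel_measurable_continuous_onI)
  have "(LINT s|lborel. f s) = (LINT s|lborel. indicator {-1..0} s *\<^sub>R f1 s + indicator {0..1} s *\<^sub>R f2 s)"
  proof (rule integral_cong_AE)
    have "AE s in lborel. s \<noteq> -1 \<and> s \<noteq> 0 \<and> s \<noteq> (1::real)"
      using AE_lborel_singleton by (auto simp: eventually_conj_iff)
    then show "AE s in lborel. f s = indicator {-1..0} s *\<^sub>R f1 s + indicator {0..1} s *\<^sub>R f2 s"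
    proof eventually_elim
      case (elim s)
      then consider "s < -1" | "-1 < s" "s < 0" | "0 < s" "s < 1" | "s > 1" by linarith
      then show ?case by cases (use assms(2-4) in auto)
    qed
  qed (use assms(1) in auto)
  then show ?thesis using int by simp
qed

lemma hat_measurable [measurable]: "hat \<in> borel_measurable borel"
  unfolding hat_def[abs_def] by measurable

lemma dhat_measurable [measurable]: "dhat \<in> borel_measurable borel"
  unfolding dhat_def[abs_def] by measurable

lemma hat_integral: "(LINT s|lborel. hat s) = 1"
  by (subst integral_two_pieces[of _ "\<lambda>s. 1 + s" "\<lambda>s. 1 - s" "\<lambda>s. s + s\<^sup>2 / 2" "\<lambda>s. s - s\<^sup>2 / 2"])
     (auto simp: hat_def intro!: derivative_eq_intros continuous_intros)

lemma hat_moment: "(LINT s|lborel. s * hat s) = 0"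
  by (subst integral_two_pieces[of _ "\<lambda>s. s + s * s" "\<lambda>s. s - s * s"
        "\<lambda>s. s\<^sup>2 / 2 + s ^ 3 / 3" "\<lambda>s. s\<^sup>2 / 2 - s ^ 3 / 3"])
     (auto simp: hat_def power2_eq_square algebra_simps intro!: derivative_eq_intros continuous_intros)

lemma hat_square_integral: "(LINT s|lborel. hat s * hat s) = 2 / 3"
  by (subst integral_two_pieces[of _ "\<lambda>s. (1 + s)\<^sup>2" "\<lambda>s. (1 - s)\<^sup>2"
        "\<lambda>s. (1 + s) ^ 3 / 3" "\<lambda>s. - ((1 - s) ^ 3 / 3)"])
     (auto simp: hat_def power2_eq_square intro!: derivative_eq_intros continuous_intros)

lemma dhat_integral: "(LINT s|lborel. dhat s) = 0"
  by (subst integral_two_pieces[of _ "\<lambda>s. 1" "\<lambda>s. -1" "\<lambda>s. s" "\<lambda>s. - s"])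
     (auto simp: dhat_def intro!: derivative_eq_intros continuous_intros)

lemma dhat_square_integral: "(LINT s|lborel. dhat s * dhat s) = 2"
  by (subst integral_two_pieces[of _ "\<lambda>s. 1" "\<lambda>s. 1" "\<lambda>s. s" "\<lambda>s. s"])
     (auto simp: dhat_def intro!: derivative_eq_intros continuous_intros)

lemma integral_scaled:
  fixes f :: "real \<Rightarrow> real"
  shows "(LINT t|lborel. f (2 ^ k * t - c)) = (LINT s|lborel. f s) / 2 ^ k"
  using lborel_integral_real_affine[of "2 ^ k" f "- c"] by simp

definition offset :: "nat \<Rightarrow> real" where
  "offset n = 2 * real (n - 2 ^ (block_of n - 1)) + 1"

lemma faber_offset: "faber n t = hat (2 ^ block_of n * t - offset n)"
  and dfaber_offset: "dfaber n t = 2 ^ block_of n * dhat (2 ^ block_of n * t - offset n)"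
  by (simp_all add: faber_def dfaber_def offset_def)

lemma gram_diag: "gram n n = 2 / 3 / 2 ^ block_of n"
  unfolding gram_def faber_offset
  using integral_scaled[of "\<lambda>s. hat s * hat s" "block_of n" "offset n"] by (simp add: hat_square_integral)

lemma dgram_diag: "dgram n n = 2 * 2 ^ block_of n"
proof -
  have "dgram n n = (LINT t|lborel. 2 ^ block_of n * 2 ^ block_of n *
      (dhat (2 ^ block_of n * t - offset n) * dhat (2 ^ block_of n * t - offset n)))"
    unfolding dgram_def dfaber_offset by (simp add: mult_ac)
  also have "\<dots> = 2 ^ block_of n * 2 ^ block_of n * (2 / 2 ^ block_of n)"
    using integral_scaled[of "\<lambda>s. dhat s * dhat s" "block_of n" "offset n"]
    by (simp add: dhat_square_integral)
  finally show ?thesis by simp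
qed

lemma gram_nonneg: "gram m n \<ge> 0"
  unfolding gram_def by (intro integral_nonneg_AE AE_I2) (simp add: faber_bounds)

lemma gram_sym: "gram m n = gram n m" and dgram_sym: "dgram m n = dgram n m"
  by (simp_all add: gram_def dgram_def mult.commute)

lemma offset_diff:
  assumes "m \<ge> 1" "n \<ge> 1" "block_of m = block_of n" "m \<noteq> n"
  shows "\<bar>offset m - offset n\<bar> \<ge> 2"
proof -
  have "2 ^ (block_of n - 1) \<le> m" "2 ^ (block_of n - 1) \<le> n"
    using mem_dyadic_block[OF assms(1)] mem_dyadic_block[OF assms(2)] assms(3)
    by (auto simp: dyadic_block_def)
  then have "offset m - offset n = 2 * (real m - real n)"
    using assms(3) by (simp add: offset_def)
  moreover have "\<bar>real m - real n\<bar> \<ge> 1" using assms(4) by linarith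
  ultimately show ?thesis by simp
qed

lemma gram_same_block:
  assumes "m \<ge> 1" "n \<ge> 1" "block_of m = block_of n" "m \<noteq> n"
  shows "gram m n = 0"
proof -
  have "hat (s - offset m) * hat (s - offset n) = 0" for s
    using offset_diff[OF assms] by (auto simp: hat_def max_def)
  then show ?thesis by (simp only: gram_def faber_offset assms(3) Bochner_Integration.integral_zero)
qed

lemma coarse_cell:
  fixes t :: real
  assumes "k \<le> L" "q = j div 2 ^ (L - k)"
  shows "real j \<le> 2 ^ L * t \<Longrightarrow> real q \<le> 2 ^ k * t"
    and "2 ^ L * t \<le> real j + 1 \<Longrightarrow> 2 ^ k * t \<le> real q + 1"
    and "real j < 2 ^ L * t \<Longrightarrow> real q < 2 ^ k * t"
    and "2 ^ L * t < real j + 1 \<Longrightarrow> 2 ^ k * t < real q + 1"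
proof -
  let ?p = "2 ^ (L - k) :: nat"
  have L: "2 ^ L * t = real ?p * (2 ^ k * t)"
    using assms(1) by (simp add: power_add[symmetric] mult.assoc[symmetric])
  have "q * ?p \<le> j" unfolding assms(2) by simp
  then have 1: "real ?p * real q \<le> real j" by (metis mult.commute of_nat_le_iff of_nat_mult)
  have "j < (q + 1) * ?p" unfolding assms(2)
    by (metis Suc_eq_plus1 dividend_less_div_times mult_Suc nat_zero_less_power_iff zero_less_numeral)
  then have "j + 1 \<le> (q + 1) * ?p" by simp
  then have "real (j + 1) \<le> real ((q + 1) * ?p)" by (rule of_nat_mono)
  then have 2: "real j + 1 \<le> real ?p * (real q + 1)"
    unfolding of_nat_mult of_nat_add of_nat_1 by (simp only: mult.commute)
  have p: "real ?p > 0" by simp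
  show "real q \<le> 2 ^ k * t" if "real j \<le> 2 ^ L * t"
    using that 1 unfolding L by (meson mult_le_cancel_left_pos order_trans p)
  show "2 ^ k * t \<le> real q + 1" if "2 ^ L * t \<le> real j + 1"
    using that 2 unfolding L by (meson mult_le_cancel_left_pos order_trans p)
  show "real q < 2 ^ k * t" if "real j < 2 ^ L * t"
    using that 1 unfolding L by (meson mult_less_cancel_left_pos le_less_trans p)
  show "2 ^ k * t < real q + 1" if "2 ^ L * t < real j + 1"
    using that 2 unfolding L by (meson mult_less_cancel_left_pos less_le_trans p)
qed

lemma hat_on_cell:
  assumes "real q \<le> s" "s \<le> real q + 1"
  shows "hat (s - (2 * real i + 1)) =
    (if q = 2 * i then s - 2 * real i else if q = 2 * i + 1 then 2 * real i + 2 - s else 0)"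
proof -
  consider "q = 2 * i" | "q = 2 * i + 1" | "real (q + 1) \<le> real (2 * i)" | "real (2 * i + 2) \<le> real q"
    unfolding of_nat_le_iff by linarith
  then show ?thesis by cases (use assms in \<open>auto simp: hat_def\<close>)
qed

lemma dhat_on_cell:
  assumes "real q < s" "s < real q + 1"
  shows "dhat (s - (2 * real i + 1)) = (if q = 2 * i then 1 else if q = 2 * i + 1 then - 1 else 0)"
proof -
  consider "q = 2 * i" | "q = 2 * i + 1" | "real (q + 1) \<le> real (2 * i)" | "real (2 * i + 2) \<le> real q"
    unfolding of_nat_le_iff by linarith
  then show ?thesis by cases (use assms in \<open>auto simp: dhat_def\<close>)
qed

lemma faber_affine_on_cell:
  assumes "block_of n \<le> L"
  obtains a b where "\<And>t. real j \<le> 2 ^ L * t \<Longrightarrow> 2 ^ L * t \<le> real j + 1 \<Longrightarrow> faber n t = a + b * t"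
proof -
  define q where "q = j div 2 ^ (L - block_of n)"
  let ?i = "n - 2 ^ (block_of n - 1)"
  note cell = coarse_cell(1,2)[OF assms q_def]
  have hq: "faber n t = (if q = 2 * ?i then - 2 * real ?i + 2 ^ block_of n * t
      else if q = 2 * ?i + 1 then 2 * real ?i + 2 + - (2 ^ block_of n) * t else 0 + 0 * t)"
    if "real j \<le> 2 ^ L * t" "2 ^ L * t \<le> real j + 1" for t
  proof -
    define s where "s = 2 ^ block_of n * t"
    have s: "real q \<le> s" "s \<le> real q + 1" using cell that by (auto simp: s_def)
    have "offset n = 2 * real ?i + 1" by (simp only: offset_def)
    then show ?thesis using hat_on_cell[OF s, of ?i] by (simp add: faber_offset s_def del: of_nat_diff)
  qed
  show thesis
    by (rule that[of "if q = 2 * ?i then - 2 * real ?i else if q = 2 * ?i + 1 then 2 * real ?i + 2 else 0"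
          "if q = 2 * ?i then 2 ^ block_of n else if q = 2 * ?i + 1 then - (2 ^ block_of n) else 0"])
       (simp only: hq split: if_split, simp)
qed

lemma dgram_off_diag:
  assumes "m \<ge> 1" "n \<ge> 1" "m \<noteq> n"
  shows "dgram m n = 0"
proof -
  have lt: "dgram m n = 0" if "m \<ge> 1" "n \<ge> 1" "block_of m < block_of n" for m n
  proof -
    let ?j = "n - 2 ^ (block_of n - 1)" and ?i = "m - 2 ^ (block_of m - 1)"
    define q where "q = ?j div 2 ^ (block_of n - 1 - block_of m)"
    define C :: real where "C = (if q = 2 * ?i then 2 ^ block_of m else if q = 2 * ?i + 1 then - (2 ^ block_of m) else 0)"
    have "dfaber m t * dfaber n t = C * dfaber n t" for t
    proof (cases "dfaber n t = 0")
      case False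
      have two: "2 ^ block_of n * t = 2 * (2 ^ (block_of n - 1) * t)"
        using block_of_ge_1[of n] by (cases "block_of n") auto
      have "-1 < 2 ^ block_of n * t - offset n" "2 ^ block_of n * t - offset n < 1"
        using False by (auto simp: dfaber_offset dhat_def split: if_splits)
      then have "real ?j < 2 ^ (block_of n - 1) * t" "2 ^ (block_of n - 1) * t < real ?j + 1"
        unfolding offset_def two by linarith+
      then have s: "real q < 2 ^ block_of m * t" "2 ^ block_of m * t < real q + 1"
        using coarse_cell(3,4)[of "block_of m" "block_of n - 1" q ?j t] that(3) by (auto simp: q_def)
      define s where "s = 2 ^ block_of m * t"
      note s = s[folded s_def]
      have "offset m = 2 * real ?i + 1" by (simp only: offset_def)
      then have "dfaber m t = C"
        using dhat_on_cell[OF s, of ?i] by (simp add: C_def dfaber_offset s_def del: of_nat_diff)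
      then show ?thesis by simp
    qed simp
    then have "dgram m n = C * (LINT t|lborel. dfaber n t)" by (simp only: dgram_def integral_mult_right_zero)
    also have "(LINT t|lborel. dfaber n t) = 0"
      unfolding dfaber_offset by (simp add: integral_scaled dhat_integral)
    finally show ?thesis by simp
  qed
  consider "block_of m < block_of n" | "block_of n < block_of m" | "block_of m = block_of n" by linarith
  then show ?thesis
  proof cases
    case 3
    have "dhat (s - offset m) * dhat (s - offset n) = 0" for s
      using offset_diff[OF assms(1,2) 3 assms(3)] by (auto simp: dhat_def)
    then have "dfaber m t * dfaber n t = 0" for t
      unfolding dfaber_offset 3 by (metis mult.assoc mult.left_commute mult_zero_right)
    then show ?thesis by (simp only: dgram_def Bochner_Integration.integral_zero)
  qed (use lt assms dgram_sym[of m n] in auto)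
qed

lemma gram_form:
  assumes "finite A" "\<And>n. n \<in> A \<Longrightarrow> n \<ge> 1"
  shows "(LINT t|lborel. (\<Sum>n\<in>A. c n * faber n t)\<^sup>2) = (\<Sum>m\<in>A. \<Sum>n\<in>A. c m * c n * gram m n)"
    and "integrable lborel (\<lambda>t. (\<Sum>n\<in>A. c n * faber n t)\<^sup>2)"
proof -
  have eq: "(\<Sum>n\<in>A. c n * faber n t)\<^sup>2 = (\<Sum>m\<in>A. \<Sum>n\<in>A. c m * c n * (faber m t * faber n t))" for t
    by (simp add: power2_eq_square sum_product mult_ac)
  show "(LINT t|lborel. (\<Sum>n\<in>A. c n * faber n t)\<^sup>2) = (\<Sum>m\<in>A. \<Sum>n\<in>A. c m * c n * gram m n)"
    unfolding eq gram_def using assms(2) by (simp add: Bochner_Integration.integral_sum integrable_faber)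
  show "integrable lborel (\<lambda>t. (\<Sum>n\<in>A. c n * faber n t)\<^sup>2)"
    unfolding eq using assms(2)
    by (intro Bochner_Integration.integrable_sum integrable_mult_right integrable_faber) auto
qed

lemma block_of_less:
  assumes "1 \<le> n" "n < 2 ^ L"
  shows "block_of n \<le> L"
proof (rule ccontr)
  assume "\<not> block_of n \<le> L"
  then have "(2::nat) ^ L \<le> 2 ^ (block_of n - 1)" by (intro power_increasing) auto
  moreover have "2 ^ (block_of n - 1) \<le> n"
    using mem_dyadic_block[OF assms(1)] unfolding dyadic_block_def by simp
  ultimately show False using assms(2) by linarith
qed

definition fsum :: "nat \<Rightarrow> (nat \<Rightarrow> real) \<Rightarrow> real \<Rightarrow> real" where
  "fsum L c t = (\<Sum>n\<in>{1..<2 ^ L}. c n * faber n t)"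

lemma fsum_affine_on_cell:
  obtains a b where "\<And>t. real j \<le> 2 ^ L * t \<Longrightarrow> 2 ^ L * t \<le> real j + 1 \<Longrightarrow> fsum L c t = a + b * t"
proof -
  have "\<exists>a b. \<forall>t. real j \<le> 2 ^ L * t \<longrightarrow> 2 ^ L * t \<le> real j + 1 \<longrightarrow> faber n t = a + b * t"
    if n: "n \<in> {1..<2 ^ L}" for n
  proof -
    have "block_of n \<le> L" using n by (intro block_of_less) auto
    from faber_affine_on_cell[OF this, of j] show ?thesis by metis
  qed
  then obtain a b where ab: "\<And>n t. n \<in> {1..<2 ^ L} \<Longrightarrow> real j \<le> 2 ^ L * t \<Longrightarrow>
      2 ^ L * t \<le> real j + 1 \<Longrightarrow> faber n t = a n + b n * t"
    by metis
  show thesis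
  proof (rule that)
    fix t assume "real j \<le> 2 ^ L * t" "2 ^ L * t \<le> real j + 1"
    then show "fsum L c t = (\<Sum>n\<in>{1..<2 ^ L}. c n * a n) + (\<Sum>n\<in>{1..<2 ^ L}. c n * b n) * t"
      by (simp add: fsum_def ab algebra_simps sum.distrib sum_distrib_left)
  qed
qed

lemma affine_square_integral:
  fixes a b p q :: real
  assumes "p \<le> q"
  shows "(LINT t|lborel. indicator {p<..<q} t * (a + b * t)\<^sup>2) \<ge> (q - p) / 6 * ((a + b * p)\<^sup>2 + (a + b * q)\<^sup>2)"
    and "integrable lborel (\<lambda>t. indicator {p<..<q} t * (a + b * t)\<^sup>2)"
proof -
  define F where "F t = a\<^sup>2 * t + a * b * t\<^sup>2 + b\<^sup>2 * t ^ 3 / 3" for t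
  have "has_bochner_integral lborel (\<lambda>t. indicator {p..q} t *\<^sub>R (a + b * t)\<^sup>2) (F q - F p)"
  proof (rule has_bochner_integral_FTC_Icc[OF assms])
    fix x assume "p \<le> x" "x \<le> q"
    have "(F has_real_derivative (a + b * x)\<^sup>2) (at x)"
      unfolding F_def by (auto intro!: derivative_eq_intros simp: power2_eq_square algebra_simps)
    then show "(F has_vector_derivative (a + b * x)\<^sup>2) (at x within {p..q})"
      by (simp add: has_real_derivative_iff_has_vector_derivative has_vector_derivative_at_within)
  qed (auto intro!: continuous_intros)
  moreover have "AE t in lborel. indicator {p..q} t *\<^sub>R (a + b * t)\<^sup>2 = indicator {p<..<q} t * (a + b * t)\<^sup>2"
  proof -
    have "AE t in lborel. t \<noteq> p \<and> t \<noteq> q" using AE_lborel_singleton by (auto simp: eventually_conj_iff)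
    then show ?thesis by eventually_elim (auto simp: indicator_def)
  qed
  ultimately have hb: "has_bochner_integral lborel (\<lambda>t. indicator {p<..<q} t * (a + b * t)\<^sup>2) (F q - F p)"
    by (subst (asm) has_bochner_integral_cong_AE) auto
  then show "integrable lborel (\<lambda>t. indicator {p<..<q} t * (a + b * t)\<^sup>2)"
    by (auto simp: has_bochner_integral_iff)
  let ?u = "a + b * p" and ?v = "a + b * q"
  have "F q - F p = (q - p) / 3 * (?u\<^sup>2 + ?u * ?v + ?v\<^sup>2)"
    unfolding F_def by (simp add: power2_eq_square power3_eq_cube algebra_simps) (simp add: field_simps)
  moreover have "?u\<^sup>2 + ?u * ?v + ?v\<^sup>2 \<ge> (?u\<^sup>2 + ?v\<^sup>2) / 2"
  proof -
    have "x\<^sup>2 + x * y + y\<^sup>2 \<ge> (x\<^sup>2 + y\<^sup>2) / 2" for x y :: real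
    proof -
      have "x\<^sup>2 + x * y + y\<^sup>2 - (x\<^sup>2 + y\<^sup>2) / 2 = (x + y)\<^sup>2 / 2"
        by (simp add: power2_eq_square field_simps)
      also have "\<dots> \<ge> 0" by simp
      finally show ?thesis by simp
    qed
    then show ?thesis .
  qed
  ultimately have "F q - F p \<ge> (q - p) / 3 * ((?u\<^sup>2 + ?v\<^sup>2) / 2)"
    using assms by (simp only:) (intro mult_left_mono, auto)
  then show "(LINT t|lborel. indicator {p<..<q} t * (a + b * t)\<^sup>2) \<ge> (q - p) / 6 * (?u\<^sup>2 + ?v\<^sup>2)"
    using hb by (simp add: has_bochner_integral_iff)
qed

lemma fsum_at_1: "fsum L c 1 = 0"
proof -
  have "faber n 1 = 0" if "n \<ge> 1" for n
    using offset_less[OF that] by (simp add: faber_def hat_def del: of_nat_diff)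
  then show ?thesis by (simp add: fsum_def)
qed

lemma nodal_bound:
  "(\<Sum>j\<le>2 ^ L. (fsum L c (real j / 2 ^ L))\<^sup>2) \<le> 6 * 2 ^ L * (LINT t|lborel. (fsum L c t)\<^sup>2)"
proof -
  let ?v = "fsum L c" and ?p = "\<lambda>j. real j / 2 ^ L"
  have int: "integrable lborel (\<lambda>t. (?v t)\<^sup>2)"
    unfolding fsum_def by (rule gram_form(2)) auto
  have cell: "(LINT t|lborel. indicator {?p j<..<?p (Suc j)} t * (?v t)\<^sup>2) \<ge> 1 / (6 * 2 ^ L) * (?v (?p j))\<^sup>2
      \<and> integrable lborel (\<lambda>t. indicator {?p j<..<?p (Suc j)} t * (?v t)\<^sup>2)" for j
  proof -
    obtain a b where ab: "\<And>t. real j \<le> 2 ^ L * t \<Longrightarrow> 2 ^ L * t \<le> real j + 1 \<Longrightarrow> ?v t = a + b * t"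
      using fsum_affine_on_cell[of j L c] by blast
    have eq: "indicator {?p j<..<?p (Suc j)} t * (?v t)\<^sup>2 = indicator {?p j<..<?p (Suc j)} t * (a + b * t)\<^sup>2" for t
    proof (cases "t \<in> {?p j<..<?p (Suc j)}")
      case True
      then have "real j \<le> 2 ^ L * t" "2 ^ L * t \<le> real j + 1"
        by (auto simp: field_simps)
      then show ?thesis by (simp add: ab)
    qed simp
    have le: "?p j \<le> ?p (Suc j)" by (simp add: divide_right_mono)
    have d: "?p (Suc j) - ?p j = 1 / 2 ^ L" by (simp add: field_simps)
    have v: "?v (?p j) = a + b * ?p j" by (rule ab) auto
    have "1 / (6 * 2 ^ L) * (?v (?p j))\<^sup>2 \<le> (?p (Suc j) - ?p j) / 6 * ((a + b * ?p j)\<^sup>2 + (a + b * ?p (Suc j))\<^sup>2)"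
      unfolding d v by (simp add: field_simps)
    then show ?thesis unfolding eq using affine_square_integral[OF le, of a b] by linarith
  qed
  have "(\<Sum>j<2 ^ L. indicator {?p j<..<?p (Suc j)} t * (?v t)\<^sup>2) \<le> (?v t)\<^sup>2" for t
  proof -
    have "(\<Sum>j<2 ^ L. indicator {?p j<..<?p (Suc j)} t :: real) \<le> 1"
    proof -
      have "(\<Sum>j<2 ^ L. indicator {?p j<..<?p (Suc j)} t :: real) =
          (\<Sum>j\<in>{j. j < 2 ^ L \<and> t \<in> {?p j<..<?p (Suc j)}}. 1)"
        by (intro sum.mono_neutral_cong_right) (auto simp: indicator_def)
      also have "\<dots> = real (card {j. j < 2 ^ L \<and> t \<in> {?p j<..<?p (Suc j)}})" by simp
      also have "\<dots> \<le> 1"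
      proof -
        have "i = j" if "t \<in> {?p i<..<?p (Suc i)}" "t \<in> {?p j<..<?p (Suc j)}" for i j
        proof -
          have "real i < 2 ^ L * t" "2 ^ L * t < real i + 1" "real j < 2 ^ L * t" "2 ^ L * t < real j + 1"
            using that by (auto simp: field_simps)
          then show ?thesis by linarith
        qed
        then have "card {j. j < 2 ^ L \<and> t \<in> {?p j<..<?p (Suc j)}} \<le> Suc 0"
          by (subst card_le_Suc0_iff_eq) auto
        then show ?thesis by simp
      qed
      finally show ?thesis .
    qed
    then show ?thesis unfolding sum_distrib_right[symmetric] by (rule mult_left_le_one_le[rotated 2]) (auto intro: sum_nonneg)
  qed
  then have "(LINT t|lborel. (\<Sum>j<2 ^ L. indicator {?p j<..<?p (Suc j)} t * (?v t)\<^sup>2)) \<le> (LINT t|lborel. (?v t)\<^sup>2)"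
    using int cell by (intro integral_mono Bochner_Integration.integrable_sum) blast+
  moreover have "(LINT t|lborel. (\<Sum>j<2 ^ L. indicator {?p j<..<?p (Suc j)} t * (?v t)\<^sup>2)) =
      (\<Sum>j<2 ^ L. LINT t|lborel. indicator {?p j<..<?p (Suc j)} t * (?v t)\<^sup>2)"
    using cell by (intro Bochner_Integration.integral_sum) auto
  moreover have "\<dots> \<ge> (\<Sum>j<2 ^ L. 1 / (6 * 2 ^ L) * (?v (?p j))\<^sup>2)"
    using cell by (intro sum_mono) auto
  ultimately have "(\<Sum>j<2 ^ L. 1 / (6 * 2 ^ L) * (?v (?p j))\<^sup>2) \<le> (LINT t|lborel. (?v t)\<^sup>2)" by linarith
  then have "(\<Sum>j<2 ^ L. (?v (?p j))\<^sup>2) \<le> 6 * 2 ^ L * (LINT t|lborel. (?v t)\<^sup>2)"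
    unfolding sum_distrib_left[symmetric] by (simp add: field_simps)
  moreover have "(\<Sum>j\<le>2 ^ L. (?v (?p j))\<^sup>2) = (\<Sum>j<2 ^ L. (?v (?p j))\<^sup>2)"
    unfolding lessThan_Suc_atMost[symmetric] sum.lessThan_Suc by (simp add: fsum_at_1)
  ultimately show ?thesis by simp
qed

definition second_diff :: "nat \<Rightarrow> (real \<Rightarrow> real) \<Rightarrow> real" where
  "second_diff n v = v (offset n / 2 ^ block_of n) -
     (v ((offset n - 1) / 2 ^ block_of n) + v ((offset n + 1) / 2 ^ block_of n)) / 2"

lemma second_diff_faber:
  assumes "m \<ge> 1" "n \<ge> 1"
  shows "second_diff n (faber m) = (if m = n then 1 else 0)"
proof -
  let ?i = "n - 2 ^ (block_of n - 1)"
  consider "block_of m < block_of n" | "block_of m = block_of n" | "block_of m > block_of n" by linarith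
  then show ?thesis
  proof cases
    case 1
    then obtain k where k: "block_of n = Suc k" "block_of m \<le> k" by (cases "block_of n") auto
    from faber_affine_on_cell[OF k(2), of ?i] obtain a b where
      ab: "\<And>t. real ?i \<le> 2 ^ k * t \<Longrightarrow> 2 ^ k * t \<le> real ?i + 1 \<Longrightarrow> faber m t = a + b * t" by blast
    have "faber m ((offset n + e) / 2 ^ block_of n) = a + b * ((offset n + e) / 2 ^ block_of n)"
      if "-1 \<le> e" "e \<le> 1" for e
    proof (rule ab)
      have "2 ^ k * ((offset n + e) / 2 ^ block_of n) = real ?i + (1 + e) / 2"
        unfolding k(1) offset_def by (simp add: field_simps del: of_nat_diff)
      then show "real ?i \<le> 2 ^ k * ((offset n + e) / 2 ^ block_of n)"
        "2 ^ k * ((offset n + e) / 2 ^ block_of n) \<le> real ?i + 1"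
        using that by auto
    qed
    from this[of 0] this[of "-1"] this[of 1] have "second_diff n (faber m) = 0"
      unfolding second_diff_def by (simp add: add_divide_distrib diff_divide_distrib algebra_simps)
    then show ?thesis using 1 by auto
  next
    case 2
    have v: "faber m ((offset n + e) / 2 ^ block_of n) = hat (offset n + e - offset m)" for e
      by (simp add: faber_offset 2)
    show ?thesis
    proof (cases "m = n")
      case True
      then show ?thesis using v[of 0] v[of "-1"] v[of 1] by (simp add: second_diff_def hat_def)
    next
      case False
      then have "\<bar>offset n - offset m\<bar> \<ge> 2" using offset_diff[OF assms 2] by linarith
      then show ?thesis using v[of 0] v[of "-1"] v[of 1] False
        by (auto simp: second_diff_def hat_def max_def)
    qed
  next
    case 3
    have "faber m (real j / 2 ^ block_of n) = 0" for j
    proof -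
      obtain d where d: "block_of m = Suc d + block_of n"
        using 3 by (metis add.commute less_imp_Suc_add add_Suc_right add_Suc)
      have "2 ^ block_of m * (real j / 2 ^ block_of n) = 2 * real (2 ^ d * j)"
        unfolding d by (simp add: power_add)
      moreover have "\<bar>2 * real (2 ^ d * j) - offset m\<bar> \<ge> 1"
      proof -
        let ?l = "m - 2 ^ (block_of m - 1)"
        have "\<bar>2 * int (2 ^ d * j) - (2 * int ?l + 1)\<bar> \<ge> 1" by presburger
        then have "real_of_int \<bar>2 * int (2 ^ d * j) - (2 * int ?l + 1)\<bar> \<ge> 1" by linarith
        then show ?thesis by (simp add: offset_def del: of_nat_diff of_nat_mult of_nat_power)
      qed
      ultimately show ?thesis by (simp add: faber_offset hat_def del: of_nat_mult of_nat_power)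
    qed
    from this[of "2 * ?i + 1"] this[of "2 * ?i"] this[of "2 * ?i + 2"] show ?thesis
      using 3 by (auto simp: second_diff_def offset_def add.commute simp del: of_nat_diff)
  qed
qed

lemma second_diff_fsum:
  assumes "n \<in> {1..<2 ^ L}"
  shows "second_diff n (fsum L c) = c n"
proof -
  have "second_diff n (fsum L c) = (\<Sum>m\<in>{1..<2 ^ L}. c m * second_diff n (faber m))"
    by (simp add: second_diff_def fsum_def sum_distrib_left sum_subtractf sum.distrib[symmetric]
        sum_divide_distrib algebra_simps diff_divide_distrib add_divide_distrib)
  also have "\<dots> = (\<Sum>m\<in>{1..<2 ^ L}. if m = n then c m else 0)"
    using assms by (intro sum.cong) (auto simp: second_diff_faber)
  also have "\<dots> = c n" using assms by simp
  finally show ?thesis .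
qed

lemma hierarchical_stability:
  assumes "1 \<le> l" "l \<le> L"
  shows "(\<Sum>n\<in>dyadic_block l. (c n)\<^sup>2) \<le> 24 * 2 ^ L * (LINT t|lborel. (fsum L c t)\<^sup>2)"
proof -
  let ?v = "fsum L c"
  let ?S = "\<Sum>j\<le>2 ^ L. (?v (real j / 2 ^ L))\<^sup>2"
  have n: "n \<in> {1..<2 ^ L} \<and> block_of n = l" if "n \<in> dyadic_block l" for n
  proof -
    have "(2::nat) ^ l \<le> 2 ^ L" using assms by (intro power_increasing) auto
    moreover have "(1::nat) \<le> 2 ^ (l - 1)" by simp
    moreover have "2 ^ (l - 1) \<le> n" "n < 2 ^ l" using that by (auto simp: dyadic_block_def)
    ultimately show ?thesis using block_of_eq[OF assms(1) that] by (metis atLeastLessThan_iff le_trans less_le_trans)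
  qed
  have node: "(\<Sum>n\<in>dyadic_block l. (?v ((offset n + e) / 2 ^ l))\<^sup>2) \<le> ?S"
    if e: "e = -1 \<or> e = 0 \<or> e = 1" for e
  proof -
    have "\<exists>r. e = real r - 1 \<and> r \<le> 2"
      using e by (elim disjE) (rule exI[of _ 0] exI[of _ 1] exI[of _ 2], simp)+
    then obtain r where r: "e = real r - 1" "r \<le> 2" by blast
    let ?f = "\<lambda>n. (2 * (n - 2 ^ (l - 1)) + r) * 2 ^ (L - l) :: nat"
    have pw: "(2::real) ^ L = 2 ^ l * 2 ^ (L - l)" using assms by (simp flip: power_add)
    have eq: "(?v ((offset n + e) / 2 ^ l))\<^sup>2 = (?v (real (?f n) / 2 ^ L))\<^sup>2" if "n \<in> dyadic_block l" for n
      using n[OF that] by (simp add: offset_def r(1) pw del: of_nat_diff)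
    have inj: "inj_on ?f (dyadic_block l)"
      by (auto simp: inj_on_def dyadic_block_def)
    have sub: "?f ` dyadic_block l \<subseteq> {..2 ^ L}"
    proof
      fix j assume "j \<in> ?f ` dyadic_block l"
      then obtain n where n': "n \<in> dyadic_block l" "j = ?f n" by auto
      have l2: "(2::nat) ^ l = 2 * 2 ^ (l - 1)" using assms(1) by (cases l) auto
      have "2 * (n - 2 ^ (l - 1)) + r \<le> 2 ^ l"
        using n'(1) r(2) l2 by (auto simp: dyadic_block_def)
      then have "j \<le> 2 ^ l * 2 ^ (L - l)" unfolding n' by (rule mult_le_mono1)
      then show "j \<in> {..2 ^ L}" using assms by (simp flip: power_add)
    qed
    have "(\<Sum>n\<in>dyadic_block l. (?v ((offset n + e) / 2 ^ l))\<^sup>2) =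
        (\<Sum>j\<in>?f ` dyadic_block l. (?v (real j / 2 ^ L))\<^sup>2)"
      by (subst sum.reindex[OF inj]) (simp add: eq)
    also have "\<dots> \<le> ?S" by (rule sum_mono2[OF _ sub]) auto
    finally show ?thesis .
  qed
  have "(c n)\<^sup>2 \<le> 2 * (?v ((offset n + 0) / 2 ^ l))\<^sup>2 + (?v ((offset n + -1) / 2 ^ l))\<^sup>2 + (?v ((offset n + 1) / 2 ^ l))\<^sup>2"
    if "n \<in> dyadic_block l" for n
  proof -
    have c: "c n = ?v ((offset n + 0) / 2 ^ l) - (?v ((offset n + -1) / 2 ^ l) + ?v ((offset n + 1) / 2 ^ l)) / 2"
      using second_diff_fsum[of n L c] n[OF that] by (simp add: second_diff_def)
    have "(x - (y + z) / 2)\<^sup>2 \<le> 2 * x\<^sup>2 + y\<^sup>2 + z\<^sup>2" for x y z :: real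
    proof -
      have "0 \<le> (x + (y + z) / 2)\<^sup>2 + (y - z)\<^sup>2 / 2" by simp
      then show ?thesis by (simp add: power2_eq_square algebra_simps) (simp add: field_simps)
    qed
    then show ?thesis unfolding c .
  qed
  then have "(\<Sum>n\<in>dyadic_block l. (c n)\<^sup>2) \<le> (\<Sum>n\<in>dyadic_block l.
      2 * (?v ((offset n + 0) / 2 ^ l))\<^sup>2 + (?v ((offset n + -1) / 2 ^ l))\<^sup>2 + (?v ((offset n + 1) / 2 ^ l))\<^sup>2)"
    by (rule sum_mono)
  also have "\<dots> \<le> 4 * ?S"
    using node[of 0] node[of "-1"] node[of 1] by (simp add: sum.distrib sum_distrib_left[symmetric])
  also have "\<dots> \<le> 24 * 2 ^ L * (LINT t|lborel. (?v t)\<^sup>2)" using nodal_bound[of L c] by simp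
  finally show ?thesis .
qed

lemma gram_1_block_sum:
  assumes "k \<ge> 1"
  shows "(\<Sum>n\<in>dyadic_block k. gram 1 n) \<ge> 1 / 8"
proof (cases "k = 1")
  case True
  have "dyadic_block 1 = {1}" by (auto simp: dyadic_block_def)
  moreover have "block_of 1 = 1" by (rule block_of_eq) (auto simp: dyadic_block_def)
  ultimately show ?thesis using True gram_diag[of 1] by simp
next
  case False
  then obtain d where k: "k = Suc (Suc d)" using assms by (cases k; cases "k - 1") auto
  have b1: "block_of 1 = 1" by (rule block_of_eq) (auto simp: dyadic_block_def)
  have g: "gram 1 (2 ^ Suc d + i) = 2 * (2 * real i + 1) / 4 ^ k" if "i < 2 ^ d" for i
  proof -
    let ?n = "2 ^ Suc d + i"
    have bn: "block_of ?n = k"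
      by (rule block_of_eq) (use that k in \<open>auto simp: dyadic_block_def\<close>)
    have off: "offset ?n = 2 * real i + 1" unfolding offset_def bn by (simp add: k)
    have eq: "faber 1 t * faber ?n t = 2 * (t * faber ?n t)" for t
    proof (cases "faber ?n t = 0")
      case False
      then have "\<bar>2 ^ k * t - (2 * real i + 1)\<bar> < 1"
        unfolding faber_offset bn off by (auto simp: hat_def max_def split: if_splits)
      then have "0 < 2 ^ k * t" "2 ^ k * t < 2 * real i + 2" by auto
      moreover have "2 * real i + 2 \<le> 2 * 2 ^ d"
      proof -
        have "real (i + 1) \<le> real (2 ^ d)" using that by (simp only: of_nat_le_iff)
        then show ?thesis by simp
      qed
      moreover have "2 ^ k * (1 / 2) = 2 * (2 ^ d :: real)" by (simp add: k)
      ultimately have t: "0 < t" "2 ^ k * t < 2 ^ k * (1 / 2)"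
        by (simp add: zero_less_mult_iff, linarith)
      from t(2) have "t < 1 / 2" by (subst (asm) mult_less_cancel_left_pos) simp_all
      with t(1)
      have "faber 1 t = 2 * t" by (simp add: faber_offset b1 offset_def hat_def del: One_nat_def)
      then show ?thesis by simp
    qed simp
    have "(LINT t|lborel. t * faber ?n t) =
        (LINT t|lborel. (\<lambda>s. (s + offset ?n) / 2 ^ k * hat s) (2 ^ k * t - offset ?n))"
      unfolding faber_offset bn by simp
    also have "\<dots> = (LINT s|lborel. (s + offset ?n) / 2 ^ k * hat s) / 2 ^ k"
      by (rule integral_scaled)
    also have "(LINT s|lborel. (s + offset ?n) / 2 ^ k * hat s) =
        (LINT s|lborel. (1 / 2 ^ k) * (s * hat s) + (offset ?n / 2 ^ k) * hat s)"
      by (simp add: algebra_simps add_divide_distrib)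
    also have "\<dots> = offset ?n / 2 ^ k"
    proof -
      have "integrable lborel hat" "integrable lborel (\<lambda>s. s * hat s)"
      proof -
        have bd: "integrable lborel f" if "f \<in> borel_measurable borel" "\<And>t. \<bar>f t\<bar> \<le> 1" "\<And>t. t \<notin> {-1..1} \<Longrightarrow> f t = 0"
          for f :: "real \<Rightarrow> real"
        proof (rule Bochner_Integration.integrable_bound)
          show "integrable lborel (indicator {-1..1::real} :: real \<Rightarrow> real)" by simp
          show "AE t in lborel. norm (f t) \<le> norm (indicator {-1..1::real} t :: real)"
            using that(2,3) by (intro AE_I2) (auto simp: indicator_def)
        qed (use that(1) in simp)
        show "integrable lborel hat" by (rule bd) (auto simp: hat_def)
        show "integrable lborel (\<lambda>s. s * hat s)"
        proof (rule bd)
          show "\<bar>t * hat t\<bar> \<le> 1" for t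
            by (cases "\<bar>t\<bar> \<le> 1") (auto simp: abs_mult hat_def intro!: mult_le_one)
        qed (auto simp: hat_def)
      qed
      then show ?thesis by (simp add: hat_integral hat_moment)
    qed
    finally have "(LINT t|lborel. t * faber ?n t) = offset ?n / 2 ^ k / 2 ^ k" .
    then show ?thesis
      unfolding gram_def eq off by (simp add: power_mult_distrib[symmetric])
  qed
  have sq: "(\<Sum>i<N. 2 * real i + 1) = (real N)\<^sup>2" for N
    by (induction N) (auto simp: power2_eq_square algebra_simps)
  have "1 / 8 = (\<Sum>i<2 ^ d. 2 * (2 * real i + 1) / 4 ^ k)"
  proof -
    have "(\<Sum>i<2 ^ d. 2 * (2 * real i + 1) / 4 ^ k) = 2 / 4 ^ k * (real (2 ^ d))\<^sup>2"
      unfolding sq[symmetric] by (simp add: sum_distrib_left field_simps)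
    also have "(real (2 ^ d))\<^sup>2 = 4 ^ d" by (simp add: power_mult[symmetric] mult.commute[of d 2] power_mult)
    finally show ?thesis by (simp add: k)
  qed
  also have "\<dots> = (\<Sum>i<2 ^ d. gram 1 (2 ^ Suc d + i))"
    by (intro sum.cong refl g[symmetric]) simp
  also have "\<dots> = (\<Sum>n\<in>(\<lambda>i. 2 ^ Suc d + i) ` {..<2 ^ d}. gram 1 n)"
    by (subst sum.reindex) (auto simp: inj_on_def)
  also have "\<dots> \<le> (\<Sum>n\<in>dyadic_block k. gram 1 n)"
    by (rule sum_mono2) (auto simp: dyadic_block_def k gram_nonneg)
  finally show ?thesis .
qed

lemma nodal_hat_expansion:
  assumes "m \<ge> 1"
  shows "\<exists>c. c 1 = 1 \<and> (\<forall>n. n \<notin> {1..<2 ^ m} \<longrightarrow> c n = 0) \<and>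
    (\<forall>t. fsum m c t = hat (2 ^ m * t - 2 ^ (m - 1))) \<and>
    (\<Sum>n\<in>{1..<2 ^ m}. (c n)\<^sup>2 * dgram n n) = 2 * 2 ^ m"
  using assms
proof (induction m rule: dec_induct)
    case base
    have b1: "block_of 1 = 1" by (rule block_of_eq) (auto simp: dyadic_block_def)
    have set: "{1..<2 ^ 1} = {1::nat}" by auto
    have off: "offset 1 = 1" unfolding offset_def b1 by simp
    have "fsum 1 (\<lambda>n. if n = 1 then 1 else 0) t = hat (2 ^ 1 * t - 2 ^ (1 - 1))" for t
      unfolding fsum_def set by (simp add: faber_offset b1 off del: One_nat_def)
    moreover have "(\<Sum>n\<in>{1..<2 ^ 1}. (if n = 1 then 1 else 0)\<^sup>2 * dgram n n) = 2 * 2 ^ 1"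
      unfolding set by (simp add: dgram_diag b1 del: One_nat_def)
    ultimately show ?case
      by (intro exI[of _ "\<lambda>n. if n = 1 then 1 else 0"] conjI allI impI) (simp_all only: set, auto)
  next
    case (step m)
    then obtain c where c: "c 1 = 1" "\<And>n. n \<notin> {1..<2 ^ m} \<Longrightarrow> c n = 0"
      "\<And>t. fsum m c t = hat (2 ^ m * t - 2 ^ (m - 1))"
      "(\<Sum>n\<in>{1..<2 ^ m}. (c n)\<^sup>2 * dgram n n) = 2 * 2 ^ m" by blast
    obtain d where m: "m = Suc d" using step(1) by (cases m) auto
    define p q :: nat where "p = 2 ^ m + 2 ^ d" and "q = 2 ^ m + (2 ^ d - 1)"
    have one: "(1::nat) \<le> 2 ^ d" by simp
    have pq: "p \<in> {2 ^ m..<2 ^ Suc m}" "q \<in> {2 ^ m..<2 ^ Suc m}"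
    proof -
      have "p < 2 ^ Suc m" "q < 2 ^ Suc m"
        using one unfolding p_def q_def m power_Suc by arith+
      moreover have "2 ^ m \<le> p" "2 ^ m \<le> q" unfolding p_def q_def by (rule le_add1)+
      ultimately show "p \<in> {2 ^ m..<2 ^ Suc m}" "q \<in> {2 ^ m..<2 ^ Suc m}" by simp_all
    qed
    have pq_ne: "p \<noteq> q" unfolding p_def q_def using one by arith
    note pq = pq pq_ne
    have bpq: "block_of p = Suc m" "block_of q = Suc m"
      using pq by (auto intro!: block_of_eq simp: dyadic_block_def)
    have off: "offset p = 2 ^ m + 1" "offset q = 2 ^ m - 1"
      using one unfolding offset_def bpq by (auto simp: p_def q_def m of_nat_diff)
    define c' where "c' n = (if n = p \<or> n = q then - 1 / 2 else c n)" for n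
    have c'_old: "c' n = c n" if "n \<in> {1..<2 ^ m}" for n using that pq by (auto simp: c'_def)
    have split: "{1..<2 ^ Suc m} = {1..<2 ^ m} \<union> {2 ^ m..<2 ^ Suc m :: nat}" by auto
    have new: "(\<Sum>n\<in>{2 ^ m..<2 ^ Suc m}. h (c' n) n) = h (-1/2) p + h (-1/2) q"
      if "\<And>n. h 0 n = 0" for h :: "real \<Rightarrow> nat \<Rightarrow> real"
    proof -
      have "(\<Sum>n\<in>{2 ^ m..<2 ^ Suc m}. h (c' n) n) = (\<Sum>n\<in>{p, q}. h (c' n) n)"
        using pq that c(2) by (intro sum.mono_neutral_right) (auto simp: c'_def)
      then show ?thesis using pq by (simp add: c'_def)
    qed
    have total: "(\<Sum>n\<in>{1..<2 ^ Suc m}. h (c' n) n) = (\<Sum>n\<in>{1..<2 ^ m}. h (c n) n) + (h (-1/2) p + h (-1/2) q)"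
      if "\<And>n. h 0 n = 0" for h :: "real \<Rightarrow> nat \<Rightarrow> real"
    proof -
      have "(\<Sum>n\<in>{1..<2 ^ Suc m}. h (c' n) n) = (\<Sum>n\<in>{1..<2 ^ m}. h (c' n) n) + (\<Sum>n\<in>{2 ^ m..<2 ^ Suc m}. h (c' n) n)"
        unfolding split by (rule sum.union_disjoint) auto
      then show ?thesis using new[of h] that c'_old by simp
    qed
    have "fsum (Suc m) c' t = hat (2 ^ Suc m * t - 2 ^ (Suc m - 1))" for t
    proof -
      define s where "s = 2 ^ Suc m * t - 2 ^ m"
      have "fsum (Suc m) c' t = fsum m c t - (faber p t + faber q t) / 2"
        unfolding fsum_def using total[of "\<lambda>x n. x * faber n t"] by (simp add: add_divide_distrib)
      also have "fsum m c t = hat (s / 2)"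
      proof -
        have "s / 2 = 2 ^ m * t - 2 ^ (m - 1)" unfolding s_def m by (simp add: diff_divide_distrib)
        then show ?thesis unfolding c(3) by (simp only:)
      qed
      also have "faber p t = hat (s - 1)" by (simp add: faber_offset bpq off s_def algebra_simps)
      also have "faber q t = hat (s + 1)" by (simp add: faber_offset bpq off s_def algebra_simps)
      also have "hat (s / 2) - (hat (s - 1) + hat (s + 1)) / 2 = hat s"
      proof -
        consider "s \<le> -2" | "-2 \<le> s" "s \<le> -1" | "-1 \<le> s" "s \<le> 0" | "0 \<le> s" "s \<le> 1" |
          "1 \<le> s" "s \<le> 2" | "2 \<le> s" by linarith
        then show ?thesis by cases (simp_all add: hat_def field_simps)
      qed
      finally show ?thesis by (simp add: s_def)
    qed
    moreover have "(\<Sum>n\<in>{1..<2 ^ Suc m}. (c' n)\<^sup>2 * dgram n n) = 2 * 2 ^ Suc m"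
      using total[of "\<lambda>x n. x\<^sup>2 * dgram n n"] c(4) by (simp add: dgram_diag bpq power2_eq_square)
    moreover have "c' 1 = 1"
    proof -
      have "(1::nat) < 2 ^ m" using one unfolding m power_Suc by linarith
      then show ?thesis using c'_old[of 1] c(1) by simp
    qed
    moreover have "c' n = 0" if "n \<notin> {1..<2 ^ Suc m}" for n
    proof -
      have "n \<notin> {1..<2 ^ m}" "n \<noteq> p" "n \<noteq> q" using that pq unfolding split by auto
      then show ?thesis using c(2) by (simp add: c'_def)
    qed
    ultimately show ?case by blast
qed

lemma nodal_hat_norm:
  assumes "m \<ge> 1" "\<And>t. fsum m c t = hat (2 ^ m * t - 2 ^ (m - 1))"
  shows "(\<Sum>n\<in>{1..<2 ^ m}. \<Sum>n'\<in>{1..<2 ^ m}. c n * c n' * gram n n') = 2 / 3 / 2 ^ m"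
proof -
  have "(\<Sum>n\<in>{1..<2 ^ m}. \<Sum>n'\<in>{1..<2 ^ m}. c n * c n' * gram n n') = (LINT t|lborel. (fsum m c t)\<^sup>2)"
    unfolding fsum_def by (rule gram_form(1)[symmetric]) auto
  also have "\<dots> = 2 / 3 / 2 ^ m"
    unfolding assms(2) power2_eq_square
    using integral_scaled[of "\<lambda>s. hat s * hat s" m "2 ^ (m - 1)"] by (simp add: hat_square_integral)
  finally show ?thesis .
qed

section \<open>Extremal eigenvalues and Rayleigh quotients\<close>

definition qform :: "'i set \<Rightarrow> ('i \<Rightarrow> 'i \<Rightarrow> real) \<Rightarrow> ('i \<Rightarrow> real) \<Rightarrow> real" where
  "qform T A v = (\<Sum>i\<in>T. \<Sum>j\<in>T. A i j * v i * v j)"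

lemma eigenvalue_qform:
  assumes "finite T" "l \<in> eigenvalues_on T A"
  obtains v where "(\<Sum>i\<in>T. (v i)\<^sup>2) > 0" "qform T A v = l * (\<Sum>i\<in>T. (v i)\<^sup>2)"
    "\<And>i. i \<in> T \<Longrightarrow> (\<Sum>j\<in>T. A i j * v j) = l * v i"
proof -
  obtain v where v: "\<exists>i\<in>T. v i \<noteq> 0" "\<And>i. i \<in> T \<Longrightarrow> (\<Sum>j\<in>T. A i j * v j) = l * v i"
    using assms(2) by (auto simp: eigenvalues_on_def)
  then obtain i where i: "i \<in> T" "v i \<noteq> 0" by blast
  have "qform T A v = (\<Sum>i\<in>T. v i * (\<Sum>j\<in>T. A i j * v j))"
    by (simp add: qform_def sum_distrib_left mult_ac)
  also have "\<dots> = (\<Sum>i\<in>T. l * (v i)\<^sup>2)"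
    by (intro sum.cong refl) (simp add: v(2) power2_eq_square)
  finally have "qform T A v = l * (\<Sum>i\<in>T. (v i)\<^sup>2)"
    by (simp add: sum_distrib_left)
  moreover have "(\<Sum>i\<in>T. (v i)\<^sup>2) > 0"
    using i assms(1) by (intro sum_pos2[of _ i]) auto
  ultimately show thesis using that v(2) by blast
qed

lemma eigenvalues_on_uminus: "eigenvalues_on T (\<lambda>i j. - A i j) = uminus ` eigenvalues_on T A"
proof -
  have sub: "uminus ` eigenvalues_on T A \<subseteq> eigenvalues_on T (\<lambda>i j. - A i j)" for A :: "'a \<Rightarrow> 'a \<Rightarrow> real"
    unfolding eigenvalues_on_def by (auto simp: sum_negf)
  have "l \<in> uminus ` eigenvalues_on T A" if "l \<in> eigenvalues_on T (\<lambda>i j. - A i j)" for l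
  proof -
    have "- l \<in> eigenvalues_on T A" using sub[of "\<lambda>i j. - A i j"] that by fastforce
    then show ?thesis by (intro image_eqI[of _ _ "- l"]) auto
  qed
  then show ?thesis using sub by blast
qed

lemma max_rayleigh_eigenvalue:
  assumes T: "finite T" "T \<noteq> {}" and sym: "\<And>i j. i \<in> T \<Longrightarrow> j \<in> T \<Longrightarrow> A i j = A j i"
  obtains l where "l \<in> eigenvalues_on T A" "\<And>v. qform T A v \<le> l * (\<Sum>i\<in>T. (v i)\<^sup>2)"
proof -
  let ?N = "\<lambda>v. \<Sum>i\<in>T. (v i)\<^sup>2 :: real"
  have contN: "continuous_on UNIV ?N" and contQ: "continuous_on UNIV (qform T A)"
    unfolding qform_def by (intro continuous_intros continuous_on_product_coordinates)+
  define K :: "('a \<Rightarrow> real) set" where "K = PiE UNIV (\<lambda>i. if i \<in> T then {-1..1} else {0})"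
  have "compactin (product_topology (\<lambda>_. euclidean) UNIV) K"
    unfolding K_def by (subst compactin_PiE) auto
  then have "compact K" by (simp add: euclidean_product_topology)
  moreover have "closed {v. ?N v = 1}"
    using contN by (intro closed_Collect_eq) auto
  ultimately have comp: "compact (K \<inter> {v. ?N v = 1})" by (rule compact_Int_closed)
  obtain i0 where i0: "i0 \<in> T" using T by auto
  have "(\<lambda>i. if i = i0 then 1 else 0) \<in> K \<inter> {v. ?N v = 1}"
    using i0 T(1) by (auto simp: K_def if_distrib[of "\<lambda>x. x\<^sup>2"] sum.delta cong: if_cong)
  then have ne: "K \<inter> {v. ?N v = 1} \<noteq> {}" by blast
  obtain v where v: "v \<in> K" "?N v = 1" and max: "\<And>w. w \<in> K \<Longrightarrow> ?N w = 1 \<Longrightarrow> qform T A w \<le> qform T A v"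
    using continuous_attains_sup[OF comp ne continuous_on_subset[OF contQ subset_UNIV]] by auto
  define l where "l = qform T A v"
  have le: "qform T A w \<le> l * ?N w" for w
  proof (cases "?N w = 0")
    case True
    then have "\<forall>i\<in>T. w i = 0" using T(1) by (simp add: sum_nonneg_eq_0_iff)
    then show ?thesis using True by (simp add: qform_def)
  next
    case False
    then have pos: "?N w > 0" by (simp add: sum_nonneg order_less_le)
    define s where "s = sqrt (?N w)"
    have s: "s > 0" "s\<^sup>2 = ?N w" using pos by (auto simp: s_def)
    define w' where "w' i = (if i \<in> T then w i / s else 0)" for i
    have N': "?N w' = 1" using s(1) pos unfolding w'_def by (simp add: power_divide s(2) sum_divide_distrib[symmetric])
    have "w' \<in> K"
    proof -
      have "\<bar>w' i\<bar> \<le> 1" if "i \<in> T" for i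
      proof -
        have "(w' i)\<^sup>2 \<le> ?N w'" using that T(1) by (intro member_le_sum) auto
        then show ?thesis unfolding N' using abs_square_le_1 by blast
      qed
      then have "w' i \<in> {-1..1}" if "i \<in> T" for i using that by (simp add: abs_le_iff)
      moreover have "w' i = 0" if "i \<notin> T" for i using that by (simp add: w'_def)
      ultimately show ?thesis by (auto simp: K_def PiE_iff)
    qed
    from max[OF this N'] have "qform T A w' \<le> l" by (simp add: l_def)
    moreover have "qform T A w' = qform T A w / s\<^sup>2"
      by (simp add: qform_def w'_def power2_eq_square sum_divide_distrib)
    ultimately show ?thesis using pos by (simp add: s(2) pos_divide_le_eq)
  qed
  have "(\<Sum>j\<in>T. A i j * v j) = l * v i" if i: "i \<in> T" for i
  proof -
    define b where "b = l * v i - (\<Sum>j\<in>T. A i j * v j)"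
    define d where "d = l - A i i"
    have quad: "0 \<le> 2 * \<epsilon> * b + \<epsilon>\<^sup>2 * d" for \<epsilon>
    proof -
      define e where "e j = (if j = i then \<epsilon> else 0)" for j
      have se: "(\<Sum>j\<in>T. h j * e j) = h i * \<epsilon>" for h :: "'a \<Rightarrow> real"
        using i T(1) by (simp add: e_def if_distrib[of "\<lambda>x. _ * x"] sum.delta cong: if_cong)
      have N: "?N (\<lambda>j. v j + e j) = ?N v + 2 * v i * \<epsilon> + \<epsilon>\<^sup>2"
      proof -
        have "?N (\<lambda>j. v j + e j) = ?N v + (\<Sum>j\<in>T. (2 * v j) * e j) + (\<Sum>j\<in>T. e j * e j)"
          by (simp add: power2_eq_square algebra_simps sum.distrib)
        then show ?thesis unfolding se by (simp add: e_def power2_eq_square)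
      qed
      have Q: "qform T A (\<lambda>j. v j + e j) = qform T A v + 2 * \<epsilon> * (\<Sum>j\<in>T. A i j * v j) + \<epsilon>\<^sup>2 * A i i"
      proof -
        have "qform T A (\<lambda>j. v j + e j) = qform T A v + (\<Sum>k\<in>T. \<Sum>j\<in>T. (A k j * v k) * e j) +
            (\<Sum>k\<in>T. (\<Sum>j\<in>T. A k j * v j) * e k) + (\<Sum>k\<in>T. (\<Sum>j\<in>T. A k j * e j) * e k)"
          by (simp add: qform_def algebra_simps sum.distrib sum_distrib_left)
        also have "(\<Sum>k\<in>T. \<Sum>j\<in>T. (A k j * v k) * e j) = (\<Sum>k\<in>T. A i k * v k) * \<epsilon>"
          unfolding se using sym[OF i] by (simp add: sum_distrib_right)
        finally show ?thesis unfolding se by (simp add: power2_eq_square)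
      qed
      have "0 \<le> l * ?N (\<lambda>j. v j + e j) - qform T A (\<lambda>j. v j + e j)" using le by (simp add: algebra_simps)
      also have "\<dots> = 2 * \<epsilon> * b + \<epsilon>\<^sup>2 * d"
        unfolding N Q b_def d_def using v(2) by (simp add: l_def[symmetric] algebra_simps)
      finally show ?thesis .
    qed
    have "b = 0"
    proof (rule ccontr)
      assume b: "b \<noteq> 0"
      define D where "D = \<bar>d\<bar> + 1"
      have D: "D > 0" "d < D" by (auto simp: D_def)
      have "2 * (- b / D) * b + (- b / D)\<^sup>2 * d < 2 * (- b / D) * b + (- b / D)\<^sup>2 * D"
        using D b by (intro add_strict_left_mono mult_strict_left_mono) (auto simp: zero_less_power2)
      also have "\<dots> = - (b\<^sup>2 / D)" using D by (simp add: power2_eq_square field_simps)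
      also have "\<dots> < 0" using b D by simp
      finally show False using quad[of "- b / D"] by linarith
    qed
    then show ?thesis by (simp add: b_def)
  qed
  moreover have "\<exists>i\<in>T. v i \<noteq> 0" using v(2) by (rule_tac ccontr) auto
  ultimately have "l \<in> eigenvalues_on T A" by (auto simp: eigenvalues_on_def)
  then show thesis using that le by blast
qed

lemma finite_eigenvalues_on:
  assumes T: "finite T" and sym: "\<And>i j. i \<in> T \<Longrightarrow> j \<in> T \<Longrightarrow> A i j = A j i"
  shows "finite (eigenvalues_on T A)"
proof (rule conjunct1[OF finite_if_finite_subsets_card_bdd[of _ "card T"]])
  fix F assume F: "F \<subseteq> eigenvalues_on T A" "finite F"
  have "\<exists>v. (\<Sum>i\<in>T. (v i)\<^sup>2) = 1 \<and> (\<forall>i\<in>T. (\<Sum>j\<in>T. A i j * v j) = l * v i)" if l: "l \<in> F" for l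
  proof -
    obtain v where v: "(\<Sum>i\<in>T. (v i)\<^sup>2) > 0" "\<And>i. i \<in> T \<Longrightarrow> (\<Sum>j\<in>T. A i j * v j) = l * v i"
      using eigenvalue_qform[OF T, of l A] F l by blast
    define s where "s = sqrt (\<Sum>i\<in>T. (v i)\<^sup>2)"
    have s: "s > 0" "s\<^sup>2 = (\<Sum>i\<in>T. (v i)\<^sup>2)" using v(1) by (auto simp: s_def)
    have "(\<Sum>i\<in>T. (v i / s)\<^sup>2) = 1"
      using v(1) by (simp add: power_divide s(2) sum_divide_distrib[symmetric])
    moreover have "(\<Sum>j\<in>T. A i j * (v j / s)) = l * (v i / s)" if "i \<in> T" for i
      using v(2)[OF that] by (simp add: sum_divide_distrib[symmetric])
    ultimately show ?thesis by (intro exI[of _ "\<lambda>i. v i / s"]) simp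
  qed
  then obtain v where v: "\<And>l. l \<in> F \<Longrightarrow> (\<Sum>i\<in>T. (v l i)\<^sup>2) = 1"
    "\<And>l i. l \<in> F \<Longrightarrow> i \<in> T \<Longrightarrow> (\<Sum>j\<in>T. A i j * v l j) = l * v l i" by metis
  have orth: "(\<Sum>i\<in>T. v l i * v l' i) = (if l = l' then 1 else 0)" if "l \<in> F" "l' \<in> F" for l l'
  proof (cases "l = l'")
    case True
    then show ?thesis using v(1)[OF that(1)] by (simp add: power2_eq_square)
  next
    case False
    have "l * (\<Sum>i\<in>T. v l i * v l' i) = (\<Sum>i\<in>T. (\<Sum>j\<in>T. A i j * v l j) * v l' i)"
      using v(2) that by (simp add: sum_distrib_left mult_ac)
    also have "\<dots> = (\<Sum>j\<in>T. \<Sum>i\<in>T. A i j * v l j * v l' i)"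
      unfolding sum_distrib_right by (rule sum.swap)
    also have "\<dots> = (\<Sum>j\<in>T. v l j * (\<Sum>i\<in>T. A j i * v l' i))"
      by (intro sum.cong refl) (simp add: sum_distrib_left sym mult_ac)
    also have "\<dots> = l' * (\<Sum>i\<in>T. v l i * v l' i)"
      using v(2) that by (simp add: sum_distrib_left mult_ac)
    finally show ?thesis using False by simp
  qed
  have bessel: "(\<Sum>l\<in>F. (v l i)\<^sup>2) \<le> 1" if i: "i \<in> T" for i
  proof -
    define e where "e j = (if j = i then 1 else 0 :: real)" for j
    define p where "p j = (\<Sum>l\<in>F. v l i * v l j)" for j
    have "0 \<le> (\<Sum>j\<in>T. (e j - p j)\<^sup>2)" by (rule sum_nonneg) simp
    also have "\<dots> = (\<Sum>j\<in>T. e j * (e j - 2 * p j)) + (\<Sum>j\<in>T. p j * p j)"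
      by (simp add: sum.distrib[symmetric] power2_eq_square algebra_simps)
    also have "(\<Sum>j\<in>T. e j * (e j - 2 * p j)) = 1 - 2 * p i"
      using i T by (simp add: e_def if_distrib[of "\<lambda>x. x * _"] sum.delta cong: if_cong)
    also have "(\<Sum>j\<in>T. p j * p j) = (\<Sum>j\<in>T. \<Sum>l\<in>F. \<Sum>l'\<in>F. v l i * v l' i * (v l j * v l' j))"
      by (simp add: p_def sum_product mult_ac)
    also have "\<dots> = (\<Sum>l\<in>F. \<Sum>l'\<in>F. v l i * v l' i * (\<Sum>j\<in>T. v l j * v l' j))"
      unfolding sum_distrib_left by (subst sum.swap, rule sum.cong[OF refl], subst sum.swap, rule refl)
    also have "\<dots> = (\<Sum>l\<in>F. \<Sum>l'\<in>F. if l = l' then v l i * v l' i else 0)"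
      by (intro sum.cong refl) (simp add: orth)
    also have "\<dots> = p i" using F(2) by (simp add: p_def sum.delta)
    finally show ?thesis by (simp add: p_def power2_eq_square)
  qed
  have "real (card F) = (\<Sum>l\<in>F. \<Sum>i\<in>T. (v l i)\<^sup>2)" using v(1) by simp
  also have "\<dots> = (\<Sum>i\<in>T. \<Sum>l\<in>F. (v l i)\<^sup>2)" by (rule sum.swap)
  also have "\<dots> \<le> (\<Sum>i\<in>T. 1)" by (intro sum_mono bessel)
  finally show "card F \<le> card T" by simp
qed

lemma extremal_eigenvalues:
  assumes T: "finite T" "T \<noteq> {}" and sym: "\<And>i j. i \<in> T \<Longrightarrow> j \<in> T \<Longrightarrow> A i j = A j i"
  shows "(\<Sum>i\<in>T. (v i)\<^sup>2) > 0 \<Longrightarrow> qform T A v / (\<Sum>i\<in>T. (v i)\<^sup>2) \<le> Max (eigenvalues_on T A)"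
    and "(\<Sum>i\<in>T. (v i)\<^sup>2) > 0 \<Longrightarrow> Min (eigenvalues_on T A) \<le> qform T A v / (\<Sum>i\<in>T. (v i)\<^sup>2)"
    and "(\<And>v. qform T A v \<le> M * (\<Sum>i\<in>T. (v i)\<^sup>2)) \<Longrightarrow> Max (eigenvalues_on T A) \<le> M"
    and "(\<And>v. m * (\<Sum>i\<in>T. (v i)\<^sup>2) \<le> qform T A v) \<Longrightarrow> m \<le> Min (eigenvalues_on T A)"
proof -
  let ?N = "\<lambda>v. \<Sum>i\<in>T. (v i)\<^sup>2 :: real"
  have fin: "finite (eigenvalues_on T A)" using T(1) sym by (rule finite_eigenvalues_on)
  obtain l where l: "l \<in> eigenvalues_on T A" "\<And>v. qform T A v \<le> l * ?N v"
    using max_rayleigh_eigenvalue[of T A, OF T sym] by blast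
  obtain l' where "l' \<in> eigenvalues_on T (\<lambda>i j. - A i j)" "\<And>v. qform T (\<lambda>i j. - A i j) v \<le> l' * ?N v"
    using max_rayleigh_eigenvalue[OF T, of "\<lambda>i j. - A i j"] sym by auto
  then have l': "- l' \<in> eigenvalues_on T A" "\<And>v. - l' * ?N v \<le> qform T A v"
    by (auto simp: eigenvalues_on_uminus qform_def sum_negf algebra_simps)
  have ne: "eigenvalues_on T A \<noteq> {}" using l by auto
  show "?N v > 0 \<Longrightarrow> qform T A v / ?N v \<le> Max (eigenvalues_on T A)"
    using l Max_ge[OF fin l(1)] by (meson order_trans pos_divide_le_eq)
  show "?N v > 0 \<Longrightarrow> Min (eigenvalues_on T A) \<le> qform T A v / ?N v"
    using l' Min_le[OF fin l'(1)] by (meson order_trans pos_le_divide_eq)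
  have q: "\<exists>v. ?N v > 0 \<and> qform T A v = x * ?N v" if "x \<in> eigenvalues_on T A" for x
    using eigenvalue_qform[OF T(1) that] by blast
  show "(\<And>v. qform T A v \<le> M * ?N v) \<Longrightarrow> Max (eigenvalues_on T A) \<le> M"
    using q[OF Max_in[OF fin ne]] by (metis mult_le_cancel_right_pos)
  show "(\<And>v. m * ?N v \<le> qform T A v) \<Longrightarrow> m \<le> Min (eigenvalues_on T A)"
    using q[OF Min_in[OF fin ne]] by (metis mult_le_cancel_right_pos)
qed

section \<open>Cholesky factorisation\<close>

definition mat_inverse_on :: "nat set \<Rightarrow> (nat \<Rightarrow> nat \<Rightarrow> real) \<Rightarrow> (nat \<Rightarrow> nat \<Rightarrow> real) \<Rightarrow> bool" where
  "mat_inverse_on S P R \<longleftrightarrow>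
     (\<forall>l\<in>S. \<forall>n\<in>S. (\<Sum>m\<in>S. P l m * R m n) = (if l = n then 1 else 0))"

lemma cholesky:
  fixes G :: "nat \<Rightarrow> nat \<Rightarrow> real"
  assumes sym: "\<And>m n. G m n = G n m"
    and pos: "\<And>c. (\<exists>n\<in>{1..<N}. c n \<noteq> 0) \<Longrightarrow> (\<Sum>m\<in>{1..<N}. \<Sum>n\<in>{1..<N}. c m * c n * G m n) > 0"
  shows "\<exists>R P. (\<forall>m n. m > n \<longrightarrow> R m n = 0 \<and> P m n = 0) \<and>
    (\<forall>m\<in>{1..<N}. \<forall>n\<in>{1..<N}. G m n = (\<Sum>r\<in>{1..<N}. R r m * R r n)) \<and>
    mat_inverse_on {1..<N} P R \<and> mat_inverse_on {1..<N} R P"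
  using pos
proof (induction N)
  case 0
  show ?case by (intro exI[of _ "\<lambda>_ _. 0"]) (auto simp: mat_inverse_on_def)
next
  case (Suc N)
  show ?case
  proof (cases "N = 0")
    case True
    then show ?thesis by (intro exI[of _ "\<lambda>_ _. 0"]) (auto simp: mat_inverse_on_def)
  next
    case False
    define S where "S = {1..<N}"
    have S': "{1..<Suc N} = insert N S" and NS: "N \<notin> S" "finite S" using False by (auto simp: S_def)
    have neN: "m \<noteq> N" if "m \<in> S" for m using that NS by auto
    have "(\<Sum>m\<in>S. \<Sum>n\<in>S. c m * c n * G m n) > 0" if c: "\<exists>n\<in>S. c n \<noteq> 0" for c
    proof -
      define c' where "c' n = (if n = N then 0 else c n)" for n
      have "\<exists>n\<in>{1..<Suc N}. c' n \<noteq> 0" using c NS unfolding S' c'_def by auto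
      from Suc.prems[OF this] have "(\<Sum>m\<in>insert N S. \<Sum>n\<in>insert N S. c' m * c' n * G m n) > 0"
        unfolding S' .
      also have "(\<Sum>m\<in>insert N S. \<Sum>n\<in>insert N S. c' m * c' n * G m n) = (\<Sum>m\<in>S. \<Sum>n\<in>S. c m * c n * G m n)"
        using NS neN by (simp add: c'_def)
      finally show ?thesis .
    qed
    from Suc.IH[folded S_def, OF this] obtain R P where
      tri: "\<And>m n. m > n \<Longrightarrow> R m n = 0 \<and> P m n = 0" and
      G: "\<And>m n. m \<in> S \<Longrightarrow> n \<in> S \<Longrightarrow> G m n = (\<Sum>r\<in>S. R r m * R r n)" and
      PR: "\<And>l n. l \<in> S \<Longrightarrow> n \<in> S \<Longrightarrow> (\<Sum>m\<in>S. P l m * R m n) = (if l = n then 1 else 0)" and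
      RP: "\<And>l n. l \<in> S \<Longrightarrow> n \<in> S \<Longrightarrow> (\<Sum>m\<in>S. R l m * P m n) = (if l = n then 1 else 0)"
      unfolding mat_inverse_on_def by blast
    define r where "r m = (\<Sum>l\<in>S. P l m * G l N)" for m
    define q where "q m = (\<Sum>k\<in>S. P m k * r k)" for m
    have Rq: "(\<Sum>m\<in>S. R l m * q m) = r l" if "l \<in> S" for l
    proof -
      have "(\<Sum>m\<in>S. R l m * q m) = (\<Sum>m\<in>S. \<Sum>k\<in>S. R l m * P m k * r k)"
        by (simp add: q_def sum_distrib_left mult_ac)
      also have "\<dots> = (\<Sum>k\<in>S. (\<Sum>m\<in>S. R l m * P m k) * r k)"
        unfolding sum_distrib_right by (rule sum.swap)
      also have "\<dots> = (\<Sum>k\<in>S. if l = k then r k else 0)" using RP that by (intro sum.cong) auto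
      also have "\<dots> = r l" using that NS by simp
      finally show ?thesis .
    qed
    have GN: "(\<Sum>k\<in>S. R k m * r k) = G m N" if "m \<in> S" for m
    proof -
      have "(\<Sum>k\<in>S. R k m * r k) = (\<Sum>k\<in>S. \<Sum>l\<in>S. P l k * R k m * G l N)"
        by (simp add: r_def sum_distrib_left mult_ac)
      also have "\<dots> = (\<Sum>l\<in>S. (\<Sum>k\<in>S. P l k * R k m) * G l N)"
        unfolding sum_distrib_right by (rule sum.swap)
      also have "\<dots> = (\<Sum>l\<in>S. if l = m then G l N else 0)" using PR that by (intro sum.cong) auto
      also have "\<dots> = G m N" using that NS by simp
      finally show ?thesis .
    qed
    have qG: "(\<Sum>m\<in>S. q m * G m N) = (\<Sum>k\<in>S. r k * r k)"
    proof -
      have "(\<Sum>m\<in>S. q m * G m N) = (\<Sum>m\<in>S. \<Sum>k\<in>S. r k * (P m k * G m N))"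
        by (simp add: q_def sum_distrib_right sum_distrib_left mult_ac)
      also have "\<dots> = (\<Sum>k\<in>S. \<Sum>m\<in>S. r k * (P m k * G m N))" by (rule sum.swap)
      also have "\<dots> = (\<Sum>k\<in>S. r k * r k)" by (simp add: r_def sum_distrib_left)
      finally show ?thesis .
    qed
    have qGq: "(\<Sum>m\<in>S. \<Sum>n\<in>S. q m * q n * G m n) = (\<Sum>k\<in>S. r k * r k)"
    proof -
      have "(\<Sum>m\<in>S. \<Sum>n\<in>S. q m * q n * G m n) = (\<Sum>m\<in>S. \<Sum>n\<in>S. \<Sum>k\<in>S. R k m * q m * (R k n * q n))"
        by (intro sum.cong refl) (simp add: G sum_distrib_left mult_ac)
      also have "\<dots> = (\<Sum>k\<in>S. \<Sum>m\<in>S. \<Sum>n\<in>S. R k m * q m * (R k n * q n))"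
      proof -
        have "(\<Sum>m\<in>S. \<Sum>n\<in>S. \<Sum>k\<in>S. R k m * q m * (R k n * q n)) =
            (\<Sum>m\<in>S. \<Sum>k\<in>S. \<Sum>n\<in>S. R k m * q m * (R k n * q n))"
          by (intro sum.cong refl sum.swap)
        also have "\<dots> = (\<Sum>k\<in>S. \<Sum>m\<in>S. \<Sum>n\<in>S. R k m * q m * (R k n * q n))"
          by (rule sum.swap)
        finally show ?thesis .
      qed
      also have "\<dots> = (\<Sum>k\<in>S. (\<Sum>m\<in>S. R k m * q m) * (\<Sum>n\<in>S. R k n * q n))"
        by (simp add: sum_product)
      also have "\<dots> = (\<Sum>k\<in>S. r k * r k)" by (intro sum.cong) (auto simp: Rq)
      finally show ?thesis .
    qed
    define s2 where "s2 = G N N - (\<Sum>k\<in>S. r k * r k)"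
    have "s2 > 0"
    proof -
      define c where "c n = (if n = N then 1 else - q n)" for n
      have "\<exists>n\<in>{1..<Suc N}. c n \<noteq> 0" using False by (intro bexI[of _ N]) (auto simp: c_def)
      from Suc.prems[OF this] have "(\<Sum>m\<in>insert N S. \<Sum>n\<in>insert N S. c m * c n * G m n) > 0"
        unfolding S' .
      also have "(\<Sum>m\<in>insert N S. \<Sum>n\<in>insert N S. c m * c n * G m n) =
          G N N - (\<Sum>n\<in>S. q n * G N n) + ((\<Sum>m\<in>S. - (q m * G m N)) + (\<Sum>m\<in>S. \<Sum>n\<in>S. q m * q n * G m n))"
        using NS neN by (simp add: c_def sum.distrib sum_negf sum_subtractf)
      also have "\<dots> = s2" using qG qGq sym by (simp add: s2_def sum_negf)
      finally show ?thesis .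
    qed
    define s where "s = sqrt s2"
    have s: "s > 0" "s * s = s2" using \<open>s2 > 0\<close> by (auto simp: s_def)
    define R' where "R' m n = (if n = N then (if m = N then s else if m \<in> S then r m else 0)
        else if m = N then 0 else R m n)" for m n
    define P' where "P' m n = (if n = N then (if m = N then 1 / s else if m \<in> S then - q m / s else 0)
        else if m = N then 0 else P m n)" for m n
    have tri': "R' m n = 0 \<and> P' m n = 0" if "m > n" for m n
      using that tri[OF that] by (auto simp: R'_def P'_def S_def)
    have G': "G m n = (\<Sum>k\<in>insert N S. R' k m * R' k n)" if "m \<in> insert N S" "n \<in> insert N S" for m n
    proof -
      have r: "(\<Sum>k\<in>S. r k * R k m) = G N m" if "m \<in> S" for m
        using GN[OF that] sym by (simp add: mult.commute)
      show ?thesis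
        using that NS neN by (auto simp: R'_def G GN r s s2_def)
    qed
    have PR': "(\<Sum>m\<in>insert N S. P' l m * R' m n) = (if l = n then 1 else 0)"
      if "l \<in> insert N S" "n \<in> insert N S" for l n
      using that NS neN s(1) by (auto simp: R'_def P'_def PR q_def[symmetric])
    have RP': "(\<Sum>m\<in>insert N S. R' l m * P' m n) = (if l = n then 1 else 0)"
      if "l \<in> insert N S" "n \<in> insert N S" for l n
      using that NS neN s(1) Rq
      by (auto simp: R'_def P'_def RP sum_negf sum_divide_distrib[symmetric])
    show ?thesis
      unfolding S' mat_inverse_on_def
    proof (intro exI conjI)
      show "\<forall>m n. n < m \<longrightarrow> R' m n = 0 \<and> P' m n = 0" using tri' by simp
      show "\<forall>m\<in>insert N S. \<forall>n\<in>insert N S. G m n = (\<Sum>r\<in>insert N S. R' r m * R' r n)"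
        by (intro ballI G')
      show "\<forall>l\<in>insert N S. \<forall>n\<in>insert N S. (\<Sum>m\<in>insert N S. P' l m * R' m n) = (if l = n then 1 else 0)"
        by (intro ballI PR')
      show "\<forall>l\<in>insert N S. \<forall>n\<in>insert N S. (\<Sum>m\<in>insert N S. R' l m * P' m n) = (if l = n then 1 else 0)"
        by (intro ballI RP')
    qed
  qed
qed

section \<open>Tensor products of matrices\<close>

definition vbox :: "('n \<Rightarrow> nat set) \<Rightarrow> (nat ^ 'n::finite) set" where
  "vbox B = {\<alpha>. \<forall>i. \<alpha> $ i \<in> B i}"

lemma vbox_eq_image: "vbox B = vec_lambda ` PiE UNIV B"
proof
  show "vbox B \<subseteq> vec_lambda ` PiE UNIV B"
  proof
    fix \<alpha> assume "\<alpha> \<in> vbox B"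
    then show "\<alpha> \<in> vec_lambda ` PiE UNIV B"
      by (intro image_eqI[of _ _ "vec_nth \<alpha>"]) (auto simp: vbox_def)
  qed
qed (auto simp: vbox_def)

lemma sum_vbox: "(\<Sum>\<alpha>\<in>vbox B. F \<alpha>) = (\<Sum>f\<in>PiE UNIV B. F (vec_lambda f))"
proof -
  have "inj_on vec_lambda (PiE UNIV B)" by (auto simp: inj_on_def vec_lambda_inject)
  then show ?thesis by (simp add: vbox_eq_image sum.reindex)
qed

lemma finite_vbox: "(\<And>i. finite (B i)) \<Longrightarrow> finite (vbox B)"
  unfolding vbox_eq_image by (intro finite_imageI finite_PiE) auto

lemma sum_prod_vbox:
  fixes f :: "'n::finite \<Rightarrow> nat \<Rightarrow> 'a::comm_semiring_1"
  assumes "\<And>i. finite (B i)"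
  shows "(\<Sum>\<alpha>\<in>vbox B. \<Prod>i\<in>UNIV. f i (\<alpha> $ i)) = (\<Prod>i\<in>UNIV. \<Sum>n\<in>B i. f i n)"
  using assms by (simp add: sum_vbox prod_sum_PiE)

lemma sum_PiE_insert:
  assumes "j \<notin> I"
  shows "(\<Sum>h\<in>PiE (insert j I) A. F h) = (\<Sum>a\<in>A j. \<Sum>f\<in>PiE I A. F (f(j := a)))"
proof -
  have "(\<Sum>h\<in>PiE (insert j I) A. F h) = (\<Sum>(a, f)\<in>A j \<times> PiE I A. F (f(j := a)))"
    unfolding PiE_insert_eq using inj_combinator[OF assms, of A]
    by (subst sum.reindex) (auto simp: case_prod_unfold comp_def)
  then show ?thesis by (simp add: sum.cartesian_product)
qed

lemma tensor_norm_PiE: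
  fixes M :: "'n \<Rightarrow> nat \<Rightarrow> nat \<Rightarrow> real"
  assumes "finite I" and fin: "\<And>i. finite (A i)" "\<And>i. finite (B i)" and c: "\<And>i. c i \<ge> 0"
    and bound: "\<And>i z. i \<in> I \<Longrightarrow>
      (\<Sum>r\<in>A i. (\<Sum>s\<in>B i. M i r s * z s)\<^sup>2) \<le> c i * (\<Sum>s\<in>B i. (z s)\<^sup>2)"
  shows "(\<Sum>f\<in>PiE I A. (\<Sum>g\<in>PiE I B. (\<Prod>i\<in>I. M i (f i) (g i)) * z g)\<^sup>2)
    \<le> (\<Prod>i\<in>I. c i) * (\<Sum>g\<in>PiE I B. (z g)\<^sup>2)"
  using assms(1) bound
proof (induction I arbitrary: z)
  case empty
  show ?case by simp
next
  case (insert j I)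
  define y where "y f b = (\<Sum>g\<in>PiE I B. (\<Prod>i\<in>I. M i (f i) (g i)) * z (g(j := b)))" for f b
  have prod_upd: "(\<Prod>i\<in>insert j I. M i ((f(j := a)) i) ((g(j := b)) i)) = M j a b * (\<Prod>i\<in>I. M i (f i) (g i))"
    for f g a b
  proof -
    have "(\<Prod>i\<in>I. M i ((f(j := a)) i) ((g(j := b)) i)) = (\<Prod>i\<in>I. M i (f i) (g i))"
      using insert(2) by (intro prod.cong) auto
    then show ?thesis using insert(1,2) by simp
  qed
  have "(\<Sum>f\<in>PiE (insert j I) A. (\<Sum>g\<in>PiE (insert j I) B. (\<Prod>i\<in>insert j I. M i (f i) (g i)) * z g)\<^sup>2)
      = (\<Sum>a\<in>A j. \<Sum>f\<in>PiE I A. (\<Sum>b\<in>B j. M j a b * y f b)\<^sup>2)"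
    unfolding sum_PiE_insert[OF insert(2)] prod_upd y_def
    by (simp add: sum_distrib_left mult.assoc)
  also have "\<dots> = (\<Sum>f\<in>PiE I A. \<Sum>a\<in>A j. (\<Sum>b\<in>B j. M j a b * y f b)\<^sup>2)" by (rule sum.swap)
  also have "\<dots> \<le> (\<Sum>f\<in>PiE I A. c j * (\<Sum>b\<in>B j. (y f b)\<^sup>2))"
    by (intro sum_mono insert.prems) simp
  also have "\<dots> = c j * (\<Sum>b\<in>B j. \<Sum>f\<in>PiE I A. (y f b)\<^sup>2)"
    unfolding sum_distrib_left[symmetric] by (subst sum.swap) (rule refl)
  also have "\<dots> \<le> c j * (\<Sum>b\<in>B j. (\<Prod>i\<in>I. c i) * (\<Sum>g\<in>PiE I B. (z (g(j := b)))\<^sup>2))"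
    unfolding y_def using insert.prems by (intro mult_left_mono sum_mono insert.IH c) auto
  also have "\<dots> = (\<Prod>i\<in>insert j I. c i) * (\<Sum>g\<in>PiE (insert j I) B. (z g)\<^sup>2)"
    unfolding sum_PiE_insert[OF insert(2)] using insert(1,2) by (simp add: sum_distrib_left[symmetric] mult.assoc)
  finally show ?case .
qed

definition tensor_apply ::
  "('n::finite \<Rightarrow> nat \<Rightarrow> nat \<Rightarrow> real) \<Rightarrow> ('n \<Rightarrow> nat set) \<Rightarrow> (nat ^ 'n \<Rightarrow> real) \<Rightarrow> nat ^ 'n \<Rightarrow> real" where
  "tensor_apply M B z \<alpha> = (\<Sum>\<mu>\<in>vbox B. (\<Prod>i\<in>UNIV. M i (\<alpha> $ i) (\<mu> $ i)) * z \<mu>)"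

lemma tensor_norm:
  fixes M :: "'n::finite \<Rightarrow> nat \<Rightarrow> nat \<Rightarrow> real"
  assumes fin: "\<And>i. finite (A i)" "\<And>i. finite (B i)" and c: "\<And>i. c i \<ge> 0"
    and bound: "\<And>i z. (\<Sum>r\<in>A i. (\<Sum>s\<in>B i. M i r s * z s)\<^sup>2) \<le> c i * (\<Sum>s\<in>B i. (z s)\<^sup>2)"
  shows "(\<Sum>\<alpha>\<in>vbox A. (tensor_apply M B z \<alpha>)\<^sup>2) \<le> (\<Prod>i\<in>UNIV. c i) * (\<Sum>\<mu>\<in>vbox B. (z \<mu>)\<^sup>2)"
  unfolding sum_vbox tensor_apply_def
  using tensor_norm_PiE[OF finite fin c bound, where I = UNIV and z = "\<lambda>g. z (vec_lambda g)"] by simp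

lemma tensor_apply_compose:
  fixes z :: "nat ^ 'n::finite \<Rightarrow> real"
  assumes "\<And>i. finite (B i)"
  shows "tensor_apply P B (tensor_apply R C z) \<alpha> = tensor_apply (\<lambda>i l n. \<Sum>m\<in>B i. P i l m * R i m n) C z \<alpha>"
proof -
  have "tensor_apply P B (tensor_apply R C z) \<alpha> =
      (\<Sum>\<mu>\<in>vbox B. \<Sum>\<nu>\<in>vbox C. (\<Prod>i\<in>UNIV. P i (\<alpha> $ i) (\<mu> $ i) * R i (\<mu> $ i) (\<nu> $ i)) * z \<nu>)"
    by (simp add: tensor_apply_def sum_distrib_left prod.distrib mult_ac)
  also have "\<dots> = (\<Sum>\<nu>\<in>vbox C. (\<Sum>\<mu>\<in>vbox B. \<Prod>i\<in>UNIV. P i (\<alpha> $ i) (\<mu> $ i) * R i (\<mu> $ i) (\<nu> $ i)) * z \<nu>)"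
    by (subst sum.swap) (simp add: sum_distrib_right)
  also have "\<dots> = tensor_apply (\<lambda>i l n. \<Sum>m\<in>B i. P i l m * R i m n) C z \<alpha>"
    unfolding tensor_apply_def
    by (intro sum.cong refl) (simp add: sum_prod_vbox[OF assms, symmetric])
  finally show ?thesis .
qed

lemma tensor_apply_cong:
  assumes "\<And>i m n. m \<in> A i \<Longrightarrow> n \<in> B i \<Longrightarrow> M i m n = M' i m n" "\<And>\<mu>. \<mu> \<in> vbox B \<Longrightarrow> z \<mu> = z' \<mu>" "\<alpha> \<in> vbox A"
  shows "tensor_apply M B z \<alpha> = tensor_apply M' B z' \<alpha>"
  using assms unfolding tensor_apply_def by (intro sum.cong arg_cong2[where f="(*)"] prod.cong) (auto simp: vbox_def)

lemma tensor_apply_id: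
  fixes z :: "nat ^ 'n::finite \<Rightarrow> real"
  assumes "\<And>i. finite (B i)" "\<alpha> \<in> vbox B"
    and "\<And>i m n. m \<in> B i \<Longrightarrow> n \<in> B i \<Longrightarrow> M i m n = (if m = n then 1 else 0)"
  shows "tensor_apply M B z \<alpha> = z \<alpha>"
proof -
  have "tensor_apply M B z \<alpha> = (\<Sum>\<mu>\<in>vbox B. if \<mu> = \<alpha> then z \<mu> else 0)"
    unfolding tensor_apply_def
  proof (rule sum.cong[OF refl])
    fix \<mu> assume \<mu>: "\<mu> \<in> vbox B"
    have eq: "M i (\<alpha> $ i) (\<mu> $ i) = (if \<alpha> $ i = \<mu> $ i then 1 else 0)" for i
      using assms(2,3) \<mu> by (simp add: vbox_def)
    show "(\<Prod>i\<in>UNIV. M i (\<alpha> $ i) (\<mu> $ i)) * z \<mu> = (if \<mu> = \<alpha> then z \<mu> else 0)"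
    proof (cases "\<mu> = \<alpha>")
      case False
      then obtain i where "\<alpha> $ i \<noteq> \<mu> $ i" by (metis vec_eq_iff)
      then have "(\<Prod>i\<in>UNIV. M i (\<alpha> $ i) (\<mu> $ i)) = 0" by (intro prod_zero) (auto simp: eq)
      then show ?thesis using False by simp
    next
      case True
      then have "(\<Prod>i\<in>UNIV. M i (\<alpha> $ i) (\<mu> $ i)) = 1" by (intro prod.neutral) (use eq in auto)
      then show ?thesis using True by simp
    qed
  qed
  also have "\<dots> = z \<alpha>" using assms(1,2) by (simp add: finite_vbox)
  finally show ?thesis .
qed

lemma tensor_qform_squares:
  fixes x :: "nat ^ 'n::finite \<Rightarrow> real"
  assumes fin: "\<And>i. finite (B i)"
    and k: "\<And>i m n. m \<in> B i \<Longrightarrow> n \<in> B i \<Longrightarrow> k i m n = (\<Sum>r\<in>B i. S i r m * S i r n)"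
  shows "(\<Sum>\<alpha>\<in>vbox B. \<Sum>\<alpha>'\<in>vbox B. x \<alpha> * x \<alpha>' * (\<Prod>i\<in>UNIV. k i (\<alpha> $ i) (\<alpha>' $ i))) =
    (\<Sum>\<rho>\<in>vbox B. (tensor_apply S B x \<rho>)\<^sup>2)"
proof -
  have prod: "(\<Prod>i\<in>UNIV. k i (\<alpha> $ i) (\<alpha>' $ i)) =
      (\<Sum>\<rho>\<in>vbox B. (\<Prod>i\<in>UNIV. S i (\<rho> $ i) (\<alpha> $ i)) * (\<Prod>i\<in>UNIV. S i (\<rho> $ i) (\<alpha>' $ i)))"
    if "\<alpha> \<in> vbox B" "\<alpha>' \<in> vbox B" for \<alpha> \<alpha>'
  proof -
    have "(\<Prod>i\<in>UNIV. k i (\<alpha> $ i) (\<alpha>' $ i)) = (\<Prod>i\<in>UNIV. \<Sum>r\<in>B i. S i r (\<alpha> $ i) * S i r (\<alpha>' $ i))"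
      using that by (intro prod.cong refl k) (auto simp: vbox_def)
    also have "\<dots> = (\<Sum>\<rho>\<in>vbox B. \<Prod>i\<in>UNIV. S i (\<rho> $ i) (\<alpha> $ i) * S i (\<rho> $ i) (\<alpha>' $ i))"
      by (rule sum_prod_vbox[OF fin, symmetric])
    finally show ?thesis by (simp add: prod.distrib)
  qed
  have "(\<Sum>\<alpha>\<in>vbox B. \<Sum>\<alpha>'\<in>vbox B. x \<alpha> * x \<alpha>' * (\<Prod>i\<in>UNIV. k i (\<alpha> $ i) (\<alpha>' $ i))) =
      (\<Sum>\<alpha>\<in>vbox B. \<Sum>\<alpha>'\<in>vbox B. \<Sum>\<rho>\<in>vbox B. ((\<Prod>i\<in>UNIV. S i (\<rho> $ i) (\<alpha> $ i)) * x \<alpha>) *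
         ((\<Prod>i\<in>UNIV. S i (\<rho> $ i) (\<alpha>' $ i)) * x \<alpha>'))"
    by (intro sum.cong refl) (simp add: prod sum_distrib_left mult_ac)
  also have "\<dots> = (\<Sum>\<alpha>\<in>vbox B. \<Sum>\<rho>\<in>vbox B. \<Sum>\<alpha>'\<in>vbox B. ((\<Prod>i\<in>UNIV. S i (\<rho> $ i) (\<alpha> $ i)) * x \<alpha>) *
         ((\<Prod>i\<in>UNIV. S i (\<rho> $ i) (\<alpha>' $ i)) * x \<alpha>'))"
    by (intro sum.cong refl sum.swap)
  also have "\<dots> = (\<Sum>\<rho>\<in>vbox B. \<Sum>\<alpha>\<in>vbox B. \<Sum>\<alpha>'\<in>vbox B. ((\<Prod>i\<in>UNIV. S i (\<rho> $ i) (\<alpha> $ i)) * x \<alpha>) *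
         ((\<Prod>i\<in>UNIV. S i (\<rho> $ i) (\<alpha>' $ i)) * x \<alpha>'))"
    by (rule sum.swap)
  also have "\<dots> = (\<Sum>\<rho>\<in>vbox B. (tensor_apply S B x \<rho>)\<^sup>2)"
    by (simp add: tensor_apply_def power2_eq_square sum_product)
  finally show ?thesis .
qed

lemma tensor_qform_product:
  fixes c :: "'n::finite \<Rightarrow> nat \<Rightarrow> real"
  assumes fin: "\<And>i. finite (B i)"
  shows "(\<Sum>\<alpha>\<in>vbox B. \<Sum>\<alpha>'\<in>vbox B. (\<Prod>i\<in>UNIV. c i (\<alpha> $ i)) * (\<Prod>i\<in>UNIV. c i (\<alpha>' $ i)) *
      (\<Prod>i\<in>UNIV. k i (\<alpha> $ i) (\<alpha>' $ i))) = (\<Prod>i\<in>UNIV. \<Sum>m\<in>B i. \<Sum>n\<in>B i. c i m * c i n * k i m n)"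
proof -
  have "(\<Sum>\<alpha>'\<in>vbox B. (\<Prod>i\<in>UNIV. c i (\<alpha> $ i)) * (\<Prod>i\<in>UNIV. c i (\<alpha>' $ i)) *
      (\<Prod>i\<in>UNIV. k i (\<alpha> $ i) (\<alpha>' $ i))) = (\<Prod>i\<in>UNIV. \<Sum>n\<in>B i. c i (\<alpha> $ i) * c i n * k i (\<alpha> $ i) n)" for \<alpha>
    using sum_prod_vbox[OF fin, where f = "\<lambda>i n. c i (\<alpha> $ i) * c i n * k i (\<alpha> $ i) n"] fin
    by (simp add: prod.distrib)
  then show ?thesis
    using sum_prod_vbox[OF fin, where f = "\<lambda>i m. \<Sum>n\<in>B i. c i m * c i n * k i m n"] by simp
qed

section \<open>Level-wise orthogonalisation of the univariate system\<close>

lemma weighted_cauchy_schwarz: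
  fixes f a :: "'i \<Rightarrow> real"
  assumes "\<And>i. i \<in> A \<Longrightarrow> a i > 0"
  shows "(\<Sum>i\<in>A. f i)\<^sup>2 \<le> (\<Sum>i\<in>A. a i) * (\<Sum>i\<in>A. (f i)\<^sup>2 / a i)"
proof -
  have "(\<Sum>i\<in>A. f i) = (\<Sum>i\<in>A. sqrt (a i) * (f i / sqrt (a i)))"
    using assms by (intro sum.cong) (auto simp: order_less_le)
  also have "\<dots>\<^sup>2 \<le> (\<Sum>i\<in>A. (sqrt (a i))\<^sup>2) * (\<Sum>i\<in>A. (f i / sqrt (a i))\<^sup>2)"
    by (rule Cauchy_Schwarz_ineq_sum)
  also have "\<dots> = (\<Sum>i\<in>A. a i) * (\<Sum>i\<in>A. (f i)\<^sup>2 / a i)"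
    using assms by (intro arg_cong2[where f="(*)"] sum.cong) (auto simp: power_divide less_imp_le)
  finally show ?thesis .
qed

lemma geometric_tail:
  fixes q :: real
  assumes "q \<ge> 2"
  shows "(\<Sum>k\<in>{m..K}. 1 / q ^ k) \<le> 2 / q ^ m"
proof (cases "m \<le> K")
  case True
  have q: "1 / q < 1" "1 / q > 0" "1 - 1 / q \<ge> 1 / 2" using assms by (auto simp: field_simps)
  have "(\<Sum>k\<in>{m..K}. (1 / q) ^ k) = ((1 / q) ^ m - (1 / q) ^ Suc K) / (1 - 1 / q)"
    using sum_gp[of "1 / q" m K] True q by auto
  also have "\<dots> \<le> (1 / q) ^ m / (1 - 1 / q)" using q by (intro divide_right_mono) auto
  also have "\<dots> \<le> (1 / q) ^ m / (1 / 2)" using q by (intro divide_left_mono) auto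
  finally show ?thesis by (simp add: power_one_over)
qed (use assms in simp)

lemma finite_dyadic_block [simp]: "finite (dyadic_block k)"
  by (simp add: dyadic_block_def)

lemma dyadic_block_pos: "n \<in> dyadic_block k \<Longrightarrow> n \<ge> 1"
proof -
  assume "n \<in> dyadic_block k"
  then have "2 ^ (k - 1) \<le> n" by (simp add: dyadic_block_def)
  moreover have "(1::nat) \<le> 2 ^ (k - 1)" by simp
  ultimately show "n \<ge> 1" by linarith
qed

lemma dyadic_block_subset:
  assumes "k \<le> M"
  shows "dyadic_block k \<subseteq> {1..<2 ^ M}"
proof
  fix n assume n: "n \<in> dyadic_block k"
  have "(2::nat) ^ k \<le> 2 ^ M" using assms by (intro power_increasing) auto
  moreover have "n < 2 ^ k" using n by (simp add: dyadic_block_def)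
  ultimately have "n < 2 ^ M" by linarith
  then show "n \<in> {1..<2 ^ M}" using dyadic_block_pos[OF n] by simp
qed

lemma mem_dyadic_block_iff: "k \<ge> 1 \<Longrightarrow> n \<in> dyadic_block k \<longleftrightarrow> n \<ge> 1 \<and> block_of n = k"
  using block_of_eq dyadic_block_pos mem_dyadic_block by blast

lemma block_of_mono:
  assumes "1 \<le> m" "m \<le> n"
  shows "block_of m \<le> block_of n"
proof (rule block_of_less)
  have "n < 2 ^ block_of n" using mem_dyadic_block[of n] assms by (auto simp: dyadic_block_def)
  then show "m < 2 ^ block_of n" using assms by simp
qed (use assms in simp)

lemma sum_dyadic_blocks: "(\<Sum>n\<in>{1..<2 ^ M}. f n) = (\<Sum>k\<in>{1..M}. \<Sum>n\<in>dyadic_block k. f n)"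
proof -
  have "block_of ` {1..<2 ^ M} \<subseteq> {1..M}"
    using block_of_less block_of_ge_1 by auto
  then have "(\<Sum>n\<in>{1..<2 ^ M}. f n) = (\<Sum>k\<in>{1..M}. \<Sum>n\<in>{n\<in>{1..<2 ^ M}. block_of n = k}. f n)"
    by (subst sum.group) auto
  also have "\<dots> = (\<Sum>k\<in>{1..M}. \<Sum>n\<in>dyadic_block k. f n)"
  proof (intro sum.cong refl)
    fix k assume k: "k \<in> {1..M}"
    then have "k \<ge> 1" "dyadic_block k \<subseteq> {1..<2 ^ M}" using dyadic_block_subset by auto
    then show "{n\<in>{1..<2 ^ M}. block_of n = k} = dyadic_block k"
      by (auto simp: mem_dyadic_block_iff)
  qed
  finally show ?thesis .
qed

lemma gram_qform_pos:
  assumes "\<exists>n\<in>{1..<2 ^ M}. c n \<noteq> 0"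
  shows "(\<Sum>m\<in>{1..<2 ^ M}. \<Sum>n\<in>{1..<2 ^ M}. c m * c n * gram m n) > 0"
proof -
  obtain n where n: "n \<in> {1..<2 ^ M}" "c n \<noteq> 0" using assms by blast
  have "0 < (c n)\<^sup>2" using n by simp
  also have "\<dots> \<le> (\<Sum>n\<in>dyadic_block (block_of n). (c n)\<^sup>2)"
    using n by (intro member_le_sum mem_dyadic_block) auto
  also have "\<dots> \<le> 24 * 2 ^ M * (LINT t|lborel. (fsum M c t)\<^sup>2)"
    using n by (intro hierarchical_stability block_of_ge_1 block_of_less) auto
  finally have "(LINT t|lborel. (fsum M c t)\<^sup>2) > 0" by (simp add: zero_less_mult_iff)
  then show ?thesis unfolding fsum_def using gram_form(1)[of "{1..<2 ^ M}" c] by simp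
qed

locale gram_factor =
  fixes M :: nat and R P :: "nat \<Rightarrow> nat \<Rightarrow> real"
  assumes tri: "\<And>m n. m > n \<Longrightarrow> R m n = 0" "\<And>m n. m > n \<Longrightarrow> P m n = 0"
    and gram_eq: "\<And>m n. m \<in> {1..<2 ^ M} \<Longrightarrow> n \<in> {1..<2 ^ M} \<Longrightarrow>
      gram m n = (\<Sum>r\<in>{1..<2 ^ M}. R r m * R r n)"
    and PR: "\<And>l n. l \<in> {1..<2 ^ M} \<Longrightarrow> n \<in> {1..<2 ^ M} \<Longrightarrow>
      (\<Sum>m\<in>{1..<2 ^ M}. P l m * R m n) = (if l = n then 1 else 0)"
    and RP: "\<And>l n. l \<in> {1..<2 ^ M} \<Longrightarrow> n \<in> {1..<2 ^ M} \<Longrightarrow>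
      (\<Sum>m\<in>{1..<2 ^ M}. R l m * P m n) = (if l = n then 1 else 0)"
begin

abbreviation "Q \<equiv> {1..<2 ^ M} :: nat set"

lemma gram_squares: "(\<Sum>m\<in>Q. (\<Sum>n\<in>Q. R m n * c n)\<^sup>2) = (\<Sum>m\<in>Q. \<Sum>n\<in>Q. c m * c n * gram m n)"
proof -
  have "(\<Sum>m\<in>Q. \<Sum>n\<in>Q. c m * c n * gram m n) = (\<Sum>m\<in>Q. \<Sum>n\<in>Q. \<Sum>r\<in>Q. R r m * c m * (R r n * c n))"
    by (intro sum.cong refl) (simp add: gram_eq sum_distrib_left mult_ac)
  also have "\<dots> = (\<Sum>m\<in>Q. \<Sum>r\<in>Q. \<Sum>n\<in>Q. R r m * c m * (R r n * c n))"
    by (intro sum.cong refl sum.swap)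
  also have "\<dots> = (\<Sum>r\<in>Q. \<Sum>m\<in>Q. \<Sum>n\<in>Q. R r m * c m * (R r n * c n))" by (rule sum.swap)
  also have "\<dots> = (\<Sum>m\<in>Q. (\<Sum>n\<in>Q. R m n * c n)\<^sup>2)" by (simp add: power2_eq_square sum_product)
  finally show ?thesis ..
qed

lemma sum_Q_block:
  assumes "k \<le> M"
  shows "(\<Sum>m\<in>Q. if m \<in> dyadic_block k then f m else 0) = (\<Sum>m\<in>dyadic_block k. f m)"
  using dyadic_block_subset[OF assms] by (simp add: sum.inter_restrict[symmetric] Int_absorb1)

lemma P_block_bound:
  assumes l: "1 \<le> l" "l \<le> M" and k: "1 \<le> k" "k \<le> M"
  shows "(\<Sum>n\<in>dyadic_block l. (\<Sum>m\<in>dyadic_block k. P n m * y m)\<^sup>2)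
    \<le> 24 * 2 ^ k * (\<Sum>m\<in>dyadic_block k. (y m)\<^sup>2)"
proof (cases "l \<le> k")
  case False
  have "P n m = 0" if "n \<in> dyadic_block l" "m \<in> dyadic_block k" for n m
  proof (rule tri(2))
    have "block_of m < block_of n" using that False l k by (simp add: mem_dyadic_block_iff)
    then show "m < n" using block_of_mono[of n m] that dyadic_block_pos by (meson not_le)
  qed
  then show ?thesis by (simp add: sum_nonneg)
next
  case True
  define y' where "y' m = (if m \<in> dyadic_block k then y m else 0)" for m
  define c where "c n = (\<Sum>m\<in>Q. P n m * y' m)" for n
  have c: "c n = (\<Sum>m\<in>dyadic_block k. P n m * y m)" for n
    unfolding c_def y'_def using sum_Q_block[OF k(2), of "\<lambda>m. P n m * y m"]
    by (simp add: if_distrib[of "\<lambda>x. _ * x"] cong: if_cong)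
  have c0: "c n = 0" if "n \<ge> 2 ^ k" for n
    unfolding c by (intro sum.neutral ballI) (use that in \<open>auto simp: dyadic_block_def tri(2)\<close>)
  have "fsum k c t = fsum M c t" for t
    unfolding fsum_def
  proof (rule sum.mono_neutral_left)
    have "(2::nat) ^ k \<le> 2 ^ M" using k by (intro power_increasing) auto
    then show "{1..<2 ^ k} \<subseteq> {1..<2 ^ M :: nat}" by auto
  qed (use c0 in auto)
  then have "(LINT t|lborel. (fsum k c t)\<^sup>2) = (LINT t|lborel. (fsum M c t)\<^sup>2)" by simp
  also have "\<dots> = (\<Sum>m\<in>Q. \<Sum>n\<in>Q. c m * c n * gram m n)"
    unfolding fsum_def by (rule gram_form(1)) auto
  also have "\<dots> = (\<Sum>m\<in>Q. (\<Sum>n\<in>Q. R m n * c n)\<^sup>2)" by (rule gram_squares[symmetric])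
  also have "\<dots> = (\<Sum>m\<in>Q. (y' m)\<^sup>2)"
  proof (rule sum.cong[OF refl])
    fix m assume m: "m \<in> Q"
    have "(\<Sum>n\<in>Q. R m n * c n) = (\<Sum>n\<in>Q. \<Sum>j\<in>Q. R m n * P n j * y' j)"
      by (simp add: c_def sum_distrib_left mult_ac)
    also have "\<dots> = (\<Sum>j\<in>Q. (\<Sum>n\<in>Q. R m n * P n j) * y' j)"
      unfolding sum_distrib_right by (rule sum.swap)
    also have "\<dots> = (\<Sum>j\<in>Q. if m = j then y' j else 0)"
    proof (rule sum.cong[OF refl])
      fix j assume "j \<in> Q"
      then show "(\<Sum>n\<in>Q. R m n * P n j) * y' j = (if m = j then y' j else 0)"
        by (subst RP[OF m]) auto
    qed
    also have "\<dots> = y' m" using m by (simp add: sum.delta)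
    finally show "(\<Sum>n\<in>Q. R m n * c n)\<^sup>2 = (y' m)\<^sup>2" by simp
  qed
  also have "\<dots> = (\<Sum>m\<in>dyadic_block k. (y m)\<^sup>2)"
    unfolding y'_def using sum_Q_block[OF k(2), of "\<lambda>m. (y m)\<^sup>2"]
    by (simp add: if_distrib[of "\<lambda>x. x\<^sup>2"] cong: if_cong)
  finally show ?thesis
    using hierarchical_stability[OF l(1) True, of c] unfolding c by simp
qed

lemma R_weighted_bound:
  "(\<Sum>m\<in>Q. (\<Sum>r\<in>Q. 2 ^ block_of m * R m r / sqrt (dgram r r) * z r)\<^sup>2) \<le> 1 * (\<Sum>r\<in>Q. (z r)\<^sup>2)"
proof -
  define c where "c r = z r / sqrt (dgram r r)" for r
  define w where "w l m = (\<Sum>r\<in>dyadic_block l. R m r * c r)" for l m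
  have w0: "w l m = 0" if "m \<in> Q" "1 \<le> l" "l < block_of m" for l m
    unfolding w_def
  proof (intro sum.neutral ballI)
    fix r assume r: "r \<in> dyadic_block l"
    have "block_of r < block_of m" using that r by (simp add: mem_dyadic_block_iff)
    then have "r < m" using block_of_mono[of m r] that by (auto simp: not_le[symmetric])
    then show "R m r * c r = 0" by (simp add: tri(1))
  qed
  have pt: "(\<Sum>r\<in>Q. 2 ^ block_of m * R m r / sqrt (dgram r r) * z r)\<^sup>2 \<le> (\<Sum>l\<in>{1..M}. 2 * 4 ^ l * (w l m)\<^sup>2)"
    if m: "m \<in> Q" for m
  proof -
    let ?k = "block_of m"
    have "(\<Sum>r\<in>Q. 2 ^ ?k * R m r / sqrt (dgram r r) * z r) = 2 ^ ?k * (\<Sum>r\<in>Q. R m r * c r)"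
      by (simp add: c_def sum_distrib_left mult_ac)
    also have "(\<Sum>r\<in>Q. R m r * c r) = (\<Sum>l\<in>{1..M}. w l m)"
      unfolding w_def by (rule sum_dyadic_blocks)
    also have "\<dots> = (\<Sum>l\<in>{?k..M}. w l m)"
      using w0[OF m] block_of_ge_1[of m] by (intro sum.mono_neutral_right) (auto simp: not_le)
    finally have "(\<Sum>r\<in>Q. 2 ^ ?k * R m r / sqrt (dgram r r) * z r)\<^sup>2 = 4 ^ ?k * (\<Sum>l\<in>{?k..M}. w l m)\<^sup>2"
      by (simp add: power_mult_distrib power2_eq_square flip: power_mult_distrib)
    also have "(\<Sum>l\<in>{?k..M}. w l m)\<^sup>2 \<le> (\<Sum>l\<in>{?k..M}. 1 / 2 ^ l) * (\<Sum>l\<in>{?k..M}. (w l m)\<^sup>2 / (1 / 2 ^ l))"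
      by (rule weighted_cauchy_schwarz) simp
    also have "\<dots> \<le> 2 / 2 ^ ?k * (\<Sum>l\<in>{?k..M}. (w l m)\<^sup>2 / (1 / 2 ^ l))"
      by (intro mult_right_mono geometric_tail sum_nonneg) auto
    also have "4 ^ ?k * (2 / 2 ^ ?k * (\<Sum>l\<in>{?k..M}. (w l m)\<^sup>2 / (1 / 2 ^ l))) =
        (\<Sum>l\<in>{?k..M}. 2 * (2 ^ ?k * 2 ^ l) * (w l m)\<^sup>2)"
    proof -
      have "(4::real) ^ ?k = 2 ^ ?k * 2 ^ ?k" by (simp flip: power_mult_distrib)
      then show ?thesis by (simp add: sum_distrib_left mult_ac)
    qed
    also have "\<dots> \<le> (\<Sum>l\<in>{?k..M}. 2 * 4 ^ l * (w l m)\<^sup>2)"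
    proof (intro sum_mono mult_right_mono mult_left_mono)
      fix l assume "l \<in> {?k..M}"
      then have "(2::real) ^ ?k \<le> 2 ^ l" by (intro power_increasing) auto
      then have "(2::real) ^ ?k * 2 ^ l \<le> 2 ^ l * 2 ^ l" by simp
      then show "(2::real) ^ ?k * 2 ^ l \<le> 4 ^ l" by (simp flip: power_mult_distrib)
    qed auto
    also have "\<dots> \<le> (\<Sum>l\<in>{1..M}. 2 * 4 ^ l * (w l m)\<^sup>2)"
      using block_of_ge_1[of m] by (intro sum_mono2) auto
    finally show ?thesis by (simp add: mult_left_mono)
  qed
  have wl: "(\<Sum>m\<in>Q. (w l m)\<^sup>2) = 2 / 3 / 2 ^ l * (\<Sum>r\<in>dyadic_block l. (c r)\<^sup>2)" if l: "l \<in> {1..M}" for l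
  proof -
    define c' where "c' r = (if r \<in> dyadic_block l then c r else 0)" for r
    have lM: "l \<le> M" using l by simp
    have "w l m = (\<Sum>r\<in>Q. R m r * c' r)" for m
      unfolding w_def c'_def using sum_Q_block[OF lM, of "\<lambda>r. R m r * c r"]
      by (simp add: if_distrib[of "\<lambda>x. _ * x"] cong: if_cong)
    then have "(\<Sum>m\<in>Q. (w l m)\<^sup>2) = (\<Sum>m\<in>Q. \<Sum>n\<in>Q. c' m * c' n * gram m n)"
      by (simp only: gram_squares)
    also have "\<dots> = (\<Sum>m\<in>Q. if m \<in> dyadic_block l then 2 / 3 / 2 ^ l * (c m)\<^sup>2 else 0)"
    proof (rule sum.cong[OF refl])
      fix m assume m: "m \<in> Q"
      show "(\<Sum>n\<in>Q. c' m * c' n * gram m n) = (if m \<in> dyadic_block l then 2 / 3 / 2 ^ l * (c m)\<^sup>2 else 0)"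
      proof (cases "m \<in> dyadic_block l")
        case True
        have "c' m * c' n * gram m n = (if m = n then 2 / 3 / 2 ^ l * (c m)\<^sup>2 else 0)" for n
        proof (cases "n \<in> dyadic_block l")
          case n: True
          have "block_of m = l" "block_of n = l" "m \<ge> 1" "n \<ge> 1"
            using True n l by (auto simp: mem_dyadic_block_iff)
          then show ?thesis using True n
            by (auto simp: c'_def gram_diag gram_same_block power2_eq_square)
        qed (use True in \<open>auto simp: c'_def\<close>)
        then show ?thesis using m True by (simp add: sum.delta)
      qed (simp add: c'_def)
    qed
    also have "\<dots> = 2 / 3 / 2 ^ l * (\<Sum>r\<in>dyadic_block l. (c r)\<^sup>2)"
      by (subst sum_Q_block[OF lM]) (simp add: sum_distrib_left)
    finally show ?thesis .
  qed
  have "(\<Sum>m\<in>Q. (\<Sum>r\<in>Q. 2 ^ block_of m * R m r / sqrt (dgram r r) * z r)\<^sup>2)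
      \<le> (\<Sum>m\<in>Q. \<Sum>l\<in>{1..M}. 2 * 4 ^ l * (w l m)\<^sup>2)" by (intro sum_mono pt)
  also have "\<dots> = (\<Sum>l\<in>{1..M}. 2 * 4 ^ l * (\<Sum>m\<in>Q. (w l m)\<^sup>2))"
    unfolding sum_distrib_left by (rule sum.swap)
  also have "\<dots> = (\<Sum>l\<in>{1..M}. \<Sum>r\<in>dyadic_block l. 2 / 3 * (z r)\<^sup>2)"
  proof (intro sum.cong refl)
    fix l assume l: "l \<in> {1..M}"
    have eq: "2 * 4 ^ l * (2 / 3 / 2 ^ l * (c r)\<^sup>2) = 2 / 3 * (z r)\<^sup>2" if "r \<in> dyadic_block l" for r
    proof -
      have "block_of r = l" using that l by (auto simp: mem_dyadic_block_iff)
      then have "(c r)\<^sup>2 = (z r)\<^sup>2 / (2 * 2 ^ l)" by (simp add: c_def power_divide dgram_diag)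
      moreover have "(4::real) ^ l = 2 ^ l * 2 ^ l" by (simp flip: power_mult_distrib)
      ultimately show ?thesis by simp
    qed
    show "2 * 4 ^ l * (\<Sum>m\<in>Q. (w l m)\<^sup>2) = (\<Sum>r\<in>dyadic_block l. 2 / 3 * (z r)\<^sup>2)"
      unfolding wl[OF l] sum_distrib_left by (rule sum.cong[OF refl eq])
  qed
  also have "\<dots> = (\<Sum>r\<in>Q. 2 / 3 * (z r)\<^sup>2)" by (rule sum_dyadic_blocks[symmetric])
  also have "\<dots> \<le> (\<Sum>r\<in>Q. (z r)\<^sup>2)" by (intro sum_mono) auto
  finally show ?thesis by simp
qed

end

lemma gram_factor_exists: "\<exists>R P. gram_factor M R P"
proof -
  obtain R P where RP: "\<And>m n. m > n \<Longrightarrow> R m n = 0 \<and> P m n = 0"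
    "\<forall>m\<in>{1..<2 ^ M}. \<forall>n\<in>{1..<2 ^ M}. gram m n = (\<Sum>r\<in>{1..<2 ^ M}. R r m * R r n)"
    "mat_inverse_on {1..<2 ^ M} P R" "mat_inverse_on {1..<2 ^ M} R P"
    using cholesky[of gram "2 ^ M", OF gram_sym gram_qform_pos] by blast
  then have "gram_factor M R P" by (unfold_locales) (auto simp: mat_inverse_on_def)
  then show ?thesis by blast
qed

section \<open>Blocks of multi-indices\<close>

lemma block_eq_vbox: "block \<beta> = vbox (\<lambda>i. dyadic_block (\<beta> $ i))"
  by (simp add: block_def vbox_def)

lemma finite_block [simp]: "finite (block \<beta>)"
  by (simp add: block_eq_vbox finite_vbox)

lemma mem_block_iff:
  "\<beta> \<in> pos_idx \<Longrightarrow> \<alpha> \<in> block \<beta> \<longleftrightarrow> \<alpha> \<in> pos_idx \<and> multi_block_of \<alpha> = \<beta>"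
  by (auto simp: block_def pos_idx_def multi_block_of_def vec_eq_iff mem_dyadic_block_iff)

lemma sum_HB_idx:
  assumes "finite \<Lambda>" "\<Lambda> \<subseteq> pos_idx"
  shows "(\<Sum>\<alpha>\<in>HB_idx \<Lambda>. f \<alpha>) = (\<Sum>\<beta>\<in>\<Lambda>. \<Sum>\<alpha>\<in>block \<beta>. f \<alpha>)"
  unfolding HB_idx_def using assms
  by (intro sum.UNION_disjoint) (auto simp: mem_block_iff subset_iff)

lemma mem_HB_idx_iff:
  "\<Lambda> \<subseteq> pos_idx \<Longrightarrow> \<alpha> \<in> HB_idx \<Lambda> \<longleftrightarrow> \<alpha> \<in> pos_idx \<and> multi_block_of \<alpha> \<in> \<Lambda>"
  by (auto simp: HB_idx_def mem_block_iff subset_iff)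

lemma le_norm_inf: "\<beta> $ i \<le> norm_inf \<beta>"
  unfolding norm_inf_def by (rule Max_ge) auto

lemma norm_inf_attained: obtains i where "\<beta> $ i = norm_inf \<beta>"
proof -
  have "norm_inf \<beta> \<in> range (\<lambda>i. \<beta> $ i)" unfolding norm_inf_def by (rule Max_in) auto
  then show thesis using that by auto
qed

lemma norm_inf_le_iff: "norm_inf \<beta> \<le> k \<longleftrightarrow> (\<forall>i. \<beta> $ i \<le> k)"
  unfolding norm_inf_def by auto

lemma norm_inf_le_norm1: "norm_inf \<beta> \<le> norm1 \<beta>"
proof -
  obtain i where "\<beta> $ i = norm_inf \<beta>" by (rule norm_inf_attained)
  then show ?thesis unfolding norm1_def by (metis UNIV_I finite_class.finite_UNIV member_le_sum zero_le)
qed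

lemma norm_inf_pos: "\<beta> \<in> pos_idx \<Longrightarrow> 1 \<le> norm_inf \<beta>"
  using le_norm_inf order_trans by (fastforce simp: pos_idx_def)

lemma norm_inf_le_k_max:
  assumes "finite \<Lambda>" "\<beta> \<in> \<Lambda>"
  shows "norm_inf \<beta> \<le> k_max \<Lambda>"
  unfolding k_max_def using assms by (intro Max_ge) auto

lemma layer_subset: "layer \<Lambda> k \<subseteq> \<Lambda>"
  by (auto simp: layer_def)

lemma sum_layers:
  assumes "finite \<Lambda>" "\<Lambda> \<subseteq> pos_idx"
  shows "(\<Sum>\<beta>\<in>\<Lambda>. f \<beta>) = (\<Sum>k\<in>{1..k_max \<Lambda>}. \<Sum>\<beta>\<in>layer \<Lambda> k. f \<beta>)"
proof -
  have "norm_inf ` \<Lambda> \<subseteq> {1..k_max \<Lambda>}"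
  proof
    fix k assume "k \<in> norm_inf ` \<Lambda>"
    then obtain \<beta> where "\<beta> \<in> \<Lambda>" "k = norm_inf \<beta>" by auto
    then show "k \<in> {1..k_max \<Lambda>}"
      using assms norm_inf_le_k_max[of \<Lambda> \<beta>] norm_inf_pos[of \<beta>] by auto
  qed
  then show ?thesis using assms(1) unfolding layer_def by (simp add: sum.group)
qed

lemma card_layer_le:
  assumes "finite \<Lambda>" "\<Lambda> \<subseteq> pos_idx"
  shows "card (layer \<Lambda> k) \<le> n_idx \<Lambda>"
proof (cases "layer \<Lambda> k = {}")
  case False
  then obtain \<beta> where "\<beta> \<in> \<Lambda>" "norm_inf \<beta> = k" by (auto simp: layer_def)
  then have "k \<in> {1..k_max \<Lambda>}" using assms norm_inf_le_k_max[of \<Lambda> \<beta>] norm_inf_pos[of \<beta>] by auto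
  then show ?thesis unfolding n_idx_def by (intro Max_ge) auto
qed simp

lemma k_max_pos: "finite \<Lambda> \<Longrightarrow> \<Lambda> \<noteq> {} \<Longrightarrow> \<Lambda> \<subseteq> pos_idx \<Longrightarrow> k_max \<Lambda> \<ge> 1"
  using norm_inf_le_k_max norm_inf_pos by (meson equals0I order_trans subset_iff)

lemma n_idx_attained:
  assumes "finite \<Lambda>" "\<Lambda> \<noteq> {}" "\<Lambda> \<subseteq> pos_idx"
  obtains k where "k \<in> {1..k_max \<Lambda>}" "card (layer \<Lambda> k) = n_idx \<Lambda>"
proof -
  have "n_idx \<Lambda> \<in> (\<lambda>k. card (layer \<Lambda> k)) ` {1..k_max \<Lambda>}"
    unfolding n_idx_def using k_max_pos[OF assms] by (intro Max_in) auto
  then show thesis using that by auto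
qed

lemma n_idx_pos:
  assumes "finite \<Lambda>" "\<Lambda> \<noteq> {}" "\<Lambda> \<subseteq> pos_idx"
  shows "n_idx \<Lambda> \<ge> 1"
proof -
  obtain \<beta> where "\<beta> \<in> \<Lambda>" using assms by auto
  then have "layer \<Lambda> (norm_inf \<beta>) \<noteq> {}" by (auto simp: layer_def)
  moreover have "finite (layer \<Lambda> (norm_inf \<beta>))" using assms(1) layer_subset finite_subset by blast
  ultimately show ?thesis using card_layer_le[OF assms(1,3), of "norm_inf \<beta>"]
    by (metis card_0_eq le_trans not_less_eq_eq One_nat_def le_zero_eq)
qed

lemma prod_power_vec: "(\<Prod>i\<in>UNIV. (b::'a::comm_semiring_1) ^ (\<beta> $ i)) = b ^ norm1 \<beta>"
  by (simp add: norm1_def power_sum)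

definition wt :: "nat ^ 'n::finite \<Rightarrow> real" where
  "wt \<beta> = 4 ^ norm_inf \<beta> * (2 / 3) ^ CARD('n) / 2 ^ norm1 \<beta>"

lemma wt_pos: "wt \<beta> > 0"
  by (simp add: wt_def)

text \<open>The squared norm \<open>\<Sum>\<^sub>\<beta> 4\<^bsup>|\<beta>|\<^sub>\<infinity>\<^esup> \<parallel>u\<^sub>\<beta>\<parallel>\<^sup>2\<close> of the blockwise
  splitting of \<open>u = \<Sum>\<^sub>\<alpha> x\<^sub>\<alpha> \<phi>\<^sub>\<alpha>\<close>.\<close>

definition split_norm :: "(nat ^ 'n::finite) set \<Rightarrow> (nat ^ 'n \<Rightarrow> real) \<Rightarrow> real" where
  "split_norm \<Lambda> x = (\<Sum>\<beta>\<in>\<Lambda>. wt \<beta> * (\<Sum>\<alpha>\<in>block \<beta>. (x \<alpha>)\<^sup>2))"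

definition total_energy :: "(nat ^ 'n::finite) set \<Rightarrow> (nat ^ 'n \<Rightarrow> real) \<Rightarrow> real" where
  "total_energy \<Lambda> x = (\<Sum>i\<in>UNIV. energy (HB_idx \<Lambda>) x i)"

lemma energy_superset:
  assumes "finite B" "A \<subseteq> B" "\<And>\<alpha>. \<alpha> \<in> B - A \<Longrightarrow> x \<alpha> = 0"
  shows "energy A x i = energy B x i"
proof -
  have "energy B x i = (\<Sum>\<alpha>\<in>A. \<Sum>\<alpha>'\<in>B. x \<alpha> * x \<alpha>' * (\<Prod>j\<in>UNIV. kern i j (\<alpha> $ j) (\<alpha>' $ j)))"
    unfolding energy_def using assms by (intro sum.mono_neutral_right) auto
  also have "\<dots> = energy A x i"
    unfolding energy_def using assms by (intro sum.cong refl sum.mono_neutral_right) auto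
  finally show ?thesis ..
qed

lemma kern_same_block:
  assumes "m \<in> dyadic_block k" "n \<in> dyadic_block k" "k \<ge> 1" "m \<noteq> n"
  shows "kern i j m n = 0"
  using assms by (auto simp: kern_def mem_dyadic_block_iff gram_same_block dgram_off_diag)

lemma energy_block:
  fixes \<beta> :: "nat ^ 'n::finite"
  assumes \<beta>: "\<beta> \<in> pos_idx"
  shows "energy (block \<beta>) x i = 3 * 4 ^ (\<beta> $ i) * (2 / 3) ^ CARD('n) / 2 ^ norm1 \<beta> * (\<Sum>\<alpha>\<in>block \<beta>. (x \<alpha>)\<^sup>2)"
proof -
  define D where "D = 3 * 4 ^ (\<beta> $ i) * (2 / 3) ^ CARD('n) / (2::real) ^ norm1 \<beta>"
  have diag: "(\<Prod>j\<in>UNIV. kern i j (\<alpha> $ j) (\<alpha> $ j)) = D" if "\<alpha> \<in> block \<beta>" for \<alpha>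
  proof -
    have b: "block_of (\<alpha> $ j) = \<beta> $ j" for j
      using that \<beta> by (intro block_of_eq) (auto simp: block_def pos_idx_def)
    have four: "(4::real) ^ (\<beta> $ i) = 2 ^ (\<beta> $ i) * 2 ^ (\<beta> $ i)" by (simp flip: power_mult_distrib)
    have k: "kern i j (\<alpha> $ j) (\<alpha> $ j) = (if j = i then 3 * 4 ^ (\<beta> $ i) else 1) * (2 / 3 / 2 ^ (\<beta> $ j))" for j
      by (simp add: kern_def gram_diag dgram_diag b four)
    have "(\<Prod>j\<in>UNIV. kern i j (\<alpha> $ j) (\<alpha> $ j)) = 3 * 4 ^ (\<beta> $ i) * (\<Prod>j\<in>UNIV. 2 / 3 / 2 ^ (\<beta> $ j))"
      unfolding k prod.distrib by (simp add: prod.delta)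
    also have "(\<Prod>j\<in>UNIV. 2 / 3 / (2::real) ^ (\<beta> $ j)) = (2 / 3) ^ CARD('n) / 2 ^ norm1 \<beta>"
      by (simp only: prod_dividef prod_power_vec prod_constant power_divide)
    finally show ?thesis by (simp add: D_def)
  qed
  have "energy (block \<beta>) x i = (\<Sum>\<alpha>\<in>block \<beta>. \<Sum>\<alpha>'\<in>block \<beta>. if \<alpha> = \<alpha>' then D * (x \<alpha>)\<^sup>2 else 0)"
    unfolding energy_def
  proof (intro sum.cong refl)
    fix \<alpha> \<alpha>' assume a: "\<alpha> \<in> block \<beta>" "\<alpha>' \<in> block \<beta>"
    show "x \<alpha> * x \<alpha>' * (\<Prod>j\<in>UNIV. kern i j (\<alpha> $ j) (\<alpha>' $ j)) = (if \<alpha> = \<alpha>' then D * (x \<alpha>)\<^sup>2 else 0)"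
    proof (cases "\<alpha> = \<alpha>'")
      case True
      then show ?thesis using diag[OF a(1)] by (simp add: power2_eq_square)
    next
      case False
      then obtain j where "\<alpha> $ j \<noteq> \<alpha>' $ j" by (metis vec_eq_iff)
      then have "kern i j (\<alpha> $ j) (\<alpha>' $ j) = 0"
        using a \<beta> by (intro kern_same_block[of _ "\<beta> $ j"]) (auto simp: block_def pos_idx_def)
      then have "(\<Prod>j\<in>UNIV. kern i j (\<alpha> $ j) (\<alpha>' $ j)) = 0" by (intro prod_zero) auto
      then show ?thesis using False by simp
    qed
  qed
  also have "\<dots> = D * (\<Sum>\<alpha>\<in>block \<beta>. (x \<alpha>)\<^sup>2)" by (simp add: sum.delta sum_distrib_left)
  finally show ?thesis by (simp add: D_def)
qed

lemma card_block:
  fixes \<beta> :: "nat ^ 'n::finite"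
  assumes "\<beta> \<in> pos_idx"
  shows "real (card (block \<beta>)) = 2 ^ norm1 \<beta> / 2 ^ CARD('n)"
proof -
  have c0: "card (dyadic_block k) = 2 ^ (k - 1)" if "k \<ge> 1" for k
  proof -
    have "(2::nat) ^ k = 2 * 2 ^ (k - 1)" using that by (cases k) auto
    then show ?thesis by (simp add: dyadic_block_def)
  qed
  have c: "real (card (dyadic_block (\<beta> $ i))) = 2 ^ (\<beta> $ i) / 2" for i
  proof -
    have "\<beta> $ i \<ge> 1" using assms by (simp add: pos_idx_def)
    then show ?thesis using c0[of "\<beta> $ i"] by (cases "\<beta> $ i") auto
  qed
  have "real (card (block \<beta>)) = (\<Sum>\<alpha>\<in>block \<beta>. \<Prod>i\<in>(UNIV::'n set). 1)" by simp
  also have "\<dots> = (\<Prod>i\<in>UNIV. \<Sum>n\<in>dyadic_block (\<beta> $ i). 1)"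
    unfolding block_eq_vbox by (subst sum_prod_vbox[symmetric]) auto
  also have "\<dots> = (\<Prod>i\<in>UNIV. 2 ^ (\<beta> $ i) / 2)" by (simp add: c)
  also have "\<dots> = 2 ^ norm1 \<beta> / 2 ^ CARD('n)"
    by (simp only: prod_dividef prod_power_vec prod_constant)
  finally show ?thesis .
qed

section \<open>The energy as a sum of squares\<close>

context gram_factor
begin

abbreviation "Qd \<equiv> vbox (\<lambda>_. Q)"

definition S :: "'n \<Rightarrow> 'n \<Rightarrow> nat \<Rightarrow> nat \<Rightarrow> real" where
  "S i j r m = (if j = i then (if r = m then sqrt (dgram m m) else 0) else R r m)"

lemma finite_Qd: "finite Qd"
  by (simp add: finite_vbox)

lemma energy_squares: "energy Qd x i = (\<Sum>\<rho>\<in>Qd. (tensor_apply (S i) (\<lambda>_. Q) x \<rho>)\<^sup>2)"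
  unfolding energy_def
proof (rule tensor_qform_squares)
  fix j m n assume mn: "m \<in> Q" "n \<in> Q"
  show "kern i j m n = (\<Sum>r\<in>Q. S i j r m * S i j r n)"
  proof (cases "j = i")
    case True
    have "(\<Sum>r\<in>Q. S i j r m * S i j r n) = (\<Sum>r\<in>Q. if r = m then (if m = n then dgram m m else 0) else 0)"
      by (intro sum.cong refl) (auto simp: S_def True dgram_diag)
    also have "\<dots> = (if m = n then dgram m m else 0)" using mn by (simp add: sum.delta)
    finally show ?thesis using mn by (auto simp: kern_def True dgram_off_diag)
  qed (simp add: kern_def S_def gram_eq[OF mn])
qed simp

lemma energy_nonneg: "energy Qd x i \<ge> 0"
  unfolding energy_squares by (intro sum_nonneg) simp

lemma HB_idx_subset_Qd:
  fixes \<Lambda> :: "(nat ^ 'n::finite) set"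
  assumes "\<Lambda> \<subseteq> pos_idx" "\<And>\<beta>. \<beta> \<in> \<Lambda> \<Longrightarrow> norm_inf \<beta> \<le> M"
  shows "HB_idx \<Lambda> \<subseteq> Qd"
proof
  fix \<alpha> assume "\<alpha> \<in> HB_idx \<Lambda>"
  then obtain \<beta> where \<beta>: "\<beta> \<in> \<Lambda>" "\<alpha> \<in> block \<beta>" by (auto simp: HB_idx_def)
  have "\<alpha> $ i \<in> Q" for i
  proof -
    have "\<beta> $ i \<le> M" using assms(2)[OF \<beta>(1)] le_norm_inf order_trans by blast
    then show ?thesis using dyadic_block_subset \<beta>(2) unfolding block_def by blast
  qed
  then show "\<alpha> \<in> Qd" by (simp add: vbox_def)
qed

end

section \<open>The largest eigenvalue\<close>

lemma energy_cong: "(\<And>\<alpha>. \<alpha> \<in> A \<Longrightarrow> x \<alpha> = y \<alpha>) \<Longrightarrow> energy A x i = energy A y i"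
  unfolding energy_def by (intro sum.cong refl) auto

lemma energy_restrict:
  assumes "finite B" "A \<subseteq> B"
  shows "energy A x i = energy B (\<lambda>\<alpha>. if \<alpha> \<in> A then x \<alpha> else 0) i"
proof -
  have "energy A x i = energy A (\<lambda>\<alpha>. if \<alpha> \<in> A then x \<alpha> else 0) i" by (rule energy_cong) simp
  also have "\<dots> = energy B (\<lambda>\<alpha>. if \<alpha> \<in> A then x \<alpha> else 0) i" by (rule energy_superset[OF assms]) simp
  finally show ?thesis .
qed

lemma layer_weight_sum:
  assumes \<Lambda>: "finite \<Lambda>" "\<Lambda> \<subseteq> pos_idx"
  shows "(\<Sum>\<beta>\<in>{\<beta>\<in>\<Lambda>. \<beta> $ i = m}. 4 ^ m / 4 ^ norm_inf \<beta>) \<le> 2 * real (n_idx \<Lambda>)"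
proof -
  let ?B = "{\<beta>\<in>\<Lambda>. \<beta> $ i = m}"
  have "norm_inf ` ?B \<subseteq> {m..k_max \<Lambda>}"
    using norm_inf_le_k_max[OF \<Lambda>(1)] le_norm_inf by fastforce
  then have "(\<Sum>\<beta>\<in>?B. 4 ^ m / 4 ^ norm_inf \<beta> :: real) =
      (\<Sum>k\<in>{m..k_max \<Lambda>}. \<Sum>\<beta>\<in>{\<beta>\<in>?B. norm_inf \<beta> = k}. 4 ^ m / 4 ^ norm_inf \<beta>)"
    using \<Lambda>(1) by (subst sum.group) auto
  also have "\<dots> \<le> (\<Sum>k\<in>{m..k_max \<Lambda>}. real (n_idx \<Lambda>) * (4 ^ m / 4 ^ k))"
  proof (rule sum_mono)
    fix k
    have "card {\<beta>\<in>?B. norm_inf \<beta> = k} \<le> card (layer \<Lambda> k)"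
      using \<Lambda>(1) by (intro card_mono) (auto simp: layer_def)
    then have "real (card {\<beta>\<in>?B. norm_inf \<beta> = k}) \<le> real (n_idx \<Lambda>)"
      using card_layer_le[OF \<Lambda>, of k] by linarith
    then show "(\<Sum>\<beta>\<in>{\<beta>\<in>?B. norm_inf \<beta> = k}. 4 ^ m / 4 ^ norm_inf \<beta>) \<le> real (n_idx \<Lambda>) * (4 ^ m / 4 ^ k)"
      by (simp add: mult_right_mono divide_right_mono)
  qed
  also have "\<dots> = real (n_idx \<Lambda>) * 4 ^ m * (\<Sum>k\<in>{m..k_max \<Lambda>}. 1 / 4 ^ k)"
    by (simp add: sum_distrib_left)
  also have "\<dots> \<le> real (n_idx \<Lambda>) * 4 ^ m * (2 / 4 ^ m)"
    by (intro mult_left_mono geometric_tail) auto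
  finally show ?thesis by simp
qed

context gram_factor
begin

lemma energy_upper:
  fixes \<Lambda> :: "(nat ^ 'n::finite) set"
  assumes \<Lambda>: "finite \<Lambda>" "\<Lambda> \<subseteq> pos_idx" "\<And>\<beta>. \<beta> \<in> \<Lambda> \<Longrightarrow> norm_inf \<beta> \<le> M"
  shows "energy (HB_idx \<Lambda>) x i \<le> 6 * real (n_idx \<Lambda>) * split_norm \<Lambda> x"
proof -
  note sub = HB_idx_subset_Qd[OF \<Lambda>(2,3)]
  have blk: "block \<beta> \<subseteq> Qd" if "\<beta> \<in> \<Lambda>" for \<beta> using sub that by (auto simp: HB_idx_def)
  define xr where "xr A \<alpha> = (if \<alpha> \<in> A then x \<alpha> else 0)" for A \<alpha>
  define w where "w \<beta> \<rho> = tensor_apply (S i) (\<lambda>_. Q) (xr (block \<beta>)) \<rho>" for \<beta> \<rho>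
  have w_eq: "w \<beta> \<rho> = (\<Sum>\<alpha>\<in>block \<beta>. (\<Prod>j\<in>UNIV. S i j (\<rho> $ j) (\<alpha> $ j)) * x \<alpha>)" if "\<beta> \<in> \<Lambda>" for \<beta> \<rho>
    unfolding w_def tensor_apply_def xr_def
    using blk[OF that] finite_Qd by (intro sum.mono_neutral_cong_right) auto
  have split: "tensor_apply (S i) (\<lambda>_. Q) (xr (HB_idx \<Lambda>)) \<rho> = (\<Sum>\<beta>\<in>\<Lambda>. w \<beta> \<rho>)" for \<rho>
  proof -
    have "tensor_apply (S i) (\<lambda>_. Q) (xr (HB_idx \<Lambda>)) \<rho> =
        (\<Sum>\<alpha>\<in>HB_idx \<Lambda>. (\<Prod>j\<in>UNIV. S i j (\<rho> $ j) (\<alpha> $ j)) * x \<alpha>)"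
      unfolding tensor_apply_def xr_def
      using sub finite_Qd by (intro sum.mono_neutral_cong_right) auto
    then show ?thesis by (simp add: sum_HB_idx[OF \<Lambda>(1,2)] w_eq)
  qed
  have w0: "w \<beta> \<rho> = 0" if "\<beta> \<in> \<Lambda>" "\<beta> $ i \<noteq> block_of (\<rho> $ i)" for \<beta> \<rho>
    unfolding w_eq[OF that(1)]
  proof (intro sum.neutral ballI)
    fix \<alpha> assume "\<alpha> \<in> block \<beta>"
    then have "block_of (\<alpha> $ i) = \<beta> $ i"
      using that(1) \<Lambda>(2) by (intro block_of_eq) (auto simp: block_def pos_idx_def)
    then have "S i i (\<rho> $ i) (\<alpha> $ i) = 0" using that(2) by (auto simp: S_def)
    then show "(\<Prod>j\<in>UNIV. S i j (\<rho> $ j) (\<alpha> $ j)) * x \<alpha> = 0" using prod_zero by fastforce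
  qed
  have pt: "(\<Sum>\<beta>\<in>\<Lambda>. w \<beta> \<rho>)\<^sup>2 \<le> 2 * real (n_idx \<Lambda>) * (\<Sum>\<beta>\<in>\<Lambda>. 4 ^ norm_inf \<beta> / 4 ^ (\<beta> $ i) * (w \<beta> \<rho>)\<^sup>2)" for \<rho>
  proof -
    let ?m = "block_of (\<rho> $ i)"
    let ?B = "{\<beta>\<in>\<Lambda>. \<beta> $ i = ?m}"
    have "(\<Sum>\<beta>\<in>\<Lambda>. w \<beta> \<rho>) = (\<Sum>\<beta>\<in>?B. w \<beta> \<rho>)"
      using w0 \<Lambda>(1) by (intro sum.mono_neutral_right) auto
    also have "\<dots>\<^sup>2 \<le> (\<Sum>\<beta>\<in>?B. 4 ^ ?m / 4 ^ norm_inf \<beta>) * (\<Sum>\<beta>\<in>?B. (w \<beta> \<rho>)\<^sup>2 / (4 ^ ?m / 4 ^ norm_inf \<beta>))"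
      by (rule weighted_cauchy_schwarz) simp
    also have "\<dots> \<le> 2 * real (n_idx \<Lambda>) * (\<Sum>\<beta>\<in>?B. (w \<beta> \<rho>)\<^sup>2 / (4 ^ ?m / 4 ^ norm_inf \<beta>))"
      by (intro mult_right_mono layer_weight_sum \<Lambda> sum_nonneg) auto
    also have "(\<Sum>\<beta>\<in>?B. (w \<beta> \<rho>)\<^sup>2 / (4 ^ ?m / 4 ^ norm_inf \<beta>)) =
        (\<Sum>\<beta>\<in>?B. 4 ^ norm_inf \<beta> / 4 ^ (\<beta> $ i) * (w \<beta> \<rho>)\<^sup>2)"
      by (intro sum.cong refl) auto
    also have "\<dots> \<le> (\<Sum>\<beta>\<in>\<Lambda>. 4 ^ norm_inf \<beta> / 4 ^ (\<beta> $ i) * (w \<beta> \<rho>)\<^sup>2)"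
      using \<Lambda>(1) by (intro sum_mono2) auto
    finally show ?thesis by (simp add: mult_left_mono)
  qed
  have "energy (HB_idx \<Lambda>) x i = energy Qd (xr (HB_idx \<Lambda>)) i"
    unfolding xr_def[abs_def] by (rule energy_restrict[OF finite_Qd sub])
  also have "\<dots> = (\<Sum>\<rho>\<in>Qd. (\<Sum>\<beta>\<in>\<Lambda>. w \<beta> \<rho>)\<^sup>2)" by (simp only: energy_squares split)
  also have "\<dots> \<le> (\<Sum>\<rho>\<in>Qd. 2 * real (n_idx \<Lambda>) * (\<Sum>\<beta>\<in>\<Lambda>. 4 ^ norm_inf \<beta> / 4 ^ (\<beta> $ i) * (w \<beta> \<rho>)\<^sup>2))"
    by (rule sum_mono) (rule pt)
  also have "\<dots> = 2 * real (n_idx \<Lambda>) * (\<Sum>\<beta>\<in>\<Lambda>. 4 ^ norm_inf \<beta> / 4 ^ (\<beta> $ i) * (\<Sum>\<rho>\<in>Qd. (w \<beta> \<rho>)\<^sup>2))"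
    unfolding sum_distrib_left[symmetric] by (subst sum.swap) (simp only: sum_distrib_left)
  also have "(\<Sum>\<beta>\<in>\<Lambda>. 4 ^ norm_inf \<beta> / 4 ^ (\<beta> $ i) * (\<Sum>\<rho>\<in>Qd. (w \<beta> \<rho>)\<^sup>2)) = 3 * split_norm \<Lambda> x"
    unfolding split_norm_def sum_distrib_left[of 3]
  proof (intro sum.cong refl)
    fix \<beta> assume \<beta>: "\<beta> \<in> \<Lambda>"
    have "(\<Sum>\<rho>\<in>Qd. (w \<beta> \<rho>)\<^sup>2) = energy Qd (xr (block \<beta>)) i" by (simp only: w_def energy_squares)
    also have "\<dots> = energy (block \<beta>) x i"
      unfolding xr_def[abs_def] by (rule energy_restrict[OF finite_Qd blk[OF \<beta>], symmetric])
    also have "\<dots> = 3 * 4 ^ (\<beta> $ i) * (2 / 3) ^ CARD('n) / 2 ^ norm1 \<beta> * (\<Sum>\<alpha>\<in>block \<beta>. (x \<alpha>)\<^sup>2)"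
      using \<beta> \<Lambda>(2) by (intro energy_block) auto
    finally show "4 ^ norm_inf \<beta> / 4 ^ (\<beta> $ i) * (\<Sum>\<rho>\<in>Qd. (w \<beta> \<rho>)\<^sup>2) = 3 * (wt \<beta> * (\<Sum>\<alpha>\<in>block \<beta>. (x \<alpha>)\<^sup>2))"
      by (simp add: wt_def)
  qed
  finally show ?thesis by simp
qed

lemma block_sum_R1:
  assumes "1 \<le> k" "k \<le> M"
  shows "(\<Sum>m\<in>dyadic_block k. R 1 m) * R 1 1 \<ge> 1 / 8" and "(R 1 1)\<^sup>2 = 1 / 3"
proof -
  have one: "1 \<in> Q" using assms one_less_power[of "2::nat" M] by auto
  have b1: "block_of 1 = 1" by (rule block_of_eq) (auto simp: dyadic_block_def)
  have g: "gram 1 m = R 1 1 * R 1 m" if "m \<in> Q" for m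
  proof -
    have "gram 1 m = (\<Sum>r\<in>Q. R r 1 * R r m)" by (rule gram_eq[OF one that])
    also have "\<dots> = (\<Sum>r\<in>Q. if r = 1 then R 1 1 * R 1 m else 0)"
      by (intro sum.cong refl) (auto simp: tri(1))
    also have "\<dots> = R 1 1 * R 1 m" using one by (simp add: sum.delta)
    finally show ?thesis .
  qed
  have "1 / 8 \<le> (\<Sum>m\<in>dyadic_block k. gram 1 m)" by (rule gram_1_block_sum[OF assms(1)])
  also have "\<dots> = (\<Sum>m\<in>dyadic_block k. R 1 m) * R 1 1"
    unfolding sum_distrib_right
  proof (intro sum.cong refl)
    fix m assume "m \<in> dyadic_block k"
    then have "m \<in> Q" using dyadic_block_subset[OF assms(2)] by blast
    from g[OF this] show "gram 1 m = R 1 m * R 1 1" by (simp only: mult.commute)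
  qed
  finally show "(\<Sum>m\<in>dyadic_block k. R 1 m) * R 1 1 \<ge> 1 / 8" .
  show "(R 1 1)\<^sup>2 = 1 / 3" using g[OF one] gram_diag[of 1] b1 by (simp add: power2_eq_square)
qed

text \<open>The test function is \<open>\<Sum>\<^sub>\<beta> \<Sum>\<^sub>\<alpha> \<phi>\<^sub>\<alpha>\<close> over the \<open>\<beta>\<close> of a fullest layer whose maximum
  is attained at a common coordinate \<open>i\<close>.  The \<open>\<partial>\<^sub>i\<close>-derivatives of its blocks all have a large
  component along \<open>\<phi>\<^sub>1\<close> in the other coordinates, so they add up.\<close>

lemma energy_lower:
  fixes \<Lambda> :: "(nat ^ 'n::finite) set"
  assumes \<Lambda>: "finite \<Lambda>" "\<Lambda> \<noteq> {}" "\<Lambda> \<subseteq> pos_idx" "\<And>\<beta>. \<beta> \<in> \<Lambda> \<Longrightarrow> norm_inf \<beta> \<le> M"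
  shows "\<exists>x. split_norm \<Lambda> x > 0 \<and>
    total_energy \<Lambda> x \<ge> real (n_idx \<Lambda>) / (real CARD('n) * 64 ^ CARD('n)) * split_norm \<Lambda> x"
proof -
  obtain k where k: "k \<in> {1..k_max \<Lambda>}" "card (layer \<Lambda> k) = n_idx \<Lambda>"
    using n_idx_attained[OF \<Lambda>(1-3)] by blast
  define B where "B i = {\<beta>\<in>layer \<Lambda> k. \<beta> $ i = k}" for i
  have fin: "finite (B i)" for i using \<Lambda>(1) by (simp add: B_def layer_def)
  have "layer \<Lambda> k \<subseteq> (\<Union>i. B i)"
  proof
    fix \<beta> assume b: "\<beta> \<in> layer \<Lambda> k"
    obtain i where "\<beta> $ i = norm_inf \<beta>" by (rule norm_inf_attained)
    then show "\<beta> \<in> (\<Union>i. B i)" using b by (auto simp: B_def layer_def)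
  qed
  then have "n_idx \<Lambda> \<le> card (\<Union>i. B i)" using k(2) fin by (metis card_mono finite_UN finite_class.finite_UNIV)
  also have "\<dots> \<le> (\<Sum>i\<in>UNIV. card (B i))" by (rule card_UN_le) simp
  finally have "n_idx \<Lambda> \<le> (\<Sum>i\<in>UNIV. card (B i))" .
  moreover have "\<exists>i. n_idx \<Lambda> \<le> CARD('n) * card (B i)" if "n_idx \<Lambda> \<le> (\<Sum>i\<in>UNIV. card (B i))"
  proof (rule ccontr)
    assume "\<not> ?thesis"
    then have lt: "CARD('n) * card (B i) < n_idx \<Lambda>" for i by (simp add: not_le)
    have "CARD('n) * (\<Sum>i\<in>UNIV. card (B i)) = (\<Sum>i\<in>UNIV. CARD('n) * card (B i))" by (simp add: sum_distrib_left)
    also have "\<dots> < (\<Sum>i\<in>(UNIV::'n set). n_idx \<Lambda>)" by (intro sum_strict_mono lt) auto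
    also have "\<dots> = CARD('n) * n_idx \<Lambda>" by simp
    finally show False using that by simp
  qed
  ultimately obtain i where i: "n_idx \<Lambda> \<le> CARD('n) * card (B i)" by blast
  let ?N = "real (card (B i))"
  have Npos: "?N > 0" using i n_idx_pos[OF \<Lambda>(1-3)] by (cases "card (B i)") auto
  have B\<Lambda>: "B i \<subseteq> \<Lambda>" "B i \<subseteq> pos_idx" using \<Lambda>(3) by (auto simp: B_def layer_def)
  have Bk: "norm_inf \<beta> = k" "\<beta> $ i = k" if "\<beta> \<in> B i" for \<beta> using that by (auto simp: B_def layer_def)
  have HB: "HB_idx (B i) \<subseteq> HB_idx \<Lambda>" using B\<Lambda> by (auto simp: HB_idx_def)
  note sub = HB_idx_subset_Qd[OF \<Lambda>(3,4)]
  define x :: "nat ^ 'n \<Rightarrow> real" where "x \<alpha> = (if \<alpha> \<in> HB_idx (B i) then 1 else 0)" for \<alpha>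
  have kM: "k \<le> M"
  proof -
    obtain \<beta> where "\<beta> \<in> B i" using Npos by (metis card_gt_0_iff ex_in_conv of_nat_0_less_iff)
    then show ?thesis using Bk(1)[of \<beta>] B\<Lambda>(1) \<Lambda>(4)[of \<beta>] by auto
  qed
  have norm: "split_norm \<Lambda> x = ?N * 4 ^ k / 3 ^ CARD('n)"
  proof -
    have "split_norm \<Lambda> x = (\<Sum>\<beta>\<in>B i. wt \<beta> * (\<Sum>\<alpha>\<in>block \<beta>. (x \<alpha>)\<^sup>2))"
      unfolding split_norm_def
    proof (rule sum.mono_neutral_right[OF \<Lambda>(1) B\<Lambda>(1)], intro ballI)
      fix \<beta> assume b: "\<beta> \<in> \<Lambda> - B i"
      have "x \<alpha> = 0" if "\<alpha> \<in> block \<beta>" for \<alpha>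
      proof -
        have "multi_block_of \<alpha> = \<beta>" using that b \<Lambda>(3) by (auto intro: multi_block_of_eq)
        then show ?thesis using b B\<Lambda>(2) by (simp add: x_def mem_HB_idx_iff)
      qed
      then show "wt \<beta> * (\<Sum>\<alpha>\<in>block \<beta>. (x \<alpha>)\<^sup>2) = 0" by simp
    qed
    also have "\<dots> = (\<Sum>\<beta>\<in>B i. 4 ^ k / 3 ^ CARD('n))"
    proof (rule sum.cong[OF refl])
      fix \<beta> assume b: "\<beta> \<in> B i"
      have "x \<alpha> = 1" if "\<alpha> \<in> block \<beta>" for \<alpha> using b that by (auto simp: x_def HB_idx_def)
      then have "(\<Sum>\<alpha>\<in>block \<beta>. (x \<alpha>)\<^sup>2) = 2 ^ norm1 \<beta> / 2 ^ CARD('n)"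
        using b B\<Lambda>(2) by (simp add: card_block subsetD)
      then show "wt \<beta> * (\<Sum>\<alpha>\<in>block \<beta>. (x \<alpha>)\<^sup>2) = 4 ^ k / 3 ^ CARD('n)"
        by (simp add: wt_def Bk[OF b] power_divide)
    qed
    finally show ?thesis by simp
  qed
  define \<rho> :: "nat \<Rightarrow> nat ^ 'n" where "\<rho> n = (\<chi> j. if j = i then n else 1)" for n
  have \<rho>Q: "\<rho> n \<in> Qd" if "n \<in> dyadic_block k" for n
  proof -
    have "n \<in> Q" using that dyadic_block_subset[OF kM] by blast
    moreover from this have "1 \<in> Q" by auto
    ultimately show ?thesis by (simp add: \<rho>_def vbox_def)
  qed
  have inj: "inj_on \<rho> (dyadic_block k)"
  proof (rule inj_onI)
    fix m n assume "\<rho> m = \<rho> n"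
    then have "\<rho> m $ i = \<rho> n $ i" by simp
    then show "m = n" by (simp add: \<rho>_def)
  qed
  let ?w = "\<lambda>n. tensor_apply (S i) (\<lambda>_. Q) x (\<rho> n)"
  have w: "(?w n)\<^sup>2 \<ge> 2 * 2 ^ k * ?N\<^sup>2 / 64 ^ CARD('n)" if n: "n \<in> dyadic_block k" for n
  proof -
    have bn: "block_of n = k" using n k by (intro block_of_eq) auto
    define p where "p \<beta> = (\<Prod>j\<in>UNIV - {i}. \<Sum>m\<in>dyadic_block (\<beta> $ j). R 1 m)" for \<beta> :: "nat ^ 'n"
    have "?w n = (\<Sum>\<alpha>\<in>HB_idx (B i). \<Prod>j\<in>UNIV. S i j (\<rho> n $ j) (\<alpha> $ j))"
      unfolding tensor_apply_def x_def using HB sub finite_Qd by (intro sum.mono_neutral_cong_right) auto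
    also have "\<dots> = (\<Sum>\<beta>\<in>B i. \<Sum>\<alpha>\<in>block \<beta>. \<Prod>j\<in>UNIV. S i j (\<rho> n $ j) (\<alpha> $ j))"
      by (rule sum_HB_idx[OF fin B\<Lambda>(2)])
    also have "\<dots> = (\<Sum>\<beta>\<in>B i. sqrt (dgram n n) * p \<beta>)"
    proof (rule sum.cong[OF refl])
      fix \<beta> assume b: "\<beta> \<in> B i"
      have "(\<Sum>\<alpha>\<in>block \<beta>. \<Prod>j\<in>UNIV. S i j (\<rho> n $ j) (\<alpha> $ j)) =
          (\<Prod>j\<in>UNIV. \<Sum>m\<in>dyadic_block (\<beta> $ j). S i j (\<rho> n $ j) m)"
        unfolding block_eq_vbox by (rule sum_prod_vbox) simp
      also have "\<dots> = (\<Sum>m\<in>dyadic_block (\<beta> $ i). S i i (\<rho> n $ i) m) *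
          (\<Prod>j\<in>UNIV - {i}. \<Sum>m\<in>dyadic_block (\<beta> $ j). S i j (\<rho> n $ j) m)"
        by (rule prod.remove) auto
      also have "(\<Sum>m\<in>dyadic_block (\<beta> $ i). S i i (\<rho> n $ i) m) = sqrt (dgram n n)"
        using n by (simp add: S_def \<rho>_def Bk[OF b] sum.delta)
      also have "(\<Prod>j\<in>UNIV - {i}. \<Sum>m\<in>dyadic_block (\<beta> $ j). S i j (\<rho> n $ j) m) = p \<beta>"
        unfolding p_def by (intro prod.cong refl) (auto simp: S_def \<rho>_def)
      finally show "(\<Sum>\<alpha>\<in>block \<beta>. \<Prod>j\<in>UNIV. S i j (\<rho> n $ j) (\<alpha> $ j)) = sqrt (dgram n n) * p \<beta>" .
    qed
    finally have wn: "?w n = sqrt (dgram n n) * (\<Sum>\<beta>\<in>B i. p \<beta>)" by (simp add: sum_distrib_left)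
    let ?d = "CARD('n) - 1"
    have p: "p \<beta> * R 1 1 ^ ?d \<ge> (1 / 8) ^ ?d" if b: "\<beta> \<in> B i" for \<beta>
    proof -
      have "p \<beta> * R 1 1 ^ ?d = (\<Prod>j\<in>UNIV - {i}. (\<Sum>m\<in>dyadic_block (\<beta> $ j). R 1 m) * R 1 1)"
        by (simp add: p_def prod.distrib card_Diff_singleton)
      also have "\<dots> \<ge> (\<Prod>j\<in>UNIV - {i}. 1 / 8)"
      proof (intro prod_mono conjI)
        fix j
        have "1 \<le> \<beta> $ j" using b B\<Lambda>(2) by (auto simp: pos_idx_def)
        moreover have "\<beta> $ j \<le> M" using le_norm_inf[of \<beta> j] Bk[OF b] kM by simp
        ultimately show "1 / 8 \<le> (\<Sum>m\<in>dyadic_block (\<beta> $ j). R 1 m) * R 1 1" by (rule block_sum_R1(1))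
      qed simp
      finally show ?thesis by (simp add: card_Diff_singleton)
    qed
    have "?N * (1 / 8) ^ ?d \<le> (\<Sum>\<beta>\<in>B i. p \<beta> * R 1 1 ^ ?d)"
      using sum_bounded_below[of "B i" "(1 / 8) ^ ?d" "\<lambda>\<beta>. p \<beta> * R 1 1 ^ ?d"] p by simp
    then have "(?N * (1 / 8) ^ ?d)\<^sup>2 \<le> ((\<Sum>\<beta>\<in>B i. p \<beta>) * R 1 1 ^ ?d)\<^sup>2"
      unfolding sum_distrib_right[symmetric] by (intro power_mono) auto
    also have "\<dots> = (\<Sum>\<beta>\<in>B i. p \<beta>)\<^sup>2 * (1 / 3) ^ ?d"
    proof -
      have "(R 1 1 ^ ?d)\<^sup>2 = ((R 1 1)\<^sup>2) ^ ?d" by (simp add: power_mult[symmetric] mult.commute)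
      moreover have "(R 1 1)\<^sup>2 = 1 / 3" using k kM by (intro block_sum_R1(2)[of k]) auto
      ultimately show ?thesis by (simp only: power_mult_distrib)
    qed
    also have "\<dots> \<le> (\<Sum>\<beta>\<in>B i. p \<beta>)\<^sup>2" by (simp add: mult_left_le power_le_one)
    also have "(?N * (1 / 8) ^ ?d)\<^sup>2 = ?N\<^sup>2 / 64 ^ ?d"
      by (simp add: power_mult_distrib power_divide power_mult[symmetric] mult.commute[of _ 2]) (simp add: power_mult)
    finally have "?N\<^sup>2 / 64 ^ ?d \<le> (\<Sum>\<beta>\<in>B i. p \<beta>)\<^sup>2" .
    moreover have "?N\<^sup>2 / 64 ^ CARD('n) \<le> ?N\<^sup>2 / 64 ^ ?d"
      by (intro divide_left_mono power_increasing) auto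
    ultimately have "?N\<^sup>2 / 64 ^ CARD('n) \<le> (\<Sum>\<beta>\<in>B i. p \<beta>)\<^sup>2" by linarith
    then have "2 * 2 ^ k * (?N\<^sup>2 / 64 ^ CARD('n)) \<le> 2 * 2 ^ k * (\<Sum>\<beta>\<in>B i. p \<beta>)\<^sup>2" by (intro mult_left_mono) auto
    then show ?thesis unfolding wn power_mult_distrib by (simp add: dgram_diag bn)
  qed
  have "real (card (dyadic_block k)) * (2 * 2 ^ k) = 4 ^ k"
  proof -
    obtain l where l: "k = Suc l" using k by (cases k) auto
    have "(4::real) ^ l = 2 ^ l * 2 ^ l" by (simp flip: power_mult_distrib)
    then show ?thesis by (simp add: dyadic_block_def l)
  qed
  then have "4 ^ k * ?N\<^sup>2 / 64 ^ CARD('n) = (\<Sum>n\<in>dyadic_block k. 2 * 2 ^ k * ?N\<^sup>2 / 64 ^ CARD('n))"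
    by simp
  also have "\<dots> \<le> (\<Sum>n\<in>dyadic_block k. (?w n)\<^sup>2)" by (intro sum_mono w)
  also have "\<dots> = (\<Sum>\<rho>\<in>\<rho> ` dyadic_block k. (tensor_apply (S i) (\<lambda>_. Q) x \<rho>)\<^sup>2)"
    by (simp add: sum.reindex[OF inj])
  also have "\<dots> \<le> (\<Sum>\<rho>\<in>Qd. (tensor_apply (S i) (\<lambda>_. Q) x \<rho>)\<^sup>2)"
    using \<rho>Q finite_Qd by (intro sum_mono2) auto
  also have "\<dots> = energy Qd x i" by (rule energy_squares[symmetric])
  also have "\<dots> = energy (HB_idx \<Lambda>) x i"
    using HB by (intro energy_superset[OF finite_Qd sub, symmetric]) (auto simp: x_def)
  also have "\<dots> \<le> total_energy \<Lambda> x"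
    unfolding total_energy_def
  proof (rule member_le_sum)
    fix j
    have "energy (HB_idx \<Lambda>) x j = energy Qd x j"
      using HB by (intro energy_superset[OF finite_Qd sub]) (auto simp: x_def)
    then show "0 \<le> energy (HB_idx \<Lambda>) x j" using energy_nonneg by simp
  qed auto
  finally have E: "4 ^ k * ?N\<^sup>2 / 64 ^ CARD('n) \<le> total_energy \<Lambda> x" .
  have "real (n_idx \<Lambda>) \<le> real CARD('n) * ?N" using i by (metis of_nat_le_iff of_nat_mult)
  then have "real (n_idx \<Lambda>) / (real CARD('n) * 64 ^ CARD('n)) \<le> ?N / 64 ^ CARD('n)"
    by (simp add: field_simps)
  then have "real (n_idx \<Lambda>) / (real CARD('n) * 64 ^ CARD('n)) * split_norm \<Lambda> x \<le> ?N / 64 ^ CARD('n) * split_norm \<Lambda> x"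
    unfolding norm by (intro mult_right_mono) auto
  also have "\<dots> \<le> 4 ^ k * ?N\<^sup>2 / 64 ^ CARD('n)"
  proof -
    have "?N / 64 ^ CARD('n) * split_norm \<Lambda> x = (4 ^ k * ?N\<^sup>2 / 64 ^ CARD('n)) / 3 ^ CARD('n)"
      unfolding norm by (simp add: power2_eq_square)
    also have "\<dots> \<le> 4 ^ k * ?N\<^sup>2 / 64 ^ CARD('n) / 1"
      by (intro divide_left_mono) auto
    finally show ?thesis by simp
  qed
  finally have "real (n_idx \<Lambda>) / (real CARD('n) * 64 ^ CARD('n)) * split_norm \<Lambda> x \<le> total_energy \<Lambda> x"
    using E by linarith
  moreover have "split_norm \<Lambda> x > 0" unfolding norm using Npos by simp
  ultimately show ?thesis by blast
qed

end

section \<open>The smallest eigenvalue\<close>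

lemma pos_idx_le_block_of:
  "\<mu> \<in> pos_idx \<Longrightarrow> (\<And>j. \<mu> $ j \<le> \<alpha> $ j) \<Longrightarrow> multi_block_of \<mu> \<le> multi_block_of \<alpha>"
  by (auto simp: less_eq_vec_def multi_block_of_def pos_idx_def intro!: block_of_mono)

lemma multi_block_of_pos: "multi_block_of \<alpha> \<in> pos_idx"
  by (simp add: multi_block_of_def pos_idx_def block_of_def)

lemma sum_half_powers: "(\<Sum>b\<in>{1..k}. 1 / 2 ^ b) \<le> (1::real)"
  using geometric_tail[of 2 1 k] by simp

lemma sum_powers_of_2: "(\<Sum>b\<in>{1..k}. 2 ^ b) \<le> 2 * (2::real) ^ k"
  by (induction k) auto

lemma sum_below_weights:
  fixes \<gamma> :: "nat ^ 'n::finite"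
  shows "(\<Sum>\<beta>\<in>vbox (\<lambda>i. {1..\<gamma> $ i}). 4 ^ norm_inf \<beta> / 2 ^ norm1 \<beta>) \<le> 2 * real CARD('n) * 2 ^ norm_inf \<gamma>"
proof -
  let ?V = "vbox (\<lambda>i. {1..\<gamma> $ i})"
  have "(\<Sum>\<beta>\<in>?V. 4 ^ norm_inf \<beta> / 2 ^ norm1 \<beta>) \<le> (\<Sum>\<beta>\<in>?V. \<Sum>i\<in>UNIV. 4 ^ (\<beta> $ i) / (2::real) ^ norm1 \<beta>)"
  proof (rule sum_mono)
    fix \<beta> :: "nat ^ 'n"
    obtain i where "\<beta> $ i = norm_inf \<beta>" by (rule norm_inf_attained)
    then show "4 ^ norm_inf \<beta> / 2 ^ norm1 \<beta> \<le> (\<Sum>i\<in>UNIV. 4 ^ (\<beta> $ i) / (2::real) ^ norm1 \<beta>)"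
      using member_le_sum[of i UNIV "\<lambda>i. 4 ^ (\<beta> $ i) / (2::real) ^ norm1 \<beta>"] by simp
  qed
  also have "\<dots> = (\<Sum>i\<in>UNIV. \<Sum>\<beta>\<in>?V. 4 ^ (\<beta> $ i) / 2 ^ norm1 \<beta>)" by (rule sum.swap)
  also have "\<dots> \<le> (\<Sum>i\<in>(UNIV::'n set). 2 * 2 ^ norm_inf \<gamma>)"
  proof (rule sum_mono)
    fix i :: 'n
    have "4 ^ (\<beta> $ i) / (2::real) ^ norm1 \<beta> = (\<Prod>j\<in>UNIV. if j = i then 2 ^ (\<beta> $ j) else 1 / 2 ^ (\<beta> $ j))" for \<beta>
    proof -
      have four: "(4::real) ^ (\<beta> $ i) = 2 ^ (\<beta> $ i) * 2 ^ (\<beta> $ i)" by (simp flip: power_mult_distrib)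
      have "(\<Prod>j\<in>UNIV. if j = i then 2 ^ (\<beta> $ j) else 1 / (2::real) ^ (\<beta> $ j)) =
          (\<Prod>j\<in>UNIV. (if j = i then 4 ^ (\<beta> $ i) else 1) * (1 / 2 ^ (\<beta> $ j)))"
        by (intro prod.cong refl) (auto simp: four)
      also have "\<dots> = 4 ^ (\<beta> $ i) * (\<Prod>j\<in>UNIV. 1 / 2 ^ (\<beta> $ j))"
        unfolding prod.distrib by (simp add: prod.delta)
      also have "\<dots> = 4 ^ (\<beta> $ i) / 2 ^ norm1 \<beta>" by (simp only: prod_dividef prod_power_vec prod.neutral_const times_divide_eq_right mult_1_right)
      finally show ?thesis ..
    qed
    then have "(\<Sum>\<beta>\<in>?V. 4 ^ (\<beta> $ i) / (2::real) ^ norm1 \<beta>) =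
        (\<Prod>j\<in>UNIV. \<Sum>b\<in>{1..\<gamma> $ j}. if j = i then 2 ^ b else 1 / 2 ^ b)"
      by (simp add: sum_prod_vbox[where f = "\<lambda>j b. if j = i then 2 ^ b else 1 / 2 ^ b"])
    also have "\<dots> \<le> (\<Prod>j\<in>UNIV. if j = i then 2 * 2 ^ norm_inf \<gamma> else 1)"
    proof (intro prod_mono conjI)
      fix j
      have "(2::real) ^ (\<gamma> $ j) \<le> 2 ^ norm_inf \<gamma>" by (intro power_increasing le_norm_inf) simp
      then show "(\<Sum>b\<in>{1..\<gamma> $ j}. if j = i then 2 ^ b else 1 / 2 ^ b) \<le> (if j = i then 2 * 2 ^ norm_inf \<gamma> else (1::real))"
        using sum_half_powers[of "\<gamma> $ j"] order_trans[OF sum_powers_of_2[of "\<gamma> $ j"] mult_left_mono[of _ _ 2]]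
        by (cases "j = i") simp_all
    qed (auto intro: sum_nonneg)
    also have "\<dots> = 2 * 2 ^ norm_inf \<gamma>" by (simp add: prod.delta)
    finally show "(\<Sum>\<beta>\<in>?V. 4 ^ (\<beta> $ i) / (2::real) ^ norm1 \<beta>) \<le> 2 * 2 ^ norm_inf \<gamma>" .
  qed
  finally show ?thesis by simp
qed

lemma real_power_norm_diff:
  "real (2 ^ (norm1 \<beta> - norm_inf \<beta>)) = 2 ^ norm1 \<beta> / 2 ^ norm_inf \<beta>"
  unfolding of_nat_power of_nat_numeral using norm_inf_le_norm1[of \<beta>] by (simp add: power_diff)

lemma sum_UNION_le_sum:
  fixes f :: "'a \<Rightarrow> real"
  assumes "finite I" "\<And>i. i \<in> I \<Longrightarrow> finite (A i)" "\<And>x. f x \<ge> 0"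
  shows "(\<Sum>x\<in>(\<Union>i\<in>I. A i). f x) \<le> (\<Sum>i\<in>I. \<Sum>x\<in>A i. f x)"
  using assms(1,2)
proof (induction I)
  case (insert i I)
  have "(\<Sum>x\<in>A i \<union> (\<Union>i\<in>I. A i). f x) \<le> (\<Sum>x\<in>A i. f x) + (\<Sum>x\<in>(\<Union>i\<in>I. A i). f x)"
    using insert by (subst sum.union_inter[symmetric]) (auto intro!: sum_nonneg assms(3))
  then show ?case using insert by fastforce
qed simp

lemma sum_powers_le_maximal:
  fixes \<Lambda> :: "(nat ^ 'n::finite) set"
  assumes \<Lambda>: "finite \<Lambda>" "\<Lambda> \<subseteq> pos_idx"
  shows "(\<Sum>\<gamma>\<in>\<Lambda>. 2 ^ norm1 \<gamma> / 2 ^ norm_inf \<gamma>) \<le> 2 ^ CARD('n) * real (nt_idx \<Lambda>)"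
proof -
  have layer: "(\<Sum>\<gamma>\<in>layer \<Lambda> k. 2 ^ norm1 \<gamma> / 2 ^ norm_inf \<gamma>) \<le>
      (\<Sum>\<beta>\<in>layer_maximal \<Lambda> k. 2 ^ CARD('n) * real (2 ^ (norm1 \<beta> - norm_inf \<beta>)))" for k
  proof -
    have fin: "finite (layer \<Lambda> k)" using \<Lambda>(1) by (simp add: layer_def)
    have finm: "finite (layer_maximal \<Lambda> k)" using fin by (simp add: layer_maximal_def)
    have "layer \<Lambda> k \<subseteq> (\<Union>\<beta>\<in>layer_maximal \<Lambda> k. vbox (\<lambda>i. {1..\<beta> $ i}))"
    proof
      fix \<gamma> assume g: "\<gamma> \<in> layer \<Lambda> k"
      obtain \<beta> where b: "\<beta> \<in> layer \<Lambda> k" "\<gamma> \<le> \<beta>" "\<And>\<beta>'. \<beta>' \<in> layer \<Lambda> k \<Longrightarrow> \<beta> \<le> \<beta>' \<Longrightarrow> \<beta> = \<beta>'"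
        using finite_has_maximal2[OF fin g] by blast
      then have "\<beta> \<in> layer_maximal \<Lambda> k" by (auto simp: layer_maximal_def)
      moreover have "\<gamma> \<in> vbox (\<lambda>i. {1..\<beta> $ i})"
        using g b(2) \<Lambda>(2) by (auto simp: vbox_def less_eq_vec_def layer_def pos_idx_def)
      ultimately show "\<gamma> \<in> (\<Union>\<beta>\<in>layer_maximal \<Lambda> k. vbox (\<lambda>i. {1..\<beta> $ i}))" by blast
    qed
    moreover have "finite (\<Union>\<beta>\<in>layer_maximal \<Lambda> k. vbox (\<lambda>i. {1..\<beta> $ i}))"
      using finm by (intro finite_UN_I finite_vbox) simp_all
    ultimately have "(\<Sum>\<gamma>\<in>layer \<Lambda> k. (2::real) ^ norm1 \<gamma> / 2 ^ k) \<le>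
        (\<Sum>\<gamma>\<in>(\<Union>\<beta>\<in>layer_maximal \<Lambda> k. vbox (\<lambda>i. {1..\<beta> $ i})). 2 ^ norm1 \<gamma> / 2 ^ k)"
      by (intro sum_mono2) simp_all
    moreover have "(\<Sum>\<gamma>\<in>layer \<Lambda> k. (2::real) ^ norm1 \<gamma> / 2 ^ norm_inf \<gamma>) = (\<Sum>\<gamma>\<in>layer \<Lambda> k. 2 ^ norm1 \<gamma> / 2 ^ k)"
      by (intro sum.cong) (auto simp: layer_def)
    ultimately have "(\<Sum>\<gamma>\<in>layer \<Lambda> k. (2::real) ^ norm1 \<gamma> / 2 ^ norm_inf \<gamma>) \<le>
        (\<Sum>\<gamma>\<in>(\<Union>\<beta>\<in>layer_maximal \<Lambda> k. vbox (\<lambda>i. {1..\<beta> $ i})). 2 ^ norm1 \<gamma> / 2 ^ k)" by simp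
    also have "\<dots> \<le> (\<Sum>\<beta>\<in>layer_maximal \<Lambda> k. \<Sum>\<gamma>\<in>vbox (\<lambda>i. {1..\<beta> $ i}). (2::real) ^ norm1 \<gamma> / 2 ^ k)"
      using finm by (rule sum_UNION_le_sum) (simp_all add: finite_vbox)
    also have "\<dots> \<le> (\<Sum>\<beta>\<in>layer_maximal \<Lambda> k. 2 ^ CARD('n) * real (2 ^ (norm1 \<beta> - norm_inf \<beta>)))"
    proof (rule sum_mono)
      fix \<beta> assume "\<beta> \<in> layer_maximal \<Lambda> k"
      then have k: "norm_inf \<beta> = k" by (simp add: layer_maximal_def layer_def)
      have "(\<Sum>\<gamma>\<in>vbox (\<lambda>i. {1..\<beta> $ i}). (2::real) ^ norm1 \<gamma>) =
          (\<Sum>\<gamma>\<in>vbox (\<lambda>i. {1..\<beta> $ i}). \<Prod>i\<in>UNIV. 2 ^ (\<gamma> $ i))" by (simp only: prod_power_vec)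
      also have "\<dots> = (\<Prod>i\<in>UNIV. \<Sum>b\<in>{1..\<beta> $ i}. 2 ^ b)" by (rule sum_prod_vbox) simp
      also have "\<dots> \<le> (\<Prod>i\<in>UNIV. 2 * 2 ^ (\<beta> $ i))"
        by (intro prod_mono conjI sum_powers_of_2 sum_nonneg) simp
      also have "\<dots> = 2 ^ CARD('n) * 2 ^ norm1 \<beta>" by (simp only: prod.distrib prod_power_vec prod_constant)
      finally have "(\<Sum>\<gamma>\<in>vbox (\<lambda>i. {1..\<beta> $ i}). (2::real) ^ norm1 \<gamma> / 2 ^ k) \<le> 2 ^ CARD('n) * 2 ^ norm1 \<beta> / 2 ^ k"
        unfolding sum_divide_distrib[symmetric] by (rule divide_right_mono) simp
      also have "\<dots> = 2 ^ CARD('n) * real (2 ^ (norm1 \<beta> - norm_inf \<beta>))"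
        unfolding real_power_norm_diff by (simp add: k)
      finally show "(\<Sum>\<gamma>\<in>vbox (\<lambda>i. {1..\<beta> $ i}). 2 ^ norm1 \<gamma> / 2 ^ k) \<le> 2 ^ CARD('n) * real (2 ^ (norm1 \<beta> - norm_inf \<beta>))" .
    qed
    finally show ?thesis .
  qed
  have "(\<Sum>\<gamma>\<in>\<Lambda>. 2 ^ norm1 \<gamma> / 2 ^ norm_inf \<gamma>) \<le> (\<Sum>k\<in>{1..k_max \<Lambda>}.
      \<Sum>\<beta>\<in>layer_maximal \<Lambda> k. 2 ^ CARD('n) * real (2 ^ (norm1 \<beta> - norm_inf \<beta>)))"
    unfolding sum_layers[OF \<Lambda>] by (intro sum_mono layer)
  also have "\<dots> = 2 ^ CARD('n) * real (nt_idx \<Lambda>)"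
    by (simp add: nt_idx_def sum_distrib_left)
  finally show ?thesis .
qed

context gram_factor
begin

text \<open>Coefficients of \<open>\<Sum>\<^sub>\<alpha> x\<^sub>\<alpha> \<phi>\<^sub>\<alpha>\<close> in the \<open>L\<^sub>2\<close>-orthonormal tensor product basis
  obtained from the hierarchical one level by level.\<close>

definition orth_coeff :: "(nat ^ 'n::finite \<Rightarrow> real) \<Rightarrow> nat ^ 'n \<Rightarrow> real" where
  "orth_coeff x = tensor_apply (\<lambda>_. R) (\<lambda>_. Q) x"

lemma orth_coeff_energy:
  fixes x :: "nat ^ 'n::finite \<Rightarrow> real"
  shows "(\<Sum>\<mu>\<in>Qd. 4 ^ block_of (\<mu> $ i) * (orth_coeff x \<mu>)\<^sup>2) \<le> energy Qd x i"
proof -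
  define T where "T j m r = (if j = i then 2 ^ block_of m * R m r / sqrt (dgram r r) else if m = r then 1 else 0)" for j :: 'n and m r
  have T: "2 ^ block_of (\<mu> $ i) * orth_coeff x \<mu> = tensor_apply T (\<lambda>_. Q) (tensor_apply (S i) (\<lambda>_. Q) x) \<mu>"
    if \<mu>: "\<mu> \<in> Qd" for \<mu>
  proof -
    define U where "U j m r = (if j = i then 2 ^ block_of m else 1) * R m r" for j :: 'n and m r
    have "tensor_apply T (\<lambda>_. Q) (tensor_apply (S i) (\<lambda>_. Q) x) \<mu> =
        tensor_apply (\<lambda>j l n. \<Sum>m\<in>Q. T j l m * S i j m n) (\<lambda>_. Q) x \<mu>"
      by (rule tensor_apply_compose) simp
    also have "\<dots> = tensor_apply U (\<lambda>_. Q) x \<mu>"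
    proof (rule tensor_apply_cong[OF _ refl \<mu>])
      fix j l n assume ln: "l \<in> Q" "n \<in> Q"
      show "(\<Sum>m\<in>Q. T j l m * S i j m n) = U j l n"
      proof (cases "j = i")
        case True
        have "(\<Sum>m\<in>Q. T j l m * S i j m n) = (\<Sum>m\<in>Q. if m = n then 2 ^ block_of l * R l n else 0)"
          by (intro sum.cong refl) (auto simp: T_def S_def True dgram_diag)
        then show ?thesis using ln True by (simp add: U_def sum.delta)
      next
        case False
        have "(\<Sum>m\<in>Q. T j l m * S i j m n) = (\<Sum>m\<in>Q. if m = l then R l n else 0)"
          by (intro sum.cong refl) (auto simp: T_def S_def False)
        then show ?thesis using ln False by (simp add: U_def sum.delta)
      qed
    qed
    also have "\<dots> = 2 ^ block_of (\<mu> $ i) * orth_coeff x \<mu>"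
    proof -
      have "(\<Prod>j\<in>UNIV. U j (\<mu> $ j) (\<alpha> $ j)) = 2 ^ block_of (\<mu> $ i) * (\<Prod>j\<in>UNIV. R (\<mu> $ j) (\<alpha> $ j))" for \<alpha>
        unfolding U_def prod.distrib by (simp add: prod.delta)
      then show ?thesis by (simp add: tensor_apply_def orth_coeff_def sum_distrib_left mult.assoc)
    qed
    finally show ?thesis ..
  qed
  have "(\<Sum>\<mu>\<in>Qd. 4 ^ block_of (\<mu> $ i) * (orth_coeff x \<mu>)\<^sup>2) =
      (\<Sum>\<mu>\<in>Qd. (tensor_apply T (\<lambda>_. Q) (tensor_apply (S i) (\<lambda>_. Q) x) \<mu>)\<^sup>2)"
  proof (intro sum.cong refl)
    fix \<mu> :: "nat ^ 'n" assume "\<mu> \<in> Qd"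
    have "(4::real) ^ block_of (\<mu> $ i) = (2 ^ block_of (\<mu> $ i))\<^sup>2"
      by (simp add: power2_eq_square flip: power_mult_distrib)
    then show "4 ^ block_of (\<mu> $ i) * (orth_coeff x \<mu>)\<^sup>2 = (tensor_apply T (\<lambda>_. Q) (tensor_apply (S i) (\<lambda>_. Q) x) \<mu>)\<^sup>2"
      unfolding T[OF \<open>\<mu> \<in> Qd\<close>, symmetric] by (simp add: power_mult_distrib)
  qed
  also have "\<dots> \<le> (\<Prod>j\<in>(UNIV :: 'n set). 1) * (\<Sum>\<rho>\<in>Qd. (tensor_apply (S i) (\<lambda>_. Q) x \<rho>)\<^sup>2)"
  proof (rule tensor_norm)
    fix j z
    show "(\<Sum>r\<in>Q. (\<Sum>s\<in>Q. T j r s * z s)\<^sup>2) \<le> 1 * (\<Sum>s\<in>Q. (z s)\<^sup>2)"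
    proof (cases "j = i")
      case True
      then show ?thesis using R_weighted_bound[of z] by (simp only: T_def if_True refl)
    next
      case False
      have "(\<Sum>s\<in>Q. T j r s * z s) = z r" if "r \<in> Q" for r
      proof -
        have "(\<Sum>s\<in>Q. T j r s * z s) = (\<Sum>s\<in>Q. if s = r then z r else 0)"
          by (intro sum.cong refl) (auto simp: T_def False)
        then show ?thesis using that by (simp add: sum.delta)
      qed
      then show ?thesis by simp
    qed
  qed auto
  also have "\<dots> = energy Qd x i" by (simp only: energy_squares prod.neutral_const mult_1)
  finally show ?thesis .
qed

lemma orth_coeff_inverse:
  assumes "\<alpha> \<in> Qd"
  shows "tensor_apply (\<lambda>_. P) (\<lambda>_. Q) (orth_coeff x) \<alpha> = x \<alpha>"
  unfolding orth_coeff_def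
  by (subst tensor_apply_compose, simp, rule tensor_apply_id) (use assms PR in auto)

text \<open>Cauchy-Schwarz with weights \<open>2\<^bsup>|\<gamma>|\<^sub>1\<^esup> / 4\<^bsup>|\<gamma>|\<^sub>\<infinity>\<^esup>\<close> balances the loss
  \<open>2\<^bsup>|\<gamma>|\<^sub>1\<^esup>\<close> in passing from orthonormal to hierarchical coefficients against the gain
  \<open>4\<^bsup>|\<gamma>|\<^sub>\<infinity>\<^esup>\<close> in the energy.\<close>

lemma split_norm_bound:
  fixes \<Lambda> :: "(nat ^ 'n::finite) set"
  assumes \<Lambda>: "finite \<Lambda>" "monotone_idx \<Lambda>" "\<And>\<beta>. \<beta> \<in> \<Lambda> \<Longrightarrow> norm_inf \<beta> \<le> M"
  shows "split_norm \<Lambda> x \<le> 2 * real CARD('n) * 32 ^ CARD('n) * real (nt_idx \<Lambda>) * total_energy \<Lambda> x"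
proof -
  have pos: "\<Lambda> \<subseteq> pos_idx" using \<Lambda>(2) by (simp add: monotone_idx_def)
  have down: "\<beta>' \<in> \<Lambda>" if "\<beta> \<in> \<Lambda>" "\<beta>' \<in> pos_idx" "\<beta>' \<le> \<beta>" for \<beta> \<beta>'
    using \<Lambda>(2) that by (auto simp: monotone_idx_def)
  have sub: "HB_idx \<Lambda> \<subseteq> Qd" using pos \<Lambda>(3) by (rule HB_idx_subset_Qd)
  have blk: "block \<beta> \<subseteq> Qd" if "\<beta> \<in> \<Lambda>" for \<beta> using sub that by (auto simp: HB_idx_def)
  have levels: "1 \<le> \<beta> $ i" "\<beta> $ i \<le> M" if "\<beta> \<in> \<Lambda>" for \<beta> i
    using that pos \<Lambda>(3)[OF that] le_norm_inf[of \<beta> i] by (auto simp: pos_idx_def)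
  define x' where "x' \<alpha> = (if \<alpha> \<in> HB_idx \<Lambda> then x \<alpha> else 0)" for \<alpha>
  have E: "total_energy \<Lambda> x = (\<Sum>i\<in>UNIV. energy Qd x' i)"
    unfolding total_energy_def x'_def[abs_def] by (intro sum.cong refl energy_restrict[OF finite_Qd sub])
  define y where "y = orth_coeff x'"
  have y0: "y \<mu> = 0" if "\<mu> \<in> Qd" "\<mu> \<notin> HB_idx \<Lambda>" for \<mu>
    unfolding y_def orth_coeff_def tensor_apply_def
  proof (intro sum.neutral ballI)
    fix \<alpha> :: "nat ^ 'n" assume "\<alpha> \<in> Qd"
    have \<mu>: "\<mu> \<in> pos_idx" using that(1) by (auto simp: vbox_def pos_idx_def)
    show "(\<Prod>j\<in>UNIV. R (\<mu> $ j) (\<alpha> $ j)) * x' \<alpha> = 0"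
    proof (cases "\<alpha> \<in> HB_idx \<Lambda> \<and> (\<forall>j. \<mu> $ j \<le> \<alpha> $ j)")
      case True
      then have "multi_block_of \<alpha> \<in> \<Lambda>" using pos by (simp add: mem_HB_idx_iff)
      then have "multi_block_of \<mu> \<in> \<Lambda>"
        by (rule down[OF _ multi_block_of_pos pos_idx_le_block_of[OF \<mu>]]) (use True in blast)
      then show ?thesis using that(2) \<mu> pos by (simp add: mem_HB_idx_iff)
    next
      case False
      then consider "\<alpha> \<notin> HB_idx \<Lambda>" | j where "\<alpha> $ j < \<mu> $ j" by (auto simp: not_le)
      then show ?thesis
      proof cases
        case (2 j)
        then have "R (\<mu> $ j) (\<alpha> $ j) = 0" by (rule tri(1))
        then have "(\<Prod>j\<in>UNIV. R (\<mu> $ j) (\<alpha> $ j)) = 0" by (intro prod_zero) auto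
        then show ?thesis by simp
      qed (simp add: x'_def)
    qed
  qed
  define Y where "Y \<gamma> = (\<Sum>\<mu>\<in>block \<gamma>. (y \<mu>)\<^sup>2)" for \<gamma>
  have Y0: "Y \<gamma> \<ge> 0" for \<gamma> unfolding Y_def by (intro sum_nonneg) simp
  have YE: "(\<Sum>\<gamma>\<in>\<Lambda>. 4 ^ norm_inf \<gamma> * Y \<gamma>) \<le> total_energy \<Lambda> x"
  proof -
    have "(\<Sum>\<gamma>\<in>\<Lambda>. 4 ^ norm_inf \<gamma> * Y \<gamma>) \<le> (\<Sum>\<gamma>\<in>\<Lambda>. \<Sum>i\<in>UNIV. 4 ^ (\<gamma> $ i) * Y \<gamma>)"
    proof (rule sum_mono)
      fix \<gamma> :: "nat ^ 'n"
      obtain i where "\<gamma> $ i = norm_inf \<gamma>" by (rule norm_inf_attained)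
      then show "4 ^ norm_inf \<gamma> * Y \<gamma> \<le> (\<Sum>i\<in>UNIV. 4 ^ (\<gamma> $ i) * Y \<gamma>)"
        using member_le_sum[of i UNIV "\<lambda>i. 4 ^ (\<gamma> $ i) * Y \<gamma>"] Y0 by simp
    qed
    also have "\<dots> = (\<Sum>i\<in>UNIV. \<Sum>\<gamma>\<in>\<Lambda>. 4 ^ (\<gamma> $ i) * Y \<gamma>)" by (rule sum.swap)
    also have "\<dots> \<le> (\<Sum>i\<in>UNIV. energy Qd x' i)"
    proof (rule sum_mono)
      fix i :: 'n
      have "(\<Sum>\<gamma>\<in>\<Lambda>. 4 ^ (\<gamma> $ i) * Y \<gamma>) = (\<Sum>\<gamma>\<in>\<Lambda>. \<Sum>\<mu>\<in>block \<gamma>. 4 ^ block_of (\<mu> $ i) * (y \<mu>)\<^sup>2)"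
      proof (intro sum.cong refl)
        fix \<gamma> assume g: "\<gamma> \<in> \<Lambda>"
        have "block_of (\<mu> $ i) = \<gamma> $ i" if "\<mu> \<in> block \<gamma>" for \<mu>
          using that levels[OF g] by (intro block_of_eq) (auto simp: block_def)
        then show "4 ^ (\<gamma> $ i) * Y \<gamma> = (\<Sum>\<mu>\<in>block \<gamma>. 4 ^ block_of (\<mu> $ i) * (y \<mu>)\<^sup>2)"
          by (simp add: Y_def sum_distrib_left)
      qed
      also have "\<dots> = (\<Sum>\<mu>\<in>HB_idx \<Lambda>. 4 ^ block_of (\<mu> $ i) * (y \<mu>)\<^sup>2)"
        by (rule sum_HB_idx[OF \<Lambda>(1) pos, symmetric])
      also have "\<dots> \<le> (\<Sum>\<mu>\<in>Qd. 4 ^ block_of (\<mu> $ i) * (y \<mu>)\<^sup>2)"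
        by (rule sum_mono2[OF finite_Qd sub]) (intro mult_nonneg_nonneg, simp_all)
      also have "\<dots> \<le> energy Qd x' i" unfolding y_def by (rule orth_coeff_energy)
      finally show "(\<Sum>\<gamma>\<in>\<Lambda>. 4 ^ (\<gamma> $ i) * Y \<gamma>) \<le> energy Qd x' i" .
    qed
    finally show ?thesis unfolding E .
  qed
  define a where "a \<gamma> = 2 ^ norm1 \<gamma> / (4::real) ^ norm_inf \<gamma>" for \<gamma> :: "nat ^ 'n"
  define Lup where "Lup \<beta> = {\<gamma>\<in>\<Lambda>. \<beta> \<le> \<gamma>}" for \<beta>
  have X: "(\<Sum>\<alpha>\<in>block \<beta>. (x \<alpha>)\<^sup>2) \<le> (\<Sum>\<gamma>\<in>Lup \<beta>. a \<gamma>) * (24 ^ CARD('n) * total_energy \<Lambda> x)"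
    if b: "\<beta> \<in> \<Lambda>" for \<beta>
  proof -
    define p where "p \<gamma> \<alpha> = tensor_apply (\<lambda>_. P) (\<lambda>i. dyadic_block (\<gamma> $ i)) y \<alpha>" for \<gamma> \<alpha>
    have xp: "x \<alpha> = (\<Sum>\<gamma>\<in>Lup \<beta>. p \<gamma> \<alpha>)" if \<alpha>: "\<alpha> \<in> block \<beta>" for \<alpha>
    proof -
      have \<alpha>Q: "\<alpha> \<in> Qd" using blk[OF b] \<alpha> by auto
      have "x \<alpha> = x' \<alpha>" using \<alpha> b by (auto simp: x'_def HB_idx_def)
      also have "\<dots> = tensor_apply (\<lambda>_. P) (\<lambda>_. Q) y \<alpha>"
        unfolding y_def by (rule orth_coeff_inverse[OF \<alpha>Q, symmetric])
      also have "\<dots> = (\<Sum>\<mu>\<in>HB_idx \<Lambda>. (\<Prod>j\<in>UNIV. P (\<alpha> $ j) (\<mu> $ j)) * y \<mu>)"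
        unfolding tensor_apply_def using y0 by (intro sum.mono_neutral_right finite_Qd sub) auto
      also have "\<dots> = (\<Sum>\<gamma>\<in>\<Lambda>. p \<gamma> \<alpha>)"
        unfolding sum_HB_idx[OF \<Lambda>(1) pos] p_def tensor_apply_def block_eq_vbox ..
      also have "\<dots> = (\<Sum>\<gamma>\<in>Lup \<beta>. p \<gamma> \<alpha>)"
      proof (rule sum.mono_neutral_right[OF \<Lambda>(1)])
        show "\<forall>\<gamma>\<in>\<Lambda> - Lup \<beta>. p \<gamma> \<alpha> = 0"
        proof
          fix \<gamma> assume "\<gamma> \<in> \<Lambda> - Lup \<beta>"
          then have g: "\<gamma> \<in> \<Lambda>" "\<not> \<beta> \<le> \<gamma>" by (auto simp: Lup_def)
          then obtain j where j: "\<gamma> $ j < \<beta> $ j" by (auto simp: less_eq_vec_def not_le)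
          show "p \<gamma> \<alpha> = 0"
            unfolding p_def tensor_apply_def
          proof (intro sum.neutral ballI)
            fix \<mu> assume "\<mu> \<in> vbox (\<lambda>i. dyadic_block (\<gamma> $ i))"
            then have "\<mu> $ j \<in> dyadic_block (\<gamma> $ j)" "\<alpha> $ j \<in> dyadic_block (\<beta> $ j)"
              using \<alpha> by (auto simp: vbox_def block_def)
            then have "\<mu> $ j < \<alpha> $ j"
              using j levels[OF g(1), of j] levels[OF b, of j] block_of_mono[of "\<alpha> $ j" "\<mu> $ j"]
              by (auto simp: mem_dyadic_block_iff not_le[symmetric])
            then have "P (\<alpha> $ j) (\<mu> $ j) = 0" by (rule tri(2))
            then have "(\<Prod>j\<in>UNIV. P (\<alpha> $ j) (\<mu> $ j)) = 0" by (intro prod_zero) auto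
            then show "(\<Prod>j\<in>UNIV. P (\<alpha> $ j) (\<mu> $ j)) * y \<mu> = 0" by simp
          qed
        qed
      qed (auto simp: Lup_def)
      finally show ?thesis .
    qed
    have pY: "(\<Sum>\<alpha>\<in>block \<beta>. (p \<gamma> \<alpha>)\<^sup>2) \<le> 24 ^ CARD('n) * 2 ^ norm1 \<gamma> * Y \<gamma>" if g: "\<gamma> \<in> Lup \<beta>" for \<gamma>
    proof -
      have g\<Lambda>: "\<gamma> \<in> \<Lambda>" using g by (simp add: Lup_def)
      have "(\<Sum>\<alpha>\<in>block \<beta>. (p \<gamma> \<alpha>)\<^sup>2) \<le> (\<Prod>i\<in>UNIV. 24 * 2 ^ (\<gamma> $ i)) * Y \<gamma>"
        unfolding p_def Y_def block_eq_vbox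
        by (rule tensor_norm) (auto intro!: P_block_bound levels b g\<Lambda>)
      also have "(\<Prod>i\<in>UNIV. 24 * 2 ^ (\<gamma> $ i)) = 24 ^ CARD('n) * (2::real) ^ norm1 \<gamma>"
        by (simp only: prod.distrib prod_power_vec prod_constant)
      finally show ?thesis .
    qed
    have apos: "a \<gamma> > 0" for \<gamma> by (simp add: a_def)
    have "(\<Sum>\<alpha>\<in>block \<beta>. (x \<alpha>)\<^sup>2) = (\<Sum>\<alpha>\<in>block \<beta>. (\<Sum>\<gamma>\<in>Lup \<beta>. p \<gamma> \<alpha>)\<^sup>2)" by (simp add: xp)
    also have "\<dots> \<le> (\<Sum>\<alpha>\<in>block \<beta>. (\<Sum>\<gamma>\<in>Lup \<beta>. a \<gamma>) * (\<Sum>\<gamma>\<in>Lup \<beta>. (p \<gamma> \<alpha>)\<^sup>2 / a \<gamma>))"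
      by (intro sum_mono weighted_cauchy_schwarz apos)
    also have "\<dots> = (\<Sum>\<gamma>\<in>Lup \<beta>. a \<gamma>) * (\<Sum>\<gamma>\<in>Lup \<beta>. (\<Sum>\<alpha>\<in>block \<beta>. (p \<gamma> \<alpha>)\<^sup>2) / a \<gamma>)"
      unfolding sum_distrib_left[symmetric] by (subst sum.swap) (simp only: sum_divide_distrib)
    also have "\<dots> \<le> (\<Sum>\<gamma>\<in>Lup \<beta>. a \<gamma>) * (\<Sum>\<gamma>\<in>Lup \<beta>. 24 ^ CARD('n) * 2 ^ norm1 \<gamma> * Y \<gamma> / a \<gamma>)"
      using apos by (intro mult_left_mono sum_mono divide_right_mono pY sum_nonneg) (auto intro: less_imp_le)
    also have "(\<Sum>\<gamma>\<in>Lup \<beta>. 24 ^ CARD('n) * 2 ^ norm1 \<gamma> * Y \<gamma> / a \<gamma>) = 24 ^ CARD('n) * (\<Sum>\<gamma>\<in>Lup \<beta>. 4 ^ norm_inf \<gamma> * Y \<gamma>)"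
      unfolding sum_distrib_left by (intro sum.cong refl) (simp add: a_def)
    also have "(\<Sum>\<gamma>\<in>Lup \<beta>. a \<gamma>) * (24 ^ CARD('n) * (\<Sum>\<gamma>\<in>Lup \<beta>. 4 ^ norm_inf \<gamma> * Y \<gamma>)) \<le>
        (\<Sum>\<gamma>\<in>Lup \<beta>. a \<gamma>) * (24 ^ CARD('n) * total_energy \<Lambda> x)"
    proof (intro mult_left_mono)
      have "(\<Sum>\<gamma>\<in>Lup \<beta>. 4 ^ norm_inf \<gamma> * Y \<gamma>) \<le> (\<Sum>\<gamma>\<in>\<Lambda>. 4 ^ norm_inf \<gamma> * Y \<gamma>)"
        using \<Lambda>(1) Y0 by (intro sum_mono2) (auto simp: Lup_def)
      then show "(\<Sum>\<gamma>\<in>Lup \<beta>. 4 ^ norm_inf \<gamma> * Y \<gamma>) \<le> total_energy \<Lambda> x" using YE by simp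
    qed (use apos in \<open>auto intro!: sum_nonneg intro: less_imp_le\<close>)
    finally show ?thesis .
  qed
  let ?K = "24 ^ CARD('n) * total_energy \<Lambda> x"
  have E0: "total_energy \<Lambda> x \<ge> 0" unfolding E by (intro sum_nonneg energy_nonneg)
  have "split_norm \<Lambda> x \<le> (\<Sum>\<beta>\<in>\<Lambda>. wt \<beta> * ((\<Sum>\<gamma>\<in>Lup \<beta>. a \<gamma>) * ?K))"
    unfolding split_norm_def by (intro sum_mono mult_left_mono X) (auto intro: less_imp_le wt_pos)
  also have "\<dots> = (\<Sum>\<beta>\<in>\<Lambda>. \<Sum>\<gamma>\<in>\<Lambda>. if \<beta> \<le> \<gamma> then wt \<beta> * a \<gamma> else 0) * ?K"
    unfolding sum_distrib_right Lup_def using \<Lambda>(1)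
    by (intro sum.cong refl) (simp add: sum.inter_filter sum_distrib_left sum_distrib_right mult.assoc
        if_distrib[of "\<lambda>x. x * _"] if_distrib[of "\<lambda>x. _ * x"] cong: if_cong)
  also have "(\<Sum>\<beta>\<in>\<Lambda>. \<Sum>\<gamma>\<in>\<Lambda>. if \<beta> \<le> \<gamma> then wt \<beta> * a \<gamma> else 0) =
      (\<Sum>\<gamma>\<in>\<Lambda>. \<Sum>\<beta>\<in>\<Lambda>. if \<beta> \<le> \<gamma> then wt \<beta> * a \<gamma> else 0)" by (rule sum.swap)
  also have "\<dots> \<le> (\<Sum>\<gamma>\<in>\<Lambda>. 2 * real CARD('n) * (2 / 3) ^ CARD('n) * (2 ^ norm1 \<gamma> / 2 ^ norm_inf \<gamma>))"
  proof (rule sum_mono)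
    fix \<gamma> assume g: "\<gamma> \<in> \<Lambda>"
    have "(\<Sum>\<beta>\<in>\<Lambda>. if \<beta> \<le> \<gamma> then wt \<beta> * a \<gamma> else 0) = (\<Sum>\<beta>\<in>{\<beta>\<in>\<Lambda>. \<beta> \<le> \<gamma>}. wt \<beta> * a \<gamma>)"
      by (simp add: sum.inter_filter \<Lambda>(1))
    also have "\<dots> \<le> (\<Sum>\<beta>\<in>vbox (\<lambda>i. {1..\<gamma> $ i}). wt \<beta> * a \<gamma>)"
      using pos by (intro sum_mono2 finite_vbox)
        (auto simp: vbox_def less_eq_vec_def pos_idx_def wt_def a_def)
    also have "\<dots> = (\<Sum>\<beta>\<in>vbox (\<lambda>i. {1..\<gamma> $ i}). 4 ^ norm_inf \<beta> / 2 ^ norm1 \<beta>) * ((2 / 3) ^ CARD('n) * a \<gamma>)"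
      unfolding sum_distrib_right by (intro sum.cong refl) (simp add: wt_def)
    also have "\<dots> \<le> 2 * real CARD('n) * 2 ^ norm_inf \<gamma> * ((2 / 3) ^ CARD('n) * a \<gamma>)"
      by (intro mult_right_mono sum_below_weights) (simp add: a_def)
    also have "\<dots> = 2 * real CARD('n) * (2 / 3) ^ CARD('n) * (2 ^ norm1 \<gamma> / 2 ^ norm_inf \<gamma>)"
    proof -
      have "(4::real) ^ norm_inf \<gamma> = 2 ^ norm_inf \<gamma> * 2 ^ norm_inf \<gamma>" by (simp flip: power_mult_distrib)
      then show ?thesis by (simp add: a_def)
    qed
    finally show "(\<Sum>\<beta>\<in>\<Lambda>. if \<beta> \<le> \<gamma> then wt \<beta> * a \<gamma> else 0) \<le>
        2 * real CARD('n) * (2 / 3) ^ CARD('n) * (2 ^ norm1 \<gamma> / 2 ^ norm_inf \<gamma>)" .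
  qed
  also have "\<dots> = 2 * real CARD('n) * (2 / 3) ^ CARD('n) * (\<Sum>\<gamma>\<in>\<Lambda>. 2 ^ norm1 \<gamma> / 2 ^ norm_inf \<gamma>)"
    by (simp only: sum_distrib_left)
  also have "\<dots> \<le> 2 * real CARD('n) * (2 / 3) ^ CARD('n) * (2 ^ CARD('n) * real (nt_idx \<Lambda>))"
    by (intro mult_left_mono sum_powers_le_maximal \<Lambda>(1) pos) auto
  finally have "split_norm \<Lambda> x \<le> 2 * real CARD('n) * (2 / 3) ^ CARD('n) * (2 ^ CARD('n) * real (nt_idx \<Lambda>)) * ?K"
    using E0 by (simp add: mult_right_mono)
  also have "\<dots> = 2 * real CARD('n) * ((2 / 3) ^ CARD('n) * 2 ^ CARD('n) * 24 ^ CARD('n)) * real (nt_idx \<Lambda>) * total_energy \<Lambda> x"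
    by (simp only: mult_ac)
  also have "(2 / 3) ^ CARD('n) * 2 ^ CARD('n) * 24 ^ CARD('n) = (32::real) ^ CARD('n)"
    by (simp flip: power_mult_distrib)
  finally show ?thesis .
qed

end

text \<open>The test function is the product of a hierarchical function of the top level in a direction
  \<open>i\<close> of maximal level and of nodal hat functions at the centre in the other directions.  The latter
  have small norm but hierarchical coefficient 1 on level 1.\<close>

lemma energy_min_upper:
  fixes \<Lambda> :: "(nat ^ 'n::finite) set"
  assumes \<Lambda>: "finite \<Lambda>" "\<Lambda> \<noteq> {}" "monotone_idx \<Lambda>"
  shows "\<exists>x. split_norm \<Lambda> x > 0 \<and>
    total_energy \<Lambda> x \<le> 3 * real CARD('n) * 2 ^ CARD('n) / real (nt'_idx \<Lambda>) * split_norm \<Lambda> x"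
proof -
  have pos: "\<Lambda> \<subseteq> pos_idx" using \<Lambda>(3) by (simp add: monotone_idx_def)
  have down: "\<beta>' \<in> \<Lambda>" if "\<beta> \<in> \<Lambda>" "\<beta>' \<in> pos_idx" "\<beta>' \<le> \<beta>" for \<beta> \<beta>'
    using \<Lambda>(3) that by (auto simp: monotone_idx_def)
  have "nt'_idx \<Lambda> \<in> (\<lambda>\<beta>. 2 ^ (norm1 \<beta> - norm_inf \<beta>)) ` \<Lambda>"
    unfolding nt'_idx_def using \<Lambda> by (intro Max_in) auto
  then obtain \<beta> where \<beta>: "\<beta> \<in> \<Lambda>" "nt'_idx \<Lambda> = 2 ^ (norm1 \<beta> - norm_inf \<beta>)" by auto
  obtain i where i: "\<beta> $ i = norm_inf \<beta>" by (rule norm_inf_attained)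
  define m where "m = norm_inf \<beta>"
  have lev: "1 \<le> \<beta> $ j" "\<beta> $ j \<le> m" for j
    using \<beta>(1) pos le_norm_inf by (auto simp: pos_idx_def m_def)
  define \<alpha>0 :: "nat ^ 'n" where "\<alpha>0 = (\<chi> j. if j = i then 2 ^ (m - 1) else 1)"
  define B where "B j = {1..<(2::nat) ^ (\<beta> $ j)}" for j
  define ok where "ok j c \<longleftrightarrow> c (\<alpha>0 $ j) = 1 \<and>
      (\<Sum>n\<in>B j. \<Sum>n'\<in>B j. c n * c n' * gram n n') = 2 / 3 / 2 ^ (\<beta> $ j) \<and>
      (\<Sum>n\<in>B j. (c n)\<^sup>2 * dgram n n) = 2 * 2 ^ (\<beta> $ j) \<and> (\<forall>n. n \<notin> B j \<longrightarrow> c n = 0)" for j c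
  have "\<exists>c. ok j c" for j
  proof (cases "j = i")
    case True
    let ?n = "2 ^ (m - 1) :: nat"
    have m: "\<beta> $ j = m" "m \<ge> 1" using True i lev[of i] by (auto simp: m_def)
    have nb: "?n \<in> dyadic_block m" using m(2) by (auto simp: dyadic_block_def)
    have "?n \<in> B j" using dyadic_block_subset[of m m] nb m(1) unfolding B_def by auto
    note n = this block_of_eq[OF m(2) nb]
    define c where "c n = (if n = ?n then 1 else 0 :: real)" for n
    have fin: "finite (B j)" by (simp add: B_def)
    have s: "(\<Sum>n\<in>B j. c n * h n) = h ?n" for h
      using n(1) fin by (simp add: c_def if_distrib[of "\<lambda>x. x * _"] sum.delta cong: if_cong)
    have "(\<Sum>n\<in>B j. \<Sum>n'\<in>B j. c n * c n' * gram n n') = (\<Sum>n\<in>B j. c n * (\<Sum>n'\<in>B j. c n' * gram n n'))"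
      by (simp add: sum_distrib_left mult.assoc)
    also have "\<dots> = 2 / 3 / 2 ^ (\<beta> $ j)" unfolding s gram_diag n(2) m(1) ..
    finally have "(\<Sum>n\<in>B j. \<Sum>n'\<in>B j. c n * c n' * gram n n') = 2 / 3 / 2 ^ (\<beta> $ j)" .
    moreover have "(\<Sum>n\<in>B j. (c n)\<^sup>2 * dgram n n) = 2 * 2 ^ (\<beta> $ j)"
      using s[of "\<lambda>n. c n * dgram n n"]
      by (simp add: power2_eq_square mult.assoc dgram_diag n(2)[unfolded One_nat_def] m(1) c_def)
    moreover have "c (\<alpha>0 $ j) = 1" using True by (simp add: c_def \<alpha>0_def)
    moreover have "\<forall>n. n \<notin> B j \<longrightarrow> c n = 0" using n(1) by (auto simp: c_def)
    ultimately have "ok j c" by (simp only: ok_def)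
    then show ?thesis by blast
  next
    case False
    then have "\<alpha>0 $ j = 1" by (simp add: \<alpha>0_def)
    obtain c where c: "c 1 = 1" "\<And>n. n \<notin> B j \<Longrightarrow> c n = 0"
      "\<And>t. fsum (\<beta> $ j) c t = hat (2 ^ (\<beta> $ j) * t - 2 ^ (\<beta> $ j - 1))"
      "(\<Sum>n\<in>B j. (c n)\<^sup>2 * dgram n n) = 2 * 2 ^ (\<beta> $ j)"
      using nodal_hat_expansion[OF lev(1)[of j], folded B_def] by blast
    have "(\<Sum>n\<in>B j. \<Sum>n'\<in>B j. c n * c n' * gram n n') = 2 / 3 / 2 ^ (\<beta> $ j)"
      unfolding B_def by (rule nodal_hat_norm[OF lev(1) c(3)])
    with c \<open>\<alpha>0 $ j = 1\<close> have "ok j c" unfolding ok_def by (intro conjI allI impI) simp_all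
    then show ?thesis by blast
  qed
  then obtain c where ok: "\<And>j. ok j (c j)" by metis
  have c: "c j (\<alpha>0 $ j) = 1"
    "(\<Sum>n\<in>B j. \<Sum>n'\<in>B j. c j n * c j n' * gram n n') = 2 / 3 / 2 ^ (\<beta> $ j)"
    "(\<Sum>n\<in>B j. (c j n)\<^sup>2 * dgram n n) = 2 * 2 ^ (\<beta> $ j)" "n \<notin> B j \<Longrightarrow> c j n = 0" for j n
    using ok[of j] by (simp_all add: ok_def)
  define x where "x \<alpha> = (\<Prod>j\<in>UNIV. c j (\<alpha> $ j))" for \<alpha>
  have finB: "finite (B j)" for j by (simp add: B_def)
  have dform: "(\<Sum>n\<in>B j. \<Sum>n'\<in>B j. c j n * c j n' * dgram n n') = 2 * 2 ^ (\<beta> $ j)" for j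
  proof -
    have "(\<Sum>n\<in>B j. \<Sum>n'\<in>B j. c j n * c j n' * dgram n n') =
        (\<Sum>n\<in>B j. \<Sum>n'\<in>B j. if n = n' then (c j n)\<^sup>2 * dgram n n else 0)"
      by (intro sum.cong refl) (auto simp: B_def dgram_off_diag power2_eq_square)
    also have "\<dots> = (\<Sum>n\<in>B j. (c j n)\<^sup>2 * dgram n n)" using finB by (simp add: sum.delta)
    finally show ?thesis by (simp only: c(3))
  qed
  have VB: "vbox B \<subseteq> HB_idx \<Lambda>"
  proof
    fix \<alpha> assume a: "\<alpha> \<in> vbox B"
    then have "\<alpha> \<in> pos_idx" by (auto simp: vbox_def B_def pos_idx_def)
    moreover have "multi_block_of \<alpha> \<le> \<beta>"
      using a by (auto simp: less_eq_vec_def multi_block_of_def vbox_def B_def intro!: block_of_less)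
    then have "multi_block_of \<alpha> \<in> \<Lambda>" using down[OF \<beta>(1) multi_block_of_pos] by blast
    ultimately show "\<alpha> \<in> HB_idx \<Lambda>" using pos by (simp add: mem_HB_idx_iff)
  qed
  have finHB: "finite (HB_idx \<Lambda>)" using \<Lambda>(1) by (simp add: HB_idx_def)
  have en: "energy (HB_idx \<Lambda>) x l \<le> 3 * 4 ^ m * (2 / 3) ^ CARD('n) / 2 ^ norm1 \<beta>" for l
  proof -
    have "energy (HB_idx \<Lambda>) x l = energy (vbox B) x l"
    proof (rule energy_superset[OF finHB VB, symmetric])
      fix \<alpha> assume "\<alpha> \<in> HB_idx \<Lambda> - vbox B"
      then obtain j where "\<alpha> $ j \<notin> B j" by (auto simp: vbox_def)
      then have "c j (\<alpha> $ j) = 0" by (rule c(4))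
      then show "x \<alpha> = 0" unfolding x_def by (intro prod_zero) auto
    qed
    also have "\<dots> = (\<Prod>j\<in>UNIV. \<Sum>n\<in>B j. \<Sum>n'\<in>B j. c j n * c j n' * kern l j n n')"
      unfolding energy_def x_def by (rule tensor_qform_product[OF finB])
    also have "\<dots> = (\<Prod>j\<in>UNIV. (if j = l then 3 * 4 ^ (\<beta> $ l) else 1) * (2 / 3 / 2 ^ (\<beta> $ j)))"
    proof (intro prod.cong refl)
      fix j
      have four: "(4::real) ^ (\<beta> $ l) = 2 ^ (\<beta> $ l) * 2 ^ (\<beta> $ l)" by (simp flip: power_mult_distrib)
      show "(\<Sum>n\<in>B j. \<Sum>n'\<in>B j. c j n * c j n' * kern l j n n') =
          (if j = l then 3 * 4 ^ (\<beta> $ l) else 1) * (2 / 3 / 2 ^ (\<beta> $ j))"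
        using c(2)[of j] dform[of j] by (auto simp: kern_def four)
    qed
    also have "\<dots> = 3 * 4 ^ (\<beta> $ l) * (\<Prod>j\<in>UNIV. 2 / 3 / 2 ^ (\<beta> $ j))"
      unfolding prod.distrib by (simp add: prod.delta)
    also have "(\<Prod>j\<in>UNIV. 2 / 3 / (2::real) ^ (\<beta> $ j)) = (2 / 3) ^ CARD('n) / 2 ^ norm1 \<beta>"
      by (simp only: prod_dividef prod_power_vec prod_constant power_divide)
    finally have "energy (HB_idx \<Lambda>) x l = 3 * 4 ^ (\<beta> $ l) * ((2 / 3) ^ CARD('n) / 2 ^ norm1 \<beta>)" .
    moreover have "3 * (4::real) ^ (\<beta> $ l) \<le> 3 * 4 ^ m" using lev(2)[of l] by (simp add: power_increasing)
    ultimately show ?thesis by (simp add: mult_right_mono divide_right_mono)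
  qed
  have E: "total_energy \<Lambda> x \<le> real CARD('n) * (3 * 4 ^ m * (2 / 3) ^ CARD('n) / 2 ^ norm1 \<beta>)"
    unfolding total_energy_def using sum_bounded_above[of UNIV "energy (HB_idx \<Lambda>) x", OF en] by simp
  define \<beta>' :: "nat ^ 'n" where "\<beta>' = (\<chi> j. if j = i then m else 1)"
  have m1: "m \<ge> 1" using lev[of i] by linarith
  have \<beta>': "\<beta>' \<in> \<Lambda>"
  proof (rule down[OF \<beta>(1)])
    show "\<beta>' \<in> pos_idx" using m1 by (auto simp: \<beta>'_def pos_idx_def)
    show "\<beta>' \<le> \<beta>" using lev(1) i by (auto simp: \<beta>'_def less_eq_vec_def m_def)
  qed
  have \<alpha>0: "\<alpha>0 \<in> block \<beta>'" using m1 by (auto simp: \<alpha>0_def \<beta>'_def block_def dyadic_block_def)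
  have "norm1 \<beta>' \<le> (\<Sum>j\<in>UNIV. (if j = i then m else 0) + 1)"
    unfolding norm1_def by (intro sum_mono) (auto simp: \<beta>'_def)
  also have "\<dots> = m + CARD('n)" unfolding sum.distrib by (simp add: sum.delta)
  finally have n1: "(2::real) ^ norm1 \<beta>' \<le> 2 ^ (m + CARD('n))" by (intro power_increasing) auto
  have "m \<le> norm_inf \<beta>'" using le_norm_inf[of \<beta>' i] by (simp add: \<beta>'_def)
  then have "(4::real) ^ m \<le> 4 ^ norm_inf \<beta>'" by (intro power_increasing) auto
  then have "4 ^ m * (2 / 3) ^ CARD('n) / 2 ^ (m + CARD('n)) \<le> wt \<beta>'"
    unfolding wt_def using n1 by (intro frac_le mult_right_mono) auto
  also have "wt \<beta>' \<le> wt \<beta>' * (\<Sum>\<alpha>\<in>block \<beta>'. (x \<alpha>)\<^sup>2)"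
  proof -
    have "(x \<alpha>0)\<^sup>2 \<le> (\<Sum>\<alpha>\<in>block \<beta>'. (x \<alpha>)\<^sup>2)" by (rule member_le_sum) (use \<alpha>0 in auto)
    moreover have "x \<alpha>0 = 1" by (simp add: x_def c(1))
    ultimately have "1 \<le> (\<Sum>\<alpha>\<in>block \<beta>'. (x \<alpha>)\<^sup>2)" by simp
    then show ?thesis using mult_left_mono[of 1 _ "wt \<beta>'"] wt_pos[of \<beta>'] by simp
  qed
  also have "\<dots> \<le> split_norm \<Lambda> x"
    unfolding split_norm_def using \<Lambda>(1) \<beta>'
    by (intro member_le_sum) (auto intro!: mult_nonneg_nonneg sum_nonneg less_imp_le[OF wt_pos])
  finally have N: "4 ^ m * (2 / 3) ^ CARD('n) / 2 ^ (m + CARD('n)) \<le> split_norm \<Lambda> x" .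
  have nt: "real (nt'_idx \<Lambda>) = 2 ^ norm1 \<beta> / 2 ^ m"
    unfolding \<beta>(2) real_power_norm_diff m_def ..
  have "real CARD('n) * (3 * 4 ^ m * (2 / 3) ^ CARD('n) / 2 ^ norm1 \<beta>) =
      3 * real CARD('n) * 2 ^ CARD('n) / real (nt'_idx \<Lambda>) * (4 ^ m * (2 / 3) ^ CARD('n) / 2 ^ (m + CARD('n)))"
    unfolding nt by (simp add: power_add)
  also have "\<dots> \<le> 3 * real CARD('n) * 2 ^ CARD('n) / real (nt'_idx \<Lambda>) * split_norm \<Lambda> x"
    by (intro mult_left_mono N) auto
  finally have "total_energy \<Lambda> x \<le> 3 * real CARD('n) * 2 ^ CARD('n) / real (nt'_idx \<Lambda>) * split_norm \<Lambda> x"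
    using E by linarith
  moreover have "split_norm \<Lambda> x > 0"
    by (rule less_le_trans[OF _ N]) simp
  ultimately show ?thesis by blast
qed

section \<open>The condition number\<close>

definition HB_scale :: "nat ^ 'n::finite \<Rightarrow> real" where
  "HB_scale \<alpha> = 2 ^ norm_inf (multi_block_of \<alpha>) * L2_norm (faber_prod \<alpha>)"

lemma HB_scale_square:
  fixes \<alpha> :: "nat ^ 'n::finite"
  assumes "\<alpha> \<in> pos_idx"
  shows "(HB_scale \<alpha>)\<^sup>2 = wt (multi_block_of \<alpha>)" "HB_scale \<alpha> > 0"
proof -
  let ?\<beta> = "multi_block_of \<alpha>"
  have "(L2_norm (faber_prod \<alpha>))\<^sup>2 = (\<Prod>j\<in>UNIV. 2 / 3 / 2 ^ (?\<beta> $ j))"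
    by (simp add: L2_norm_faber_prod[OF assms] gram_diag multi_block_of_def)
  also have "\<dots> = (2 / 3) ^ CARD('n) / 2 ^ norm1 ?\<beta>"
    by (simp only: prod_dividef prod_power_vec prod_constant power_divide)
  finally show sq: "(HB_scale \<alpha>)\<^sup>2 = wt ?\<beta>"
    by (simp add: HB_scale_def wt_def power_mult_distrib power_mult[symmetric] mult.commute[of _ 2])
      (simp add: power_mult)
  have "HB_scale \<alpha> \<ge> 0" by (simp add: HB_scale_def L2_norm_def)
  moreover have "HB_scale \<alpha> \<noteq> 0" using sq wt_pos[of ?\<beta>] by auto
  ultimately show "HB_scale \<alpha> > 0" by simp
qed

lemma HB_fun_combination:
  fixes A :: "(nat ^ 'n::finite) set"
  shows "(\<lambda>x. \<Sum>\<alpha>\<in>A. v \<alpha> * HB_fun \<alpha> x) = (\<lambda>x. \<Sum>\<alpha>\<in>A. v \<alpha> / HB_scale \<alpha> * faber_prod \<alpha> x)"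
  by (simp add: HB_fun_def HB_scale_def)

lemma HB_combination_H10:
  fixes A :: "(nat ^ 'n::finite) set"
  assumes "finite A" "A \<subseteq> pos_idx"
  shows "(\<lambda>x. \<Sum>\<alpha>\<in>A. v \<alpha> * HB_fun \<alpha> x) \<in> H10"
  unfolding HB_fun_combination by (rule faber_combination_H10(1)[OF assms])

lemma HB_fun_H10:
  assumes "\<alpha> \<in> pos_idx"
  shows "HB_fun \<alpha> \<in> H10"
  using HB_combination_H10[of "{\<alpha>}" "\<lambda>_. 1"] assms by simp

lemma elliptic_formD:
  assumes "elliptic_form \<mu>0 \<mu>1 a"
  shows "u \<in> H10 \<Longrightarrow> v \<in> H10 \<Longrightarrow> a u v = a v u"
    and "u \<in> H10 \<Longrightarrow> v \<in> H10 \<Longrightarrow> w \<in> H10 \<Longrightarrow>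
      a (\<lambda>x. r * u x + s * v x) w = r * a u w + s * a v w"
    and "u \<in> H10 \<Longrightarrow> \<mu>0 * (H10_norm u)\<^sup>2 \<le> a u u"
    and "u \<in> H10 \<Longrightarrow> a u u \<le> \<mu>1 * (H10_norm u)\<^sup>2"
  using assms by (simp_all add: elliptic_form_def)

lemma elliptic_form_sum:
  fixes A :: "(nat ^ 'n::finite) set"
  assumes a: "elliptic_form \<mu>0 \<mu>1 a" and A: "finite A" "A \<subseteq> pos_idx" and w: "w \<in> H10"
  shows "a (\<lambda>x. \<Sum>\<alpha>\<in>A. v \<alpha> * HB_fun \<alpha> x) w = (\<Sum>\<alpha>\<in>A. v \<alpha> * a (HB_fun \<alpha>) w)"
  using A
proof (induction A)
  case empty
  have "a (\<lambda>x. 0 * w x + 0 * w x) w = 0 * a w w + 0 * a w w"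
    by (rule elliptic_formD(2)[OF a w w w])
  then show ?case by simp
next
  case (insert \<alpha> A)
  let ?g = "\<lambda>x. \<Sum>\<alpha>\<in>A. v \<alpha> * HB_fun \<alpha> x"
  have "HB_fun \<alpha> \<in> H10" "?g \<in> H10" using insert by (auto intro: HB_fun_H10 HB_combination_H10)
  then have "a (\<lambda>x. v \<alpha> * HB_fun \<alpha> x + 1 * ?g x) w = v \<alpha> * a (HB_fun \<alpha>) w + 1 * a ?g w"
    using w by (intro elliptic_formD(2)[OF a])
  then show ?case using insert by simp
qed

lemma stiffness_qform:
  fixes \<Lambda> :: "(nat ^ 'n::finite) set"
  assumes a: "elliptic_form \<mu>0 \<mu>1 a" and \<Lambda>: "finite \<Lambda>" "\<Lambda> \<subseteq> pos_idx"
  shows "\<mu>0 * total_energy \<Lambda> (\<lambda>\<alpha>. v \<alpha> / HB_scale \<alpha>) \<le> qform (HB_idx \<Lambda>) (HB_stiffness a) v"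
    and "qform (HB_idx \<Lambda>) (HB_stiffness a) v \<le> \<mu>1 * total_energy \<Lambda> (\<lambda>\<alpha>. v \<alpha> / HB_scale \<alpha>)"
    and "(\<Sum>\<alpha>\<in>HB_idx \<Lambda>. (v \<alpha>)\<^sup>2) = split_norm \<Lambda> (\<lambda>\<alpha>. v \<alpha> / HB_scale \<alpha>)"
proof -
  let ?T = "HB_idx \<Lambda>" and ?x = "\<lambda>\<alpha>. v \<alpha> / HB_scale \<alpha>"
  have T: "finite ?T" "?T \<subseteq> pos_idx" using \<Lambda> by (auto simp: HB_idx_def mem_block_iff subset_iff)
  define u where "u = (\<lambda>x. \<Sum>\<alpha>\<in>?T. v \<alpha> * HB_fun \<alpha> x)"
  have u: "u \<in> H10" unfolding u_def by (rule HB_combination_H10[OF T])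
  have "qform ?T (HB_stiffness a) v = (\<Sum>\<alpha>\<in>?T. v \<alpha> * (\<Sum>\<alpha>'\<in>?T. v \<alpha>' * a (HB_fun \<alpha>') (HB_fun \<alpha>)))"
    unfolding qform_def sum_distrib_left
  proof (intro sum.cong refl)
    fix \<alpha> \<alpha>' assume "\<alpha> \<in> ?T" "\<alpha>' \<in> ?T"
    then have "HB_fun \<alpha> \<in> H10" "HB_fun \<alpha>' \<in> H10" using T by (auto intro: HB_fun_H10)
    then have "a (HB_fun \<alpha>) (HB_fun \<alpha>') = a (HB_fun \<alpha>') (HB_fun \<alpha>)"
      by (rule elliptic_formD(1)[OF a])
    then show "HB_stiffness a \<alpha> \<alpha>' * v \<alpha> * v \<alpha>' = v \<alpha> * (v \<alpha>' * a (HB_fun \<alpha>') (HB_fun \<alpha>))"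
      by (simp add: HB_stiffness_def)
  qed
  also have "\<dots> = (\<Sum>\<alpha>\<in>?T. v \<alpha> * a u (HB_fun \<alpha>))"
    unfolding u_def using T by (intro sum.cong refl) (simp add: elliptic_form_sum[OF a] HB_fun_H10 subset_iff)
  also have "\<dots> = (\<Sum>\<alpha>\<in>?T. v \<alpha> * a (HB_fun \<alpha>) u)"
  proof (intro sum.cong refl)
    fix \<alpha> assume "\<alpha> \<in> ?T"
    then have "HB_fun \<alpha> \<in> H10" using T by (auto intro: HB_fun_H10)
    then have "a u (HB_fun \<alpha>) = a (HB_fun \<alpha>) u" using u by (intro elliptic_formD(1)[OF a])
    then show "v \<alpha> * a u (HB_fun \<alpha>) = v \<alpha> * a (HB_fun \<alpha>) u" by simp
  qed
  also have "\<dots> = a u u"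
    unfolding u_def by (rule elliptic_form_sum[OF a T HB_combination_H10[OF T], symmetric])
  finally have q: "qform ?T (HB_stiffness a) v = a u u" .
  have "(H10_norm u)\<^sup>2 = total_energy \<Lambda> ?x"
    unfolding u_def HB_fun_combination total_energy_def by (rule faber_combination_H10(2)[OF T])
  then show "\<mu>0 * total_energy \<Lambda> ?x \<le> qform ?T (HB_stiffness a) v"
    "qform ?T (HB_stiffness a) v \<le> \<mu>1 * total_energy \<Lambda> ?x"
    using elliptic_formD(3,4)[OF a u] unfolding q by simp_all
  show "(\<Sum>\<alpha>\<in>?T. (v \<alpha>)\<^sup>2) = split_norm \<Lambda> ?x"
    unfolding split_norm_def sum_HB_idx[OF \<Lambda>] sum_distrib_left
  proof (intro sum.cong refl)
    fix \<beta> \<alpha> assume "\<beta> \<in> \<Lambda>" "\<alpha> \<in> block \<beta>"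
    then have "\<alpha> \<in> pos_idx" "multi_block_of \<alpha> = \<beta>" using \<Lambda>(2) by (auto simp: mem_block_iff subset_iff)
    then show "(v \<alpha>)\<^sup>2 = wt \<beta> * (v \<alpha> / HB_scale \<alpha>)\<^sup>2"
      using HB_scale_square[of \<alpha>] wt_pos[of \<beta>] by (simp add: power_divide)
  qed
qed

lemma kappa_HB_bounds:
  fixes \<Lambda> :: "(nat ^ 'n::finite) set"
  assumes a: "elliptic_form \<mu>0 \<mu>1 a" and \<mu>: "0 < \<mu>0" "\<mu>0 \<le> \<mu>1"
    and \<Lambda>: "finite \<Lambda>" "\<Lambda> \<noteq> {}" "monotone_idx \<Lambda>"
  shows "\<mu>0 / (real CARD('n) * 64 ^ CARD('n)) / (\<mu>1 * (3 * real CARD('n) * 2 ^ CARD('n))) *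
      real (n_idx \<Lambda>) * real (nt'_idx \<Lambda>) \<le> kappa_HB a \<Lambda>"
    and "kappa_HB a \<Lambda> \<le> (\<mu>1 * (6 * real CARD('n))) * (2 * real CARD('n) * 32 ^ CARD('n)) / \<mu>0 *
      real (n_idx \<Lambda>) * real (nt_idx \<Lambda>)"
proof -
  let ?d = "real CARD('n)" and ?T = "HB_idx \<Lambda>" and ?A = "HB_stiffness a"
  let ?n = "real (n_idx \<Lambda>)" and ?nt = "real (nt_idx \<Lambda>)" and ?nt' = "real (nt'_idx \<Lambda>)"
  have pos: "\<Lambda> \<subseteq> pos_idx" using \<Lambda>(3) by (simp add: monotone_idx_def)
  obtain R P where "gram_factor (k_max \<Lambda>) R P" using gram_factor_exists by blast
  then interpret gram_factor "k_max \<Lambda>" R P .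
  note kM = norm_inf_le_k_max[OF \<Lambda>(1)]
  have fin: "finite ?T" using \<Lambda>(1) by (simp add: HB_idx_def)
  have ne: "?T \<noteq> {}"
  proof -
    obtain \<beta> where "\<beta> \<in> \<Lambda>" using \<Lambda>(2) by auto
    moreover have "(\<chi> j. 2 ^ (\<beta> $ j - 1)) \<in> block \<beta>"
      using \<open>\<beta> \<in> \<Lambda>\<close> pos by (auto simp: block_def dyadic_block_def pos_idx_def subset_iff Suc_le_eq)
    ultimately show ?thesis by (auto simp: HB_idx_def)
  qed
  have sym: "?A \<alpha> \<alpha>' = ?A \<alpha>' \<alpha>" if "\<alpha> \<in> ?T" "\<alpha>' \<in> ?T" for \<alpha> \<alpha>'
  proof -
    have "HB_fun \<alpha> \<in> H10" "HB_fun \<alpha>' \<in> H10"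
      using that pos by (auto simp: mem_HB_idx_iff intro!: HB_fun_H10)
    then show ?thesis unfolding HB_stiffness_def by (rule elliptic_formD(1)[OF a])
  qed
  note ext = extremal_eigenvalues[of ?T ?A, OF fin ne sym]
  note qf = stiffness_qform[OF a \<Lambda>(1) pos]
  have E_nonneg: "total_energy \<Lambda> x \<ge> 0" for x
  proof -
    have "energy ?T x i = energy Qd (\<lambda>\<alpha>. if \<alpha> \<in> ?T then x \<alpha> else 0) i" for i
      by (rule energy_restrict[OF finite_Qd HB_idx_subset_Qd[OF pos kM]])
    then show ?thesis unfolding total_energy_def by (intro sum_nonneg) (simp only: energy_nonneg)
  qed
  have lift: "\<exists>v. split_norm \<Lambda> (\<lambda>\<alpha>. v \<alpha> / HB_scale \<alpha>) = split_norm \<Lambda> x \<and>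
      total_energy \<Lambda> (\<lambda>\<alpha>. v \<alpha> / HB_scale \<alpha>) = total_energy \<Lambda> x" for x
  proof (intro exI[of _ "\<lambda>\<alpha>. x \<alpha> * HB_scale \<alpha>"] conjI)
    have eq: "x \<alpha> * HB_scale \<alpha> / HB_scale \<alpha> = x \<alpha>" if "\<alpha> \<in> pos_idx" for \<alpha>
      using HB_scale_square(2)[OF that] by simp
    have "x \<alpha> * HB_scale \<alpha> / HB_scale \<alpha> = x \<alpha>" if "\<beta> \<in> \<Lambda>" "\<alpha> \<in> block \<beta>" for \<alpha> \<beta>
      using that pos by (intro eq) (auto simp: mem_block_iff subset_iff)
    then show "split_norm \<Lambda> (\<lambda>\<alpha>. x \<alpha> * HB_scale \<alpha> / HB_scale \<alpha>) = split_norm \<Lambda> x"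
      unfolding split_norm_def by (intro sum.cong arg_cong2[where f="(*)"] refl) simp
    have "x \<alpha> * HB_scale \<alpha> / HB_scale \<alpha> = x \<alpha>" if "\<alpha> \<in> ?T" for \<alpha>
      using that pos by (intro eq) (auto simp: mem_HB_idx_iff)
    then show "total_energy \<Lambda> (\<lambda>\<alpha>. x \<alpha> * HB_scale \<alpha> / HB_scale \<alpha>) = total_energy \<Lambda> x"
      unfolding total_energy_def by (intro sum.cong refl energy_cong)
  qed
  let ?Max = "Max (eigenvalues_on ?T ?A)" and ?Min = "Min (eigenvalues_on ?T ?A)"
  have max_le: "?Max \<le> \<mu>1 * (6 * ?d) * ?n"
  proof (rule ext(3))
    fix v :: "nat ^ 'n \<Rightarrow> real"
    have "total_energy \<Lambda> x \<le> ?d * (6 * ?n * split_norm \<Lambda> x)" for x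
      unfolding total_energy_def
      using sum_bounded_above[of UNIV "energy ?T x"] energy_upper[OF \<Lambda>(1) pos kM] by simp
    then have "\<mu>1 * total_energy \<Lambda> (\<lambda>\<alpha>. v \<alpha> / HB_scale \<alpha>) \<le>
        \<mu>1 * (?d * (6 * ?n * split_norm \<Lambda> (\<lambda>\<alpha>. v \<alpha> / HB_scale \<alpha>)))"
      using \<mu> by (intro mult_left_mono) auto
    with qf(2)[of v] show "qform ?T ?A v \<le> \<mu>1 * (6 * ?d) * ?n * (\<Sum>\<alpha>\<in>?T. (v \<alpha>)\<^sup>2)"
      unfolding qf(3) by (simp only: mult_ac)
  qed
  have max_ge: "\<mu>0 / (?d * 64 ^ CARD('n)) * ?n \<le> ?Max"
  proof -
    obtain x where x: "split_norm \<Lambda> x > 0" "total_energy \<Lambda> x \<ge> ?n / (?d * 64 ^ CARD('n)) * split_norm \<Lambda> x"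
      using energy_lower[OF \<Lambda>(1,2) pos kM] by blast
    obtain v where v: "split_norm \<Lambda> (\<lambda>\<alpha>. v \<alpha> / HB_scale \<alpha>) = split_norm \<Lambda> x"
      "total_energy \<Lambda> (\<lambda>\<alpha>. v \<alpha> / HB_scale \<alpha>) = total_energy \<Lambda> x" using lift by blast
    have "\<mu>0 * (?n / (?d * 64 ^ CARD('n)) * split_norm \<Lambda> x) \<le> \<mu>0 * total_energy \<Lambda> x"
      using x(2) \<mu> by (intro mult_left_mono) auto
    also have "\<dots> \<le> qform ?T ?A v" using qf(1)[of v] v by simp
    finally have "\<mu>0 / (?d * 64 ^ CARD('n)) * ?n \<le> qform ?T ?A v / split_norm \<Lambda> x"
      using x(1) by (simp add: pos_le_divide_eq)
    also have "\<dots> \<le> ?Max" using ext(1)[of v] qf(3)[of v] v x(1) by simp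
    finally show ?thesis .
  qed
  have min_le: "?Min \<le> \<mu>1 * (3 * ?d * 2 ^ CARD('n)) / ?nt'"
  proof -
    obtain x where x: "split_norm \<Lambda> x > 0" "total_energy \<Lambda> x \<le> 3 * ?d * 2 ^ CARD('n) / ?nt' * split_norm \<Lambda> x"
      using energy_min_upper[OF \<Lambda>] by blast
    obtain v where v: "split_norm \<Lambda> (\<lambda>\<alpha>. v \<alpha> / HB_scale \<alpha>) = split_norm \<Lambda> x"
      "total_energy \<Lambda> (\<lambda>\<alpha>. v \<alpha> / HB_scale \<alpha>) = total_energy \<Lambda> x" using lift by blast
    have "?Min \<le> qform ?T ?A v / split_norm \<Lambda> x" using ext(2)[of v] qf(3)[of v] v x(1) by simp
    also have "\<dots> \<le> \<mu>1 * (3 * ?d * 2 ^ CARD('n)) / ?nt'"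
    proof -
      have "qform ?T ?A v \<le> \<mu>1 * total_energy \<Lambda> x" using qf(2)[of v] v by simp
      also have "\<dots> \<le> \<mu>1 * (3 * ?d * 2 ^ CARD('n) / ?nt' * split_norm \<Lambda> x)"
        using x(2) \<mu> by (intro mult_left_mono) auto
      finally show ?thesis using x(1) by (simp add: pos_divide_le_eq)
    qed
    finally show ?thesis .
  qed
  let ?C = "2 * ?d * 32 ^ CARD('n) * ?nt"
  have sn: "split_norm \<Lambda> x \<le> ?C * total_energy \<Lambda> x" for x :: "nat ^ 'n \<Rightarrow> real"
    by (rule split_norm_bound[OF \<Lambda>(1,3) kM])
  have Cpos: "?C > 0"
  proof -
    obtain x where x: "split_norm \<Lambda> x > 0" using energy_min_upper[OF \<Lambda>] by blast
    then have "0 < ?C * total_energy \<Lambda> x" using sn[of x] by linarith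
    then show ?thesis using E_nonneg[of x] by (auto simp: zero_less_mult_iff)
  qed
  have min_ge: "\<mu>0 / ?C \<le> ?Min"
  proof (rule ext(4))
    fix v :: "nat ^ 'n \<Rightarrow> real"
    let ?x = "\<lambda>\<alpha>. v \<alpha> / HB_scale \<alpha>"
    have "\<mu>0 / ?C * split_norm \<Lambda> ?x \<le> \<mu>0 / ?C * (?C * total_energy \<Lambda> ?x)"
      using Cpos \<mu> by (intro mult_left_mono sn) auto
    also have "\<dots> = \<mu>0 * total_energy \<Lambda> ?x"
    proof -
      have "\<mu>0 / C * (C * t) = \<mu>0 * t" if "C > 0" for C t :: real using that by simp
      from this[OF Cpos] show ?thesis .
    qed
    also have "\<dots> \<le> qform ?T ?A v" by (rule qf(1))
    finally show "\<mu>0 / ?C * (\<Sum>\<alpha>\<in>?T. (v \<alpha>)\<^sup>2) \<le> qform ?T ?A v" unfolding qf(3) .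
  qed
  have min_pos: "?Min > 0" using min_ge Cpos \<mu> by (meson divide_pos_pos less_le_trans)
  have max_pos: "?Max \<ge> 0" using max_ge \<mu> by (intro order_trans[OF _ max_ge]) auto
  have nt'_pos: "?nt' > 0"
  proof (rule ccontr)
    assume "\<not> ?thesis"
    then have "?nt' = 0" by simp
    then show False using min_le min_pos by simp
  qed
  have "\<mu>0 / (?d * 64 ^ CARD('n)) / (\<mu>1 * (3 * ?d * 2 ^ CARD('n))) * ?n * ?nt' =
      (\<mu>0 / (?d * 64 ^ CARD('n)) * ?n) / (\<mu>1 * (3 * ?d * 2 ^ CARD('n)) / ?nt')" by simp
  also have "\<dots> \<le> ?Max / ?Min"
    using max_ge min_le min_pos max_pos by (intro frac_le) auto
  finally show "\<mu>0 / (?d * 64 ^ CARD('n)) / (\<mu>1 * (3 * ?d * 2 ^ CARD('n))) * ?n * ?nt' \<le> kappa_HB a \<Lambda>"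
    by (simp add: kappa_HB_def)
  have "?Max / ?Min \<le> (\<mu>1 * (6 * ?d) * ?n) / (\<mu>0 / ?C)"
    using max_le min_ge Cpos \<mu> by (intro frac_le) auto
  also have "\<dots> = (\<mu>1 * (6 * ?d)) * (2 * ?d * 32 ^ CARD('n)) / \<mu>0 * ?n * ?nt" by simp
  finally show "kappa_HB a \<Lambda> \<le> (\<mu>1 * (6 * ?d)) * (2 * ?d * 32 ^ CARD('n)) / \<mu>0 * ?n * ?nt"
    by (simp add: kappa_HB_def)
qed

section \<open>Asymptotics for sparse and full grids\<close>

lemma card_vbox:
  fixes B :: "'n::finite \<Rightarrow> nat set"
  assumes "\<And>i. finite (B i)"
  shows "card (vbox B) = (\<Prod>i\<in>UNIV. card (B i))"
proof -
  have "card (vbox B) = (\<Sum>\<alpha>\<in>vbox B. \<Prod>i\<in>(UNIV::'n set). 1)" by simp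
  also have "\<dots> = (\<Prod>i\<in>UNIV. \<Sum>n\<in>B i. 1)" by (rule sum_prod_vbox[OF assms])
  finally show ?thesis by simp
qed

definition top_box :: "'n::finite \<Rightarrow> nat \<Rightarrow> (nat ^ 'n) set" where
  "top_box i m = vbox (\<lambda>j. if j = i then {m} else {1..m})"

lemma finite_top_box: "finite (top_box i m)"
  unfolding top_box_def by (rule finite_vbox) auto

lemma top_box_norms:
  assumes "\<beta> \<in> top_box i m"
  shows "norm_inf \<beta> = m" "norm1 \<beta> - norm_inf \<beta> = (\<Sum>j\<in>UNIV - {i}. \<beta> $ j)"
proof -
  have b: "\<beta> $ j \<in> (if j = i then {m} else {1..m})" for j using assms by (auto simp: top_box_def vbox_def)
  have i: "\<beta> $ i = m" using b[of i] by simp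
  have "\<beta> $ j \<le> m" for j using b[of j] by (auto split: if_splits)
  then show n: "norm_inf \<beta> = m" using le_norm_inf[of \<beta> i] i by (intro antisym) (auto simp: norm_inf_le_iff)
  have "norm1 \<beta> = m + (\<Sum>j\<in>UNIV - {i}. \<beta> $ j)" unfolding norm1_def by (subst sum.remove[of _ i]) (auto simp: i)
  then show "norm1 \<beta> - norm_inf \<beta> = (\<Sum>j\<in>UNIV - {i}. \<beta> $ j)" using n by simp
qed

lemma card_top_box: "card (top_box i m) = m ^ (CARD('n) - 1)" for i :: "'n::finite"
proof -
  have "card (top_box i m) = (\<Prod>j\<in>UNIV. card (if j = i then {m} else {1..m}))"
    unfolding top_box_def by (rule card_vbox) auto
  also have "\<dots> = (\<Prod>j\<in>UNIV - {i}. m)"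
    by (subst prod.remove[of _ i]) (auto intro!: prod.cong)
  finally show ?thesis by (simp add: card_Diff_singleton)
qed

lemma layer_subset_top_box:
  assumes "\<Lambda> \<subseteq> pos_idx"
  shows "layer \<Lambda> m \<subseteq> (\<Union>i. top_box i m)"
proof
  fix \<beta> assume b: "\<beta> \<in> layer \<Lambda> m"
  obtain i where "\<beta> $ i = norm_inf \<beta>" by (rule norm_inf_attained)
  then have "\<beta> \<in> top_box i m"
    using b assms le_norm_inf[of \<beta>] by (auto simp: layer_def top_box_def vbox_def pos_idx_def)
  then show "\<beta> \<in> (\<Union>i. top_box i m)" by blast
qed

lemma n_idx_le:
  fixes \<Lambda> :: "(nat ^ 'n::finite) set"
  assumes \<Lambda>: "finite \<Lambda>" "\<Lambda> \<noteq> {}" "\<Lambda> \<subseteq> pos_idx"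
  shows "n_idx \<Lambda> \<le> CARD('n) * k_max \<Lambda> ^ (CARD('n) - 1)"
proof -
  obtain k where k: "k \<in> {1..k_max \<Lambda>}" "card (layer \<Lambda> k) = n_idx \<Lambda>"
    using n_idx_attained[OF \<Lambda>] by blast
  have "card (layer \<Lambda> k) \<le> card (\<Union>i. top_box i k :: (nat ^ 'n) set)"
    by (intro card_mono layer_subset_top_box \<Lambda> finite_UN_I finite_top_box) simp
  also have "\<dots> \<le> (\<Sum>i\<in>(UNIV :: 'n set). card (top_box i k))" by (rule card_UN_le) simp
  also have "\<dots> = CARD('n) * k ^ (CARD('n) - 1)" by (simp add: card_top_box)
  also have "\<dots> \<le> CARD('n) * k_max \<Lambda> ^ (CARD('n) - 1)" using k by (intro mult_left_mono power_mono) auto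
  finally show ?thesis using k by simp
qed

lemma cube_lower_bounds:
  fixes \<Lambda> :: "(nat ^ 'n::finite) set"
  assumes \<Lambda>: "finite \<Lambda>" "monotone_idx \<Lambda>" and m: "(\<chi> j. m) \<in> \<Lambda>"
  shows "m ^ (CARD('n) - 1) \<le> n_idx \<Lambda>" "2 ^ ((CARD('n) - 1) * m) \<le> nt'_idx \<Lambda>"
proof -
  have pos: "\<Lambda> \<subseteq> pos_idx" using \<Lambda>(2) by (simp add: monotone_idx_def)
  have m1: "m \<ge> 1" using m pos by (auto simp: pos_idx_def)
  fix i :: 'n
  have sub: "top_box i m \<subseteq> layer \<Lambda> m"
  proof
    fix \<beta> assume b: "\<beta> \<in> top_box i m"
    have r: "1 \<le> \<beta> $ j \<and> \<beta> $ j \<le> m" for j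
    proof -
      have "\<beta> $ j \<in> (if j = i then {m} else {1..m})" using b by (auto simp: top_box_def vbox_def)
      then show ?thesis using m1 by (auto split: if_splits)
    qed
    then have "\<beta> \<in> pos_idx" "\<beta> \<le> (\<chi> j. m)" by (auto simp: pos_idx_def less_eq_vec_def)
    then have "\<beta> \<in> \<Lambda>" using \<Lambda>(2) m unfolding monotone_idx_def by blast
    then show "\<beta> \<in> layer \<Lambda> m" using top_box_norms(1)[OF b] by (simp add: layer_def)
  qed
  have "finite (layer \<Lambda> m)" using \<Lambda>(1) by (simp add: layer_def)
  then have "card (top_box i m) \<le> card (layer \<Lambda> m)" using sub by (rule card_mono)
  then show "m ^ (CARD('n) - 1) \<le> n_idx \<Lambda>"
    using card_layer_le[OF \<Lambda>(1) pos, of m] by (simp add: card_top_box)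
  have mem: "(\<chi> j. m) \<in> top_box i m" using m1 by (auto simp: top_box_def vbox_def)
  have "norm1 (\<chi> j. m :: nat ^ 'n) - norm_inf (\<chi> j. m :: nat ^ 'n) = (CARD('n) - 1) * m"
    using top_box_norms(2)[OF mem] by (simp add: card_Diff_singleton)
  moreover have "2 ^ (norm1 (\<chi> j. m :: nat ^ 'n) - norm_inf (\<chi> j. m :: nat ^ 'n)) \<le> nt'_idx \<Lambda>"
    unfolding nt'_idx_def using \<Lambda>(1) m by (intro Max_ge) auto
  ultimately show "2 ^ ((CARD('n) - 1) * m) \<le> nt'_idx \<Lambda>" by simp
qed

lemma sum_powers_le:
  fixes q :: real
  assumes "q > 1"
  shows "(\<Sum>b\<in>{1..m}. q ^ b) \<le> q / (q - 1) * q ^ m"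
proof (induction m)
  case (Suc m)
  have "q / (q - 1) * q ^ m + q ^ Suc m = q / (q - 1) * q ^ Suc m" using assms by (simp add: field_simps)
  then show ?case using Suc by simp
qed (use assms in simp)

lemma layer_power_sum:
  fixes \<Lambda> :: "(nat ^ 'n::finite) set" and q :: real
  assumes "\<Lambda> \<subseteq> pos_idx" and q: "q > 1"
  shows "(\<Sum>\<beta>\<in>layer \<Lambda> m. q ^ (norm1 \<beta> - norm_inf \<beta>)) \<le> real CARD('n) * (q / (q - 1) * q ^ m) ^ (CARD('n) - 1)"
proof -
  have box: "(\<Sum>\<beta>\<in>top_box i m. q ^ (norm1 \<beta> - norm_inf \<beta>)) \<le> (q / (q - 1) * q ^ m) ^ (CARD('n) - 1)" for i :: 'n
  proof -
    have "(\<Sum>\<beta>\<in>top_box i m. q ^ (norm1 \<beta> - norm_inf \<beta>)) =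
        (\<Sum>\<beta>\<in>top_box i m. \<Prod>j\<in>UNIV. if j = i then 1 else q ^ (\<beta> $ j))"
    proof (rule sum.cong[OF refl])
      fix \<beta> assume "\<beta> \<in> top_box i m"
      from top_box_norms(2)[OF this] have "q ^ (norm1 \<beta> - norm_inf \<beta>) = (\<Prod>j\<in>UNIV - {i}. q ^ (\<beta> $ j))"
        by (simp add: power_sum)
      also have "\<dots> = (\<Prod>j\<in>UNIV. if j = i then 1 else q ^ (\<beta> $ j))"
        by (intro prod.mono_neutral_cong_left) auto
      finally show "q ^ (norm1 \<beta> - norm_inf \<beta>) = (\<Prod>j\<in>UNIV. if j = i then 1 else q ^ (\<beta> $ j))" .
    qed
    also have "\<dots> = (\<Prod>j\<in>UNIV. \<Sum>b\<in>(if j = i then {m} else {1..m}). if j = i then 1 else q ^ b)"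
      unfolding top_box_def by (rule sum_prod_vbox) auto
    also have "\<dots> = (\<Prod>j\<in>UNIV - {i}. \<Sum>b\<in>{1..m}. q ^ b)"
      by (subst prod.remove[of _ i]) (auto intro!: prod.cong)
    also have "\<dots> = (\<Sum>b\<in>{1..m}. q ^ b) ^ (CARD('n) - 1)" by (simp add: card_Diff_singleton)
    also have "\<dots> \<le> (q / (q - 1) * q ^ m) ^ (CARD('n) - 1)"
      using q by (intro power_mono sum_powers_le sum_nonneg) auto
    finally show ?thesis .
  qed
  have "(\<Sum>\<beta>\<in>layer \<Lambda> m. q ^ (norm1 \<beta> - norm_inf \<beta>)) \<le>
      (\<Sum>\<beta>\<in>(\<Union>i. top_box i m :: (nat ^ 'n) set). q ^ (norm1 \<beta> - norm_inf \<beta>))"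
    using q layer_subset_top_box[OF assms(1)] by (intro sum_mono2 finite_UN_I finite_top_box) auto
  also have "\<dots> \<le> (\<Sum>i\<in>(UNIV :: 'n set). \<Sum>\<beta>\<in>top_box i m. q ^ (norm1 \<beta> - norm_inf \<beta>))"
    using q by (intro sum_UNION_le_sum finite_top_box) auto
  also have "\<dots> \<le> real CARD('n) * (q / (q - 1) * q ^ m) ^ (CARD('n) - 1)"
    using sum_bounded_above[of UNIV "\<lambda>i::'n. \<Sum>\<beta>\<in>top_box i m. q ^ (norm1 \<beta> - norm_inf \<beta>)", OF box] by simp
  finally show ?thesis .
qed

lemma nt_idx_le:
  fixes \<Lambda> :: "(nat ^ 'n::finite) set"
  assumes "finite \<Lambda>"
  shows "real (nt_idx \<Lambda>) \<le> (\<Sum>m\<in>{1..k_max \<Lambda>}. \<Sum>\<beta>\<in>layer \<Lambda> m. 2 ^ (norm1 \<beta> - norm_inf \<beta>))"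
proof -
  have "nt_idx \<Lambda> \<le> (\<Sum>m\<in>{1..k_max \<Lambda>}. \<Sum>\<beta>\<in>layer \<Lambda> m. 2 ^ (norm1 \<beta> - norm_inf \<beta>))"
    unfolding nt_idx_def using assms
    by (intro sum_mono sum_mono2) (auto simp: layer_maximal_def layer_def)
  then have "real (nt_idx \<Lambda>) \<le> real (\<Sum>m\<in>{1..k_max \<Lambda>}. \<Sum>\<beta>\<in>layer \<Lambda> m. 2 ^ (norm1 \<beta> - norm_inf \<beta>))"
    by (rule of_nat_mono)
  then show ?thesis by simp
qed

lemma sum_two_sided_geometric:
  fixes r x :: real
  assumes r: "0 < r" "r < 1" and x: "x \<ge> 0"
  shows "(\<Sum>m\<in>{1..k}. r powr \<bar>real m - x\<bar>) \<le> 2 / (1 - r)"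
proof -
  define p where "p = nat \<lfloor>x\<rfloor>"
  have p: "real p \<le> x" "x < real p + 1" using x by (auto simp: p_def)
  have geo: "(\<Sum>j<n. r ^ j) \<le> 1 / (1 - r)" for n
  proof -
    have "(\<Sum>j<n. r ^ j) = (1 - r ^ n) / (1 - r)" using r by (simp add: sum_gp_strict)
    then show ?thesis using r by (simp add: divide_right_mono)
  qed
  have "(\<Sum>m\<in>{1..k}. r powr \<bar>real m - x\<bar>) \<le> (\<Sum>m\<in>{1..k}. if m \<le> p then r ^ (p - m) else r ^ (m - Suc p))"
  proof (rule sum_mono)
    fix m assume "m \<in> {1..k}"
    show "r powr \<bar>real m - x\<bar> \<le> (if m \<le> p then r ^ (p - m) else r ^ (m - Suc p))"
    proof (cases "m \<le> p")
      case True
      then have "real (p - m) \<le> \<bar>real m - x\<bar>" using p by (simp add: of_nat_diff)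
      then have "r powr \<bar>real m - x\<bar> \<le> r powr real (p - m)" using r by (intro powr_mono') auto
      then show ?thesis unfolding powr_realpow[OF r(1)] using True by (simp only: if_True)
    next
      case False
      then have "real (m - Suc p) \<le> \<bar>real m - x\<bar>" using p by (simp add: of_nat_diff)
      then have "r powr \<bar>real m - x\<bar> \<le> r powr real (m - Suc p)" using r by (intro powr_mono') auto
      then show ?thesis unfolding powr_realpow[OF r(1)] using False by (simp only: if_False)
    qed
  qed
  also have "\<dots> = (\<Sum>m\<in>{m\<in>{1..k}. m \<le> p}. r ^ (p - m)) + (\<Sum>m\<in>{m\<in>{1..k}. \<not> m \<le> p}. r ^ (m - Suc p))"
    by (subst sum.If_cases) (auto intro!: arg_cong2[where f="(+)"] sum.cong)
  also have "(\<Sum>m\<in>{m\<in>{1..k}. m \<le> p}. r ^ (p - m)) = (\<Sum>j\<in>(\<lambda>m. p - m) ` {m\<in>{1..k}. m \<le> p}. r ^ j)"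
    by (subst sum.reindex) (auto simp: inj_on_def)
  also have "\<dots> \<le> (\<Sum>j<Suc p. r ^ j)" using r by (intro sum_mono2) auto
  also have "\<dots> \<le> 1 / (1 - r)" by (rule geo)
  also have "(\<Sum>m\<in>{m\<in>{1..k}. \<not> m \<le> p}. r ^ (m - Suc p)) = (\<Sum>j\<in>(\<lambda>m. m - Suc p) ` {m\<in>{1..k}. \<not> m \<le> p}. r ^ j)"
    by (subst sum.reindex) (auto simp: inj_on_def)
  also have "\<dots> \<le> (\<Sum>j<Suc k. r ^ j)" using r by (intro sum_mono2) auto
  also have "\<dots> \<le> 1 / (1 - r)" by (rule geo)
  finally show ?thesis by simp
qed

lemma norm1_minus_norm_inf:
  fixes \<beta> :: "nat ^ 'n::finite"
  assumes "\<beta> \<in> pos_idx"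
  shows "CARD('n) - 1 \<le> norm1 \<beta> - norm_inf \<beta>"
proof -
  obtain i where i: "\<beta> $ i = norm_inf \<beta>" by (rule norm_inf_attained)
  have "norm1 \<beta> = norm_inf \<beta> + (\<Sum>j\<in>UNIV - {i}. \<beta> $ j)" unfolding norm1_def by (subst sum.remove[of _ i]) (auto simp: i)
  moreover have "(\<Sum>j\<in>UNIV - {i}. 1) \<le> (\<Sum>j\<in>UNIV - {i}. \<beta> $ j)"
    using assms by (intro sum_mono) (auto simp: pos_idx_def)
  ultimately show ?thesis by (simp add: card_Diff_singleton)
qed

lemma norm_inf_mono: "\<beta>' \<le> \<beta> \<Longrightarrow> norm_inf \<beta>' \<le> norm_inf \<beta>"
  unfolding norm_inf_le_iff by (auto simp: less_eq_vec_def intro: order_trans[OF _ le_norm_inf])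

lemma norm_inf_diff_le:
  assumes "\<beta>' \<le> \<beta>"
  shows "norm_inf \<beta> + norm1 \<beta>' \<le> norm_inf \<beta>' + norm1 \<beta>"
proof -
  obtain i where i: "\<beta> $ i = norm_inf \<beta>" by (rule norm_inf_attained)
  have s: "norm1 b = b $ i + (\<Sum>j\<in>UNIV - {i}. b $ j)" for b
    unfolding norm1_def by (subst sum.remove[of _ i]) auto
  have "(\<Sum>j\<in>UNIV - {i}. \<beta>' $ j) \<le> (\<Sum>j\<in>UNIV - {i}. \<beta> $ j)"
    using assms by (intro sum_mono) (auto simp: less_eq_vec_def)
  then show ?thesis using s[of \<beta>] s[of \<beta>'] i le_norm_inf[of \<beta>' i] by linarith
qed

lemma finite_full_idx: "finite (full_idx k :: (nat ^ 'n::finite) set)"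
proof -
  have "(full_idx k :: (nat ^ 'n) set) \<subseteq> vbox (\<lambda>_. {1..k})"
    by (auto simp: full_idx_def vbox_def pos_idx_def norm_inf_le_iff)
  then show ?thesis by (rule finite_subset) (simp add: finite_vbox)
qed

lemma monotone_full_idx: "monotone_idx (full_idx k)"
  unfolding monotone_idx_def full_idx_def using norm_inf_mono order_trans by blast

lemma energy_idx_norm_inf:
  fixes \<beta> :: "nat ^ 'n::finite"
  assumes "a0 < 1" "\<beta> \<in> energy_idx a0 k"
  shows "norm_inf \<beta> \<le> k"
proof -
  have b: "\<beta> \<in> pos_idx" "real (norm1 \<beta>) - a0 * real (norm_inf \<beta>) \<le> (1 - a0) * real k + real CARD('n) - 1"
    using assms(2) by (auto simp: energy_idx_def)
  have "CARD('n) \<ge> 1" by (simp add: Suc_leI)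
  then have "norm_inf \<beta> + CARD('n) \<le> norm1 \<beta> + 1"
    using norm1_minus_norm_inf[OF b(1)] norm_inf_le_norm1[of \<beta>] by linarith
  then have "real (norm_inf \<beta> + CARD('n)) \<le> real (norm1 \<beta> + 1)" by (rule of_nat_mono)
  then have "(1 - a0) * real (norm_inf \<beta>) \<le> (1 - a0) * real k" using b(2) by (simp add: algebra_simps)
  then show ?thesis using assms(1) by simp
qed

lemma finite_energy_idx: "a0 < 1 \<Longrightarrow> finite (energy_idx a0 k :: (nat ^ 'n::finite) set)"
  by (rule finite_subset[OF _ finite_full_idx[of k]])
    (auto simp: full_idx_def energy_idx_norm_inf, auto simp: energy_idx_def)

lemma monotone_energy_idx:
  assumes "a0 < 1"
  shows "monotone_idx (energy_idx a0 k)"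
  unfolding monotone_idx_def
proof (intro conjI ballI impI)
  fix \<beta> \<beta>' :: "nat ^ 'a" assume b: "\<beta> \<in> energy_idx a0 k" "\<beta>' \<in> pos_idx" "\<beta>' \<le> \<beta>"
  have "real (norm_inf \<beta> + norm1 \<beta>') \<le> real (norm_inf \<beta>' + norm1 \<beta>)"
    by (rule of_nat_mono) (rule norm_inf_diff_le[OF b(3)])
  moreover have "(1 - a0) * real (norm_inf \<beta>') \<le> (1 - a0) * real (norm_inf \<beta>)"
    using assms norm_inf_mono[OF b(3)] by (intro mult_left_mono) auto
  ultimately have "real (norm1 \<beta>') - a0 * real (norm_inf \<beta>') \<le> real (norm1 \<beta>) - a0 * real (norm_inf \<beta>)"
    by (simp add: algebra_simps)
  then show "\<beta>' \<in> energy_idx a0 k" using b by (auto simp: energy_idx_def)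
qed (auto simp: energy_idx_def)

text \<open>Write \<open>s = |\<beta>|\<^sub>1 - |\<beta>|\<^sub>\<infinity>\<close>.  On the layer \<open>m\<close> one has \<open>s \<le> (d - 1) m\<close> and
  \<open>s \<le> S := (1 - a\<^sub>0) (k - m) + d - 1\<close>; the two bounds balance at the level \<open>x\<close>.  Above it,
  \<open>2\<^bsup>s\<^esup> \<le> 2\<^bsup>\<theta> s\<^esup> 2\<^bsup>(1 - \<theta>) S\<^esup>\<close> with small \<open>\<theta>\<close> avoids counting the
  maximal elements of the layer.\<close>

lemma nt_idx_energy_le:
  assumes d: "CARD('n::finite) > 1" and a0: "a0 < 1"
  shows "\<exists>C>0. \<forall>k. real (nt_idx (energy_idx a0 k :: (nat ^ 'n) set)) \<le>
    C * 2 powr (real k * (real CARD('n) - 1) * (1 - a0) / (real CARD('n) - a0))"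
proof -
  define D where "D = CARD('n) - 1"
  define \<theta> where "\<theta> = (1 - a0) / (2 * (real CARD('n) - a0))"
  define q where "q = 2 powr \<theta>"
  define \<epsilon> where "\<epsilon> = min 1 ((1 - a0) / 2)"
  have D: "real CARD('n) = real D + 1" "D \<ge> 1" using d by (auto simp: D_def)
  have pos: "real D + 1 - a0 > 0" using a0 by simp
  have \<theta>: "0 < \<theta>" "\<theta> < 1" "\<theta> * (real D + 1 - a0) = (1 - a0) / 2"
    using a0 pos by (auto simp: \<theta>_def D field_simps)
  have q: "q > 1" using \<theta> by (simp add: q_def)
  define A where "A = real CARD('n) * (2 ^ D + (q / (q - 1)) ^ D * 2 powr real D)"
  define r where "r = 2 powr (- \<epsilon>)"
  have \<epsilon>: "\<epsilon> > 0" using a0 by (simp add: \<epsilon>_def)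
  have r: "0 < r" "r < 1" using \<epsilon> by (auto simp: r_def powr_less_one)
  have A: "A > 0" using q by (auto simp: A_def intro!: mult_pos_pos add_pos_pos)
  have "real (nt_idx (energy_idx a0 k :: (nat ^ 'n) set)) \<le>
      A * (2 / (1 - r)) * 2 powr (real k * (real CARD('n) - 1) * (1 - a0) / (real CARD('n) - a0))" for k
  proof -
    let ?\<Lambda> = "energy_idx a0 k :: (nat ^ 'n) set"
    define x where "x = (1 - a0) * real k / (real D + 1 - a0)"
    have x: "x \<ge> 0" "x * (real D + 1 - a0) = (1 - a0) * real k" using a0 pos by (auto simp: x_def)
    have kx: "real D * x = (1 - a0) * (real k - x)" using x(2) by (simp add: algebra_simps)
    have \<Lambda>pos: "?\<Lambda> \<subseteq> pos_idx" by (auto simp: energy_idx_def)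
    have layer: "(\<Sum>\<beta>\<in>layer ?\<Lambda> m. 2 ^ (norm1 \<beta> - norm_inf \<beta>)) \<le> A * 2 powr (real D * x) * r powr \<bar>real m - x\<bar>" for m
    proof (cases "real m \<le> x")
      case True
      have "(\<Sum>\<beta>\<in>layer ?\<Lambda> m. (2::real) ^ (norm1 \<beta> - norm_inf \<beta>)) \<le> real CARD('n) * (2 * 2 ^ m) ^ D"
        using layer_power_sum[OF \<Lambda>pos, of 2 m] by (simp add: D_def)
      also have "\<dots> = real CARD('n) * 2 ^ D * 2 powr (real D * real m)"
      proof -
        have "(2::real) powr (real D * real m) = 2 powr real (m * D)" by (simp add: mult.commute)
        also have "\<dots> = 2 ^ (m * D)" by (rule powr_realpow) simp
        also have "\<dots> = (2 ^ m) ^ D" by (rule power_mult)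
        finally show ?thesis by (simp add: power_mult_distrib)
      qed
      also have "real D * real m \<le> real D * x + (- \<epsilon>) * \<bar>real m - x\<bar>"
      proof -
        have "\<epsilon> * (x - real m) \<le> real D * (x - real m)"
          using True D(2) by (intro mult_right_mono) (auto simp: \<epsilon>_def min_def)
        then show ?thesis using True by (simp add: algebra_simps)
      qed
      also have "real CARD('n) * 2 ^ D * 2 powr (real D * x + (- \<epsilon>) * \<bar>real m - x\<bar>) =
          real CARD('n) * 2 ^ D * (2 powr (real D * x) * r powr \<bar>real m - x\<bar>)"
        by (simp only: powr_add r_def powr_powr mult_ac)
      also have "\<dots> \<le> A * (2 powr (real D * x) * r powr \<bar>real m - x\<bar>)"
        using q by (intro mult_right_mono) (auto simp: A_def)
      finally show ?thesis by (simp add: mult.assoc mult_left_mono)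
    next
      case False
      define s where "s = (1 - a0) * (real k - real m) + real D"
      have le_s: "real (norm1 \<beta> - norm_inf \<beta>) \<le> s" if "\<beta> \<in> layer ?\<Lambda> m" for \<beta>
      proof -
        have "real (norm1 \<beta>) - a0 * real m \<le> (1 - a0) * real k + real D" "norm_inf \<beta> = m"
          using that by (auto simp: layer_def energy_idx_def D)
        then show ?thesis using norm_inf_le_norm1[of \<beta>] by (simp add: s_def of_nat_diff algebra_simps)
      qed
      have "(\<Sum>\<beta>\<in>layer ?\<Lambda> m. (2::real) ^ (norm1 \<beta> - norm_inf \<beta>)) \<le>
          (\<Sum>\<beta>\<in>layer ?\<Lambda> m. q ^ (norm1 \<beta> - norm_inf \<beta>) * 2 powr ((1 - \<theta>) * s))"
      proof (rule sum_mono)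
        fix \<beta> assume b: "\<beta> \<in> layer ?\<Lambda> m"
        let ?t = "norm1 \<beta> - norm_inf \<beta>"
        have "(2::real) ^ ?t = 2 powr real ?t" by (simp add: powr_realpow)
        also have "\<dots> = 2 powr (\<theta> * real ?t) * 2 powr ((1 - \<theta>) * real ?t)"
          by (simp add: powr_add[symmetric] algebra_simps)
        also have "2 powr (\<theta> * real ?t) = q ^ ?t" using q by (simp add: q_def powr_powr[symmetric] powr_realpow)
        also have "2 powr ((1 - \<theta>) * real ?t) \<le> 2 powr ((1 - \<theta>) * s)"
          using \<theta> le_s[OF b] by (intro powr_mono mult_left_mono) auto
        finally show "(2::real) ^ ?t \<le> q ^ ?t * 2 powr ((1 - \<theta>) * s)" using q by (simp add: mult_left_mono)
      qed
      also have "\<dots> = (\<Sum>\<beta>\<in>layer ?\<Lambda> m. q ^ (norm1 \<beta> - norm_inf \<beta>)) * 2 powr ((1 - \<theta>) * s)"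
        by (simp only: sum_distrib_right)
      also have "\<dots> \<le> real CARD('n) * (q / (q - 1) * q ^ m) ^ D * 2 powr ((1 - \<theta>) * s)"
        unfolding D_def by (intro mult_right_mono layer_power_sum \<Lambda>pos q) auto
      also have "\<dots> = real CARD('n) * (q / (q - 1)) ^ D * 2 powr (\<theta> * real D * real m + (1 - \<theta>) * s)"
      proof -
        have "(q ^ m) ^ D = 2 powr (\<theta> * real D * real m)"
          using q by (simp add: power_mult[symmetric] powr_realpow[symmetric]) (simp add: q_def powr_powr mult_ac)
        then show ?thesis unfolding power_mult_distrib[of "q / (q - 1)" "q ^ m"] powr_add
          by (simp only: mult_ac)
      qed
      also have "\<theta> * real D * real m + (1 - \<theta>) * s \<le> real D * x + (- \<epsilon>) * \<bar>real m - x\<bar> + real D"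
      proof -
        have "\<theta> * real D * real m + (1 - \<theta>) * s =
            real D * x + (real m - x) * (\<theta> * (real D + 1 - a0) - (1 - a0)) + (1 - \<theta>) * real D"
        proof -
          have "\<theta> * real D * real m + (1 - \<theta>) * s = \<theta> * real D * (real m - x) + \<theta> * (real D * x) +
              (1 - \<theta>) * ((1 - a0) * (real k - x)) - (1 - \<theta>) * (1 - a0) * (real m - x) + (1 - \<theta>) * real D"
            by (simp add: s_def algebra_simps)
          then show ?thesis unfolding kx[symmetric] by (simp add: algebra_simps)
        qed
        also have "\<dots> = real D * x - (real m - x) * ((1 - a0) / 2) + (1 - \<theta>) * real D"
          unfolding \<theta>(3) by (simp add: field_simps)
        also have "\<dots> \<le> real D * x - (real m - x) * \<epsilon> + real D"
        proof -
          have "(real m - x) * \<epsilon> \<le> (real m - x) * ((1 - a0) / 2)"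
          proof (rule mult_left_mono)
            show "\<epsilon> \<le> (1 - a0) / 2" unfolding \<epsilon>_def by (rule min.cobounded2)
          qed (use False in simp)
          moreover have "(1 - \<theta>) * real D \<le> real D" using \<theta> by (simp add: mult_left_le_one_le)
          ultimately show ?thesis by linarith
        qed
        finally show ?thesis using False by (simp add: algebra_simps)
      qed
      also have "real CARD('n) * (q / (q - 1)) ^ D * 2 powr (real D * x + (- \<epsilon>) * \<bar>real m - x\<bar> + real D) =
          real CARD('n) * ((q / (q - 1)) ^ D * 2 powr real D) * (2 powr (real D * x) * r powr \<bar>real m - x\<bar>)"
        by (simp only: powr_add r_def powr_powr mult_ac)
      also have "\<dots> \<le> A * (2 powr (real D * x) * r powr \<bar>real m - x\<bar>)"
        using q by (intro mult_right_mono) (auto simp: A_def intro!: mult_left_mono)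
      finally show ?thesis using q by (simp add: mult.assoc mult_left_mono)
    qed
    have "real (nt_idx ?\<Lambda>) \<le> (\<Sum>m\<in>{1..k_max ?\<Lambda>}. A * 2 powr (real D * x) * r powr \<bar>real m - x\<bar>)"
      using nt_idx_le[OF finite_energy_idx[OF a0, of k]] by (rule order_trans) (intro sum_mono layer)
    also have "\<dots> = A * 2 powr (real D * x) * (\<Sum>m\<in>{1..k_max ?\<Lambda>}. r powr \<bar>real m - x\<bar>)"
      by (simp only: sum_distrib_left)
    also have "\<dots> \<le> A * 2 powr (real D * x) * (2 / (1 - r))"
      using A by (intro mult_left_mono sum_two_sided_geometric r x) auto
    also have "real D * x = real k * (real CARD('n) - 1) * (1 - a0) / (real CARD('n) - a0)"
      by (simp add: x_def D)
    finally show ?thesis by (simp add: mult_ac)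
  qed
  moreover have "A * (2 / (1 - r)) > 0" using A r by simp
  ultimately show ?thesis by blast
qed

lemma energy_idx_lower:
  assumes d: "CARD('n::finite) > 1" and a0: "a0 < 1" and k: "k \<ge> 2"
  defines "\<rho> \<equiv> (1 - a0) / (real CARD('n) - a0)"
  shows "(\<rho> / 2) ^ (CARD('n) - 1) * real k ^ (CARD('n) - 1) \<le> real (n_idx (energy_idx a0 k :: (nat ^ 'n) set))"
    and "2 powr (- (real CARD('n) - 1) * \<rho>) *
      2 powr (real k * (real CARD('n) - 1) * (1 - a0) / (real CARD('n) - a0)) \<le>
      real (nt'_idx (energy_idx a0 k :: (nat ^ 'n) set))"
    and "(energy_idx a0 k :: (nat ^ 'n) set) \<noteq> {}"
proof -
  let ?d = "real CARD('n)"
  have pos: "?d - a0 > 0" "?d \<ge> 2" using d a0 by auto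
  define y where "y = ((1 - a0) * real k + ?d - 1) / (?d - a0)"
  define m where "m = nat \<lfloor>y\<rfloor>"
  have "(1 - a0) * 1 \<le> (1 - a0) * real k" using a0 k by (intro mult_left_mono) auto
  then have "?d - a0 \<le> (1 - a0) * real k + ?d - 1" by simp
  then have y1: "y \<ge> 1" using pos by (simp add: y_def pos_le_divide_eq)
  have m: "real m \<le> y" "y - 1 \<le> real m" "m \<ge> 1" using y1 by (auto simp: m_def le_nat_iff)
  have "y - 1 = \<rho> * (real k - 1)" using pos by (simp add: y_def \<rho>_def field_simps)
  then have m\<rho>: "\<rho> * (real k - 1) \<le> real m" using m by simp
  have \<rho>: "\<rho> > 0" using a0 pos by (simp add: \<rho>_def)
  have "real m * (?d - a0) \<le> (1 - a0) * real k + ?d - 1"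
    using m(1) pos by (simp add: y_def pos_le_divide_eq)
  moreover have "norm1 (\<chi> j. m :: nat ^ 'n) = CARD('n) * m" by (simp add: norm1_def)
  moreover have "norm_inf (\<chi> j. m :: nat ^ 'n) = m" by (simp add: norm_inf_def)
  ultimately have mem: "(\<chi> j. m) \<in> (energy_idx a0 k :: (nat ^ 'n) set)"
    using m(3) by (simp add: energy_idx_def pos_idx_def algebra_simps)
  then show "(energy_idx a0 k :: (nat ^ 'n) set) \<noteq> {}" by auto
  note low = cube_lower_bounds[OF finite_energy_idx[OF a0] monotone_energy_idx[OF a0] mem]
  have "\<rho> / 2 * real k \<le> \<rho> * (real k - 1)" using \<rho> k by (simp add: field_simps)
  then have "\<rho> / 2 * real k \<le> real m" using m\<rho> by linarith
  then have "(\<rho> / 2 * real k) ^ (CARD('n) - 1) \<le> real m ^ (CARD('n) - 1)"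
    using \<rho> by (intro power_mono) auto
  also have "\<dots> = real (m ^ (CARD('n) - 1))" by simp
  also have "\<dots> \<le> real (n_idx (energy_idx a0 k :: (nat ^ 'n) set))" using low(1) by (rule of_nat_mono)
  finally show "(\<rho> / 2) ^ (CARD('n) - 1) * real k ^ (CARD('n) - 1) \<le> real (n_idx (energy_idx a0 k :: (nat ^ 'n) set))"
    by (simp only: power_mult_distrib)
  have "2 powr (- (?d - 1) * \<rho>) * 2 powr (real k * (?d - 1) * (1 - a0) / (?d - a0)) =
      2 powr ((?d - 1) * (\<rho> * (real k - 1)))"
  proof -
    have eq: "real k * (?d - 1) * (1 - a0) / (?d - a0) = (?d - 1) * (\<rho> * real k)" by (simp add: \<rho>_def)
    show ?thesis unfolding eq powr_add[symmetric] by (simp add: algebra_simps)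
  qed
  also have "\<dots> \<le> 2 powr ((?d - 1) * real m)" using pos m\<rho> by (intro powr_mono mult_left_mono) auto
  also have "(?d - 1) * real m = real ((CARD('n) - 1) * m)" using d by (simp add: of_nat_diff)
  also have "2 powr real ((CARD('n) - 1) * m) = real (2 ^ ((CARD('n) - 1) * m))"
    by (subst powr_realpow) auto
  also have "\<dots> \<le> real (nt'_idx (energy_idx a0 k :: (nat ^ 'n) set))" using low(2) by (rule of_nat_mono)
  finally show "2 powr (- (?d - 1) * \<rho>) * 2 powr (real k * (?d - 1) * (1 - a0) / (?d - a0)) \<le>
      real (nt'_idx (energy_idx a0 k :: (nat ^ 'n) set))" .
qed

lemma k_max_le:
  assumes "finite \<Lambda>" "\<Lambda> \<noteq> {}" "\<And>\<beta>. \<beta> \<in> \<Lambda> \<Longrightarrow> norm_inf \<beta> \<le> k"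
  shows "k_max \<Lambda> \<le> k"
  unfolding k_max_def using assms by (subst Max_le_iff) auto

lemma asymp_from_bounds:
  fixes \<Lambda> :: "nat \<Rightarrow> (nat ^ 'n::finite) set" and F :: "nat \<Rightarrow> real"
  assumes \<mu>: "0 < \<mu>0" "\<mu>0 \<le> \<mu>1"
    and c: "c1 > 0" "c2 > 0" "C2 > 0" and F: "\<And>k. F k \<ge> 0"
    and \<Lambda>: "\<And>k. k \<ge> 2 \<Longrightarrow> finite (\<Lambda> k) \<and> \<Lambda> k \<noteq> {} \<and> monotone_idx (\<Lambda> k)"
    and top: "\<And>k \<beta>. \<beta> \<in> \<Lambda> k \<Longrightarrow> norm_inf \<beta> \<le> k"
    and n: "\<And>k. k \<ge> 2 \<Longrightarrow> c1 * real k ^ (CARD('n) - 1) \<le> real (n_idx (\<Lambda> k))"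
    and nt': "\<And>k. k \<ge> 2 \<Longrightarrow> c2 * F k \<le> real (nt'_idx (\<Lambda> k))"
    and nt: "\<And>k. k \<ge> 2 \<Longrightarrow> real (nt_idx (\<Lambda> k)) \<le> C2 * F k"
  shows "\<exists>c>0. \<exists>C>0. \<forall>a. elliptic_form \<mu>0 \<mu>1 a \<longrightarrow>
    asymp_with c C (\<lambda>k. kappa_HB a (\<Lambda> k)) (\<lambda>k. real k ^ (CARD('n) - 1) * F k)"
proof -
  let ?d = "real CARD('n)"
  define l where "l = \<mu>0 / (?d * 64 ^ CARD('n)) / (\<mu>1 * (3 * ?d * 2 ^ CARD('n)))"
  define L where "L = (\<mu>1 * (6 * ?d)) * (2 * ?d * 32 ^ CARD('n)) / \<mu>0"
  have lL: "l > 0" "L > 0" using \<mu> by (auto simp: l_def L_def intro!: divide_pos_pos mult_pos_pos)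
  have main: "1 / (L * ?d * C2) * kappa_HB a (\<Lambda> k) \<le> real k ^ (CARD('n) - 1) * F k \<and>
      real k ^ (CARD('n) - 1) * F k \<le> 1 / (l * c1 * c2) * kappa_HB a (\<Lambda> k)"
    if a: "elliptic_form \<mu>0 \<mu>1 a" and k: "k \<ge> 2" for a k
  proof
    have \<Lambda>k: "finite (\<Lambda> k)" "\<Lambda> k \<noteq> {}" "monotone_idx (\<Lambda> k)" using \<Lambda>[OF k] by auto
    then have pos: "\<Lambda> k \<subseteq> pos_idx" by (simp add: monotone_idx_def)
    note kb = kappa_HB_bounds[OF a \<mu> \<Lambda>k, folded l_def L_def]
    have "n_idx (\<Lambda> k) \<le> CARD('n) * k_max (\<Lambda> k) ^ (CARD('n) - 1)" by (rule n_idx_le[OF \<Lambda>k(1,2) pos])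
    also have "\<dots> \<le> CARD('n) * k ^ (CARD('n) - 1)"
      using k_max_le[OF \<Lambda>k(1,2) top] by (intro mult_left_mono power_mono) auto
    finally have "real (n_idx (\<Lambda> k)) \<le> real (CARD('n) * k ^ (CARD('n) - 1))" by (rule of_nat_mono)
    then have nk: "real (n_idx (\<Lambda> k)) \<le> ?d * real k ^ (CARD('n) - 1)" by simp
    have "kappa_HB a (\<Lambda> k) \<le> L * real (n_idx (\<Lambda> k)) * real (nt_idx (\<Lambda> k))" by (rule kb(2))
    also have "\<dots> \<le> L * (?d * real k ^ (CARD('n) - 1)) * (C2 * F k)"
      using nk nt[OF k] lL by (intro mult_mono) auto
    finally show "1 / (L * ?d * C2) * kappa_HB a (\<Lambda> k) \<le> real k ^ (CARD('n) - 1) * F k"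
      using lL c by (simp add: pos_divide_le_eq mult_ac)
    have "l * (c1 * real k ^ (CARD('n) - 1)) * (c2 * F k) \<le> l * real (n_idx (\<Lambda> k)) * real (nt'_idx (\<Lambda> k))"
      using n[OF k] nt'[OF k] lL c F by (intro mult_mono) auto
    also have "\<dots> \<le> kappa_HB a (\<Lambda> k)" by (rule kb(1))
    finally show "real k ^ (CARD('n) - 1) * F k \<le> 1 / (l * c1 * c2) * kappa_HB a (\<Lambda> k)"
      using lL c by (simp add: pos_le_divide_eq mult_ac)
  qed
  show ?thesis
  proof (rule exI[of _ "1 / (L * ?d * C2)"], rule conjI)
    show "1 / (L * ?d * C2) > 0" using lL c by simp
    show "\<exists>C>0. \<forall>a. elliptic_form \<mu>0 \<mu>1 a \<longrightarrow>
      asymp_with (1 / (L * ?d * C2)) C (\<lambda>k. kappa_HB a (\<Lambda> k)) (\<lambda>k. real k ^ (CARD('n) - 1) * F k)"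
    proof (rule exI[of _ "1 / (l * c1 * c2)"], rule conjI)
      show "1 / (l * c1 * c2) > 0" using lL c by simp
      show "\<forall>a. elliptic_form \<mu>0 \<mu>1 a \<longrightarrow> asymp_with (1 / (L * ?d * C2)) (1 / (l * c1 * c2))
          (\<lambda>k. kappa_HB a (\<Lambda> k)) (\<lambda>k. real k ^ (CARD('n) - 1) * F k)"
        unfolding asymp_with_def eventually_sequentially using main by blast
    qed
  qed
qed

lemma asymp_energy_idx:
  assumes "CARD('n::finite) > 1" "0 < \<mu>0" "\<mu>0 \<le> \<mu>1" "a0 < 1"
  shows "\<exists>c>0. \<exists>C>0. \<forall>a. elliptic_form \<mu>0 \<mu>1 a \<longrightarrow>
    asymp_with c C (\<lambda>k. kappa_HB a (energy_idx a0 k :: (nat ^ 'n) set))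
      (\<lambda>k. real k ^ (CARD('n) - 1) * 2 powr (real k * (real CARD('n) - 1) * (1 - a0) / (real CARD('n) - a0)))"
proof -
  let ?\<rho> = "(1 - a0) / (real CARD('n) - a0)"
  have \<rho>: "?\<rho> > 0" using assms by simp
  obtain C where C: "C > 0" "\<And>k. real (nt_idx (energy_idx a0 k :: (nat ^ 'n) set)) \<le>
      C * 2 powr (real k * (real CARD('n) - 1) * (1 - a0) / (real CARD('n) - a0))"
    using nt_idx_energy_le[OF assms(1,4)] by blast
  show ?thesis
  proof (rule asymp_from_bounds[where ?c1.0 = "(?\<rho> / 2) ^ (CARD('n) - 1)" and
        ?c2.0 = "2 powr (- (real CARD('n) - 1) * ?\<rho>)" and ?C2.0 = C])
    show "(?\<rho> / 2) ^ (CARD('n) - 1) > 0" by (rule zero_less_power[OF half_gt_zero[OF \<rho>]])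
    show "norm_inf \<beta> \<le> k" if "\<beta> \<in> (energy_idx a0 k :: (nat ^ 'n) set)" for k \<beta>
      using energy_idx_norm_inf[OF assms(4) that] .
    show "finite (energy_idx a0 k :: (nat ^ 'n) set) \<and> (energy_idx a0 k :: (nat ^ 'n) set) \<noteq> {} \<and>
        monotone_idx (energy_idx a0 k :: (nat ^ 'n) set)" if "k \<ge> 2" for k
      using energy_idx_lower(3)[OF assms(1,4) that] finite_energy_idx[OF assms(4)] monotone_energy_idx[OF assms(4)]
      by blast
  qed (use assms C energy_idx_lower(1,2)[OF assms(1,4)] in auto)
qed

lemma sparse_idx_eq: "(sparse_idx k :: (nat ^ 'n::finite) set) = energy_idx 0 k"
proof -
  have "CARD('n) \<ge> 1" by (simp add: Suc_leI)
  then have "n \<le> k + CARD('n) - 1 \<longleftrightarrow> real n \<le> real k + real CARD('n) - 1" for n by linarith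
  then show ?thesis by (auto simp: sparse_idx_def energy_idx_def)
qed

lemma asymp_full_idx:
  assumes d: "CARD('n::finite) > 1" and \<mu>: "0 < \<mu>0" "\<mu>0 \<le> \<mu>1"
  shows "\<exists>c>0. \<exists>C>0. \<forall>a. elliptic_form \<mu>0 \<mu>1 a \<longrightarrow>
    asymp_with c C (\<lambda>k. kappa_HB a (full_idx k :: (nat ^ 'n) set))
      (\<lambda>k. real k ^ (CARD('n) - 1) * 2 ^ (k * (CARD('n) - 1)))"
proof (rule asymp_from_bounds[OF \<mu>, where ?c1.0 = 1 and ?c2.0 = 1 and ?C2.0 = "real CARD('n) * 2 ^ (CARD('n) - 1) * 2"])
  fix k :: nat
  let ?\<Lambda> = "full_idx k :: (nat ^ 'n) set" and ?D = "CARD('n) - 1"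
  show "norm_inf \<beta> \<le> k" if "\<beta> \<in> ?\<Lambda>" for \<beta> using that by (simp add: full_idx_def)
  assume k: "k \<ge> 2"
  have mem: "(\<chi> j. k) \<in> ?\<Lambda>" using k by (simp add: full_idx_def pos_idx_def norm_inf_le_iff)
  show "finite ?\<Lambda> \<and> ?\<Lambda> \<noteq> {} \<and> monotone_idx ?\<Lambda>" using mem finite_full_idx monotone_full_idx by blast
  note low = cube_lower_bounds[OF finite_full_idx monotone_full_idx mem]
  have "real (k ^ ?D) \<le> real (n_idx ?\<Lambda>)" using low(1) by (rule of_nat_mono)
  then show "1 * real k ^ ?D \<le> real (n_idx ?\<Lambda>)" by simp
  have "real (2 ^ (?D * k)) \<le> real (nt'_idx ?\<Lambda>)" using low(2) by (rule of_nat_mono)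
  then show "1 * 2 ^ (k * ?D) \<le> real (nt'_idx ?\<Lambda>)" by (simp add: mult.commute)
  have km: "k_max ?\<Lambda> \<le> k" using mem by (intro k_max_le finite_full_idx) (auto simp: full_idx_def)
  have "real (nt_idx ?\<Lambda>) \<le> (\<Sum>m\<in>{1..k_max ?\<Lambda>}. real CARD('n) * (2 / (2 - 1) * 2 ^ m) ^ ?D)"
    by (rule order_trans[OF nt_idx_le[OF finite_full_idx]], intro sum_mono layer_power_sum) (auto simp: full_idx_def)
  also have "\<dots> \<le> (\<Sum>m\<in>{1..k}. real CARD('n) * (2 / (2 - 1) * 2 ^ m) ^ ?D)"
    using km by (intro sum_mono2) auto
  also have "\<dots> = real CARD('n) * 2 ^ ?D * (\<Sum>m\<in>{1..k}. (2 ^ ?D) ^ m)"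
    unfolding sum_distrib_left
    by (intro sum.cong refl) (simp add: power_mult_distrib power_mult[symmetric] mult.commute)
  also have "\<dots> \<le> real CARD('n) * 2 ^ ?D * (2 * (2 ^ ?D) ^ k)"
  proof (intro mult_left_mono)
    have D: "?D \<ge> 1" using d by simp
    have q: "(2::real) \<le> 2 ^ ?D" using power_increasing[OF D, of "2::real"] by simp
    then have "(\<Sum>m\<in>{1..k}. ((2::real) ^ ?D) ^ m) \<le> 2 ^ ?D / (2 ^ ?D - 1) * (2 ^ ?D) ^ k" by (intro sum_powers_le) linarith
    also have "\<dots> \<le> 2 * (2 ^ ?D) ^ k"
      using q by (intro mult_right_mono) (auto simp: divide_le_eq)
    finally show "(\<Sum>m\<in>{1..k}. (2 ^ ?D) ^ m) \<le> (2::real) * (2 ^ ?D) ^ k" .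
  qed auto
  finally show "real (nt_idx ?\<Lambda>) \<le> real CARD('n) * 2 ^ ?D * 2 * 2 ^ (k * ?D)"
    by (simp add: power_mult[symmetric] mult.commute mult.left_commute)
qed auto

theorem theorem1:
  fixes \<mu>0 \<mu>1 :: real
  assumes "CARD('n::finite) > 1" and "0 < \<mu>0" and "\<mu>0 \<le> \<mu>1"
  shows
    "(\<exists>c>0. \<exists>C>0. \<forall>a :: (real ^ 'n \<Rightarrow> real) \<Rightarrow> (real ^ 'n \<Rightarrow> real) \<Rightarrow> real. elliptic_form \<mu>0 \<mu>1 a \<longrightarrow>
        (\<forall>\<Lambda>. finite \<Lambda> \<and> \<Lambda> \<noteq> {} \<and> monotone_idx \<Lambda> \<longrightarrow>
           c * real (n_idx \<Lambda>) * real (nt'_idx \<Lambda>) \<le> kappa_HB a \<Lambda> \<and>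
           kappa_HB a \<Lambda> \<le> C * real (n_idx \<Lambda>) * real (nt_idx \<Lambda>))) \<and>
     (\<exists>c>0. \<exists>C>0. \<forall>a :: (real ^ 'n \<Rightarrow> real) \<Rightarrow> (real ^ 'n \<Rightarrow> real) \<Rightarrow> real. elliptic_form \<mu>0 \<mu>1 a \<longrightarrow>
        asymp_with c C (\<lambda>k. kappa_HB a (sparse_idx k))
          (\<lambda>k. real k ^ (CARD('n) - 1) *
               2 powr (real k * (real CARD('n) - 1) / real CARD('n)))) \<and>
     (\<exists>c>0. \<exists>C>0. \<forall>a :: (real ^ 'n \<Rightarrow> real) \<Rightarrow> (real ^ 'n \<Rightarrow> real) \<Rightarrow> real. elliptic_form \<mu>0 \<mu>1 a \<longrightarrow>
        asymp_with c C (\<lambda>k. kappa_HB a (full_idx k))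
          (\<lambda>k. real k ^ (CARD('n) - 1) * 2 ^ (k * (CARD('n) - 1)))) \<and>
     (\<forall>a0::real. a0 < 1 \<longrightarrow>
       (\<exists>c>0. \<exists>C>0. \<forall>a :: (real ^ 'n \<Rightarrow> real) \<Rightarrow> (real ^ 'n \<Rightarrow> real) \<Rightarrow> real. elliptic_form \<mu>0 \<mu>1 a \<longrightarrow>
          asymp_with c C (\<lambda>k. kappa_HB a (energy_idx a0 k))
            (\<lambda>k. real k ^ (CARD('n) - 1) *
                 2 powr (real k * (real CARD('n) - 1) * (1 - a0) / (real CARD('n) - a0)))))"
proof (intro conjI allI impI, goal_cases)
  case 1
  let ?d = "real CARD('n)"
  let ?l = "\<mu>0 / (?d * 64 ^ CARD('n)) / (\<mu>1 * (3 * ?d * 2 ^ CARD('n)))"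
  let ?L = "(\<mu>1 * (6 * ?d)) * (2 * ?d * 32 ^ CARD('n)) / \<mu>0"
  have "?l > 0" "?L > 0" using assms(2,3) by (auto intro!: divide_pos_pos mult_pos_pos)
  then show ?case using kappa_HB_bounds[OF _ assms(2,3)] by blast
next
  case 2
  show ?case using asymp_energy_idx[OF assms, of 0] by (simp add: sparse_idx_eq)
next
  case 3
  show ?case by (rule asymp_full_idx[OF assms])
next
  case (4 a0)
  then show ?case by (rule asymp_energy_idx[OF assms])
qed

end
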